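(* Let $d,d_1\ge1$, $T\in(-\infty,\infty]$, let $a=(a^{ij})_{i,j\le d_1}$, $b,\bar b$ ($\mathbb R^{d_1}$-valued), $c$ be measurable functions of $(t,x,\mathsf v)\in\mathbb R^{1+d+d_1}$ with $\delta|\xi|^2\le a^{ij}\xi_i\xi_j$, $|a^{ij}|\le\delta^{-1}$ ($\delta\in(0,1)$) and $|b|+|\bar b|+|c|\le L$, and let $\alpha:\mathbb R^{d_1}\to\mathbb R^d$ satisfy $\sup_{\mathsf v\ne\mathsf v'}|\alpha(\mathsf v)-\alpha(\mathsf v')|/|\mathsf v-\mathsf v'|^\theta<\infty$ for some $\theta\in(0,1]$. Define $\mathcal P_\alpha u=\partial_tu+\alpha(\mathsf v)\cdot D_xu-D_{\mathsf v_i}(a^{ij}D_{\mathsf v_j}u)$. (i) There exists $\lambda_0=\lambda_0(d,d_1,\delta,L)>0$ such that for any $\lambda\ge\lambda_0$ and $u\in\mathfrak S_2(\mathbb R^{1+d+d_1}_T,\alpha)$, $\vec f,g\in L_2(\mathbb R^{1+d+d_1}_T)$ satisfying $$\mathcal P_\alpha u+\operatorname{div}_{\mathsf v}(\bar bu)+b\cdot D_{\mathsf v}u+(c+\lambda)u=\operatorname{div}_{\mathsf v}\vec f+g,$$ one has $\lambda^{1/2}\|u\|+\|D_{\mathsf v}u\|\le N\|\vec f\|+N\lambda^{-1/2}\|g\|$, with $\|\cdot\|=\|\cdot\|_{L_2(\mathbb R^{1+d+d_1}_T)}$ and $N=N(d,d_1,\delta)$. Moreover, for any $\vec f,g\in L_2(\mathbb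 R^{1+d+d_1}_T)$ and $\lambda\ge\lambda_0$ this equation has a unique solution $u\in\mathfrak S_2(\mathbb R^{1+d+d_1}_T,\alpha)$. (ii) For any $S<T$ (finite) and $\vec f,g\in L_2((S,T)\times\mathbb R^{d+d_1})$ the Cauchy problem $\mathcal P_\alpha u+\operatorname{div}_{\mathsf v}(\bar bu)+b\cdot D_{\mathsf v}u+cu=\operatorname{div}_{\mathsf v}\vec f+g$, $u(S,\cdot)=0$ has a unique solution $u\in\mathfrak S_2((S,T)\times\mathbb R^{d+d_1},\alpha)$, and $\|u\|+\|D_{\mathsf v}u\|\le N\|\vec f\|+N\|g\|$ with norms in $L_2((S,T)\times\mathbb R^{d+d_1})$ and $N=N(d,d_1,\delta,L,T-S)$.
   Context: Points of $\mathbb R^{1+d+d_1}$ are $(t,x,\mathsf v)$, $x\in\mathbb R^d$, $\mathsf v\in\mathbb R^{d_1}$; $\mathbb R^{1+d+d_1}_T=(-\infty,T)\times\mathbb R^{d+d_1}$. For open $G$, $\mathbb H^{-1}_2(G)$ is the space of $u=\operatorname{div}_{\mathsf v}\vec f+g$ with $\vec f,g\in L_2(G)$, normed by $\inf(\|\vec f\|_{L_2}+\|g\|_{L_2})$. $\mathfrak S_2(G,\alpha)$ is the set of $u$ with $u,D_{\mathsf v}u\in L_2(G)$ and $\partial_tu+\alpha(\mathsf v)\cdot D_xu\in\mathbb H^{-1}_2(G)$; a solution means the equation holds in $\mathbb H^{-1}_2$. A solution of the Cauchy problem with $u(S,\cdot)=0$ on $(S,T)$ means: there is $\tilde u\in\mathfrak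 S_2(\mathbb R^{1+d+d_1}_T,\alpha)$, $\tilde u=u$ on $(S,T)\times\mathbb R^{d+d_1}$, $\tilde u=0$ for $t<S$, and the equation holds in $\mathbb H^{-1}_2((S,T)\times\mathbb R^{d+d_1})$. *)

theory Defs
  imports "HOL-Analysis.Analysis"
begin

type_synonym ('d, 'd1) pt = "real \<times> (real ^ 'd) \<times> (real ^ 'd1)"

primrec iter_dd :: "'a::real_normed_vector list \<Rightarrow> ('a \<Rightarrow> real) \<Rightarrow> 'a \<Rightarrow> real" where
  "iter_dd [] f = f"
| "iter_dd (h # hs) f = (\<lambda>p. frechet_derivative (iter_dd hs f) (at p) h)"

definition smooth_fn :: "('a::real_normed_vector \<Rightarrow> real) \<Rightarrow> bool" where
  "smooth_fn f \<longleftrightarrow> (\<forall>hs p. iter_dd hs f differentiable (at p))"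

definition test_fn :: "'a::real_normed_vector set \<Rightarrow> ('a \<Rightarrow> real) \<Rightarrow> bool" where
  "test_fn G \<phi> \<longleftrightarrow> smooth_fn \<phi> \<and> compact (closure {p. \<phi> p \<noteq> 0})
      \<and> closure {p. \<phi> p \<noteq> 0} \<subseteq> G"

definition pd :: "('a::real_normed_vector \<Rightarrow> real) \<Rightarrow> 'a \<Rightarrow> 'a \<Rightarrow> real" where
  "pd \<phi> h p = frechet_derivative \<phi> (at p) h"

definition Dt :: "(('d::finite, 'd1::finite) pt \<Rightarrow> real) \<Rightarrow> ('d, 'd1) pt \<Rightarrow> real" where
  "Dt \<phi> p = pd \<phi> (1, 0, 0) p"

definition Dx :: "(('d::finite, 'd1::finite) pt \<Rightarrow> real) \<Rightarrow> ('d, 'd1) pt \<Rightarrow> real ^ 'd" where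
  "Dx \<phi> p = (\<chi> k. pd \<phi> (0, axis k 1, 0) p)"

definition Dv :: "(('d::finite, 'd1::finite) pt \<Rightarrow> real) \<Rightarrow> ('d, 'd1) pt \<Rightarrow> real ^ 'd1" where
  "Dv \<phi> p = (\<chi> i. pd \<phi> (0, 0, axis i 1) p)"

definition HT :: "ereal \<Rightarrow> ('d::finite, 'd1::finite) pt set" where
  "HT T = {p. ereal (fst p) < T}"

definition Strip :: "real \<Rightarrow> real \<Rightarrow> ('d::finite, 'd1::finite) pt set" where
  "Strip S T = {p. S < fst p \<and> fst p < T}"

definition L2 :: "'a::euclidean_space set \<Rightarrow> ('a \<Rightarrow> real) \<Rightarrow> bool" where
  "L2 G f \<longleftrightarrow> f \<in> borel_measurable (lebesgue_on G) \<and> integrable (lebesgue_on G) (\<lambda>p. (f p)\<^sup>2)"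

definition L2v :: "'a::euclidean_space set \<Rightarrow> ('a \<Rightarrow> 'b::euclidean_space) \<Rightarrow> bool" where
  "L2v G f \<longleftrightarrow> f \<in> borel_measurable (lebesgue_on G) \<and> integrable (lebesgue_on G) (\<lambda>p. (norm (f p))\<^sup>2)"

definition nrm :: "'a::euclidean_space set \<Rightarrow> ('a \<Rightarrow> real) \<Rightarrow> real" where
  "nrm G f = sqrt (\<integral>p. (f p)\<^sup>2 \<partial>(lebesgue_on G))"

definition nrmv :: "'a::euclidean_space set \<Rightarrow> ('a \<Rightarrow> 'b::euclidean_space) \<Rightarrow> real" where
  "nrmv G f = sqrt (\<integral>p. (norm (f p))\<^sup>2 \<partial>(lebesgue_on G))"

definition weak_Dv :: "('d::finite, 'd1::finite) pt set \<Rightarrow> (('d, 'd1) pt \<Rightarrow> real)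
    \<Rightarrow> (('d, 'd1) pt \<Rightarrow> real ^ 'd1) \<Rightarrow> bool" where
  "weak_Dv G u w \<longleftrightarrow> (\<forall>\<phi>. test_fn G \<phi> \<longrightarrow> (\<forall>i.
      (\<integral>p. u p * pd \<phi> (0, 0, axis i 1) p \<partial>(lebesgue_on G))
        = - (\<integral>p. (w p $ i) * \<phi> p \<partial>(lebesgue_on G))))"

text \<open>Distributional action of (d_t + alpha(v).D_x) u on a test function phi.\<close>
definition transport_pair :: "('d::finite, 'd1::finite) pt set \<Rightarrow> (real ^ 'd1 \<Rightarrow> real ^ 'd)
    \<Rightarrow> (('d, 'd1) pt \<Rightarrow> real) \<Rightarrow> (('d, 'd1) pt \<Rightarrow> real) \<Rightarrow> real" where
  "transport_pair G \<alpha> u \<phi> =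
     - (\<integral>p. u p * (Dt \<phi> p + \<alpha> (snd (snd p)) \<bullet> Dx \<phi> p) \<partial>(lebesgue_on G))"

text \<open>Action of div_v F + g (an element of H^{-1}_2(G)) on a test function phi.\<close>
definition Hm1_pair :: "('d::finite, 'd1::finite) pt set \<Rightarrow> (('d, 'd1) pt \<Rightarrow> real ^ 'd1)
    \<Rightarrow> (('d, 'd1) pt \<Rightarrow> real) \<Rightarrow> (('d, 'd1) pt \<Rightarrow> real) \<Rightarrow> real" where
  "Hm1_pair G F g \<phi> = - (\<integral>p. F p \<bullet> Dv \<phi> p \<partial>(lebesgue_on G)) + (\<integral>p. g p * \<phi> p \<partial>(lebesgue_on G))"

definition S2 :: "('d::finite, 'd1::finite) pt set \<Rightarrow> (real ^ 'd1 \<Rightarrow> real ^ 'd)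
    \<Rightarrow> (('d, 'd1) pt \<Rightarrow> real) \<Rightarrow> (('d, 'd1) pt \<Rightarrow> real ^ 'd1) \<Rightarrow> bool" where
  "S2 G \<alpha> u w \<longleftrightarrow> L2 G u \<and> L2v G w \<and> weak_Dv G u w \<and>
     (\<exists>F g. L2v G F \<and> L2 G g \<and>
        (\<forall>\<phi>. test_fn G \<phi> \<longrightarrow> transport_pair G \<alpha> u \<phi> = Hm1_pair G F g \<phi>))"

text \<open>The equation
  P_alpha u + div_v(bb u) + b.D_v u + (c+lam) u = div_v f + g
  holds in H^{-1}_2(G) (i.e. tested against all phi in C_c^infinity(G)).\<close>
definition eq_holds :: "('d::finite, 'd1::finite) pt set \<Rightarrow> (real ^ 'd1 \<Rightarrow> real ^ 'd)
    \<Rightarrow> (('d, 'd1) pt \<Rightarrow> real ^ 'd1 ^ 'd1) \<Rightarrow> (('d, 'd1) pt \<Rightarrow> real ^ 'd1)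
    \<Rightarrow> (('d, 'd1) pt \<Rightarrow> real ^ 'd1) \<Rightarrow> (('d, 'd1) pt \<Rightarrow> real) \<Rightarrow> real
    \<Rightarrow> (('d, 'd1) pt \<Rightarrow> real ^ 'd1) \<Rightarrow> (('d, 'd1) pt \<Rightarrow> real)
    \<Rightarrow> (('d, 'd1) pt \<Rightarrow> real) \<Rightarrow> (('d, 'd1) pt \<Rightarrow> real ^ 'd1) \<Rightarrow> bool" where
  "eq_holds G \<alpha> a b bb c lam f g u w \<longleftrightarrow> (\<forall>\<phi>. test_fn G \<phi> \<longrightarrow>
      transport_pair G \<alpha> u \<phi>
      + (\<integral>p. (a p *v w p) \<bullet> Dv \<phi> p \<partial>(lebesgue_on G))
      - (\<integral>p. u p * (bb p \<bullet> Dv \<phi> p) \<partial>(lebesgue_on G))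
      + (\<integral>p. ((b p \<bullet> w p) + (c p + lam) * u p) * \<phi> p \<partial>(lebesgue_on G))
      = Hm1_pair G f g \<phi>)"

definition coeff_hyp :: "real \<Rightarrow> real \<Rightarrow> (('d::finite, 'd1::finite) pt \<Rightarrow> real ^ 'd1 ^ 'd1)
    \<Rightarrow> (('d, 'd1) pt \<Rightarrow> real ^ 'd1) \<Rightarrow> (('d, 'd1) pt \<Rightarrow> real ^ 'd1)
    \<Rightarrow> (('d, 'd1) pt \<Rightarrow> real) \<Rightarrow> bool" where
  "coeff_hyp \<delta> L a b bb c \<longleftrightarrow>
     a \<in> borel_measurable lebesgue \<and> b \<in> borel_measurable lebesgue \<and>
     bb \<in> borel_measurable lebesgue \<and> c \<in> borel_measurable lebesgue \<and>
     (\<forall>p \<xi>. \<delta> * (norm \<xi>)\<^sup>2 \<le> \<xi> \<bullet> (a p *v \<xi>)) \<and>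
     (\<forall>p i j. \<bar>a p $ i $ j\<bar> \<le> 1 / \<delta>) \<and>
     (\<forall>p. norm (b p) + norm (bb p) + \<bar>c p\<bar> \<le> L)"

definition holder_alpha :: "(real ^ 'd1 \<Rightarrow> real ^ 'd) \<Rightarrow> bool" where
  "holder_alpha \<alpha> \<longleftrightarrow> (\<exists>\<theta> K. 0 < \<theta> \<and> \<theta> \<le> 1 \<and>
     (\<forall>v v'. v \<noteq> v' \<longrightarrow> norm (\<alpha> v - \<alpha> v') \<le> K * norm (v - v') powr \<theta>))"

definition cauchy_sol :: "real \<Rightarrow> real \<Rightarrow> (real ^ 'd1 \<Rightarrow> real ^ 'd)
    \<Rightarrow> (('d::finite, 'd1::finite) pt \<Rightarrow> real ^ 'd1 ^ 'd1) \<Rightarrow> (('d, 'd1) pt \<Rightarrow> real ^ 'd1)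
    \<Rightarrow> (('d, 'd1) pt \<Rightarrow> real ^ 'd1) \<Rightarrow> (('d, 'd1) pt \<Rightarrow> real)
    \<Rightarrow> (('d, 'd1) pt \<Rightarrow> real ^ 'd1) \<Rightarrow> (('d, 'd1) pt \<Rightarrow> real)
    \<Rightarrow> (('d, 'd1) pt \<Rightarrow> real) \<Rightarrow> (('d, 'd1) pt \<Rightarrow> real ^ 'd1) \<Rightarrow> bool" where
  "cauchy_sol S T \<alpha> a b bb c f g u w \<longleftrightarrow>
     S2 (Strip S T) \<alpha> u w \<and> eq_holds (Strip S T) \<alpha> a b bb c 0 f g u w \<and>
     (\<exists>ut wt. S2 (HT (ereal T)) \<alpha> ut wt \<and> (\<forall>p \<in> Strip S T. ut p = u p)
        \<and> (\<forall>p. fst p < S \<longrightarrow> ut p = 0))"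

end

theory Submission
  imports Defs
begin

text \<open>
  The energy inequality \<open>\<integral> F \<bullet> D\<^sub>v u - g u \<le> 0\<close> for \<open>\<partial>\<^sub>t u + \<alpha>(v) \<bullet> D\<^sub>x u = div\<^sub>v F + g\<close> on
  \<open>t < T\<close> carries everything. It is obtained by testing the localised equation with an even mollification of
  the localised \<open>u\<close>: the transport term then reduces to the commutator
  \<open>(\<alpha>(v) - \<alpha>(v')) \<bullet> D\<^sub>x \<rho>(p - p')\<close>, which vanishes in the limit when the kernel has width \<open>\<epsilon>\<close> in
  \<open>(t, x)\<close> and width \<open>\<sigma>\<close> in \<open>v\<close> with \<open>\<sigma>\<^sup>\<theta> = \<epsilon>\<^sup>2\<close>. Uniqueness and the a priori estimate follow by
  absorbing lower order terms into a large \<open>\<lambda>\<close>. Existence comes from Lions' projection theorem, applied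
  to pairs (function, velocity gradient) with the relation between the two imposed weakly. For the Cauchy problem,
  the zero extension of a solution again solves the equation on \<open>t < T\<close>, since cut-offs in time commute with
  \<open>div\<^sub>v\<close>, and multiplication by \<open>exp (- \<lambda> (t - S))\<close> produces the large zeroth order term.
\<close>

subsection \<open>Smooth functions and test functions\<close>

text \<open>The obstacle is that \<open>u\<close> cannot be tested against itself: only its gradient
  in v exists, and the transport term is merely a distribution. With a mollified test function the x
  derivative of the kernel costs 1/\<epsilon>, while the Holder condition gains \<sigma>^\<theta>,
  so the commutator is of order \<epsilon>. A tiny \<sigma> is free, because every v derivative of
  the kernel is shifted onto the weak gradient. On a half space only an inequality results: the
  cut-off near the final time has a large derivative, but of favourable sign. The a priori estimate
  is a budget. Of \<delta>|w|^2 a quarter each goes to the drift and to f; of lam |u|^2 a quarter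
  each goes to g and to the lower order terms, whence
  \<open>4 * (L\<^sup>2 / \<delta> + L) + 1\<close>. Each of the two norms on the left then carries
  2/\<delta>, whence \<open>4 / \<delta>\<close>. Pairs in L2 spare the construction of a Sobolev
  space for the existence part. Coercivity of the adjoint on (\<phi>, D_v \<phi>) is elementary,
  since test functions have compact support inside the domain and the transport field is divergence
  free.\<close>

lemma smooth_fn_differentiable: "smooth_fn f \<Longrightarrow> f differentiable (at p)"
  unfolding smooth_fn_def by (metis iter_dd.simps(1))

text \<open>\<open>iter_dd\<close> applies the head of the list last, so a derivative taken first
  sits at the end; this is what lets a derivative of a smooth function inherit smoothness.\<close>

lemma iter_dd_append: "iter_dd (hs @ [h]) f = iter_dd hs (pd f h)"
  by (induction hs) (simp_all add: pd_def[abs_def])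

lemma smooth_fn_pd: "smooth_fn f \<Longrightarrow> smooth_fn (pd f h)"
  unfolding smooth_fn_def by (metis iter_dd_append)

text \<open>A family of differentiable functions that is stable under directional derivatives
  contains all iterated derivatives of its members. Smoothness is proved below by exhibiting such a
  family instead of computing higher derivatives.\<close>

lemma smooth_fn_coinduct:
  assumes "f \<in> A"
    and "\<And>f p. f \<in> A \<Longrightarrow> f differentiable (at p)"
    and "\<And>f h. f \<in> A \<Longrightarrow> pd f h \<in> A"
  shows "smooth_fn f"
proof -
  have "\<forall>f\<in>A. iter_dd hs f \<in> A" for hs
  proof (induction hs)
    case (Cons h hs)
    then show ?case using assms(3)[of "iter_dd hs _" h] by (auto simp: pd_def[abs_def])
  qed simp
  then show ?thesis unfolding smooth_fn_def using assms(1,2) by blast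
qed

lemma has_derivative_pd: "f differentiable (at p) \<Longrightarrow> (f has_derivative (\<lambda>h. pd f h p)) (at p)"
  unfolding pd_def using frechet_derivative_works by fastforce

lemma pd_eqI: "(f has_derivative f') (at p) \<Longrightarrow> pd f h p = f' h"
  unfolding pd_def using frechet_derivative_at by metis

lemma smooth_fn_continuous_on: "smooth_fn f \<Longrightarrow> continuous_on A f"
  by (meson continuous_at_imp_continuous_on differentiable_imp_continuous_within smooth_fn_differentiable)

lemma smooth_fn_const: "smooth_fn (\<lambda>p. c)"
proof (rule smooth_fn_coinduct[where A = "range (\<lambda>c. (\<lambda>p. c))"])
  fix f :: "'a \<Rightarrow> real" and h assume "f \<in> range (\<lambda>c p. c)"
  then obtain c where f: "f = (\<lambda>p. c)" by auto
  have "pd f h = (\<lambda>p. 0)" by (auto simp: f fun_eq_iff intro!: pd_eqI[where f' = "\<lambda>h. 0"])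
  then show "pd f h \<in> range (\<lambda>c p. c)" by auto
qed auto

lemma pd_const [simp]: "pd (\<lambda>p. c) h p = 0"
  by (rule pd_eqI[where f' = "\<lambda>h. 0"]) auto

lemma pd_add: "smooth_fn f \<Longrightarrow> smooth_fn g \<Longrightarrow> pd (\<lambda>p. f p + g p) h p = pd f h p + pd g h p"
  by (rule pd_eqI[where f' = "\<lambda>h. pd f h p + pd g h p"])
     (intro has_derivative_add has_derivative_pd smooth_fn_differentiable)

lemma pd_mult:
  "smooth_fn f \<Longrightarrow> smooth_fn g \<Longrightarrow> pd (\<lambda>p. f p * g p) h p = pd f h p * g p + f p * pd g h p"
  by (rule trans[OF pd_eqI[where f' = "\<lambda>h. f p * pd g h p + pd f h p * g p"]])
     (auto intro!: has_derivative_mult has_derivative_pd smooth_fn_differentiable)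

text \<open>The product rule turns one product into two, so sums are adjoined to obtain a family
  stable under \<open>pd\<close>.\<close>

inductive_set prod_span :: "('a::real_normed_vector \<Rightarrow> real) set" where
  prod: "smooth_fn f \<Longrightarrow> smooth_fn g \<Longrightarrow> (\<lambda>p. f p * g p) \<in> prod_span"
| sum: "f \<in> prod_span \<Longrightarrow> g \<in> prod_span \<Longrightarrow> (\<lambda>p. f p + g p) \<in> prod_span"

lemma prod_span_differentiable: "f \<in> prod_span \<Longrightarrow> f differentiable (at p)"
proof (induction rule: prod_span.induct)
  case (prod f g)
  then show ?case by (intro differentiable_mult) (rule smooth_fn_differentiable, assumption)+
next
  case (sum f g)
  then show ?case by (intro differentiable_add)
qed

lemma prod_span_pd: "f \<in> prod_span \<Longrightarrow> pd f h \<in> prod_span"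
proof (induction rule: prod_span.induct)
  case (prod f g)
  then have "pd (\<lambda>p. f p * g p) h = (\<lambda>p. pd f h p * g p + f p * pd g h p)"
    by (auto simp: pd_mult fun_eq_iff)
  with prod show ?case by (auto intro!: prod_span.intros smooth_fn_pd)
next
  case (sum f g)
  then have "pd (\<lambda>p. f p + g p) h = (\<lambda>p. pd f h p + pd g h p)"
    by (intro ext pd_eqI[where f' = "\<lambda>h. pd f h p + pd g h p" for p] has_derivative_add
        has_derivative_pd prod_span_differentiable)
  with sum show ?case by (auto intro!: prod_span.intros)
qed

lemma prod_span_smooth: "f \<in> prod_span \<Longrightarrow> smooth_fn f"
  by (rule smooth_fn_coinduct[where A = prod_span]) (auto intro: prod_span_differentiable prod_span_pd)

lemma smooth_fn_mult: "smooth_fn f \<Longrightarrow> smooth_fn g \<Longrightarrow> smooth_fn (\<lambda>p. f p * g p)"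
  using prod_span_smooth prod_span.prod by blast

text \<open>The sum is read as f * 1 + g * 1, a member of the product family.\<close>

lemma smooth_fn_add: "smooth_fn f \<Longrightarrow> smooth_fn g \<Longrightarrow> smooth_fn (\<lambda>p. f p + g p)"
  using prod_span_smooth[OF prod_span.sum[OF prod_span.prod prod_span.prod],
      of f "\<lambda>p. 1" g "\<lambda>p. 1"] by (simp add: smooth_fn_const)

lemma smooth_fn_prod: "(\<And>i. i \<in> I \<Longrightarrow> smooth_fn (f i)) \<Longrightarrow> smooth_fn (\<lambda>p. \<Prod>i\<in>I. f i p)"
  by (induction I rule: infinite_finite_induct) (auto intro: smooth_fn_mult smooth_fn_const)

lemma smooth_fn_affine:
  fixes l :: "'a::real_normed_vector \<Rightarrow> 'b::real_normed_vector"
  assumes "smooth_fn f" "bounded_linear l"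
  shows "smooth_fn (\<lambda>p. f (l p + b))"
    and "pd (\<lambda>p. f (l p + b)) h p = pd f (l h) (l p + b)"
proof -
  have D: "((\<lambda>p. f (l p + b)) has_derivative (\<lambda>h. pd f (l h) (l p + b))) (at p)"
    if "smooth_fn f" for f :: "'b \<Rightarrow> real" and p
  proof -
    have "((\<lambda>p. l p + b) has_derivative l) (at p)"
      using bounded_linear_imp_has_derivative[OF assms(2)] by (auto intro: has_derivative_add_const)
    from has_derivative_compose[OF this has_derivative_pd[OF smooth_fn_differentiable[OF that]]]
    show ?thesis .
  qed
  show E: "pd (\<lambda>p. f (l p + b)) h p = pd f (l h) (l p + b)"
    by (rule pd_eqI[OF D[OF assms(1)]])
  show "smooth_fn (\<lambda>p. f (l p + b))"
  proof (rule smooth_fn_coinduct[where A = "{\<lambda>p. f (l p + b) | f. smooth_fn f}"])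
    show "(\<lambda>p. f (l p + b)) \<in> {\<lambda>p. f (l p + b) |f. smooth_fn f}" using assms by auto
  next
    fix g p assume "g \<in> {\<lambda>p. f (l p + b) |f. smooth_fn f}"
    then show "g differentiable at p" using D differentiable_def by blast
  next
    fix g h assume "g \<in> {\<lambda>p. f (l p + b) |f. smooth_fn f}"
    then obtain f where f: "smooth_fn f" "g = (\<lambda>p. f (l p + b))" by auto
    have "pd g h = (\<lambda>p. pd f (l h) (l p + b))"
      unfolding f(2) by (intro ext pd_eqI[OF D[OF f(1)]])
    then show "pd g h \<in> {\<lambda>p. f (l p + b) |f. smooth_fn f}"
      using smooth_fn_pd[OF f(1)] by (intro CollectI exI[of _ "pd f (l h)"]) auto
  qed
qed

text \<open>An antiderivative needs only one extra member in a stable family, since its own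
  derivatives are multiples of the smooth f. This is how the integrated bump becomes a smooth
  step.\<close>

lemma smooth_fn_real_deriv:
  fixes F f :: "real \<Rightarrow> real"
  assumes D: "\<And>x. (F has_real_derivative f x) (at x)" and f: "smooth_fn f"
  shows "smooth_fn F" and "pd F h x = f x * h"
proof -
  have pd: "pd F h x = f x * h" for h x
    by (rule pd_eqI) (use D[of x] in \<open>simp add: has_field_derivative_def\<close>)
  show "pd F h x = f x * h" by (rule pd)
  show "smooth_fn F"
  proof (rule smooth_fn_coinduct[where A = "insert F {f. smooth_fn f}"])
    fix g p assume "g \<in> insert F {f. smooth_fn f}"
    then show "g differentiable at p" 
      using D smooth_fn_differentiable by (auto simp: has_field_derivative_def differentiable_def)
  next
    fix g h assume "g \<in> insert F {f. smooth_fn f}"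
    moreover have "pd F h = (\<lambda>x. f x * h)" using pd by auto
    ultimately show "pd g h \<in> insert F {f. smooth_fn f}"
      using smooth_fn_pd smooth_fn_mult[OF f smooth_fn_const] by auto
  qed auto
qed

lemma smooth_fn_exp: "smooth_fn (\<lambda>x::real. exp (c * x))"
proof (rule smooth_fn_coinduct[where A = "range (\<lambda>k x. k * exp (c * x))"])
  have "(\<lambda>x. exp (c * x)) = (\<lambda>k x. k * exp (c * x)) 1" by auto
  then show "(\<lambda>x. exp (c * x)) \<in> range (\<lambda>k x. k * exp (c * x))" by blast
next
  fix f :: "real \<Rightarrow> real" and h assume "f \<in> range (\<lambda>k x. k * exp (c * x))"
  then obtain k where f: "f = (\<lambda>x. k * exp (c * x))" by auto
  have "pd f h = (\<lambda>x. (k * c * h) * exp (c * x))"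
    by (auto simp: f fun_eq_iff intro!: trans[OF pd_eqI] derivative_eq_intros)
  then show "pd f h \<in> range (\<lambda>k x. k * exp (c * x))" by auto
next
  fix f :: "real \<Rightarrow> real" and p assume "f \<in> range (\<lambda>k x. k * exp (c * x))"
  then obtain k where f: "f = (\<lambda>x. k * exp (c * x))" by auto
  show "f differentiable (at p)"
    unfolding f real_differentiable_def by (auto intro!: derivative_eq_intros exI)
qed

section \<open>Smooth steps from exp(-1/x)\<close>

definition flat :: "nat \<Rightarrow> real \<Rightarrow> real" where
  "flat k x = (if x > 0 then exp (- (1 / x)) * (1 / x) ^ k else 0)"

text \<open>Differentiating exp(-1/x) x^(-k) raises the exponent by two and by one, which is why
  \<open>flat\<close> carries the power k: the family is then stable up to linear combinations. At 0
  the right difference quotient is y^(k+1) / exp y with y = 1/h, which tends to 0.\<close>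

lemma flat_deriv: "(flat k has_real_derivative (flat (k + 2) x - k * flat (k + 1) x)) (at x)"
proof (cases "x = 0")
  case False
  show ?thesis
  proof (cases "x > 0")
    case True
    have i: "((\<lambda>x. 1 / x) has_real_derivative - ((1 / x) * (1 / x))) (at x)"
      using DERIV_inverse[of x] True by (simp add: divide_inverse power2_eq_square)
    \<comment> \<open>For k = 0 the truncated exponent \<open>k - Suc 0\<close> is harmless because
      of the factor k.\<close>
    have p: "real k * (1 / x) ^ (k - Suc 0) * (1 / x) = real k * (1 / x) ^ k"
      by (cases k) auto
    have "((\<lambda>x. exp (- (1 / x)) * (1 / x) ^ k) has_real_derivative
        exp (- (1 / x)) * ((1 / x) * (1 / x)) * (1 / x) ^ k
          + real k * (- ((1 / x) * (1 / x)) * (1 / x) ^ (k - Suc 0)) * exp (- (1 / x))) (at x)"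
      using DERIV_mult[OF DERIV_fun_exp[OF DERIV_minus[OF i]] DERIV_power[OF i, of k]] by simp
    also have "exp (- (1 / x)) * ((1 / x) * (1 / x)) * (1 / x) ^ k
          + real k * (- ((1 / x) * (1 / x)) * (1 / x) ^ (k - Suc 0)) * exp (- (1 / x))
        = exp (- (1 / x)) * ((1 / x) * (1 / x)) * (1 / x) ^ k
          - (real k * (1 / x) ^ (k - Suc 0) * (1 / x)) * (1 / x) * exp (- (1 / x))"
      by (simp add: mult_ac)
    also have "\<dots> = flat (k + 2) x - k * flat (k + 1) x"
      unfolding p using True by (simp add: flat_def mult_ac)
    finally have "((\<lambda>x. exp (- (1 / x)) * (1 / x) ^ k) has_real_derivative
       (flat (k + 2) x - k * flat (k + 1) x)) (at x)" .
    then show ?thesis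
      by (rule has_field_derivative_transform_within_open[where S = "{0<..}"])
         (use True in \<open>auto simp: flat_def\<close>)
  next
    case F: False
    have "((\<lambda>x. 0) has_real_derivative (flat (k + 2) x - k * flat (k + 1) x)) (at x)"
      using F by (auto simp: flat_def)
    then show ?thesis
      by (rule has_field_derivative_transform_within_open[where S = "{..<0}"])
         (use False F in \<open>auto simp: flat_def\<close>)
  qed
next
  case True
  have "((\<lambda>h. inverse h ^ (k + 1) / exp (inverse h)) \<longlongrightarrow> 0) (at_right (0::real))"
    using filterlim_compose[OF tendsto_power_div_exp_0 filterlim_inverse_at_top_right] .
  then have "((\<lambda>h. flat k h / h) \<longlongrightarrow> 0) (at_right 0)"
    by (rule Lim_transform_eventually)
       (auto simp: eventually_at_filter flat_def exp_minus divide_inverse mult_ac)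
  moreover have "((\<lambda>h. flat k h / h) \<longlongrightarrow> 0) (at_left 0)"
    by (rule Lim_transform_eventually[OF tendsto_const])
       (auto simp: eventually_at_filter flat_def)
  ultimately have "((\<lambda>h. flat k h / h) \<longlongrightarrow> 0) (at 0)"
    by (simp add: filterlim_at_split)
  then show ?thesis using True by (simp add: DERIV_def flat_def)
qed

inductive_set flat_span :: "(real \<Rightarrow> real) set" where
  base: "(\<lambda>x. c * flat k x) \<in> flat_span"
| sum: "f \<in> flat_span \<Longrightarrow> g \<in> flat_span \<Longrightarrow> (\<lambda>x. f x + g x) \<in> flat_span"

lemma flat_span_deriv: "f \<in> flat_span \<Longrightarrow> \<exists>f'. (\<forall>x. (f has_real_derivative f' x) (at x)) \<and> (\<forall>h. (\<lambda>x. f' x * h) \<in> flat_span)"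
proof (induction rule: flat_span.induct)
  case (base c k)
  show ?case
  proof (intro exI[of _ "\<lambda>x. c * (flat (k + 2) x - k * flat (k + 1) x)"] conjI allI)
    show "((\<lambda>x. c * flat k x) has_real_derivative c * (flat (k + 2) x - real k * flat (k + 1) x)) (at x)" for x
      using flat_deriv[of k x] by (rule DERIV_cmult)
    fix h
    have "(\<lambda>x. (c * h) * flat (k + 2) x + (- c * real k * h) * flat (k + 1) x) \<in> flat_span"
      by (intro flat_span.intros)
    then show "(\<lambda>x. c * (flat (k + 2) x - real k * flat (k + 1) x) * h) \<in> flat_span"
      by (simp add: algebra_simps)
  qed
next
  case (sum f g)
  then obtain f' g' where "\<forall>x. (f has_real_derivative f' x) (at x)" "\<forall>h. (\<lambda>x. f' x * h) \<in> flat_span"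
    "\<forall>x. (g has_real_derivative g' x) (at x)" "\<forall>h. (\<lambda>x. g' x * h) \<in> flat_span" by auto
  then show ?case
    by (intro exI[of _ "\<lambda>x. f' x + g' x"]) (auto intro!: DERIV_add flat_span.sum simp: distrib_right)
qed

lemma smooth_fn_flat: "smooth_fn (flat k)"
proof (rule smooth_fn_coinduct[where A = flat_span])
  show "flat k \<in> flat_span" using flat_span.base[of 1 k] by simp
  fix f :: "real \<Rightarrow> real" assume f: "f \<in> flat_span"
  then obtain f' where f': "\<And>x. (f has_real_derivative f' x) (at x)" "\<And>h. (\<lambda>x. f' x * h) \<in> flat_span"
    using flat_span_deriv by blast
  show "f differentiable at p" for p
    using f'(1) by (auto simp: has_field_derivative_def differentiable_def)
  show "pd f h \<in> flat_span" for h
  proof -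
    have "pd f h = (\<lambda>x. f' x * h)"
      by (intro ext pd_eqI) (use f'(1) in \<open>simp add: has_field_derivative_def\<close>)
    with f'(2) show ?thesis by simp
  qed
qed

text \<open>A smooth bump positive exactly on (0,1); it serves as the derivative of the step before
  normalisation.\<close>

definition eta :: "real \<Rightarrow> real" where
  "eta x = flat 0 x * flat 0 (1 - x)"

lemma eta_nonneg: "0 \<le> eta x" and eta_pos: "0 < x \<Longrightarrow> x < 1 \<Longrightarrow> 0 < eta x"
  and eta_0: "x \<le> 0 \<or> 1 \<le> x \<Longrightarrow> eta x = 0"
  by (auto simp: eta_def flat_def)

lemma smooth_fn_eta: "smooth_fn eta"
  unfolding eta_def[abs_def]
  using smooth_fn_affine(1)[OF smooth_fn_flat[of 0], of uminus 1]
  by (intro smooth_fn_mult smooth_fn_flat) (auto simp: bounded_linear_minus bounded_linear_ident)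

lemma ex_step:
  "\<exists>s::real \<Rightarrow> real. \<exists>s'. smooth_fn s \<and> (\<forall>x. (s has_real_derivative s' x) (at x)) \<and> (\<forall>x. 0 \<le> s' x)
     \<and> (\<forall>x\<le>0. s x = 0) \<and> (\<forall>x\<ge>1. s x = 1)"
proof -
  define F where "F x = (if x \<le> 0 then 0 else integral {0..x} eta)" for x :: real
  have cont: "continuous_on A eta" for A by (rule smooth_fn_continuous_on[OF smooth_fn_eta])
  have D: "(F has_real_derivative eta x) (at x)" for x
  proof (cases "x \<le> -1")
    case True
    have "((\<lambda>x. 0) has_real_derivative eta x) (at x)" using True eta_0 by auto
    then show ?thesis
      by (rule has_field_derivative_transform_within_open[where S = "{..<0}"])
         (use True in \<open>auto simp: F_def\<close>)
  next
    case False
    \<comment> \<open>The primitive is started at -2, where \<open>eta\<close> still vanishes, so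
      that x is an interior point of the interval of integration also when it lies near 0.\<close>
    define G where "G y = integral {-2..y} eta" for y :: real
    have "(G has_real_derivative eta x) (at x within {-2..x+1})"
      unfolding G_def by (rule integral_has_real_derivative[OF cont]) (use False in auto)
    then have G: "(G has_real_derivative eta x) (at x)"
      using False by (subst (asm) at_within_interior) (auto simp: interior_atLeastAtMost_real)
    show ?thesis
    proof (rule has_field_derivative_transform_within_open[OF G, where S = "{-1<..}"])
      fix y :: real assume "y \<in> {-1<..}"
      show "G y = F y"
      proof (cases "y \<le> 0")
        case True
        then have "G y = integral {-2..y} (\<lambda>x. 0)"
          unfolding G_def by (intro integral_cong) (auto simp: eta_0)
        then show ?thesis using True by (simp add: F_def)
      next
        case False
        have "integral {-2..0} eta + integral {0..y} eta = integral {-2..y} eta"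
          by (rule Henstock_Kurzweil_Integration.integral_combine)
             (use False in \<open>auto intro: integrable_continuous_interval cont\<close>)
        moreover have "integral {-2..0} eta = integral {-2..0::real} (\<lambda>x. 0)"
          by (intro integral_cong) (auto simp: eta_0)
        ultimately show ?thesis using False by (simp add: F_def G_def)
      qed
    qed (use False in auto)
  qed
  have mono: "F x \<le> F y" if "x \<le> y" for x y
    by (rule DERIV_nonneg_imp_nondecreasing[OF that]) (use D eta_nonneg in blast)
  have F1: "F x = F 1" if "x \<ge> 1" for x
  proof -
    have "integral {0..1} eta + integral {1..x} eta = integral {0..x} eta"
      by (rule Henstock_Kurzweil_Integration.integral_combine) (use that in \<open>auto intro: integrable_continuous_interval cont\<close>)
    moreover have "integral {1..x} eta = integral {1..x} (\<lambda>x. 0)"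
      by (intro integral_cong) (auto simp: eta_0)
    ultimately show ?thesis using that by (simp add: F_def)
  qed
  have pos: "F 1 > 0"
  proof -
    \<comment> \<open>Otherwise monotonicity makes F constant on (0,1), although its derivative at
      1/2 is positive.\<close>
    have "F 1 \<noteq> F 0"
    proof
      assume E: "F 1 = F 0"
      have "F x = F 0" if "0 < x" "x < 1" for x using mono[of 0 x] mono[of x 1] E that by auto
      then have "((\<lambda>x. F 0) has_real_derivative eta (1/2)) (at (1/2))"
        by (intro has_field_derivative_transform_within_open[OF D, where S = "{0<..<1}"]) auto
      then have "eta (1/2) = 0" using DERIV_unique DERIV_const by blast
      then show False using eta_pos[of "1/2"] by auto
    qed
    then show ?thesis using mono[of 0 1] by (simp add: F_def)
  qed
  have 1: "((\<lambda>x. F x / F 1) has_real_derivative (1 / F 1) * eta x) (at x)" for x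
    using DERIV_cmult[OF D, of "1 / F 1"] by simp
  have "smooth_fn (\<lambda>x. F x / F 1)"
    by (rule smooth_fn_real_deriv(1)[OF 1]) (intro smooth_fn_mult smooth_fn_const smooth_fn_eta)
  moreover have "0 \<le> 1 / F 1 * eta x" for x using pos eta_nonneg by simp
  moreover have "x \<le> 0 \<Longrightarrow> F x / F 1 = 0" for x by (simp add: F_def)
  moreover have "F x / F 1 = 1" if "1 \<le> x" for x unfolding F1[OF that] using pos by simp
  ultimately show ?thesis
    using 1 by (intro exI[of _ "\<lambda>x. F x / F 1"] exI[of _ "\<lambda>x. (1 / F 1) * eta x"]) blast
qed

definition step :: "real \<Rightarrow> real" where
  "step = (SOME s. \<exists>s'. smooth_fn s \<and> (\<forall>x. (s has_real_derivative s' x) (at x)) \<and> (\<forall>x. 0 \<le> s' x)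
     \<and> (\<forall>x\<le>0. s x = 0) \<and> (\<forall>x\<ge>1. s x = 1))"

lemma step_props:
  shows smooth_fn_step: "smooth_fn step"
    and step_pd: "pd step h x = deriv step x * h"
    and step_deriv_nonneg: "0 \<le> deriv step x"
    and step_0: "x \<le> 0 \<Longrightarrow> step x = 0" and step_1: "x \<ge> 1 \<Longrightarrow> step x = 1"
    and step_nonneg: "0 \<le> step x" and step_le_1: "step x \<le> 1"
proof -
  obtain s' where s: "smooth_fn step" "\<And>x. (step has_real_derivative s' x) (at x)" "\<And>x. 0 \<le> s' x"
     "\<And>x. x\<le>0 \<Longrightarrow> step x = 0" "\<And>x. x\<ge>1 \<Longrightarrow> step x = 1"
    using someI_ex[OF ex_step] unfolding step_def[symmetric] by blast
  have d: "deriv step x = s' x" for x using s(2) by (rule DERIV_imp_deriv)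
  show "smooth_fn step" "0 \<le> deriv step x"
    "x \<le> 0 \<Longrightarrow> step x = 0" "x \<ge> 1 \<Longrightarrow> step x = 1" using s by (auto simp: d)
  show "pd step h x = deriv step x * h"
    by (rule pd_eqI) (use s(2) in \<open>simp add: d has_field_derivative_def\<close>)
  have mono: "step x \<le> step y" if "x \<le> y" for x y
    by (rule DERIV_nonneg_imp_nondecreasing[OF that]) (use s in blast)
  show "0 \<le> step x" using mono[of "min x 0" x] s(4)[of "min x 0"] by auto
  show "step x \<le> 1" using mono[of x "max x 1"] s(5)[of "max x 1"] by auto
qed

lemma pd_scale: "smooth_fn f \<Longrightarrow> pd f (c *\<^sub>R h) p = c * pd f h p"
  using has_derivative_pd[OF smooth_fn_differentiable, THEN has_derivative_linear, of f p]
    linear_scale by fastforce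

lemma pd_line:
  assumes "smooth_fn f"
  shows "((\<lambda>s. f (p + s *\<^sub>R h)) has_real_derivative pd f h (p + s *\<^sub>R h)) (at s)"
proof -
  have "((\<lambda>s. p + s *\<^sub>R h) has_derivative (\<lambda>s. s *\<^sub>R h)) (at s)"
    by (auto intro!: derivative_eq_intros)
  from has_derivative_compose[OF this has_derivative_pd[OF smooth_fn_differentiable[OF assms]]]
  moreover have "(\<lambda>x. pd f (x *\<^sub>R h) (p + s *\<^sub>R h)) = (*) (pd f h (p + s *\<^sub>R h))"
    by (auto simp: pd_scale[OF assms])
  ultimately show ?thesis by (simp add: has_field_derivative_def)
qed

lemma pd_invariant:
  assumes "smooth_fn f" "\<And>s. f (p + s *\<^sub>R h) = f p"
  shows "pd f h p = 0"
  using DERIV_unique[OF pd_line[OF assms(1), of p h 0]] by (simp add: assms(2))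

lemma smooth_fn_cmult: "smooth_fn f \<Longrightarrow> smooth_fn (\<lambda>p. c * f p)"
  by (intro smooth_fn_mult smooth_fn_const)

lemma pd_cmult: "smooth_fn f \<Longrightarrow> pd (\<lambda>p. c * f p) h p = c * pd f h p"
  by (subst pd_mult[OF smooth_fn_const]) auto

lemma smooth_fn_reflect:
  assumes "smooth_fn f"
  shows "smooth_fn (\<lambda>p. f (q - p))" "pd (\<lambda>p. f (q - p)) h p = - pd f h (q - p)"
proof -
  have l: "bounded_linear (uminus :: 'a \<Rightarrow> 'a)" by (intro bounded_linear_minus bounded_linear_ident)
  show "smooth_fn (\<lambda>p. f (q - p))"
    using smooth_fn_affine(1)[OF assms l, of q] by simp
  show "pd (\<lambda>p. f (q - p)) h p = - pd f h (q - p)"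
    using smooth_fn_affine(2)[OF assms l, of q h p] pd_scale[OF assms, of "-1" h] by simp
qed

lemma smooth_fn_shift:
  assumes "smooth_fn f"
  shows "smooth_fn (\<lambda>p. f (p - q))" "pd (\<lambda>p. f (p - q)) h p = pd f h (p - q)"
  using smooth_fn_affine(1)[OF assms bounded_linear_ident, of "-q"]
    smooth_fn_affine(2)[OF assms bounded_linear_ident, of "-q"] by auto

lemma smooth_fn_inner:
  fixes e :: "'a::real_inner"
  assumes "smooth_fn f"
  shows "smooth_fn (\<lambda>p. f (p \<bullet> e / r))" "pd (\<lambda>p. f (p \<bullet> e / r)) h p = pd f 1 (p \<bullet> e / r) * (h \<bullet> e / r)"
proof -
  have l: "bounded_linear (\<lambda>p. p \<bullet> e / r)"
    by (intro bounded_linear_divide[THEN bounded_linear_compose] bounded_linear_inner_left)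
  show "smooth_fn (\<lambda>p. f (p \<bullet> e / r))"
    using smooth_fn_affine(1)[OF assms l, of 0] by simp
  show "pd (\<lambda>p. f (p \<bullet> e / r)) h p = pd f 1 (p \<bullet> e / r) * (h \<bullet> e / r)"
    using smooth_fn_affine(2)[OF assms l, of 0 h p] pd_scale[OF assms, of "h \<bullet> e / r" 1]
    by simp
qed

text \<open>Any compact set off which the function vanishes can replace the closed support, since it
  is closed and so contains the closure of the nonzero set.\<close>

lemma test_fnI:
  assumes "smooth_fn \<phi>" "compact K" "K \<subseteq> G" "\<And>p. p \<notin> K \<Longrightarrow> \<phi> p = 0"
  shows "test_fn G \<phi>"
proof -
  have "closure {p. \<phi> p \<noteq> 0} \<subseteq> K"
    using assms by (intro closure_minimal compact_imp_closed) auto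
  then show ?thesis
    unfolding test_fn_def using assms compact_Int_closed[OF assms(2) closed_closure, of "{p. \<phi> p \<noteq> 0}"]
    by (auto simp: Int_absorb1)
qed

lemma test_fnE:
  assumes "test_fn G \<phi>"
  obtains K where "smooth_fn \<phi>" "compact K" "K \<subseteq> G" "\<And>p. p \<notin> K \<Longrightarrow> \<phi> p = 0"
  using assms closure_subset[of "{p. \<phi> p \<noteq> 0}"] unfolding test_fn_def by blast

lemma test_fn_smooth: "test_fn G \<phi> \<Longrightarrow> smooth_fn \<phi>"
  by (simp add: test_fn_def)

lemma test_fn_mono: "test_fn G \<phi> \<Longrightarrow> G \<subseteq> G' \<Longrightarrow> test_fn G' \<phi>"
  by (auto simp: test_fn_def)

lemma test_fn_mult:
  assumes "test_fn G \<phi>" "smooth_fn \<psi>"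
  shows "test_fn G (\<lambda>p. \<phi> p * \<psi> p)" "test_fn G (\<lambda>p. \<psi> p * \<phi> p)"
  by (rule test_fnE[OF assms(1)], rule test_fnI, auto intro!: smooth_fn_mult assms)+

lemma test_fn_add:
  assumes "test_fn G \<phi>" "test_fn G \<psi>"
  shows "test_fn G (\<lambda>p. \<phi> p + \<psi> p)"
proof -
  obtain K where K: "smooth_fn \<phi>" "compact K" "K \<subseteq> G" "\<And>p. p \<notin> K \<Longrightarrow> \<phi> p = 0"
    using test_fnE[OF assms(1)] by blast
  obtain K' where K': "smooth_fn \<psi>" "compact K'" "K' \<subseteq> G" "\<And>p. p \<notin> K' \<Longrightarrow> \<psi> p = 0"
    using test_fnE[OF assms(2)] by blast
  show ?thesis
    by (rule test_fnI[where K = "K \<union> K'"]) (use K K' in \<open>auto intro!: smooth_fn_add compact_Un\<close>)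
qed

lemma test_fn_pd:
  assumes "test_fn G \<phi>"
  shows "test_fn G (pd \<phi> h)"
proof -
  obtain K where K: "smooth_fn \<phi>" "compact K" "K \<subseteq> G" "\<And>p. p \<notin> K \<Longrightarrow> \<phi> p = 0"
    using test_fnE[OF assms(1)] by blast
  have "pd \<phi> h p = 0" if "p \<notin> K" for p
  proof (rule pd_eqI)
    have "((\<lambda>p. 0) has_derivative (\<lambda>h. 0)) (at p)" by simp
    then show "(\<phi> has_derivative (\<lambda>h. 0)) (at p)"
      by (rule has_derivative_transform_within_open[where s = "- K"])
         (use K that in \<open>auto simp: compact_imp_closed open_Compl\<close>)
  qed
  then show ?thesis using K by (intro test_fnI[of _ K] smooth_fn_pd) auto
qed

lemma test_fn_zero: "test_fn G (\<lambda>p. 0)"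
  by (rule test_fnI[where K = "{}"]) (auto intro: smooth_fn_const)

section \<open>Even plateau functions and their anisotropic products\<close>

definition bmp :: "real \<Rightarrow> real" where
  "bmp x = step (2 + x) * step (2 - x)"

lemma smooth_fn_bmp: "smooth_fn bmp"
  unfolding bmp_def[abs_def]
  using smooth_fn_reflect(1)[OF smooth_fn_step, of 2] smooth_fn_shift(1)[OF smooth_fn_step, of "-2"]
  by (intro smooth_fn_mult) (auto simp: add.commute)

lemma bmp_props:
  shows bmp_even: "bmp (- x) = bmp x" and bmp_nonneg: "0 \<le> bmp x" and bmp_le_1: "bmp x \<le> 1"
    and bmp_1: "\<bar>x\<bar> \<le> 1 \<Longrightarrow> bmp x = 1" and bmp_0: "2 \<le> \<bar>x\<bar> \<Longrightarrow> bmp x = 0"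
proof -
  show "bmp (- x) = bmp x" "0 \<le> bmp x"
    by (auto simp: bmp_def step_nonneg)
  show "bmp x \<le> 1"
    unfolding bmp_def using mult_mono[of "step (2 + x)" 1 "step (2 - x)" 1] step_nonneg step_le_1 by auto
  show "bmp x = 1" if "\<bar>x\<bar> \<le> 1" using that by (auto simp: bmp_def step_1)
  show "bmp x = 0" if "2 \<le> \<bar>x\<bar>"
    using that step_0[of "2 + x"] step_0[of "2 - x"] by (cases "x \<ge> 0") (auto simp: bmp_def)
qed

lemma test_fn_bounded:
  assumes "test_fn G \<phi>"
  obtains C where "C \<ge> 0" "\<And>p. \<bar>\<phi> p\<bar> \<le> C"
proof -
  obtain K where K: "smooth_fn \<phi>" "compact K" "K \<subseteq> G" "\<And>p. p \<notin> K \<Longrightarrow> \<phi> p = 0"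
    using test_fnE[OF assms] by blast
  have "bounded (\<phi> ` K)"
    using K by (intro compact_imp_bounded compact_continuous_image smooth_fn_continuous_on)
  then obtain C where C: "\<And>p. p \<in> K \<Longrightarrow> \<bar>\<phi> p\<bar> \<le> C" by (auto simp: bounded_iff)
  show ?thesis
  proof (rule that[of "max C 0"])
    fix p show "\<bar>\<phi> p\<bar> \<le> max C 0" using C[of p] K(4)[of p] by (cases "p \<in> K") auto
  qed auto
qed

lemma test_fn_bmp: "test_fn UNIV bmp"
  by (rule test_fnI[where K = "{-2..2}"]) (auto simp: smooth_fn_bmp bmp_0)

text \<open>One bound for the derivative of \<open>bmp\<close>, shared by all rescaled bumps, so
  that later estimates depend on the widths only through 1 / r e.\<close>

definition bmpC :: real where
  "bmpC = (SOME C. C \<ge> 0 \<and> (\<forall>x. \<bar>pd bmp 1 x\<bar> \<le> C))"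

lemma bmpC: "bmpC \<ge> 0" "\<bar>pd bmp 1 x\<bar> \<le> bmpC"
proof -
  have "\<exists>C. C \<ge> 0 \<and> (\<forall>x. \<bar>pd bmp 1 x\<bar> \<le> C)"
    using test_fn_bounded[OF test_fn_pd[OF test_fn_bmp]] by metis
  from someI_ex[OF this] show "bmpC \<ge> 0" "\<bar>pd bmp 1 x\<bar> \<le> bmpC" unfolding bmpC_def by auto
qed

text \<open>Each coordinate has its own width r e; the plateau is \<open>box_of r\<close> and the
  support lies in the doubled box. The same functions serve as mollifiers (small widths) and as
  cut-offs (large widths).\<close>

definition boxbump :: "('a::euclidean_space \<Rightarrow> real) \<Rightarrow> 'a \<Rightarrow> real" where
  "boxbump r p = (\<Prod>e\<in>Basis. bmp ((p \<bullet> e) / r e))"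

definition box_of :: "('a::euclidean_space \<Rightarrow> real) \<Rightarrow> 'a set" where
  "box_of r = cbox (- (\<Sum>e\<in>Basis. r e *\<^sub>R e)) (\<Sum>e\<in>Basis. r e *\<^sub>R e)"

lemma mem_box_of: "p \<in> box_of r \<longleftrightarrow> (\<forall>e\<in>Basis. \<bar>p \<bullet> e\<bar> \<le> r e)"
  by (auto simp: box_of_def mem_box abs_le_iff)

lemma compact_box_of: "compact (box_of r)"
  by (simp add: box_of_def)

lemma measure_box_of:
  assumes "\<And>e. e \<in> Basis \<Longrightarrow> r e > 0"
  shows "measure lborel (box_of r) = (\<Prod>e\<in>Basis. 2 * r e)"
  using assms
  by (auto simp: box_of_def measure_lborel_cbox_eq inner_diff_left inner_add_left less_imp_le intro!: prod.cong)

context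
  fixes r :: "'a::euclidean_space \<Rightarrow> real"
  assumes r: "\<And>e. e \<in> Basis \<Longrightarrow> r e > 0"
begin

lemma boxbump_nonneg: "0 \<le> boxbump r p" and boxbump_le_1: "boxbump r p \<le> 1"
  by (auto simp: boxbump_def bmp_nonneg bmp_le_1 intro!: prod_nonneg prod_le_1)

lemma boxbump_even: "boxbump r (- p) = boxbump r p"
  by (simp add: boxbump_def bmp_even)

lemma boxbump_1: "p \<in> box_of r \<Longrightarrow> boxbump r p = 1"
  using r by (auto simp: boxbump_def mem_box_of intro!: prod.neutral bmp_1)

lemma boxbump_0: "p \<notin> box_of (\<lambda>e. 2 * r e) \<Longrightarrow> boxbump r p = 0"
proof -
  assume "p \<notin> box_of (\<lambda>e. 2 * r e)"
  then obtain e where e: "e \<in> Basis" "\<bar>p \<bullet> e\<bar> > 2 * r e" by (auto simp: mem_box_of not_le)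
  then have "bmp ((p \<bullet> e) / r e) = 0" using r[OF e(1)] by (intro bmp_0) (auto simp: field_simps)
  then show ?thesis using e by (auto simp: boxbump_def)
qed

lemma smooth_fn_boxbump: "smooth_fn (boxbump r)"
  unfolding boxbump_def[abs_def] by (intro smooth_fn_prod smooth_fn_inner smooth_fn_bmp)

lemma test_fn_boxbump: "test_fn UNIV (boxbump r)"
  by (rule test_fnI[OF smooth_fn_boxbump compact_box_of]) (auto intro: boxbump_0)

lemma pd_boxbump_0:
  assumes "p \<notin> box_of (\<lambda>e. 2 * r e)" shows "pd (boxbump r) h p = 0"
proof -
  have "test_fn (box_of (\<lambda>e. 2 * r e)) (boxbump r)"
    by (rule test_fnI[OF smooth_fn_boxbump compact_box_of]) (auto intro: boxbump_0)
  from test_fn_pd[OF this, of h] show ?thesis using assms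
    by (elim test_fnE) auto
qed

text \<open>The factors for the other coordinates do not vary along e, so only one factor is
  differentiated, and the remaining product is at most 1.\<close>

lemma pd_boxbump:
  assumes e: "e \<in> Basis"
  shows "\<bar>pd (boxbump r) e p\<bar> \<le> bmpC / r e"
proof -
  define Q where "Q p = (\<Prod>e'\<in>Basis - {e}. bmp ((p \<bullet> e') / r e'))" for p
  have Q: "smooth_fn Q"
    unfolding Q_def[abs_def] by (intro smooth_fn_prod smooth_fn_inner smooth_fn_bmp)
  have Q1: "\<bar>Q p\<bar> \<le> 1"
    unfolding Q_def abs_prod by (auto simp: bmp_nonneg bmp_le_1 intro!: prod_le_1)
  have B: "boxbump r = (\<lambda>p. bmp ((p \<bullet> e) / r e) * Q p)"
    using e by (auto simp: fun_eq_iff boxbump_def Q_def prod.remove)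
  have "pd Q e p = 0"
  proof (rule pd_invariant[OF Q])
    show "Q (p + s *\<^sub>R e) = Q p" for s
      unfolding Q_def
    proof (intro prod.cong refl)
      fix e' assume "e' \<in> Basis - {e}"
      then have "e \<bullet> e' = 0" using e by (auto simp: inner_not_same_Basis)
      then show "bmp ((p + s *\<^sub>R e) \<bullet> e' / r e') = bmp (p \<bullet> e' / r e')" by (simp add: inner_add_left)
    qed
  qed
  then have "pd (boxbump r) e p = pd bmp 1 (p \<bullet> e / r e) * (1 / r e) * Q p"
    unfolding B by (subst pd_mult[OF smooth_fn_inner(1)[OF smooth_fn_bmp] Q])
      (auto simp: smooth_fn_inner(2)[OF smooth_fn_bmp] e)
  then have "\<bar>pd (boxbump r) e p\<bar> = \<bar>pd bmp 1 (p \<bullet> e / r e)\<bar> * (1 / r e) * \<bar>Q p\<bar>"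
    using r[OF e] by (simp add: abs_mult)
  also have "\<dots> \<le> bmpC * (1 / r e) * 1"
    using bmpC Q1 r[OF e] by (intro mult_mono mult_nonneg_nonneg) auto
  finally show ?thesis by simp
qed

end

text \<open>Oddness of the derivatives of the kernel drives the cancellation in the energy identity,
  and is the reason for keeping all bumps even.\<close>

lemma pd_even_odd:
  assumes "smooth_fn f" "\<And>p. f (- p) = f p"
  shows "pd f h (- p) = - pd f h p"
  using smooth_fn_reflect(2)[OF assms(1), of 0 h p] assms(2) by simp

section \<open>Continuous functions with compact support\<close>

definition cc :: "('a::euclidean_space \<Rightarrow> 'b::real_normed_vector) \<Rightarrow> bool" where
  "cc f \<longleftrightarrow> continuous_on UNIV f \<and> (\<exists>K. compact K \<and> (\<forall>p. p \<notin> K \<longrightarrow> f p = 0))"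

lemma cc_test_fn: "test_fn G \<phi> \<Longrightarrow> cc \<phi>"
  unfolding cc_def by (meson smooth_fn_continuous_on test_fnE)

lemma cc_bounded:
  assumes "cc f" obtains C where "C \<ge> 0" "\<And>p. norm (f p) \<le> C"
proof -
  obtain K where K: "continuous_on UNIV f" "compact K" "\<And>p. p \<notin> K \<Longrightarrow> f p = 0"
    using assms unfolding cc_def by auto
  have "bounded (f ` K)"
    using K by (intro compact_imp_bounded compact_continuous_image) (auto intro: continuous_on_subset)
  then obtain C where C: "\<And>p. p \<in> K \<Longrightarrow> norm (f p) \<le> C" by (auto simp: bounded_iff)
  show ?thesis
  proof (rule that[of "max C 0"])
    fix p show "norm (f p) \<le> max C 0" using C[of p] K(3)[of p] by (cases "p \<in> K") auto
  qed auto
qed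

lemma cc_scaleR: "cc f \<Longrightarrow> continuous_on UNIV g \<Longrightarrow> cc (\<lambda>p. g p *\<^sub>R f p)"
  unfolding cc_def by (fastforce intro!: continuous_intros)

lemma cc_mult:
  fixes f g :: "'a::euclidean_space \<Rightarrow> real"
  shows "cc f \<Longrightarrow> continuous_on UNIV g \<Longrightarrow> cc (\<lambda>p. g p * f p)"
    "cc f \<Longrightarrow> continuous_on UNIV g \<Longrightarrow> cc (\<lambda>p. f p * g p)"
  using cc_scaleR[of f g] by (auto simp: mult.commute)

lemma cc_add: "cc f \<Longrightarrow> cc g \<Longrightarrow> cc (\<lambda>p. f p + g p)"
proof -
  assume "cc f" "cc g"
  then obtain K K' where "compact K" "\<And>p. p \<notin> K \<Longrightarrow> f p = 0" "compact K'" "\<And>p. p \<notin> K' \<Longrightarrow> g p = 0"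
     "continuous_on UNIV f" "continuous_on UNIV g"
    unfolding cc_def by blast
  then show ?thesis unfolding cc_def
    by (intro conjI continuous_intros exI[of _ "K \<union> K'"]) (auto intro: compact_Un)
qed

lemma cc_zero: "cc (\<lambda>p. 0)" by (auto simp: cc_def intro!: exI[of _ "{}"])

lemma cc_sum: "(\<And>i. i \<in> I \<Longrightarrow> cc (f i)) \<Longrightarrow> cc (\<lambda>p. \<Sum>i\<in>I. f i p)"
  by (induction I rule: infinite_finite_induct) (auto intro: cc_add cc_zero)

lemma cc_vec:
  assumes "\<And>i. cc (\<lambda>p. f p $ i)"
  shows "cc (f :: 'a::euclidean_space \<Rightarrow> real ^ 'n)"
proof -
  have "f = (\<lambda>p. \<Sum>i\<in>UNIV. (f p $ i) *\<^sub>R axis i 1)"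
    by (simp add: fun_eq_iff vec_eq_iff axis_def if_distrib cong: if_cong)
  moreover have "cc (\<lambda>p. (f p $ i) *\<^sub>R (axis i 1 :: real ^ 'n))" for i
    using assms[of i] unfolding cc_def by (fastforce intro!: continuous_intros)
  ultimately show ?thesis using cc_sum[of UNIV] by fastforce
qed

subsection \<open>Square-integrable functions\<close>

text \<open>The measure is arbitrary and the values are Euclidean, so that the same lemmas serve
  \<open>lborel\<close> for mollification, \<open>lebesgue_on G\<close> for the equation, and pairs
  (function, gradient) for existence.\<close>

definition sqi :: "'a measure \<Rightarrow> ('a \<Rightarrow> 'b::euclidean_space) \<Rightarrow> bool" where
  "sqi M f \<longleftrightarrow> f \<in> borel_measurable M \<and> integrable M (\<lambda>x. (norm (f x))\<^sup>2)"

definition sq :: "'a measure \<Rightarrow> ('a \<Rightarrow> 'b::euclidean_space) \<Rightarrow> real" where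
  "sq M f = (\<integral>x. (norm (f x))\<^sup>2 \<partial>M)"

lemma L2v_sqi: "L2v G f \<longleftrightarrow> sqi (lebesgue_on G) f"
  by (simp add: L2v_def sqi_def)

lemma L2_sqi: "L2 G f \<longleftrightarrow> sqi (lebesgue_on G) f"
  by (simp add: L2_def sqi_def)

lemma nrm_sq: "nrm G f = sqrt (sq (lebesgue_on G) f)"
  by (simp add: nrm_def sq_def)

lemma nrmv_sq: "nrmv G f = sqrt (sq (lebesgue_on G) f)"
  by (simp add: nrmv_def sq_def)

lemma sq_nonneg [simp]: "0 \<le> sq M f"
  by (simp add: sq_def)

lemma sqi_measurable: "sqi M f \<Longrightarrow> f \<in> borel_measurable M"
  by (simp add: sqi_def)

lemma sqi_inner_integrable:
  assumes "sqi M f" "sqi M g"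
  shows "integrable M (\<lambda>x. f x \<bullet> g x)"
proof (rule Bochner_Integration.integrable_bound)
  show "integrable M (\<lambda>x. (norm (f x))\<^sup>2 + (norm (g x))\<^sup>2)"
    using assms by (auto simp: sqi_def)
  show "(\<lambda>x. f x \<bullet> g x) \<in> borel_measurable M"
    using assms by (auto simp: sqi_def)
  have "\<bar>f x \<bullet> g x\<bar> \<le> (norm (f x))\<^sup>2 + (norm (g x))\<^sup>2" for x
    using Cauchy_Schwarz_ineq2[of "f x" "g x"] sum_squares_bound[of "norm (f x)" "norm (g x)"]
      mult_nonneg_nonneg[OF norm_ge_zero[of "f x"] norm_ge_zero[of "g x"]] by linarith
  then show "AE x in M. norm (f x \<bullet> g x) \<le> norm ((norm (f x))\<^sup>2 + (norm (g x))\<^sup>2)" by auto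
qed

lemma sqi_mult_integrable:
  fixes f g :: "'a \<Rightarrow> real"
  shows "sqi M f \<Longrightarrow> sqi M g \<Longrightarrow> integrable M (\<lambda>x. f x * g x)"
  using sqi_inner_integrable[of M f g] by (simp add: inner_real_def mult.commute)

lemma sqi_dominated:
  assumes "sqi M f" "g \<in> borel_measurable M" "\<And>x. x \<in> space M \<Longrightarrow> norm (g x) \<le> C * norm (f x)"
  shows "sqi M g"
  unfolding sqi_def
proof
  show "integrable M (\<lambda>x. (norm (g x))\<^sup>2)"
  proof (rule Bochner_Integration.integrable_bound)
    show "integrable M (\<lambda>x. C\<^sup>2 * (norm (f x))\<^sup>2)" using assms by (auto simp: sqi_def)
    show "(\<lambda>x. (norm (g x))\<^sup>2) \<in> borel_measurable M" using assms by auto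
    show "AE x in M. norm ((norm (g x))\<^sup>2) \<le> norm (C\<^sup>2 * (norm (f x))\<^sup>2)"
      using power_mono[OF assms(3) norm_ge_zero, of _ 2] by (auto simp: power_mult_distrib)
  qed
qed fact

lemma sqi_add:
  assumes "sqi M f" "sqi M g"
  shows "sqi M (\<lambda>x. f x + g x)"
  unfolding sqi_def
proof
  show m: "(\<lambda>x. f x + g x) \<in> borel_measurable M" using assms by (auto simp: sqi_def)
  have "(\<lambda>x. (norm (f x + g x))\<^sup>2) = (\<lambda>x. (norm (f x))\<^sup>2 + 2 * (f x \<bullet> g x) + (norm (g x))\<^sup>2)"
    by (auto simp: fun_eq_iff power2_norm_eq_inner inner_add_left inner_add_right inner_commute)
  then show "integrable M (\<lambda>x. (norm (f x + g x))\<^sup>2)"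
    using assms sqi_inner_integrable[OF assms] by (auto simp: sqi_def)
qed

lemma sqi_scaleR: "sqi M f \<Longrightarrow> sqi M (\<lambda>x. c *\<^sub>R f x)"
  by (rule sqi_dominated[where C = "\<bar>c\<bar>"]) (auto simp: sqi_def)

lemma sqi_minus: "sqi M f \<Longrightarrow> sqi M (\<lambda>x. - f x)"
  using sqi_scaleR[of M f "-1"] by simp

lemma sqi_diff: "sqi M f \<Longrightarrow> sqi M g \<Longrightarrow> sqi M (\<lambda>x. f x - g x)"
  using sqi_add[of M f "\<lambda>x. - g x"] sqi_minus[of M g] by simp

lemma sqi_zero: "sqi M (\<lambda>x. 0)"
  by (simp add: sqi_def)

lemma sqi_sum: "(\<And>i. i \<in> I \<Longrightarrow> sqi M (f i)) \<Longrightarrow> sqi M (\<lambda>p. \<Sum>i\<in>I. f i p)"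
  by (induction I rule: infinite_finite_induct) (auto intro: sqi_add sqi_zero)

lemma sqi_cong: "(\<And>x. x \<in> space M \<Longrightarrow> f x = g x) \<Longrightarrow> sqi M f \<Longrightarrow> sqi M g"
  by (rule sqi_dominated[where C = 1 and f = f]) (auto simp: sqi_def cong: measurable_cong)

lemma sqi_Pair: "sqi M f \<Longrightarrow> sqi M g \<Longrightarrow> sqi M (\<lambda>x. (f x, g x))"
  by (auto simp: sqi_def norm_Pair)

lemma sqi_fst: "sqi M h \<Longrightarrow> sqi M (\<lambda>x. fst (h x))"
proof (rule sqi_dominated[where C = 1 and f = h])
  show "norm (fst (h x)) \<le> 1 * norm (h x)" for x
    using norm_fst_le[of "fst (h x)" "snd (h x)"] by simp
qed (auto simp: sqi_def intro!: borel_measurable_continuous_on[where f = fst] continuous_intros)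

lemma sqi_snd: "sqi M h \<Longrightarrow> sqi M (\<lambda>x. snd (h x))"
proof (rule sqi_dominated[where C = 1 and f = h])
  show "norm (snd (h x)) \<le> 1 * norm (h x)" for x
    using norm_snd_le[of "snd (h x)" "fst (h x)"] by simp
qed (auto simp: sqi_def intro!: borel_measurable_continuous_on[where f = snd] continuous_intros)

lemma borel_measurable_vec_nth: "f \<in> borel_measurable M \<Longrightarrow> (\<lambda>x. f x $ i) \<in> borel_measurable M"
  for f :: "'a \<Rightarrow> real ^ 'n"
  by (rule borel_measurable_continuous_on[where f = "\<lambda>v. v $ i"]) (intro continuous_intros)

lemma sqi_nth: "sqi M f \<Longrightarrow> sqi M (\<lambda>x. f x $ i)" for f :: "'a \<Rightarrow> real ^ 'n"
  by (rule sqi_dominated[where C = 1 and f = f])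
     (auto simp: sqi_def component_le_norm_cart intro: borel_measurable_vec_nth)

lemma sq_add:
  assumes "sqi M f" "sqi M g"
  shows "sq M (\<lambda>x. f x + c *\<^sub>R g x) = sq M f + 2 * c * (\<integral>x. f x \<bullet> g x \<partial>M) + c\<^sup>2 * sq M g"
proof -
  have "(\<lambda>x. (norm (f x + c *\<^sub>R g x))\<^sup>2) = (\<lambda>x. (norm (f x))\<^sup>2 + ((2 * c) * (f x \<bullet> g x) + c\<^sup>2 * (norm (g x))\<^sup>2))"
    unfolding power2_norm_eq_inner
    by (auto simp: fun_eq_iff inner_add_left inner_add_right inner_commute power2_eq_square algebra_simps)
  then show ?thesis
    unfolding sq_def using assms sqi_inner_integrable[OF assms] by (simp add: sqi_def)
qed

text \<open>A minimum at s = 0 has vanishing first variation. The coefficient is enlarged to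
  \<bar>b\<bar> + 1 so that it is positive, and s is the minimiser of the enlarged parabola.\<close>

lemma quadratic_nonneg_linear_zero:
  fixes a b :: real
  assumes "\<And>s. 0 \<le> s * a + s\<^sup>2 * b"
  shows "a = 0"
proof (rule ccontr)
  assume "a \<noteq> 0"
  define D where "D = \<bar>b\<bar> + 1"
  have D: "D > 0" "b \<le> D" by (auto simp: D_def)
  define s where "s = - a / (2 * D)"
  have "s * a + s\<^sup>2 * b \<le> s * a + s\<^sup>2 * D"
    using D by (intro add_left_mono mult_left_mono) auto
  also have "\<dots> = - ((a * a) / (4 * D))"
    using D by (simp add: s_def power2_eq_square field_simps)
  finally have "s * a + s\<^sup>2 * b \<le> - ((a * a) / (4 * D))" .
  moreover have "(a * a) / (4 * D) > 0" using \<open>a \<noteq> 0\<close> D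
    by (intro divide_pos_pos) (auto simp: zero_less_mult_iff)
  ultimately show False using assms[of s] by linarith
qed

lemma sqi_Cauchy_Schwarz:
  assumes "sqi M f" "sqi M g"
  shows "\<bar>\<integral>x. f x \<bullet> g x \<partial>M\<bar> \<le> sqrt (sq M f) * sqrt (sq M g)"
proof -
  define I where "I = (\<integral>x. f x \<bullet> g x \<partial>M)"
  have *: "0 \<le> sq M f + 2 * c * I + c\<^sup>2 * sq M g" for c
    using sq_add[OF assms, of c] sq_nonneg[of M "\<lambda>x. f x + c *\<^sub>R g x"] unfolding I_def by simp
  have "I\<^sup>2 \<le> sq M f * sq M g"
  proof (cases "sq M g = 0")
    case True
    have "I = 0"
    proof (rule ccontr)
      assume "I \<noteq> 0"
      \<comment> \<open>With \<open>sq M g = 0\<close> the quadratic is affine in c, and this c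
        makes it equal to -1.\<close>
      then have "2 * (- (sq M f + 1) / (2 * I)) * I = - (sq M f + 1)" by simp
      then show False using *[of "- (sq M f + 1) / (2 * I)"] unfolding True by linarith
    qed
    then show ?thesis by simp
  next
    case False
    then have pos: "sq M g > 0" using sq_nonneg[of M g] by linarith
    have "0 \<le> sq M f + 2 * (- I / sq M g) * I + (- I / sq M g)\<^sup>2 * sq M g" by (rule *)
    also have "\<dots> = sq M f - I\<^sup>2 / sq M g" using pos by (simp add: power2_eq_square field_simps)
    finally show ?thesis using pos by (simp add: field_simps)
  qed
  then have "sqrt (I\<^sup>2) \<le> sqrt (sq M f * sq M g)" by (rule real_sqrt_le_mono)
  then show ?thesis unfolding I_def by (simp add: real_sqrt_mult)
qed

lemma sq_AE_zero:
  assumes "sqi M f" "sq M f = 0"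
  shows "AE x in M. f x = 0"
  using integral_nonneg_eq_0_iff_AE[of M "\<lambda>x. (norm (f x))\<^sup>2"] assms by (simp add: sqi_def sq_def)

lemma sqi_nn_integral: "sqi M f \<Longrightarrow> (\<integral>\<^sup>+ x. ennreal ((norm (f x))\<^sup>2) \<partial>M) = ennreal (sq M f)"
  unfolding sqi_def sq_def by (intro nn_integral_eq_integral) auto

text \<open>Squared distances decay like 4^(-n), so the squared increments remain summable in mean
  after multiplication by 2^n. Almost everywhere the increments are then dominated by a geometric
  series, which gives a pointwise limit; Fatou's lemma turns this limit into convergence of the
  squared norms.\<close>

lemma sqi_complete:
  fixes k :: "nat \<Rightarrow> 'a \<Rightarrow> 'b::euclidean_space"
  assumes k: "\<And>n. sqi M (k n)" and C: "C \<ge> 0"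
    and cauchy: "\<And>n m. sq M (\<lambda>x. k n x - k m x) \<le> C * ((1/4) ^ n + (1/4) ^ m)"
  shows "\<exists>h. sqi M h \<and> (\<lambda>n. sq M (\<lambda>x. k n x - h x)) \<longlonglongrightarrow> 0"
proof -
  define d where "d n x = (norm (k (Suc n) x - k n x))\<^sup>2" for n x
  have km [measurable]: "k n \<in> borel_measurable M" for n using k by (auto simp: sqi_def)
  have dm [measurable]: "d n \<in> borel_measurable M" for n unfolding d_def[abs_def] by measurable
  have "(\<integral>\<^sup>+ x. (\<Sum>n. ennreal (2 ^ n * d n x)) \<partial>M) = (\<Sum>n. \<integral>\<^sup>+ x. ennreal (2 ^ n * d n x) \<partial>M)"
    by (intro nn_integral_suminf) measurable
  also have "\<dots> \<le> (\<Sum>n. ennreal (2 * C * (1/2) ^ n))"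
  proof (intro suminf_le allI)
    fix n
    have "(\<integral>\<^sup>+ x. ennreal (2 ^ n * d n x) \<partial>M) = ennreal (2 ^ n) * (\<integral>\<^sup>+ x. ennreal (d n x) \<partial>M)"
      by (simp add: ennreal_mult d_def nn_integral_cmult)
    also have "(\<integral>\<^sup>+ x. ennreal (d n x) \<partial>M) = ennreal (sq M (\<lambda>x. k (Suc n) x - k n x))"
      unfolding d_def by (rule sqi_nn_integral) (intro sqi_diff k)
    also have "\<dots> \<le> ennreal (C * ((1/4) ^ Suc n + (1/4) ^ n))"
      by (intro ennreal_leI cauchy)
    also have "ennreal (2 ^ n) * ennreal (C * ((1/4) ^ Suc n + (1/4) ^ n))
       = ennreal (2 ^ n * (C * ((1/4) ^ Suc n + (1/4) ^ n)))"
      using C by (intro ennreal_mult[symmetric]) auto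
    also have "\<dots> \<le> ennreal (2 * C * (1/2) ^ n)"
    proof (intro ennreal_leI)
      have "2 ^ n * (1/4::real) ^ n = (1/2) ^ n" by (simp add: power_mult_distrib[symmetric])
      then have "2 ^ n * (C * ((1/4) ^ Suc n + (1/4) ^ n)) = C * (5/4) * (1/2) ^ n"
        by (simp add: algebra_simps)
      also have "\<dots> \<le> C * 2 * (1/2) ^ n" using C by (intro mult_right_mono mult_left_mono) auto
      finally show "2 ^ n * (C * ((1/4) ^ Suc n + (1/4) ^ n)) \<le> 2 * C * (1/2) ^ n" by (simp add: mult.commute)
    qed
    finally show "(\<integral>\<^sup>+ x. ennreal (2 ^ n * d n x) \<partial>M) \<le> ennreal (2 * C * (1/2) ^ n)"
      by (meson mult_left_mono order_trans zero_le)
  qed auto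
  also have "\<dots> = ennreal (\<Sum>n. 2 * C * (1/2) ^ n)"
    using C by (intro suminf_ennreal2 summable_mult summable_geometric) auto
  also have "\<dots> < \<infinity>" by simp
  finally have "AE x in M. (\<Sum>n. ennreal (2 ^ n * d n x)) \<noteq> \<infinity>"
    by (intro nn_integral_PInf_AE) auto
  then have conv: "AE x in M. convergent (\<lambda>n. k n x)"
  proof eventually_elim
    case (elim x)
    then have "summable (\<lambda>n. 2 ^ n * d n x)" 
      by (intro summable_suminf_not_top) (auto simp: d_def)
    then have "Bseq (\<lambda>n. 2 ^ n * d n x)" 
      by (intro convergent_imp_Bseq) (auto simp: convergent_def dest: summable_LIMSEQ_zero)
    then obtain S where S: "S > 0" "\<And>n. \<bar>2 ^ n * d n x\<bar> \<le> S" by (auto elim: BseqE)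
    have dn: "norm (k (Suc n) x - k n x) \<le> sqrt S * (sqrt (1/2)) ^ n" for n
    proof (rule power2_le_imp_le)
      have "d n x \<le> S * (1/2) ^ n" using S(2)[of n] by (simp add: field_simps d_def)
      also have "\<dots> = (sqrt S * sqrt (1/2) ^ n)\<^sup>2" using S(1)
        by (simp add: power_mult_distrib power_mult[symmetric] mult.commute[of n] power_mult)
      finally show "(norm (k (Suc n) x - k n x))\<^sup>2 \<le> (sqrt S * sqrt (1/2) ^ n)\<^sup>2" unfolding d_def .
    qed (use S(1) in auto)
    have sm: "summable (\<lambda>n. sqrt S * (sqrt (1/2)) ^ n)"
      by (intro summable_mult summable_geometric) simp
    have "summable (\<lambda>n. k (Suc n) x - k n x)"
      by (rule summable_comparison_test'[OF sm, of 0], rule dn)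
    then show "convergent (\<lambda>n. k n x)"
      by (simp add: summable_iff_convergent sum_lessThan_telescope[of "\<lambda>i. k i x"]
          convergent_diff_const_right_iff)
  qed
  define h where "h x = lim (\<lambda>n. k n x)" for x
  have hm [measurable]: "h \<in> borel_measurable M"
    unfolding h_def[abs_def] by (rule borel_measurable_lim_metric) measurable
  have fatou: "(\<integral>\<^sup>+ x. ennreal ((norm (k n x - h x))\<^sup>2) \<partial>M) \<le> ennreal (2 * C * (1/4) ^ n)" for n
  proof -
    have "(\<integral>\<^sup>+ x. ennreal ((norm (k n x - h x))\<^sup>2) \<partial>M)
        = (\<integral>\<^sup>+ x. liminf (\<lambda>m. ennreal ((norm (k n x - k m x))\<^sup>2)) \<partial>M)"
    proof (rule nn_integral_cong_AE)
      show "AE x in M. ennreal ((norm (k n x - h x))\<^sup>2) = liminf (\<lambda>m. ennreal ((norm (k n x - k m x))\<^sup>2))"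
        using conv
      proof eventually_elim
        case (elim x)
        then have "(\<lambda>m. k m x) \<longlonglongrightarrow> h x" unfolding h_def by (simp add: convergent_LIMSEQ_iff)
        then have "(\<lambda>m. ennreal ((norm (k n x - k m x))\<^sup>2)) \<longlonglongrightarrow> ennreal ((norm (k n x - h x))\<^sup>2)"
          by (intro tendsto_intros tendsto_ennrealI)
        from lim_imp_Liminf[OF _ this] show ?case by simp
      qed
    qed
    also have "\<dots> \<le> liminf (\<lambda>m. \<integral>\<^sup>+ x. ennreal ((norm (k n x - k m x))\<^sup>2) \<partial>M)"
      by (rule nn_integral_liminf) measurable
    also have "\<dots> = liminf (\<lambda>m. ennreal (sq M (\<lambda>x. k n x - k m x)))"
      by (simp add: sqi_nn_integral sqi_diff k)
    also have "\<dots> \<le> ennreal (2 * C * (1/4) ^ n)"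
    proof (rule order_trans[OF Liminf_le_Limsup Limsup_bounded])
      show "\<forall>\<^sub>F m in sequentially. ennreal (sq M (\<lambda>x. k n x - k m x)) \<le> ennreal (2 * C * (1/4) ^ n)"
        using eventually_ge_at_top[of n]
      proof eventually_elim
        case (elim m)
        have "sq M (\<lambda>x. k n x - k m x) \<le> C * ((1/4) ^ n + (1/4) ^ m)" by (rule cauchy)
        also have "\<dots> \<le> C * ((1/4) ^ n + (1/4) ^ n)"
          using C elim by (intro mult_left_mono add_left_mono power_decreasing) auto
        finally show ?case by (intro ennreal_leI) simp
      qed
    qed simp
    finally show ?thesis .
  qed
  have sqi_d: "sqi M (\<lambda>x. k n x - h x)" for n
    unfolding sqi_def
    by (intro conjI integrableI_bounded) (use fatou[of n] in \<open>auto intro: le_less_trans\<close>)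
  have "sqi M h"
    using sqi_diff[OF k[of 0] sqi_d[of 0]] by simp
  moreover have *: "sq M (\<lambda>x. k n x - h x) \<le> 2 * C * (1/4) ^ n" for n
    using fatou[of n] C by (simp add: sqi_nn_integral[OF sqi_d])
  have "(\<lambda>n. 2 * C * (1/4) ^ n) \<longlonglongrightarrow> 2 * C * 0"
    by (intro tendsto_intros LIMSEQ_power_zero) simp
  then have "(\<lambda>n. 2 * C * (1/4) ^ n) \<longlonglongrightarrow> 0" by simp
  then have "(\<lambda>n. sq M (\<lambda>x. k n x - h x)) \<longlonglongrightarrow> 0"
    by (rule Lim_null_comparison[rotated]) (use * in simp)
  ultimately show ?thesis by blast
qed

lemma sqi_inner_tendsto:
  assumes "\<And>n. sqi M (k n)" "sqi M h" "sqi M g" "(\<lambda>n. sq M (\<lambda>x. k n x - h x)) \<longlonglongrightarrow> 0"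
  shows "(\<lambda>n. \<integral>x. k n x \<bullet> g x \<partial>M) \<longlonglongrightarrow> (\<integral>x. h x \<bullet> g x \<partial>M)"
proof -
  have "(\<lambda>n. sqrt (sq M (\<lambda>x. k n x - h x)) * sqrt (sq M g)) \<longlonglongrightarrow> sqrt 0 * sqrt (sq M g)"
    by (intro tendsto_intros assms)
  then have *: "(\<lambda>n. sqrt (sq M (\<lambda>x. k n x - h x)) * sqrt (sq M g)) \<longlonglongrightarrow> 0" by simp
  have "(\<lambda>n. (\<integral>x. k n x \<bullet> g x \<partial>M) - (\<integral>x. h x \<bullet> g x \<partial>M)) \<longlonglongrightarrow> 0"
  proof (rule Lim_null_comparison[OF _ *], intro always_eventually allI)
    fix n
    have "(\<integral>x. k n x \<bullet> g x \<partial>M) - (\<integral>x. h x \<bullet> g x \<partial>M) = (\<integral>x. (k n x - h x) \<bullet> g x \<partial>M)"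
      unfolding inner_diff_left
      by (intro Bochner_Integration.integral_diff[symmetric] sqi_inner_integrable assms)
    then show "norm ((\<integral>x. k n x \<bullet> g x \<partial>M) - (\<integral>x. h x \<bullet> g x \<partial>M)) \<le> sqrt (sq M (\<lambda>x. k n x - h x)) * sqrt (sq M g)"
      using sqi_Cauchy_Schwarz[OF sqi_diff[OF assms(1,2)] assms(3), of n] by simp
  qed
  then show ?thesis by (simp add: LIM_zero_iff)
qed

text \<open>Lions' projection theorem: the functional is represented by the limit of a minimising sequence
  of \<open>\<parallel>k\<parallel>\<^sup>2 / 2 - l\<close>, so that no completion or quotient of the test space is needed.\<close>

lemma lions_representation:
  fixes X :: "(('a \<Rightarrow> 'b::euclidean_space) \<times> real) set"
  assumes sqi: "\<And>k l. (k, l) \<in> X \<Longrightarrow> sqi M k"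
    and ne: "X \<noteq> {}"
    and lin: "\<And>k l k' l' c. (k, l) \<in> X \<Longrightarrow> (k', l') \<in> X \<Longrightarrow> (\<lambda>x. k x + c *\<^sub>R k' x, l + c * l') \<in> X"
    and bd: "\<And>k l. (k, l) \<in> X \<Longrightarrow> \<bar>l\<bar> \<le> C * sqrt (sq M k)"
  shows "\<exists>h. sqi M h \<and> (\<forall>(k, l)\<in>X. (\<integral>x. h x \<bullet> k x \<partial>M) = l)"
proof -
  define J :: "('a \<Rightarrow> 'b) \<times> real \<Rightarrow> real" where "J = (\<lambda>(k, l). sq M k / 2 - l)"
  have Jb: "J z \<ge> - C\<^sup>2 / 2" if "z \<in> X" for z
  proof -
    define k l where "k = fst z" and "l = snd z"
    then have z: "z = (k, l)" by simp
    have "\<bar>l\<bar> \<le> C * sqrt (sq M k)" by (rule bd) (use that z in simp)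
    then have "l \<le> C * sqrt (sq M k)" by linarith
    also have "\<dots> \<le> (C\<^sup>2 + (sqrt (sq M k))\<^sup>2) / 2" using sum_squares_bound[of C "sqrt (sq M k)"] by simp
    finally show ?thesis by (simp add: z J_def)
  qed
  define m where "m = Inf (J ` X)"
  have bdd: "bdd_below (J ` X)" using Jb by (intro bdd_belowI[of _ "- C\<^sup>2 / 2"]) auto
  have m_le: "m \<le> J z" if "z \<in> X" for z unfolding m_def by (rule cInf_lower[OF imageI[OF that] bdd])
  have "\<exists>z\<in>X. J z < m + (1/4) ^ n" for n
  proof -
    have "Inf (J ` X) < m + (1/4) ^ n" unfolding m_def by simp
    from cInf_lessD[OF _ this] ne show ?thesis by blast
  qed
  then obtain z where z: "\<And>n. z n \<in> X" "\<And>n::nat. J (z n) < m + (1/4) ^ n" by metis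
  define k where "k n = fst (z n)" for n
  define l where "l n = snd (z n)" for n
  have kl: "(k n, l n) \<in> X" for n using z(1)[of n] by (simp add: k_def l_def)
  have Jkl: "sq M (k n) / 2 - l n < m + (1/4) ^ n" for n
    using z(2)[of n] by (simp add: J_def k_def l_def split: prod.splits)
  have ks: "sqi M (k n)" for n using sqi kl by blast
  have "sq M (\<lambda>x. k i x - k j x) \<le> 4 * ((1/4) ^ i + (1/4) ^ j)" for i j
  proof -
    \<comment> \<open>Closure is available only in the form k + c k', so half of \<open>k i\<close>
      is produced by subtracting half of it. The midpoint of two approximate minimisers then lies in
      X, and the parallelogram law makes the sequence Cauchy.\<close>
    have "(\<lambda>x. k i x + (-1/2) *\<^sub>R k i x, l i + (-1/2) * l i) \<in> X" by (intro lin kl)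
    from lin[OF this kl[of j], of "1/2"]
    have "(\<lambda>x. (1/2) *\<^sub>R (k i x + k j x), (l i + l j) / 2) \<in> X"
    proof -
      have e: "k i x + (-1/2) *\<^sub>R k i x + (1/2) *\<^sub>R k j x = (1/2) *\<^sub>R (k i x + k j x)" for x
        using scaleR_left.add[of 1 "-1/2" "k i x"] by (simp add: scaleR_add_right)
      show "(\<lambda>x. k i x + (-1/2) *\<^sub>R k i x + (1/2) *\<^sub>R k j x, l i + (-1/2) * l i + 1/2 * l j) \<in> X
        \<Longrightarrow> (\<lambda>x. (1/2) *\<^sub>R (k i x + k j x), (l i + l j) / 2) \<in> X"
        unfolding e by (simp add: field_simps)
    qed
    then have "m \<le> sq M (\<lambda>x. (1/2) *\<^sub>R (k i x + k j x)) / 2 - (l i + l j) / 2"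
      using m_le by (fastforce simp: J_def)
    moreover have "sq M (\<lambda>x. (1/2) *\<^sub>R (k i x + k j x)) = sq M (\<lambda>x. k i x + k j x) / 4"
      by (simp add: sq_def power_divide)
    moreover have "sq M (\<lambda>x. k i x + k j x) + sq M (\<lambda>x. k i x - k j x) = 2 * sq M (k i) + 2 * sq M (k j)"
      using sq_add[OF ks ks, of i 1 j] sq_add[OF ks ks, of i "-1" j] by simp
    moreover have "n2 \<le> 4 * (e1 + e2)"
      if "m \<le> q / 2 - (a + b) / 2" "q = n1 / 4" "n1 + n2 = 2 * u + 2 * v" "u / 2 - a < m + e1" "v / 2 - b < m + e2"
      for n1 n2 u v q a b e1 e2 :: real
      using that by (simp add: field_simps)
    ultimately show ?thesis using Jkl[of i] Jkl[of j] by blast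
  qed
  from sqi_complete[OF ks _ this] obtain h where h: "sqi M h" "(\<lambda>n. sq M (\<lambda>x. k n x - h x)) \<longlonglongrightarrow> 0"
    by auto
  have "(\<integral>x. h x \<bullet> k' x \<partial>M) = l'" if "(k', l') \<in> X" for k' l'
  proof -
    have k': "sqi M k'" using sqi that by blast
    \<comment> \<open>First variation: moving the approximate minimiser \<open>k n\<close> by s k'
      lowers the functional by at most (1/4)^n, an error that disappears in the limit.\<close>
    have "0 \<le> s * ((\<integral>x. h x \<bullet> k' x \<partial>M) - l') + s\<^sup>2 * (sq M k' / 2)" for s
    proof -
      have *: "0 \<le> (1/4) ^ n + (s * ((\<integral>x. k n x \<bullet> k' x \<partial>M) - l') + s\<^sup>2 * (sq M k' / 2))" for n
      proof -
        have "m \<le> sq M (\<lambda>x. k n x + s *\<^sub>R k' x) / 2 - (l n + s * l')"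
          using m_le[OF lin[OF kl that, of n s]] by (simp add: J_def)
        then show ?thesis using Jkl[of n] unfolding sq_add[OF ks k'] by (simp add: algebra_simps)
      qed
      have "(\<lambda>n. (1/4) ^ n + (s * ((\<integral>x. k n x \<bullet> k' x \<partial>M) - l') + s\<^sup>2 * (sq M k' / 2)))
         \<longlonglongrightarrow> 0 + (s * ((\<integral>x. h x \<bullet> k' x \<partial>M) - l') + s\<^sup>2 * (sq M k' / 2))"
        by (intro tendsto_intros LIMSEQ_power_zero sqi_inner_tendsto[OF ks h(1) k' h(2)]) auto
      from LIMSEQ_le_const[OF this] * show ?thesis by auto
    qed
    from quadratic_nonneg_linear_zero[OF this] show ?thesis by simp
  qed
  with h(1) show ?thesis by blast
qed

subsection \<open>Integrals of compactly supported functions\<close>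

lemma integral_lebesgue_on_mono_support:
  fixes h :: "'a::euclidean_space \<Rightarrow> real"
  assumes "A \<subseteq> B" "A \<in> sets lebesgue" "B \<in> sets lebesgue" "\<And>p. p \<in> B \<Longrightarrow> p \<notin> A \<Longrightarrow> h p = 0"
  shows "(\<integral>p. h p \<partial>lebesgue_on B) = (\<integral>p. h p \<partial>lebesgue_on A)"
  using integral_restrict[OF assms(1-3), of h] assms(4)
  by (subst Bochner_Integration.integral_cong[where g = "\<lambda>x. if x \<in> A then h x else 0"]) auto

lemma integrable_lebesgue_on_subset:
  fixes h :: "'a::euclidean_space \<Rightarrow> real"
  assumes "A \<subseteq> B" "A \<in> sets lebesgue" "B \<in> sets lebesgue" "integrable (lebesgue_on B) h"
  shows "integrable (lebesgue_on A) h"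
proof -
  have *: "set_integrable lebesgue B h" 
    using assms(3,4) by (simp add: set_integrable_def integrable_restrict_space)
  have "set_integrable lebesgue A h" by (rule set_integrable_subset[OF *]) (use assms in auto)
  then show ?thesis using assms(2) by (simp add: set_integrable_def integrable_restrict_space)
qed

lemma sqi_lebesgue_on_subset:
  assumes "A \<subseteq> B" "A \<in> sets lebesgue" "B \<in> sets lebesgue" "sqi (lebesgue_on B) h"
  shows "sqi (lebesgue_on A) h"
  unfolding sqi_def
proof
  have h: "h \<in> borel_measurable (lebesgue_on B)" "integrable (lebesgue_on B) (\<lambda>x. (norm (h x))\<^sup>2)"
    using assms(4) by (auto simp: sqi_def)
  show "h \<in> borel_measurable (lebesgue_on A)" by (rule measurable_restrict_mono[OF h(1) assms(1)])
  show "integrable (lebesgue_on A) (\<lambda>x. (norm (h x))\<^sup>2)"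
    by (rule integrable_lebesgue_on_subset[OF assms(1-3) h(2)])
qed

lemma sqi_extend_zero:
  assumes "A \<in> sets lebesgue" "B \<in> sets lebesgue" "sqi (lebesgue_on A) h"
  shows "sqi (lebesgue_on B) (\<lambda>p. if p \<in> A then h p else 0)"
proof -
  have "sqi lebesgue (\<lambda>p. if p \<in> A then h p else 0)"
    unfolding sqi_def
  proof
    show "(\<lambda>p. if p \<in> A then h p else 0) \<in> borel_measurable lebesgue"
      using assms by (intro borel_measurable_if_I) (auto simp: sqi_def)
    have "(\<lambda>p. (norm (if p \<in> A then h p else 0))\<^sup>2) = (\<lambda>p. if p \<in> A then (norm (h p))\<^sup>2 else 0)" by auto
    then show "integrable lebesgue (\<lambda>p. (norm (if p \<in> A then h p else 0))\<^sup>2)"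
      using assms by (simp add: Lebesgue_Measure.integrable_restrict_UNIV sqi_def)
  qed
  then show ?thesis
    using sqi_lebesgue_on_subset[of B UNIV] assms by (simp add: lebesgue_on_UNIV_eq)
qed

lemma cc_measurable:
  assumes "cc f" shows "f \<in> borel_measurable borel"
  using assms unfolding cc_def by (intro borel_measurable_continuous_onI) auto

lemma cc_integrable_lborel:
  fixes f :: "'a::euclidean_space \<Rightarrow> 'b::euclidean_space"
  assumes "cc f" shows "integrable lborel f"
proof -
  obtain C where C: "\<And>p. norm (f p) \<le> C" using cc_bounded[OF assms] by metis
  obtain K where K: "compact K" "\<And>p. p \<notin> K \<Longrightarrow> f p = 0" using assms by (auto simp: cc_def)
  show ?thesis
    by (rule integrableI_bounded_set[of K _ _ C])
       (use C K cc_measurable[OF assms] emeasure_compact_finite[OF K(1)] in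
         \<open>auto simp: compact_imp_closed borel_closed\<close>)
qed

lemma cc_inner: "cc f \<Longrightarrow> continuous_on UNIV g \<Longrightarrow> cc (\<lambda>p. g p \<bullet> f p)"
  unfolding cc_def by (fastforce intro!: continuous_intros)

lemma cc_sqi_lborel:
  fixes f :: "'a::euclidean_space \<Rightarrow> 'b::euclidean_space"
  assumes "cc f" shows "sqi lborel f"
  unfolding sqi_def
proof
  show "f \<in> borel_measurable lborel" using cc_measurable[OF assms] by simp
  have "cc (\<lambda>p. f p \<bullet> f p)" using assms by (intro cc_inner) (auto simp: cc_def)
  from cc_integrable_lborel[OF this] show "integrable lborel (\<lambda>x. (norm (f x))\<^sup>2)"
    by (simp add: power2_norm_eq_inner)
qed

lemma sqi_lborel_lebesgue: "sqi lborel f \<Longrightarrow> sqi lebesgue f"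
  by (auto simp: sqi_def integrable_completion measurable_completion)

lemma cc_sqi:
  fixes f :: "'a::euclidean_space \<Rightarrow> 'b::euclidean_space"
  assumes "cc f" "G \<in> sets lebesgue" shows "sqi (lebesgue_on G) f"
  using sqi_lebesgue_on_subset[of G UNIV f] assms(2) sqi_lborel_lebesgue[OF cc_sqi_lborel[OF assms(1)]]
  by (simp add: lebesgue_on_UNIV_eq)

lemma lborel_reflect:
  fixes t :: "'a::euclidean_space"
  shows "distr lborel borel (\<lambda>x. t - x) = lborel"
proof -
  have "density (distr lborel borel (\<lambda>x. t + (-1) *\<^sub>R x)) (\<lambda>_. 1) = (lborel :: 'a measure)"
    using lborel_affine[of "-1" t] by simp
  then show ?thesis by (simp add: density_1)
qed

lemma
  fixes f :: "'a::euclidean_space \<Rightarrow> 'b::euclidean_space" and t :: 'a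
  assumes [measurable]: "f \<in> borel_measurable borel"
  shows lborel_integral_reflect: "(\<integral>x. f (t - x) \<partial>lborel) = (\<integral>x. f x \<partial>lborel)"
    and lborel_integrable_reflect: "integrable lborel (\<lambda>x. f (t - x)) \<longleftrightarrow> integrable lborel f"
    and lborel_integral_shift: "(\<integral>x. f (x + t) \<partial>lborel) = (\<integral>x. f x \<partial>lborel)"
proof -
  have "(\<integral>x. f x \<partial>lborel) = (\<integral>x. f x \<partial>(distr lborel borel (\<lambda>x. t - x)))" by (simp add: lborel_reflect)
  then show "(\<integral>x. f (t - x) \<partial>lborel) = (\<integral>x. f x \<partial>lborel)" by (simp add: integral_distr)
  have "integrable lborel f \<longleftrightarrow> integrable (distr lborel borel (\<lambda>x. t - x)) f" by (simp add: lborel_reflect)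
  then show "integrable lborel (\<lambda>x. f (t - x)) \<longleftrightarrow> integrable lborel f" by (simp add: integrable_distr_eq)
  have "(\<integral>x. f x \<partial>lborel) = (\<integral>x. f x \<partial>(distr lborel borel ((+) t)))" by (simp only: lborel_distr_plus)
  then show "(\<integral>x. f (x + t) \<partial>lborel) = (\<integral>x. f x \<partial>lborel)" by (simp add: integral_distr add.commute)
qed

text \<open>Mollification uses Fubini over \<open>lborel\<close>, whereas the functions of the
  theorem are only Lebesgue measurable; a Borel version is chosen coordinate by coordinate.\<close>

lemma ex_borel_representative:
  fixes f :: "'a::euclidean_space \<Rightarrow> 'b::euclidean_space"
  assumes "f \<in> borel_measurable lebesgue"
  shows "\<exists>g\<in>borel_measurable borel. AE x in lborel. f x = g x"
proof -
  have "\<exists>g\<in>borel_measurable lborel. AE x in lborel. f x \<bullet> b = g x" for b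
    by (rule completion_ex_borel_measurable_real) (use assms in measurable)
  then obtain g where g: "\<And>b. g b \<in> borel_measurable borel" "\<And>b. AE x in lborel. f x \<bullet> b = g b x"
    by (metis measurable_lborel2)
  show ?thesis
  proof (intro bexI)
    have "AE x in lborel. \<forall>b\<in>Basis. f x \<bullet> b = g b x"
      by (rule AE_finite_allI) (auto simp: g)
    then show "AE x in lborel. f x = (\<Sum>b\<in>Basis. g b x *\<^sub>R b)"
    proof eventually_elim
      case (elim x)
      have "f x = (\<Sum>b\<in>Basis. (f x \<bullet> b) *\<^sub>R b)" by (simp add: euclidean_representation)
      also have "\<dots> = (\<Sum>b\<in>Basis. g b x *\<^sub>R b)" by (intro sum.cong) (auto simp: elim)
      finally show ?case .
    qed
  qed (use g in measurable)
qed

subsection \<open>Mollification\<close>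

text \<open>Integrating over q first replaces k (p - q) by the integral of k, since reflections and
  translations preserve \<open>lborel\<close>. This and its mirror image are the two halves of the
  Schur bound.\<close>

lemma conv_square:
  fixes A k :: "'a::euclidean_space \<Rightarrow> real"
  assumes A: "sqi lborel A" and k: "integrable lborel k"
  shows "integrable (lborel \<Otimes>\<^sub>M lborel) (\<lambda>(p, q). (A p)\<^sup>2 * k (p - q))"
    and "(\<integral>z. (\<lambda>(p, q). (A p)\<^sup>2 * k (p - q)) z \<partial>(lborel \<Otimes>\<^sub>M lborel)) = sq lborel A * (\<integral>z. k z \<partial>lborel)"
proof -
  have [measurable]: "A \<in> borel_measurable borel" "k \<in> borel_measurable borel"
    using A k by (auto simp: sqi_def dest: borel_measurable_integrable)
  have A2: "integrable lborel (\<lambda>p. (A p)\<^sup>2)" using A by (simp add: sqi_def)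
  have kq: "integrable lborel (\<lambda>q. k (p - q))" for p
    using k by (subst lborel_integrable_reflect) auto
  show 1: "integrable (lborel \<Otimes>\<^sub>M lborel) (\<lambda>(p, q). (A p)\<^sup>2 * k (p - q))"
  proof (rule lborel_pair.Fubini_integrable)
    have "(\<integral>q. norm ((A p)\<^sup>2 * k (p - q)) \<partial>lborel) = (A p)\<^sup>2 * (\<integral>z. \<bar>k z\<bar> \<partial>lborel)" for p
      using lborel_integral_reflect[of "\<lambda>z. \<bar>k z\<bar>" p] by (simp add: abs_mult)
    then show "integrable lborel (\<lambda>p. \<integral>q. norm (case (p, q) of (p, q) \<Rightarrow> (A p)\<^sup>2 * k (p - q)) \<partial>lborel)"
      using A2 by simp
    show "AE p in lborel. integrable lborel (\<lambda>q. case (p, q) of (p, q) \<Rightarrow> (A p)\<^sup>2 * k (p - q))"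
      using kq by auto
  qed measurable
  show "(\<integral>z. (\<lambda>(p, q). (A p)\<^sup>2 * k (p - q)) z \<partial>(lborel \<Otimes>\<^sub>M lborel)) = sq lborel A * (\<integral>z. k z \<partial>lborel)"
    using lborel_pair.integral_fst'[OF 1] lborel_integral_reflect[of k]
    by (simp add: sq_def)
qed

lemma conv_square':
  fixes A k :: "'a::euclidean_space \<Rightarrow> real"
  assumes A: "sqi lborel A" and k: "integrable lborel k"
  shows "integrable (lborel \<Otimes>\<^sub>M lborel) (\<lambda>(p, q). (A q)\<^sup>2 * k (p - q))"
    and "(\<integral>z. (\<lambda>(p, q). (A q)\<^sup>2 * k (p - q)) z \<partial>(lborel \<Otimes>\<^sub>M lborel)) = sq lborel A * (\<integral>z. k z \<partial>lborel)"
proof -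
  have [measurable]: "A \<in> borel_measurable borel" "k \<in> borel_measurable borel"
    using A k by (auto simp: sqi_def dest: borel_measurable_integrable)
  have k': "integrable lborel (\<lambda>z. k (- z))"
    using k lborel_integrable_reflect[of k 0] by simp
  note c = conv_square[OF A k']
  show "integrable (lborel \<Otimes>\<^sub>M lborel) (\<lambda>(p, q). (A q)\<^sup>2 * k (p - q))"
    using lborel_pair.integrable_product_swap[OF c(1)] by (simp add: case_prod_beta)
  have "(\<integral>z. (\<lambda>(p, q). (A q)\<^sup>2 * k (p - q)) z \<partial>(lborel \<Otimes>\<^sub>M lborel))
     = (\<integral>z. (\<lambda>(p, q). (A p)\<^sup>2 * k (- (p - q))) z \<partial>(lborel \<Otimes>\<^sub>M lborel))"
    by (subst lborel_pair.integral_product_swap[symmetric]) (auto simp: case_prod_beta)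
  then show "(\<integral>z. (\<lambda>(p, q). (A q)\<^sup>2 * k (p - q)) z \<partial>(lborel \<Otimes>\<^sub>M lborel)) = sq lborel A * (\<integral>z. k z \<partial>lborel)"
    using c(2) lborel_integral_reflect[of k 0] by simp
qed

text \<open>Young's inequality separates \<open>A p\<close> from \<open>B q\<close>, and each square
  is integrated against k by Fubini. The weight \<eta> stays free so that smallness of one factor
  can be balanced against the size of the other.\<close>

lemma schur:
  fixes A B k :: "'a::euclidean_space \<Rightarrow> real" and H :: "'a \<times> 'a \<Rightarrow> real"
  assumes A: "sqi lborel A" and B: "sqi lborel B" and k: "integrable lborel k"
    and H: "H \<in> borel_measurable (lborel \<Otimes>\<^sub>M lborel)"
    and le: "\<And>p q. \<bar>H (p, q)\<bar> \<le> \<bar>A p\<bar> * \<bar>B q\<bar> * k (p - q)" and k0: "\<And>z. 0 \<le> k z"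
    and \<eta>: "\<eta> > 0"
  shows "integrable (lborel \<Otimes>\<^sub>M lborel) H"
    and "\<bar>\<integral>z. H z \<partial>(lborel \<Otimes>\<^sub>M lborel)\<bar> \<le> (\<eta> * sq lborel A + sq lborel B / \<eta>) / 2 * (\<integral>z. k z \<partial>lborel)"
proof -
  let ?M = "lborel \<Otimes>\<^sub>M lborel :: ('a \<times> 'a) measure"
  let ?D = "\<lambda>z. \<eta> / 2 * (\<lambda>(p, q). (A p)\<^sup>2 * k (p - q)) z + 1 / (2 * \<eta>) * (\<lambda>(p, q). (B q)\<^sup>2 * k (p - q)) z"
  note a = conv_square[OF A k] and b = conv_square'[OF B k]
  have D: "integrable ?M ?D"
    by (intro Bochner_Integration.integrable_add integrable_mult_right a b)
  have HD: "\<bar>H z\<bar> \<le> ?D z" for z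
  proof (cases z)
    case (Pair p q)
    have "2 * (\<eta> * \<bar>A p\<bar>) * \<bar>B q\<bar> \<le> (\<eta> * \<bar>A p\<bar>)\<^sup>2 + \<bar>B q\<bar>\<^sup>2" by (rule sum_squares_bound)
    then have "\<eta> * (2 * (\<bar>A p\<bar> * \<bar>B q\<bar>)) \<le> \<eta> * (\<eta> * (A p)\<^sup>2 + (B q)\<^sup>2 / \<eta>)"
      using \<eta> by (simp add: power_mult_distrib power2_eq_square algebra_simps)
    then have "2 * (\<bar>A p\<bar> * \<bar>B q\<bar>) \<le> \<eta> * (A p)\<^sup>2 + (B q)\<^sup>2 / \<eta>"
      using \<eta> by simp
    then have "\<bar>A p\<bar> * \<bar>B q\<bar> \<le> \<eta> / 2 * (A p)\<^sup>2 + 1 / (2 * \<eta>) * (B q)\<^sup>2"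
      by (simp add: field_simps)
    then have "\<bar>A p\<bar> * \<bar>B q\<bar> * k (p - q) \<le> (\<eta> / 2 * (A p)\<^sup>2 + 1 / (2 * \<eta>) * (B q)\<^sup>2) * k (p - q)"
      using k0 by (intro mult_right_mono) auto
    then show ?thesis using le[of p q] Pair by (simp add: algebra_simps)
  qed
  show I: "integrable ?M H"
    by (rule Bochner_Integration.integrable_bound[OF D H], rule AE_I2)
       (use order_trans[OF HD abs_ge_self] in simp)
  have "\<bar>\<integral>z. H z \<partial>?M\<bar> \<le> (\<integral>z. \<bar>H z\<bar> \<partial>?M)" by (rule integral_abs_bound)
  also have "\<dots> \<le> (\<integral>z. ?D z \<partial>?M)" by (rule integral_mono) (use I D HD in auto)
  also have "\<dots> = \<eta> / 2 * (sq lborel A * (\<integral>z. k z \<partial>lborel)) + 1 / (2 * \<eta>) * (sq lborel B * (\<integral>z. k z \<partial>lborel))"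
    using a b by (subst Bochner_Integration.integral_add) auto
  also have "\<dots> = (\<eta> * sq lborel A + sq lborel B / \<eta>) / 2 * (\<integral>z. k z \<partial>lborel)"
    using \<eta> by (simp add: field_simps)
  finally show "\<bar>\<integral>z. H z \<partial>?M\<bar> \<le> (\<eta> * sq lborel A + sq lborel B / \<eta>) / 2 * (\<integral>z. k z \<partial>lborel)" .
qed

text \<open>Only ratios of box volumes enter the bounds for this kernel, so no change of variables is needed for
  the anisotropic scaling.\<close>

definition kern :: "('a::euclidean_space \<Rightarrow> real) \<Rightarrow> 'a \<Rightarrow> real" where
  "kern r p = (1 / (\<integral>z. boxbump r z \<partial>lborel)) * boxbump r p"

context
  fixes r :: "'a::euclidean_space \<Rightarrow> real"
  assumes r: "\<And>e. e \<in> Basis \<Longrightarrow> r e > 0"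
begin

lemma boxbump_integral_ge: "(\<Prod>e\<in>Basis. 2 * r e) \<le> (\<integral>z. boxbump r z \<partial>lborel)"
proof -
  have "(\<Prod>e\<in>Basis. 2 * r e) = (\<integral>z. indicator (box_of r) z \<partial>lborel)"
    using measure_box_of[of r] r by simp
  also have "\<dots> \<le> (\<integral>z. boxbump r z \<partial>lborel)"
  proof (rule integral_mono)
    show "integrable lborel (indicat_real (box_of r))"
      by (rule integrable_real_indicator[OF _ emeasure_compact_finite[OF compact_box_of]])
         (simp add: box_of_def)
    show "integrable lborel (boxbump r)"
      by (rule cc_integrable_lborel[OF cc_test_fn[OF test_fn_boxbump[where r = r, OF r]]])
    show "indicat_real (box_of r) z \<le> boxbump r z" for z
      using boxbump_1[where r = r, OF r, of z] boxbump_nonneg[where r = r, OF r, of z] by (auto simp: indicator_def)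
  qed
  finally show ?thesis .
qed

lemma boxbump_integral_pos: "0 < (\<integral>z. boxbump r z \<partial>lborel)"
proof -
  have "0 < (\<Prod>e\<in>Basis. 2 * r e)" using r by (intro prod_pos) auto
  then show ?thesis using boxbump_integral_ge by linarith
qed

lemma kern_nonneg: "0 \<le> kern r p"
  using boxbump_integral_pos by (simp add: kern_def boxbump_nonneg[where r = r, OF r])

lemma kern_even: "kern r (- p) = kern r p"
  by (simp add: kern_def boxbump_even[where r = r, OF r])

lemma kern_0: "p \<notin> box_of (\<lambda>e. 2 * r e) \<Longrightarrow> kern r p = 0"
  by (simp add: kern_def boxbump_0[where r = r, OF r])

lemma test_fn_kern: "test_fn UNIV (kern r)"
  unfolding kern_def[abs_def] by (intro test_fn_mult test_fn_boxbump[where r = r, OF r] smooth_fn_const)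

lemma kern_integral: "(\<integral>z. kern r z \<partial>lborel) = 1"
  using boxbump_integral_pos by (simp add: kern_def)

lemma pd_kern: "pd (kern r) h p = (1 / (\<integral>z. boxbump r z \<partial>lborel)) * pd (boxbump r) h p"
  unfolding kern_def[abs_def] by (rule pd_cmult[OF smooth_fn_boxbump[where r = r, OF r]])

lemma pd_kern_0: "p \<notin> box_of (\<lambda>e. 2 * r e) \<Longrightarrow> pd (kern r) h p = 0"
  by (simp add: pd_kern pd_boxbump_0[where r = r, OF r])

text \<open>The derivative is at most \<open>bmpC\<close> / r e / J on the doubled box, whose volume
  is 2^DIM times the plateau volume, and J is at least that plateau volume. Hence only the width in
  direction e enters, however thin the kernel is in the other directions.\<close>

lemma pd_kern_L1:
  assumes e: "e \<in> Basis"
  shows "(\<integral>z. \<bar>pd (kern r) e z\<bar> \<partial>lborel) \<le> bmpC / r e * 2 ^ DIM('a)"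
proof -
  define J where "J = (\<integral>z. boxbump r z \<partial>lborel)"
  have J: "J > 0" "(\<Prod>e\<in>Basis. 2 * r e) \<le> J" using boxbump_integral_pos boxbump_integral_ge by (auto simp: J_def)
  have "(\<integral>z. \<bar>pd (kern r) e z\<bar> \<partial>lborel) \<le> (\<integral>z. (bmpC / r e / J) * indicator (box_of (\<lambda>e. 2 * r e)) z \<partial>lborel)"
  proof (rule integral_mono)
    show "integrable lborel (\<lambda>z. \<bar>pd (kern r) e z\<bar>)"
      by (intro integrable_abs cc_integrable_lborel cc_test_fn[OF test_fn_pd[OF test_fn_kern]])
    show "integrable lborel (\<lambda>z. (bmpC / r e / J) * indicat_real (box_of (\<lambda>e. 2 * r e)) z)"
      by (intro integrable_mult_right integrable_real_indicator[OF _ emeasure_compact_finite[OF compact_box_of]])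
         (simp add: box_of_def)
    fix z
    have "\<bar>pd (kern r) e z\<bar> = \<bar>pd (boxbump r) e z\<bar> / J"
      using J unfolding pd_kern J_def[symmetric] by (simp add: abs_mult)
    also have "\<dots> \<le> bmpC / r e / J"
      using J pd_boxbump[where r = r, OF r e] by (intro divide_right_mono) auto
    finally show "\<bar>pd (kern r) e z\<bar> \<le> (bmpC / r e / J) * indicat_real (box_of (\<lambda>e. 2 * r e)) z"
      using pd_kern_0[of z e] by (auto simp: indicator_def)
  qed
  also have "\<dots> = (bmpC / r e / J) * (\<Prod>e\<in>Basis. 2 * (2 * r e))"
    using measure_box_of[of "\<lambda>e. 2 * r e"] r by simp
  also have "(\<Prod>e\<in>Basis. 2 * (2 * r e)) = 2 ^ DIM('a) * (\<Prod>e\<in>Basis. 2 * r e)"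
    unfolding prod.distrib[of "\<lambda>_. 2" "\<lambda>e. 2 * r e"] by simp
  also have "(bmpC / r e / J) * (2 ^ DIM('a) * (\<Prod>e\<in>Basis. 2 * r e)) \<le> (bmpC / r e / J) * (2 ^ DIM('a) * J)"
    using J bmpC r[OF e] by (intro mult_left_mono) auto
  also have "\<dots> = bmpC / r e * 2 ^ DIM('a)" using J by simp
  finally show ?thesis .
qed

end

text \<open>The L2 pairing of A with the convolution of B and the kernel, kept as one double
  integral over (p, q).\<close>

definition mol :: "('a::euclidean_space \<Rightarrow> real) \<Rightarrow> ('a \<Rightarrow> real) \<Rightarrow> ('a \<Rightarrow> real) \<Rightarrow> real" where
  "mol r A B = (\<integral>z. (\<lambda>(p, q). A p * B q * kern r (p - q)) z \<partial>(lborel \<Otimes>\<^sub>M lborel))"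

lemma
  fixes r :: "'a::euclidean_space \<Rightarrow> real"
  assumes r: "\<And>e. e \<in> Basis \<Longrightarrow> r e > 0" and A: "sqi lborel A" and B: "sqi lborel B"
  shows mol_integrable: "integrable (lborel \<Otimes>\<^sub>M lborel) (\<lambda>(p, q). A p * B q * kern r (p - q))"
    and mol_bound: "\<eta> > 0 \<Longrightarrow> \<bar>mol r A B\<bar> \<le> (\<eta> * sq lborel A + sq lborel B / \<eta>) / 2"
proof -
  have k: "integrable lborel (kern r)" by (rule cc_integrable_lborel[OF cc_test_fn[OF test_fn_kern[where r = r, OF r]]])
  have [measurable]: "A \<in> borel_measurable borel" "B \<in> borel_measurable borel" "kern r \<in> borel_measurable borel"
    using A B k by (auto simp: sqi_def dest: borel_measurable_integrable)
  let ?H = "\<lambda>(p, q). A p * B q * kern r (p - q)"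
  have H: "?H \<in> borel_measurable (lborel \<Otimes>\<^sub>M lborel)" by measurable
  have le: "\<bar>?H (p, q)\<bar> \<le> \<bar>A p\<bar> * \<bar>B q\<bar> * kern r (p - q)" for p q
    by (simp add: abs_mult kern_nonneg[where r = r, OF r])
  show "integrable (lborel \<Otimes>\<^sub>M lborel) ?H"
    by (rule schur(1)[OF A B k H le kern_nonneg[where r = r, OF r] zero_less_one])
  show "\<bar>mol r A B\<bar> \<le> (\<eta> * sq lborel A + sq lborel B / \<eta>) / 2" if "\<eta> > 0"
    using schur(2)[OF A B k H le kern_nonneg[where r = r, OF r] that] by (simp add: mol_def kern_integral[where r = r, OF r])
qed

lemma mol_diff:
  fixes r :: "'a::euclidean_space \<Rightarrow> real"
  assumes r: "\<And>e. e \<in> Basis \<Longrightarrow> r e > 0" and A: "sqi lborel A" and B: "sqi lborel B" and C: "sqi lborel C"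
  shows "mol r A (\<lambda>q. B q - C q) = mol r A B - mol r A C"
proof -
  have E: "(\<lambda>(p, q). A p * (B q - C q) * kern r (p - q))
    = (\<lambda>z. (\<lambda>(p, q). A p * B q * kern r (p - q)) z - (\<lambda>(p, q). A p * C q * kern r (p - q)) z)"
    by (auto simp: fun_eq_iff algebra_simps)
  show ?thesis
    unfolding mol_def E
    by (rule Bochner_Integration.integral_diff[OF mol_integrable[where r = r, OF r A B]
        mol_integrable[where r = r, OF r A C]])
qed

text \<open>A measurable function is almost everywhere a limit of continuous ones. Truncating these
  at height m and by \<kappa>, which is 1 on the ball of radius R and 0 off the ball of radius R +
  1, provides a common bound for dominated convergence.\<close>

lemma sqi_bounded_approx:
  fixes B :: "'a::euclidean_space \<Rightarrow> real"
  assumes B: "sqi lborel B" "\<And>x. \<bar>B x\<bar> \<le> m" "\<And>x. norm x > R \<Longrightarrow> B x = 0" and m: "m \<ge> 0"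
  shows "\<exists>k. (\<forall>n. cc (k n)) \<and> (\<lambda>n. sq lborel (\<lambda>x. B x - k n x)) \<longlonglongrightarrow> 0"
proof -
  have [measurable]: "B \<in> borel_measurable borel" using B(1) by (simp add: sqi_def)
  have "B measurable_on UNIV"
    by (rule lebesgue_measurable_imp_measurable_on_real) (auto simp: lebesgue_on_UNIV_eq measurable_completion)
  then obtain N g where N: "negligible N" and g: "\<And>n. continuous_on UNIV (g n)"
    and lim: "\<And>x. x \<notin> N \<Longrightarrow> (\<lambda>n. g n x) \<longlonglongrightarrow> B x"
    unfolding measurable_on_def by auto
  define \<kappa> where "\<kappa> x = max 0 (min 1 (R + 1 - norm x))" for x :: 'a
  define k where "k n x = \<kappa> x * max (- m) (min m (g n x))" for n x
  have k: "cc (k n)" for n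
    unfolding cc_def k_def \<kappa>_def
    by (intro conjI continuous_intros g exI[of _ "cball 0 (R + 1)"]) auto
  have km [measurable]: "k n \<in> borel_measurable borel" for n by (rule cc_measurable[OF k])
  have "(\<lambda>n. \<integral>x. (norm (B x - k n x))\<^sup>2 \<partial>lborel) \<longlonglongrightarrow> (\<integral>x. 0 \<partial>(lborel :: 'a measure))"
  proof (rule integral_dominated_convergence[where w = "\<lambda>x. (2 * m)\<^sup>2 * indicator (cball 0 (R + 1)) x"])
    show "integrable lborel (\<lambda>x. (2 * m)\<^sup>2 * indicat_real (cball 0 (R + 1)) (x::'a))"
      by (intro integrable_mult_right integrable_real_indicator[OF _ emeasure_compact_finite]) auto
    have "AE x in lborel. x \<notin> N"
      using N AE_completion_iff[of "\<lambda>x. x \<notin> N" lborel] AE_not_in[of N lebesgue]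
      by (simp add: negligible_iff_null_sets)
    then show "AE x in lborel. (\<lambda>n. (norm (B x - k n x))\<^sup>2) \<longlonglongrightarrow> 0"
    proof eventually_elim
      case (elim x)
      have "(\<lambda>n. k n x) \<longlonglongrightarrow> \<kappa> x * max (- m) (min m (B x))"
        unfolding k_def by (intro tendsto_intros lim elim)
      also have "\<kappa> x * max (- m) (min m (B x)) = B x"
        using B(2)[of x] B(3)[of x] by (cases "norm x > R") (auto simp: \<kappa>_def)
      finally have "(\<lambda>n. (norm (B x - k n x))\<^sup>2) \<longlonglongrightarrow> (norm (B x - B x))\<^sup>2"
        by (intro tendsto_intros)
      then show ?case by simp
    qed
    have "(norm (B x - k n x))\<^sup>2 \<le> (2 * m)\<^sup>2 * indicator (cball 0 (R + 1)) x" for n x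
    proof (cases "norm x \<le> R + 1")
      case True
      have "\<bar>k n x\<bar> \<le> 1 * m" unfolding k_def abs_mult
        by (intro mult_mono) (use m in \<open>auto simp: \<kappa>_def\<close>)
      then have "norm (B x - k n x) \<le> 2 * m" using B(2)[of x] by simp
      then show ?thesis using True power_mono[of "norm (B x - k n x)" "2 * m" 2] by simp
    next
      case False
      then show ?thesis using B(3)[of x] by (auto simp: k_def \<kappa>_def)
    qed
    then show "AE x in lborel. norm ((norm (B x - k n x))\<^sup>2) \<le> (2 * m)\<^sup>2 * indicat_real (cball 0 (R + 1)) x" for n
      by simp
  qed auto
  then show ?thesis using k by (auto simp: sq_def)
qed

lemma sq_diff_triangle:
  assumes "sqi M f" "sqi M g"
  shows "sq M (\<lambda>x. f x + g x) \<le> 2 * sq M f + 2 * sq M g"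
proof -
  have "sq M (\<lambda>x. f x + g x) + sq M (\<lambda>x. f x - g x) = 2 * sq M f + 2 * sq M g"
    using sq_add[OF assms, of 1] sq_add[OF assms, of "-1"] by simp
  then show ?thesis using sq_nonneg[of M "\<lambda>x. f x - g x"] by linarith
qed

text \<open>Truncation at height m costs little by dominated convergence and reduces to the bounded
  case. The two errors below e / 4 are doubled by the parallelogram law and add up to less than
  e.\<close>

lemma sqi_cc_dense:
  fixes B :: "'a::euclidean_space \<Rightarrow> real"
  assumes B: "sqi lborel B" "\<And>x. norm x > R \<Longrightarrow> B x = 0" and "e > 0"
  shows "\<exists>k. cc k \<and> sq lborel (\<lambda>x. B x - k x) < e"
proof -
  have [measurable]: "B \<in> borel_measurable borel" using B(1) by (simp add: sqi_def)
  define T where "T m x = max (- real m) (min (real m) (B x))" for m x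
  have Ts: "sqi lborel (T m)" for m
    by (rule sqi_dominated[OF B(1), where C = 1]) (auto simp: T_def[abs_def])
  have Tm [measurable]: "T m \<in> borel_measurable borel" for m using Ts[of m] by (simp add: sqi_def)
  have "(\<lambda>m. \<integral>x. (norm (B x - T m x))\<^sup>2 \<partial>lborel) \<longlonglongrightarrow> (\<integral>x. 0 \<partial>(lborel :: 'a measure))"
  proof (rule integral_dominated_convergence[where w = "\<lambda>x. (norm (B x))\<^sup>2"])
    show "integrable lborel (\<lambda>x. (norm (B x))\<^sup>2)" using B(1) by (simp add: sqi_def)
    show "AE x in lborel. (\<lambda>m. (norm (B x - T m x))\<^sup>2) \<longlonglongrightarrow> 0"
    proof (intro AE_I2 tendsto_eventually)
      fix x
      show "\<forall>\<^sub>F m in sequentially. (norm (B x - T m x))\<^sup>2 = 0"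
        using eventually_ge_at_top[of "nat \<lceil>\<bar>B x\<bar>\<rceil>"]
      proof eventually_elim
        case (elim m)
        then have "\<bar>B x\<bar> \<le> real m" by linarith
        then show ?case by (auto simp: T_def)
      qed
    qed
    show "AE x in lborel. norm ((norm (B x - T m x))\<^sup>2) \<le> (norm (B x))\<^sup>2" for m
    proof (intro AE_I2)
      fix x
      have "norm (B x - T m x) \<le> norm (B x)" by (auto simp: T_def)
      then show "norm ((norm (B x - T m x))\<^sup>2) \<le> (norm (B x))\<^sup>2"
        using power_mono[of "norm (B x - T m x)" "norm (B x)" 2] by simp
    qed
  qed auto
  then have "\<forall>\<^sub>F m in sequentially. sq lborel (\<lambda>x. B x - T m x) < e / 4"
    by (intro order_tendstoD(2)[of _ 0]) (use \<open>e > 0\<close> in \<open>auto simp: sq_def\<close>)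
  then obtain m where m: "sq lborel (\<lambda>x. B x - T m x) < e / 4" by (auto simp: eventually_sequentially)
  have "\<bar>T m x\<bar> \<le> real m" for x by (auto simp: T_def max_def min_def)
  moreover have "T m x = 0" if "norm x > R" for x using B(2)[OF that] by (simp add: T_def)
  ultimately have "\<exists>k. (\<forall>n. cc (k n)) \<and> (\<lambda>n. sq lborel (\<lambda>x. T m x - k n x)) \<longlonglongrightarrow> 0"
    by (intro sqi_bounded_approx[OF Ts, where m = "real m" and R = R]) auto
  then obtain k where k: "\<And>n. cc (k n)" "(\<lambda>n. sq lborel (\<lambda>x. T m x - k n x)) \<longlonglongrightarrow> 0"
    by blast
  then have "\<forall>\<^sub>F n in sequentially. sq lborel (\<lambda>x. T m x - k n x) < e / 4"
    by (intro order_tendstoD(2)[of _ 0]) (use \<open>e > 0\<close> in auto)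
  then obtain n where n: "sq lborel (\<lambda>x. T m x - k n x) < e / 4" by (auto simp: eventually_sequentially)
  have "sq lborel (\<lambda>x. (B x - T m x) + (T m x - k n x)) \<le> 2 * sq lborel (\<lambda>x. B x - T m x) + 2 * sq lborel (\<lambda>x. T m x - k n x)"
    by (intro sq_diff_triangle sqi_diff B Ts cc_sqi_lborel k)
  then have "sq lborel (\<lambda>x. B x - k n x) < e" using m n by simp
  then show ?thesis using k(1) by blast
qed

text \<open>B is exchanged for a compactly supported continuous k before and after the limit. For k
  itself only k q - k p on the shrinking support of the kernel remains, and uniform continuity makes
  it small.\<close>

lemma mol_tendsto:
  fixes A B :: "'a::euclidean_space \<Rightarrow> real" and r :: "nat \<Rightarrow> 'a \<Rightarrow> real"
  assumes r: "\<And>n e. e \<in> Basis \<Longrightarrow> r n e > 0" and r0: "\<And>e. e \<in> Basis \<Longrightarrow> (\<lambda>n. r n e) \<longlonglongrightarrow> 0"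
    and A: "sqi lborel A" "\<And>x. norm x > R \<Longrightarrow> A x = 0"
    and B: "sqi lborel B" "\<And>x. norm x > R \<Longrightarrow> B x = 0"
  shows "(\<lambda>n. mol (r n) A B) \<longlonglongrightarrow> (\<integral>x. A x * B x \<partial>lborel)"
proof (rule tendstoI)
  fix e' :: real assume e': "e' > 0"
  define S where "S = sq lborel A + 1"
  have S: "S > 0" "sq lborel A \<le> S" using sq_nonneg[of lborel A] unfolding S_def by linarith+
  define \<tau> where "\<tau> = e' / (4 * S)"
  have \<tau>: "\<tau> > 0" "3 * (\<tau> * S) < e'" using e' S by (auto simp: \<tau>_def)
  obtain k where k: "cc k" "sq lborel (\<lambda>x. B x - k x) < \<tau>\<^sup>2"
    using sqi_cc_dense[where B = B and R = R and e = "\<tau>\<^sup>2"] B \<tau> by auto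
  have ks: "sqi lborel k" by (rule cc_sqi_lborel[OF k(1)])
  have Am [measurable]: "A \<in> borel_measurable borel" and km [measurable]: "k \<in> borel_measurable borel"
    using A(1) ks by (auto simp: sqi_def)
  define V where "V = measure lborel (cball (0::'a) (R + 1)) + 1"
  have V: "V > 0" by (simp add: V_def add_nonneg_pos)
  \<comment> \<open>Chosen so that the constant \<omega> on the ball of radius R + 1 has squared
    norm at most \<tau>^2; the Schur bound with weight \<tau> then yields \<tau> S, which matches
    the other two errors.\<close>
  define \<omega> where "\<omega> = \<tau> / sqrt V"
  have \<omega>: "\<omega> > 0" "\<omega>\<^sup>2 * V = \<tau>\<^sup>2" using \<tau> V by (auto simp: \<omega>_def power_divide)
  define D where "D x = \<omega> * indicator (cball 0 (R + 1)) x" for x :: 'a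
  have ind: "integrable lborel (indicat_real (cball (0::'a) (R + 1)))"
    by (intro integrable_real_indicator[OF _ emeasure_compact_finite]) auto
  have D2: "(\<lambda>x. (norm (D x))\<^sup>2) = (\<lambda>x. \<omega>\<^sup>2 * indicator (cball 0 (R + 1)) x)"
    by (auto simp: D_def fun_eq_iff indicator_def)
  have D: "sqi lborel D" unfolding sqi_def D2 using ind by (auto simp: D_def[abs_def])
  have sqD: "sq lborel D \<le> \<tau>\<^sup>2"
  proof -
    have "sq lborel D = \<omega>\<^sup>2 * measure lborel (cball (0::'a) (R + 1))" unfolding sq_def D2 by simp
    also have "\<dots> \<le> \<omega>\<^sup>2 * V" by (intro mult_left_mono) (auto simp: V_def)
    finally show ?thesis using \<omega> by simp
  qed
  have half: "(\<tau> * sq lborel A + s / \<tau>) / 2 \<le> \<tau> * S" if "s \<le> \<tau>\<^sup>2" for s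
  proof -
    have "s / \<tau> \<le> \<tau>\<^sup>2 / \<tau>" using that \<tau> by (intro divide_right_mono) auto
    also have "\<dots> = \<tau>" using \<tau> by (simp add: power2_eq_square)
    finally have "\<tau> * sq lborel A + s / \<tau> \<le> \<tau> * S" using \<tau> by (simp add: S_def algebra_simps)
    then have "(\<tau> * sq lborel A + s / \<tau>) / 2 \<le> (\<tau> * S) / 2" by (intro divide_right_mono) auto
    also have "\<dots> \<le> \<tau> * S" using \<tau> S by simp
    finally show ?thesis .
  qed
  have "uniformly_continuous_on (cball 0 (R + 1)) k"
    using k(1) by (intro compact_uniformly_continuous) (auto simp: cc_def intro: continuous_on_subset)
  then obtain \<delta> where \<delta>: "\<delta> > 0" "\<And>p q. p \<in> cball 0 (R + 1) \<Longrightarrow> q \<in> cball 0 (R + 1) \<Longrightarrow> dist q p < \<delta> \<Longrightarrow> dist (k q) (k p) < \<omega>"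
    unfolding uniformly_continuous_on_def using \<omega> by metis
  have "(\<lambda>n. \<Sum>e\<in>Basis. 2 * r n e) \<longlonglongrightarrow> (\<Sum>e\<in>(Basis::'a set). 2 * 0)"
    by (intro tendsto_intros r0)
  then have "(\<lambda>n. \<Sum>e\<in>(Basis::'a set). 2 * r n e) \<longlonglongrightarrow> 0" by simp
  then have "\<forall>\<^sub>F n in sequentially. (\<Sum>e\<in>Basis. 2 * r n e) < min 1 \<delta>"
    by (rule order_tendstoD) (use \<delta> in auto)
  then show "\<forall>\<^sub>F n in sequentially. dist (mol (r n) A B) (\<integral>x. A x * B x \<partial>lborel) < e'"
  proof eventually_elim
    case (elim n)
    have rn: "\<And>e. e \<in> Basis \<Longrightarrow> r n e > 0" using r by auto
    have small: "norm z < min 1 \<delta>" if "z \<in> box_of (\<lambda>e. 2 * r n e)" for z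
    proof -
      have "norm z \<le> (\<Sum>e\<in>Basis. \<bar>z \<bullet> e\<bar>)" by (rule norm_le_l1)
      also have "\<dots> \<le> (\<Sum>e\<in>Basis. 2 * r n e)" using that by (intro sum_mono) (auto simp: mem_box_of)
      finally show ?thesis using elim by linarith
    qed
    let ?K = "kern (r n)"
    have K: "integrable lborel ?K" by (rule cc_integrable_lborel[OF cc_test_fn[OF test_fn_kern[OF rn]]])
    have [measurable]: "?K \<in> borel_measurable borel" using K by auto
    have K0: "0 \<le> ?K z" for z by (rule kern_nonneg[OF rn])
    have near: "q \<in> cball 0 (R + 1) \<and> dist q p < \<delta>" if "?K (p - q) \<noteq> 0" "norm p \<le> R" for p q
    proof -
      have "p - q \<in> box_of (\<lambda>e. 2 * r n e)" using kern_0[where r = "r n", OF rn] that(1) by blast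
      from small[OF this] have "norm (p - q) < 1" "norm (p - q) < \<delta>" by auto
      then show ?thesis using that(2) norm_triangle_ineq4[of p "p - q"] 
        by (auto simp: dist_norm norm_minus_commute)
    qed
    define H where "H = (\<lambda>(p, q). A p * k q * ?K (p - q) - A p * k p * ?K (p - q))"
    have Hm: "H \<in> borel_measurable (lborel \<Otimes>\<^sub>M lborel)" unfolding H_def by measurable
    have Hle: "\<bar>H (p, q)\<bar> \<le> \<bar>A p\<bar> * \<bar>D q\<bar> * ?K (p - q)" for p q
    proof (cases "A p = 0 \<or> ?K (p - q) = 0")
      case True then show ?thesis by (auto simp: H_def)
    next
      case False
      then have p: "norm p \<le> R" using A(2)[of p] by force
      have q: "q \<in> cball 0 (R + 1)" "dist q p < \<delta>" using near[of p q] False p by auto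
      have "\<bar>k q - k p\<bar> \<le> \<omega>" using \<delta>(2)[of p q] p q by (auto simp: dist_real_def)
      then have "\<bar>k q - k p\<bar> \<le> \<bar>D q\<bar>" using q \<omega> by (simp add: D_def)
      moreover have "H (p, q) = A p * (k q - k p) * ?K (p - q)" by (simp add: H_def algebra_simps)
      ultimately show ?thesis using K0[of "p - q"] by (simp add: abs_mult mult_left_mono mult_right_mono)
    qed
    note HI = schur[OF A(1) D K Hm Hle K0 \<tau>(1)]
    have b1: "\<bar>\<integral>z. H z \<partial>(lborel \<Otimes>\<^sub>M lborel)\<bar> \<le> \<tau> * S"
      using HI(2) half[OF sqD] by (simp add: kern_integral[where r = "r n", OF rn])
    have I1: "integrable (lborel \<Otimes>\<^sub>M lborel) (\<lambda>(p, q). A p * k q * ?K (p - q))"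
      by (rule mol_integrable[where r = "r n", OF rn A(1) ks])
    have E: "(\<lambda>(p, q). A p * k p * ?K (p - q)) = (\<lambda>z. (\<lambda>(p, q). A p * k q * ?K (p - q)) z - H z)"
      by (auto simp: H_def fun_eq_iff)
    have I2: "integrable (lborel \<Otimes>\<^sub>M lborel) (\<lambda>(p, q). A p * k p * ?K (p - q))"
      unfolding E by (rule Bochner_Integration.integrable_diff[OF I1 HI(1)])
    have I2eq: "(\<integral>z. (\<lambda>(p, q). A p * k p * ?K (p - q)) z \<partial>(lborel \<Otimes>\<^sub>M lborel)) = (\<integral>x. A x * k x \<partial>lborel)"
      using lborel_pair.integral_fst'[OF I2] lborel_integral_reflect[of ?K] kern_integral[where r = "r n", OF rn]
      by simp
    have H2: "H = (\<lambda>z. (\<lambda>(p, q). A p * k q * ?K (p - q)) z - (\<lambda>(p, q). A p * k p * ?K (p - q)) z)"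
      by (auto simp: H_def fun_eq_iff)
    have Hmol: "(\<integral>z. H z \<partial>(lborel \<Otimes>\<^sub>M lborel)) = mol (r n) A k - (\<integral>x. A x * k x \<partial>lborel)"
      unfolding H2 Bochner_Integration.integral_diff[OF I1 I2] I2eq mol_def by (rule refl)
    have b2: "\<bar>mol (r n) A (\<lambda>x. B x - k x)\<bar> \<le> \<tau> * S"
      by (rule order_trans[OF mol_bound[where r = "r n", OF rn A(1) sqi_diff[OF B(1) ks] \<tau>(1)]
            half[OF less_imp_le[OF k(2)]]])
    have b3: "\<bar>\<integral>x. A x * (B x - k x) \<partial>lborel\<bar> \<le> \<tau> * S"
    proof -
      have "\<bar>\<integral>x. A x * (B x - k x) \<partial>lborel\<bar> \<le> sqrt (sq lborel A) * sqrt (sq lborel (\<lambda>x. B x - k x))"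
        using sqi_Cauchy_Schwarz[OF A(1) sqi_diff[OF B(1) ks]] by (simp add: inner_real_def)
      also have "\<dots> \<le> S * \<tau>"
      proof (intro mult_mono)
        have "S\<^sup>2 - sq lborel A = (sq lborel A)\<^sup>2 + sq lborel A + 1"
          by (simp add: S_def power2_eq_square algebra_simps)
        moreover have "0 \<le> (sq lborel A)\<^sup>2 + sq lborel A + 1" by (intro add_nonneg_nonneg) auto
        ultimately show "sqrt (sq lborel A) \<le> S" using S by (intro real_le_lsqrt) auto
        show "sqrt (sq lborel (\<lambda>x. B x - k x)) \<le> \<tau>" using k(2) \<tau> by (intro real_le_lsqrt) auto
      qed (use S in auto)
      finally show ?thesis by (simp add: mult.commute)
    qed
    have iB: "integrable lborel (\<lambda>x. A x * B x)" and ik: "integrable lborel (\<lambda>x. A x * k x)"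
      using sqi_mult_integrable A B ks by auto
    have "(\<integral>x. A x * (B x - k x) \<partial>lborel) = (\<integral>x. A x * B x \<partial>lborel) - (\<integral>x. A x * k x \<partial>lborel)"
      unfolding right_diff_distrib by (rule Bochner_Integration.integral_diff[OF iB ik])
    then have "\<bar>mol (r n) A B - (\<integral>x. A x * B x \<partial>lborel)\<bar>
       \<le> \<bar>mol (r n) A (\<lambda>x. B x - k x)\<bar> + \<bar>\<integral>z. H z \<partial>(lborel \<Otimes>\<^sub>M lborel)\<bar> + \<bar>\<integral>x. A x * (B x - k x) \<partial>lborel\<bar>"
      using mol_diff[where r = "r n", OF rn A(1) B(1) ks] Hmol by linarith
    also have "\<dots> \<le> \<tau> * S + \<tau> * S + \<tau> * S" by (intro add_mono b1 b2 b3)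
    also have "\<dots> < e'" using \<tau>(2) by linarith
    finally show "dist (mol (r n) A B) (\<integral>x. A x * B x \<partial>lborel) < e'" unfolding dist_real_def .
  qed
qed

section \<open>Double integrals with a difference kernel, and the cancellation for odd
  kernels\<close>

definition dbl :: "('a::euclidean_space \<Rightarrow> real) \<Rightarrow> ('a \<Rightarrow> real) \<Rightarrow> ('a \<Rightarrow> real) \<Rightarrow> real" where
  "dbl D A B = (\<integral>z. (\<lambda>(p, q). A p * B q * D (p - q)) z \<partial>(lborel \<Otimes>\<^sub>M lborel))"

lemma
  fixes D A B :: "'a::euclidean_space \<Rightarrow> real"
  assumes D: "cc D" and A: "sqi lborel A" and B: "sqi lborel B"
  shows dbl_integrable: "integrable (lborel \<Otimes>\<^sub>M lborel) (\<lambda>(p, q). A p * B q * D (p - q))"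
    and dbl_p: "(\<integral>p. A p * (\<integral>q. B q * D (p - q) \<partial>lborel) \<partial>lborel) = dbl D A B"
    and dbl_q: "(\<integral>q. B q * (\<integral>p. A p * D (p - q) \<partial>lborel) \<partial>lborel) = dbl D A B"
    and dbl_q_integrable: "integrable lborel (\<lambda>q. B q * (\<integral>p. A p * D (p - q) \<partial>lborel))"
proof -
  have [measurable]: "A \<in> borel_measurable borel" "B \<in> borel_measurable borel" "D \<in> borel_measurable borel"
    using A B cc_measurable[OF D] by (auto simp: sqi_def)
  let ?H = "\<lambda>(p, q). A p * B q * D (p - q)"
  have H: "?H \<in> borel_measurable (lborel \<Otimes>\<^sub>M lborel)" by measurable
  have k: "integrable lborel (\<lambda>z. \<bar>D z\<bar>)" by (intro integrable_abs cc_integrable_lborel D)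
  show I: "integrable (lborel \<Otimes>\<^sub>M lborel) ?H"
    by (rule schur(1)[OF A B k H _ _ zero_less_one]) (auto simp: abs_mult)
  show "(\<integral>p. A p * (\<integral>q. B q * D (p - q) \<partial>lborel) \<partial>lborel) = dbl D A B"
    using lborel_pair.integral_fst'[OF I] by (simp add: dbl_def mult.assoc)
  have S: "integrable (lborel \<Otimes>\<^sub>M lborel) (\<lambda>(q, p). A p * B q * D (p - q))"
    using lborel_pair.integrable_product_swap[OF I] by (simp add: case_prod_beta)
  have "(\<integral>z. (\<lambda>(q, p). A p * B q * D (p - q)) z \<partial>(lborel \<Otimes>\<^sub>M lborel)) = dbl D A B"
    unfolding dbl_def
    using lborel_pair.integral_product_swap[of ?H] H by simp
  moreover have e: "(\<integral>p. A p * B q * D (p - q) \<partial>lborel) = B q * (\<integral>p. A p * D (p - q) \<partial>lborel)" for q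
    unfolding integral_mult_right_zero[symmetric] by (simp add: mult_ac)
  ultimately show "(\<integral>q. B q * (\<integral>p. A p * D (p - q) \<partial>lborel) \<partial>lborel) = dbl D A B"
    using lborel_pair.integral_fst'[OF S] by simp
  show "integrable lborel (\<lambda>q. B q * (\<integral>p. A p * D (p - q) \<partial>lborel))"
    using lborel_pair.integrable_fst'[OF S] by (simp add: e)
qed

text \<open>Exchanging the variables p and q flips the sign of an odd kernel.\<close>

lemma dbl_swap:
  fixes D A B :: "'a::euclidean_space \<Rightarrow> real"
  assumes D: "cc D" "\<And>z. D (- z) = - D z" and A: "sqi lborel A" and B: "sqi lborel B"
  shows "dbl D B A = - dbl D A B"
proof -
  have H: "(\<lambda>(p, q). A p * B q * D (p - q)) \<in> borel_measurable (lborel \<Otimes>\<^sub>M lborel)"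
    using dbl_integrable[OF D(1) A B] by auto
  have e: "(\<lambda>(q, p). A p * B q * D (p - q)) = (\<lambda>z. - (\<lambda>(p, q). B p * A q * D (p - q)) z)"
  proof
    fix z :: "'a \<times> 'a"
    obtain q p where z: "z = (q, p)" by force
    have "D (q - p) = - D (p - q)" using D(2)[of "p - q"] by simp
    then show "(\<lambda>(q, p). A p * B q * D (p - q)) z = - (\<lambda>(p, q). B p * A q * D (p - q)) z"
      by (simp add: z)
  qed
  have "dbl D A B = (\<integral>z. (\<lambda>(q, p). A p * B q * D (p - q)) z \<partial>(lborel \<Otimes>\<^sub>M lborel))"
    unfolding dbl_def using lborel_pair.integral_product_swap[OF H] by simp
  also have "\<dots> = - dbl D B A" unfolding e dbl_def by simp
  finally show ?thesis by simp
qed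

text \<open>For an odd kernel the weight \<open>a\<close> enters only through the commutator \<open>a p - a q\<close>.\<close>

lemma dbl_commutator:
  fixes D U a :: "'a::euclidean_space \<Rightarrow> real"
  assumes D: "cc D" "\<And>z. D (- z) = - D z" and U: "sqi lborel U" and A: "sqi lborel (\<lambda>p. a p * U p)"
    and le: "\<And>p q. D (p - q) \<noteq> 0 \<Longrightarrow> \<bar>a p - a q\<bar> \<le> \<omega>" and \<omega>: "\<omega> \<ge> 0"
  shows "\<bar>dbl D (\<lambda>p. a p * U p) U\<bar> \<le> \<omega> * sq lborel U * (\<integral>z. \<bar>D z\<bar> \<partial>lborel)"
proof -
  let ?A = "\<lambda>p. a p * U p"
  let ?H = "\<lambda>z. (\<lambda>(p, q). ?A p * U q * D (p - q)) z - (\<lambda>(p, q). U p * ?A q * D (p - q)) z"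
  note I1 = dbl_integrable[OF D(1) A U] and I2 = dbl_integrable[OF D(1) U A]
  \<comment> \<open>Antisymmetry lets the form be averaged with its mirror image, in which a q
    stands in place of a p with the opposite sign.\<close>
  have "2 * dbl D ?A U = dbl D ?A U - dbl D U ?A"
    using dbl_swap[OF D U A] by simp
  also have "\<dots> = (\<integral>z. ?H z \<partial>(lborel \<Otimes>\<^sub>M lborel))"
    unfolding dbl_def by (rule Bochner_Integration.integral_diff[OF I1 I2, symmetric])
  finally have 1: "2 * dbl D ?A U = (\<integral>z. ?H z \<partial>(lborel \<Otimes>\<^sub>M lborel))" .
  have k: "integrable lborel (\<lambda>z. \<omega> * \<bar>D z\<bar>)" by (intro integrable_abs cc_integrable_lborel D integrable_mult_right)
  have Hle: "\<bar>?H (p, q)\<bar> \<le> \<bar>U p\<bar> * \<bar>U q\<bar> * (\<omega> * \<bar>D (p - q)\<bar>)" for p q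
  proof (cases "D (p - q) = 0")
    case False
    have "?H (p, q) = U p * U q * ((a p - a q) * D (p - q))" by (simp add: algebra_simps)
    then have "\<bar>?H (p, q)\<bar> = \<bar>U p\<bar> * \<bar>U q\<bar> * (\<bar>a p - a q\<bar> * \<bar>D (p - q)\<bar>)" by (simp only: abs_mult)
    also have "\<dots> \<le> \<bar>U p\<bar> * \<bar>U q\<bar> * (\<omega> * \<bar>D (p - q)\<bar>)"
      by (intro mult_left_mono mult_right_mono le False mult_nonneg_nonneg) auto
    finally show ?thesis .
  qed simp
  have "\<bar>\<integral>z. ?H z \<partial>(lborel \<Otimes>\<^sub>M lborel)\<bar> \<le> (1 * sq lborel U + sq lborel U / 1) / 2 * (\<integral>z. \<omega> * \<bar>D z\<bar> \<partial>lborel)"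
    by (rule schur(2)[OF U U k borel_measurable_integrable Hle _ zero_less_one])
       (use \<omega> Bochner_Integration.integrable_diff[OF I1 I2] in auto)
  also have "\<dots> = \<omega> * sq lborel U * (\<integral>z. \<bar>D z\<bar> \<partial>lborel)" by simp
  finally have "2 * \<bar>dbl D ?A U\<bar> \<le> \<omega> * sq lborel U * (\<integral>z. \<bar>D z\<bar> \<partial>lborel)" unfolding 1[symmetric] by simp
  then show ?thesis by linarith
qed

section \<open>The energy identity on the whole space\<close>

lemma Basis_pt:
  "(1, 0, 0) \<in> (Basis :: ('d::finite, 'd1::finite) pt set)"
  "(0, axis k 1, 0) \<in> (Basis :: ('d::finite, 'd1::finite) pt set)"
  "(0, 0, axis i 1) \<in> (Basis :: ('d::finite, 'd1::finite) pt set)"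
  by (auto simp: Basis_prod_def zero_prod_def axis_in_Basis_iff image_iff)

text \<open>A basis vector is a velocity direction exactly when its last component is nonzero; thus
  \<epsilon> is the width in t and x, and \<sigma> the width in v.\<close>

definition rr :: "real \<Rightarrow> real \<Rightarrow> ('d::finite, 'd1::finite) pt \<Rightarrow> real" where
  "rr \<epsilon> \<sigma> e = (if snd (snd e) \<noteq> 0 then \<sigma> else \<epsilon>)"

lemma rr_simps [simp]: "rr \<epsilon> \<sigma> (1, 0, 0) = \<epsilon>" "rr \<epsilon> \<sigma> (0, axis k 1, 0) = \<epsilon>" "rr \<epsilon> \<sigma> (0, 0, axis i 1) = \<sigma>"
  by (auto simp: rr_def axis_eq_0_iff)

lemma rr_pos: "0 < \<epsilon> \<Longrightarrow> 0 < \<sigma> \<Longrightarrow> 0 < rr \<epsilon> \<sigma> e"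
  by (simp add: rr_def)

lemma box_rr_v:
  fixes z :: "('d::finite, 'd1::finite) pt"
  assumes "z \<in> box_of (\<lambda>e. 2 * rr \<epsilon> \<sigma> e)"
  shows "norm (snd (snd z)) \<le> 2 * \<sigma> * CARD('d1)"
proof -
  have "\<bar>snd (snd z) $ i\<bar> \<le> 2 * \<sigma>" for i
    using assms[unfolded mem_box_of, rule_format, OF Basis_pt(3)[of i]]
    by (cases z) (simp add: inner_axis)
  then have "(\<Sum>i\<in>UNIV. \<bar>snd (snd z) $ i\<bar>) \<le> (\<Sum>i\<in>(UNIV::'d1 set). 2 * \<sigma>)" by (intro sum_mono)
  then show ?thesis using norm_le_l1_cart[of "snd (snd z)"] by (simp add: mult.commute)
qed

lemma inner_vec_sum: "x \<bullet> y = (\<Sum>i\<in>UNIV. x $ i * y $ i)" for x y :: "real ^ 'n"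
  by (simp add: inner_vec_def)

text \<open>The equation is tested in p with \<rho> (p - q) for every fixed q, multiplied by
  \<open>U q\<close> and integrated. The left side is a sum of forms with odd kernels and tends to
  0. On the right the v derivative of the kernel is shifted to W through the variable q, so that no
  factor 1/\<sigma> appears and only mollified pairings remain.\<close>

lemma global_energy:
  fixes U g :: "('d::finite, 'd1::finite) pt \<Rightarrow> real" and F W :: "('d, 'd1) pt \<Rightarrow> real ^ 'd1"
    and \<alpha> :: "real ^ 'd1 \<Rightarrow> real ^ 'd"
  assumes cont: "continuous_on UNIV \<alpha>"
    and hol: "\<And>v v'. norm (\<alpha> v - \<alpha> v') \<le> K * norm (v - v') powr \<theta>" and \<theta>: "\<theta> > 0" and K: "K \<ge> 0"
    and sqi: "sqi lborel U" "sqi lborel g" "sqi lborel F" "sqi lborel W"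
    and supp: "\<And>p. norm p > R \<Longrightarrow> U p = 0" "\<And>p. norm p > R \<Longrightarrow> g p = 0"
      "\<And>p. norm p > R \<Longrightarrow> F p = 0" "\<And>p. norm p > R \<Longrightarrow> W p = 0"
    and weak: "\<And>\<phi> i. test_fn UNIV \<phi> \<Longrightarrow>
      (\<integral>p. U p * pd \<phi> (0, 0, axis i 1) p \<partial>lborel) = - (\<integral>p. (W p $ i) * \<phi> p \<partial>lborel)"
    and eq: "\<And>\<phi>. test_fn UNIV \<phi> \<Longrightarrow>
      (\<integral>p. U p * (Dt \<phi> p + \<alpha> (snd (snd p)) \<bullet> Dx \<phi> p) \<partial>lborel)
        = (\<integral>p. F p \<bullet> Dv \<phi> p \<partial>lborel) - (\<integral>p. g p * \<phi> p \<partial>lborel)"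
  shows "(\<integral>p. F p \<bullet> W p \<partial>lborel) = (\<integral>p. g p * U p \<partial>lborel)"
proof -
  define \<epsilon> where "\<epsilon> n = inverse (real (Suc n))" for n
  \<comment> \<open>One factor of \<sigma>^\<theta> = \<epsilon>^2 pays for the x derivative of the
    kernel, the other makes the commutator vanish.\<close>
  define \<sigma> where "\<sigma> n = \<epsilon> n powr (2 / \<theta>)" for n
  have \<epsilon>: "\<epsilon> n > 0" for n by (simp add: \<epsilon>_def)
  have \<epsilon>0: "\<epsilon> \<longlonglongrightarrow> 0" unfolding \<epsilon>_def by (rule LIMSEQ_inverse_real_of_nat)
  have \<sigma>: "\<sigma> n > 0" for n using \<epsilon>[of n] by (simp add: \<sigma>_def)
  have \<sigma>0: "\<sigma> \<longlonglongrightarrow> 0" unfolding \<sigma>_def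
    by (rule tendsto_zero_powrI[OF \<epsilon>0 tendsto_const]) (use \<theta> \<epsilon> in \<open>auto intro: always_eventually less_imp_le\<close>)
  define r :: "nat \<Rightarrow> ('d, 'd1) pt \<Rightarrow> real" where "r n = rr (\<epsilon> n) (\<sigma> n)" for n
  have r: "\<And>e. e \<in> Basis \<Longrightarrow> r n e > 0" for n using \<epsilon> \<sigma> by (simp add: r_def rr_pos)
  have r0: "(\<lambda>n. r n e) \<longlonglongrightarrow> 0" for e
    using \<epsilon>0 \<sigma>0 by (cases "snd (snd e) = 0") (auto simp: r_def rr_def)
  define \<rho> where "\<rho> n = kern (r n)" for n
  have \<rho>t: "test_fn UNIV (\<rho> n)" for n unfolding \<rho>_def by (rule test_fn_kern[where r = "r n", OF r])
  have \<rho>s: "smooth_fn (\<rho> n)" for n by (rule test_fn_smooth[OF \<rho>t])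
  have Dcc: "cc (pd (\<rho> n) h)" for n h by (rule cc_test_fn[OF test_fn_pd[OF \<rho>t]])
  have \<rho>cc: "cc (\<rho> n)" for n by (rule cc_test_fn[OF \<rho>t])
  have Dodd: "pd (\<rho> n) h (- z) = - pd (\<rho> n) h z" for n h z
    by (rule pd_even_odd[OF \<rho>s]) (simp add: \<rho>_def kern_even[where r = "r n", OF r])
  have shift_t: "test_fn UNIV (\<lambda>p. \<rho> n (p - q))" for n q
  proof -
    obtain C where C: "compact C" "\<And>p. p \<notin> C \<Longrightarrow> \<rho> n p = 0" using \<rho>cc[of n] unfolding cc_def by blast
    show ?thesis
    proof (rule test_fnI[where K = "(\<lambda>p. p + q) ` C"])
      show "compact ((\<lambda>p. p + q) ` C)" by (intro compact_continuous_image continuous_intros C)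
      show "\<rho> n (p - q) = 0" if "p \<notin> (\<lambda>p. p + q) ` C" for p
        by (rule C(2)) (use that image_eqI[of p "\<lambda>p. p + q" "p - q" C] in auto)
    qed (auto intro: smooth_fn_shift(1)[OF \<rho>s])
  qed
  have refl_t: "test_fn UNIV (\<lambda>q. \<rho> n (p - q))" for n p
  proof -
    have "(\<lambda>q. \<rho> n (p - q)) = (\<lambda>q. \<rho> n (q - p))"
    proof
      show "\<rho> n (p - q) = \<rho> n (q - p)" for q
        using kern_even[where r = "r n", OF r, of "p - q"] by (simp add: \<rho>_def)
    qed
    then show ?thesis using shift_t by simp
  qed
  define al where "al k p = \<alpha> (snd (snd p)) $ k" for k and p :: "('d, 'd1) pt"
  have alc: "continuous_on UNIV (al k)" for k
    unfolding al_def
    by (intro continuous_intros continuous_on_compose2[OF cont]) auto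
  have aU: "sqi lborel (\<lambda>p. al k p * U p)" for k
  proof -
    have "bounded (al k ` cball 0 R)"
      by (intro compact_imp_bounded compact_continuous_image continuous_on_subset[OF alc]) auto
    then obtain C where "\<forall>p\<in>cball 0 R. \<bar>al k p\<bar> \<le> C" by (auto simp: bounded_iff)
    then have C: "\<bar>al k p\<bar> \<le> C" if "norm p \<le> R" for p using that by (simp add: mem_cball_0)
    have [measurable]: "al k \<in> borel_measurable borel" "U \<in> borel_measurable borel"
      using borel_measurable_continuous_onI[OF alc] sqi(1) by (auto simp: sqi_def)
    show ?thesis
    proof (rule sqi_dominated[OF sqi(1), where C = C])
      fix p
      show "norm (al k p * U p) \<le> C * norm (U p)"
        using C[of p] supp(1)[of p] by (cases "norm p > R") (auto simp: abs_mult intro!: mult_right_mono)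
    qed simp
  qed
  define dt :: "('d, 'd1) pt" where "dt = (1, 0, 0)"
  define dx :: "'d \<Rightarrow> ('d, 'd1) pt" where "dx k = (0, axis k 1, 0)" for k
  define dv :: "'d1 \<Rightarrow> ('d, 'd1) pt" where "dv i = (0, 0, axis i 1)" for i
  define I where "I n = dbl (pd (\<rho> n) dt) U U + (\<Sum>k\<in>UNIV. dbl (pd (\<rho> n) (dx k)) (\<lambda>p. al k p * U p) U)" for n
  have Fi: "sqi lborel (\<lambda>p. F p $ i)" and Wi: "sqi lborel (\<lambda>p. W p $ i)" for i
    using sqi by (auto intro: sqi_nth)
  have sI: "integrable lborel (\<lambda>p. A p * D (p - q))" if sA: "sqi lborel A" and cD: "cc D" for A D :: "('d, 'd1) pt \<Rightarrow> real" and q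
  proof (rule sqi_mult_integrable[OF sA cc_sqi_lborel])
    obtain C where C: "continuous_on UNIV D" "compact C" "\<And>p. p \<notin> C \<Longrightarrow> D p = 0" using cD by (auto simp: cc_def)
    show "cc (\<lambda>p. D (p - q))"
      unfolding cc_def
    proof (intro conjI exI[of _ "(\<lambda>p. p + q) ` C"] allI impI)
      show "continuous_on UNIV (\<lambda>p. D (p - q))"
        by (rule continuous_on_compose2[OF C(1)]) (auto intro!: continuous_intros)
      show "compact ((\<lambda>p. p + q) ` C)" by (intro compact_continuous_image continuous_intros C)
      show "D (p - q) = 0" if "p \<notin> (\<lambda>p. p + q) ` C" for p
        by (rule C(3)) (use that image_eqI[of p "\<lambda>p. p + q" "p - q" C] in auto)
    qed
  qed
  have step1: "I n = (\<Sum>i\<in>UNIV. mol (r n) (\<lambda>p. F p $ i) (\<lambda>p. W p $ i)) - mol (r n) g U" for n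
  proof -
    have inner: "(\<integral>p. U p * pd (\<rho> n) dt (p - q) \<partial>lborel) + (\<Sum>k\<in>UNIV. \<integral>p. (al k p * U p) * pd (\<rho> n) (dx k) (p - q) \<partial>lborel)
      = (\<Sum>i\<in>UNIV. \<integral>p. F p $ i * pd (\<rho> n) (dv i) (p - q) \<partial>lborel) - (\<integral>p. g p * \<rho> n (p - q) \<partial>lborel)" for q
    proof -
      have "(\<integral>p. U p * (Dt (\<lambda>p. \<rho> n (p - q)) p + \<alpha> (snd (snd p)) \<bullet> Dx (\<lambda>p. \<rho> n (p - q)) p) \<partial>lborel)
        = (\<integral>p. U p * pd (\<rho> n) dt (p - q) + (\<Sum>k\<in>UNIV. (al k p * U p) * pd (\<rho> n) (dx k) (p - q)) \<partial>lborel)"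
        by (intro Bochner_Integration.integral_cong refl)
           (simp add: Dt_def Dx_def smooth_fn_shift(2)[OF \<rho>s] inner_vec_sum al_def dt_def dx_def
             distrib_left sum_distrib_left mult_ac)
      also have "\<dots> = (\<integral>p. U p * pd (\<rho> n) dt (p - q) \<partial>lborel) + (\<Sum>k\<in>UNIV. \<integral>p. (al k p * U p) * pd (\<rho> n) (dx k) (p - q) \<partial>lborel)"
        by (subst Bochner_Integration.integral_add)
           (auto intro!: sI sqi Dcc aU Bochner_Integration.integrable_sum Bochner_Integration.integral_sum)
      finally have L: "(\<integral>p. U p * (Dt (\<lambda>p. \<rho> n (p - q)) p + \<alpha> (snd (snd p)) \<bullet> Dx (\<lambda>p. \<rho> n (p - q)) p) \<partial>lborel)
        = \<dots>" .
      have "(\<integral>p. F p \<bullet> Dv (\<lambda>p. \<rho> n (p - q)) p \<partial>lborel) = (\<integral>p. (\<Sum>i\<in>UNIV. F p $ i * pd (\<rho> n) (dv i) (p - q)) \<partial>lborel)"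
        by (intro Bochner_Integration.integral_cong refl)
           (simp add: Dv_def smooth_fn_shift(2)[OF \<rho>s] inner_vec_sum dv_def)
      also have "\<dots> = (\<Sum>i\<in>UNIV. \<integral>p. F p $ i * pd (\<rho> n) (dv i) (p - q) \<partial>lborel)"
        by (intro Bochner_Integration.integral_sum sI Fi Dcc)
      finally show ?thesis using eq[OF shift_t[of n q]] L by simp
    qed
    \<comment> \<open>As a function of q the kernel \<rho> (p - q) has a derivative of opposite
      sign, and the weak gradient of U supplies a second sign; the two cancel.\<close>
    have J1: "(\<integral>q. U q * (\<integral>p. F p $ i * pd (\<rho> n) (dv i) (p - q) \<partial>lborel) \<partial>lborel) = mol (r n) (\<lambda>p. F p $ i) (\<lambda>p. W p $ i)" for i
    proof -
      have "(\<integral>q. U q * pd (\<rho> n) (dv i) (p - q) \<partial>lborel) = (\<integral>q. W q $ i * \<rho> n (p - q) \<partial>lborel)" for p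
        using weak[OF refl_t[of n p], of i] by (simp add: smooth_fn_reflect(2)[OF \<rho>s] dv_def)
      then have "dbl (pd (\<rho> n) (dv i)) (\<lambda>p. F p $ i) U = dbl (\<rho> n) (\<lambda>p. F p $ i) (\<lambda>p. W p $ i)"
        unfolding dbl_p[OF Dcc Fi sqi(1), symmetric] dbl_p[OF \<rho>cc Fi Wi, symmetric] by simp
      then show ?thesis unfolding dbl_q[OF Dcc Fi sqi(1)] by (simp add: mol_def dbl_def \<rho>_def)
    qed
    have "I n = (\<integral>q. U q * (\<integral>p. U p * pd (\<rho> n) dt (p - q) \<partial>lborel) \<partial>lborel)
        + (\<Sum>k\<in>UNIV. \<integral>q. U q * (\<integral>p. (al k p * U p) * pd (\<rho> n) (dx k) (p - q) \<partial>lborel) \<partial>lborel)"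
      unfolding I_def by (simp only: dbl_q[OF Dcc sqi(1) sqi(1)] dbl_q[OF Dcc aU sqi(1)])
    also have "\<dots> = (\<integral>q. U q * (\<integral>p. U p * pd (\<rho> n) dt (p - q) \<partial>lborel)
        + (\<Sum>k\<in>UNIV. U q * (\<integral>p. (al k p * U p) * pd (\<rho> n) (dx k) (p - q) \<partial>lborel)) \<partial>lborel)"
      by (subst Bochner_Integration.integral_add)
         (auto intro!: dbl_q_integrable sqi Dcc aU Bochner_Integration.integrable_sum Bochner_Integration.integral_sum[symmetric])
    also have "\<dots> = (\<integral>q. (\<Sum>i\<in>UNIV. U q * (\<integral>p. F p $ i * pd (\<rho> n) (dv i) (p - q) \<partial>lborel)) - U q * (\<integral>p. g p * \<rho> n (p - q) \<partial>lborel) \<partial>lborel)"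
      unfolding sum_distrib_left[symmetric] distrib_left[symmetric] right_diff_distrib[symmetric] inner by (rule refl)
    also have "\<dots> = (\<Sum>i\<in>UNIV. \<integral>q. U q * (\<integral>p. F p $ i * pd (\<rho> n) (dv i) (p - q) \<partial>lborel) \<partial>lborel)
        - (\<integral>q. U q * (\<integral>p. g p * \<rho> n (p - q) \<partial>lborel) \<partial>lborel)"
      by (subst Bochner_Integration.integral_diff)
         (auto intro!: dbl_q_integrable sqi Dcc Fi \<rho>cc Bochner_Integration.integrable_sum Bochner_Integration.integral_sum)
    also have "\<dots> = (\<Sum>i\<in>UNIV. mol (r n) (\<lambda>p. F p $ i) (\<lambda>p. W p $ i)) - mol (r n) g U"
      unfolding J1 dbl_q[OF \<rho>cc sqi(2) sqi(1)] by (simp add: mol_def dbl_def \<rho>_def)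
    finally show ?thesis .
  qed
  define Q where "Q = K * (2 * CARD('d1)) powr \<theta> * sq lborel U * (bmpC * 2 ^ DIM(('d, 'd1) pt))"
  have step2: "\<bar>I n\<bar> \<le> (\<Sum>k\<in>(UNIV::'d set). Q * \<epsilon> n)" for n
  proof -
    \<comment> \<open>The time derivative carries the constant weight 1, hence has commutator
      0.\<close>
    have "\<bar>dbl (pd (\<rho> n) dt) (\<lambda>p. 1 * U p) U\<bar> \<le> 0 * sq lborel U * (\<integral>z. \<bar>pd (\<rho> n) dt z\<bar> \<partial>lborel)"
      by (rule dbl_commutator[OF Dcc Dodd sqi(1)]) (use sqi(1) in auto)
    then have t: "dbl (pd (\<rho> n) dt) U U = 0" by simp
    have x: "\<bar>dbl (pd (\<rho> n) (dx k)) (\<lambda>p. al k p * U p) U\<bar> \<le> Q * \<epsilon> n" for k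
    proof -
      let ?\<omega> = "K * (2 * \<sigma> n * CARD('d1)) powr \<theta>"
      have "\<bar>dbl (pd (\<rho> n) (dx k)) (\<lambda>p. al k p * U p) U\<bar> \<le> ?\<omega> * sq lborel U * (\<integral>z. \<bar>pd (\<rho> n) (dx k) z\<bar> \<partial>lborel)"
      proof (rule dbl_commutator[OF Dcc Dodd sqi(1) aU])
        fix p q assume "pd (\<rho> n) (dx k) (p - q) \<noteq> 0"
        then have "p - q \<in> box_of (\<lambda>e. 2 * r n e)"
          using pd_kern_0[where r = "r n", OF r] unfolding \<rho>_def by blast
        then have "norm (snd (snd (p - q))) \<le> 2 * \<sigma> n * CARD('d1)" unfolding r_def by (rule box_rr_v)
        then have "norm (snd (snd p) - snd (snd q)) powr \<theta> \<le> (2 * \<sigma> n * CARD('d1)) powr \<theta>"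
          using \<theta> by (intro powr_mono2) auto
        moreover have "\<bar>al k p - al k q\<bar> \<le> norm (\<alpha> (snd (snd p)) - \<alpha> (snd (snd q)))"
          using component_le_norm_cart[of "\<alpha> (snd (snd p)) - \<alpha> (snd (snd q))" k] by (simp add: al_def)
        ultimately show "\<bar>al k p - al k q\<bar> \<le> ?\<omega>"
          using hol[of "snd (snd p)" "snd (snd q)"] K by (meson mult_left_mono order_trans)
      qed (use K in auto)
      \<comment> \<open>The width in an x direction is \<epsilon>, so the L1 norm of this derivative
        is of order 1/\<epsilon> whatever \<sigma> is.\<close>
      also have "\<dots> \<le> ?\<omega> * sq lborel U * (bmpC / \<epsilon> n * 2 ^ DIM(('d, 'd1) pt))"
        using pd_kern_L1[where r = "r n", OF r Basis_pt(2)[of k]] K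
        by (intro mult_left_mono mult_nonneg_nonneg) (auto simp: \<rho>_def dx_def r_def)
      also have "?\<omega> = K * (2 * CARD('d1)) powr \<theta> * (\<epsilon> n)\<^sup>2"
      proof -
        have "(2 * \<sigma> n * CARD('d1)) powr \<theta> = ((2 * CARD('d1)) * \<sigma> n) powr \<theta>" by (simp add: mult_ac)
        also have "\<dots> = (2 * CARD('d1)) powr \<theta> * \<sigma> n powr \<theta>"
          by (rule powr_mult)
        also have "\<sigma> n powr \<theta> = \<epsilon> n powr 2" using \<theta> by (simp add: \<sigma>_def powr_powr)
        also have "\<dots> = (\<epsilon> n)\<^sup>2" using \<epsilon>[of n] by (simp add: powr_numeral)
        finally show ?thesis by simp
      qed
      also have "K * (2 * CARD('d1)) powr \<theta> * (\<epsilon> n)\<^sup>2 * sq lborel U * (bmpC / \<epsilon> n * 2 ^ DIM(('d, 'd1) pt)) = Q * \<epsilon> n"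
        using \<epsilon>[of n] by (simp add: Q_def power2_eq_square)
      finally show ?thesis .
    qed
    have "\<bar>I n\<bar> = \<bar>\<Sum>k\<in>UNIV. dbl (pd (\<rho> n) (dx k)) (\<lambda>p. al k p * U p) U\<bar>" unfolding I_def t by simp
    also have "\<dots> \<le> (\<Sum>k\<in>UNIV. \<bar>dbl (pd (\<rho> n) (dx k)) (\<lambda>p. al k p * U p) U\<bar>)" by (rule sum_abs)
    also have "\<dots> \<le> (\<Sum>k\<in>(UNIV::'d set). Q * \<epsilon> n)" by (intro sum_mono x)
    finally show ?thesis .
  qed
  have "(\<lambda>n. \<Sum>k\<in>(UNIV::'d set). Q * \<epsilon> n) \<longlonglongrightarrow> (\<Sum>k\<in>(UNIV::'d set). Q * 0)"
    by (intro tendsto_intros \<epsilon>0)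
  then have "(\<lambda>n. \<Sum>k\<in>(UNIV::'d set). Q * \<epsilon> n) \<longlonglongrightarrow> 0" by simp
  then have I0: "I \<longlonglongrightarrow> 0"
    by (intro Lim_null_comparison[of I "\<lambda>n. \<Sum>k\<in>(UNIV::'d set). Q * \<epsilon> n"] always_eventually allI)
       (use step2 in simp)
  have "I \<longlonglongrightarrow> (\<Sum>i\<in>UNIV. \<integral>p. F p $ i * W p $ i \<partial>lborel) - (\<integral>p. g p * U p \<partial>lborel)"
    unfolding step1[abs_def]
    by (intro tendsto_diff tendsto_sum mol_tendsto[where R = R] r r0 Fi Wi sqi) (auto simp: supp)
  from LIMSEQ_unique[OF I0 this]
  have "(\<Sum>i\<in>UNIV. \<integral>p. F p $ i * W p $ i \<partial>lborel) = (\<integral>p. g p * U p \<partial>lborel)" by simp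
  moreover have "(\<integral>p. F p \<bullet> W p \<partial>lborel) = (\<Sum>i\<in>UNIV. \<integral>p. F p $ i * W p $ i \<partial>lborel)"
    unfolding inner_vec_sum by (intro Bochner_Integration.integral_sum sqi_mult_integrable Fi Wi)
  ultimately show ?thesis by simp
qed

subsection \<open>Local energy identity\<close>

text \<open>The transport field. Its coefficients do not depend on the variables in which it
  differentiates, so its formal adjoint is -Y although \<alpha> need not be differentiable.\<close>

abbreviation Y :: "(real ^ 'd1 \<Rightarrow> real ^ 'd) \<Rightarrow> (('d::finite, 'd1::finite) pt \<Rightarrow> real) \<Rightarrow> ('d, 'd1) pt \<Rightarrow> real" where
  "Y \<alpha> \<phi> p \<equiv> Dt \<phi> p + \<alpha> (snd (snd p)) \<bullet> Dx \<phi> p"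

lemma cc_sqi_mult:
  fixes u :: "'a::euclidean_space \<Rightarrow> real"
  assumes "cc c" "G \<in> sets lebesgue" "sqi (lebesgue_on G) u"
  shows "sqi (lebesgue_on G) (\<lambda>p. c p * u p)"
proof -
  obtain C where C: "\<And>p. norm (c p) \<le> C" using cc_bounded[OF assms(1)] by metis
  show ?thesis
    by (rule sqi_dominated[OF assms(3), of _ C])
       (use C sqi_measurable[OF assms(3)] sqi_measurable[OF cc_sqi[OF assms(1,2)]] in
         \<open>auto simp: abs_mult intro!: mult_right_mono\<close>)
qed

lemma cc_sqi_scaleR:
  fixes F :: "'a::euclidean_space \<Rightarrow> 'b::euclidean_space" and c :: "'a \<Rightarrow> real"
  assumes "cc c" "G \<in> sets lebesgue" "sqi (lebesgue_on G) F"
  shows "sqi (lebesgue_on G) (\<lambda>p. c p *\<^sub>R F p)"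
proof -
  obtain C where C: "\<And>p. norm (c p) \<le> C" using cc_bounded[OF assms(1)] by metis
  show ?thesis
    by (rule sqi_dominated[OF assms(3), of _ C])
       (use C sqi_measurable[OF assms(3)] sqi_measurable[OF cc_sqi[OF assms(1,2)]] in
         \<open>auto intro!: mult_right_mono\<close>)
qed

lemma cc_sqi_scaleR':
  fixes u :: "'a::euclidean_space \<Rightarrow> real" and V :: "'a \<Rightarrow> 'b::euclidean_space"
  assumes "cc V" "G \<in> sets lebesgue" "sqi (lebesgue_on G) u"
  shows "sqi (lebesgue_on G) (\<lambda>p. u p *\<^sub>R V p)"
proof -
  obtain C where C: "\<And>p. norm (V p) \<le> C" using cc_bounded[OF assms(1)] by metis
  show ?thesis
    by (rule sqi_dominated[OF assms(3), of _ C])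
       (use C sqi_measurable[OF assms(3)] sqi_measurable[OF cc_sqi[OF assms(1,2)]] in
         \<open>auto simp: mult.commute[of C] intro!: mult_left_mono\<close>)
qed

lemma cc_sqi_inner:
  fixes F V :: "'a::euclidean_space \<Rightarrow> 'b::euclidean_space"
  assumes "cc V" "G \<in> sets lebesgue" "sqi (lebesgue_on G) F"
  shows "sqi (lebesgue_on G) (\<lambda>p. F p \<bullet> V p)"
proof -
  obtain C where C: "\<And>p. norm (V p) \<le> C" using cc_bounded[OF assms(1)] by metis
  show ?thesis
  proof (rule sqi_dominated[OF assms(3), of _ C])
    show "(\<lambda>p. F p \<bullet> V p) \<in> borel_measurable (lebesgue_on G)"
      using sqi_measurable[OF assms(3)] sqi_measurable[OF cc_sqi[OF assms(1,2)]] by measurable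
    fix p
    have "norm (F p \<bullet> V p) \<le> norm (F p) * norm (V p)" by (simp add: Cauchy_Schwarz_ineq2)
    also have "\<dots> \<le> norm (F p) * C" by (intro mult_left_mono C) simp
    finally show "norm (F p \<bullet> V p) \<le> C * norm (F p)" by (simp add: mult.commute)
  qed
qed

lemma cc_integrable_mult:
  fixes u :: "'a::euclidean_space \<Rightarrow> real"
  assumes "cc c" "G \<in> sets lebesgue" "sqi (lebesgue_on G) u"
  shows "integrable (lebesgue_on G) (\<lambda>p. u p * c p)"
  by (intro sqi_mult_integrable cc_sqi assms)

lemma cc_integrable_inner:
  fixes F :: "'a::euclidean_space \<Rightarrow> 'b::euclidean_space"
  assumes "cc c" "G \<in> sets lebesgue" "sqi (lebesgue_on G) F"
  shows "integrable (lebesgue_on G) (\<lambda>p. F p \<bullet> c p)"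
  by (intro sqi_inner_integrable cc_sqi assms)

lemma test_fn_outside: "test_fn G \<phi> \<Longrightarrow> p \<notin> G \<Longrightarrow> \<phi> p = 0"
  using closure_subset[of "{p. \<phi> p \<noteq> 0}"] unfolding test_fn_def by blast

lemma cc_pd: "test_fn G \<phi> \<Longrightarrow> cc (pd \<phi> h)"
  by (rule cc_test_fn[OF test_fn_pd])

lemma cc_Dv: "test_fn G \<phi> \<Longrightarrow> cc (Dv \<phi>)"
  by (rule cc_vec) (simp add: Dv_def cc_pd)

lemma cc_Dx: "test_fn G \<phi> \<Longrightarrow> cc (Dx \<phi>)"
  by (rule cc_vec) (simp add: Dx_def cc_pd)

lemma cc_Y:
  assumes "test_fn G \<phi>" "continuous_on UNIV \<alpha>"
  shows "cc (Y \<alpha> \<phi>)"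
proof (intro cc_add cc_inner)
  show "cc (Dt \<phi>)" unfolding Dt_def[abs_def] by (rule cc_pd[OF assms(1)])
  show "cc (Dx \<phi>)" by (rule cc_Dx[OF assms(1)])
  show "continuous_on UNIV (\<lambda>p. \<alpha> (snd (snd p)))"
    by (rule continuous_on_compose2[OF assms(2)]) (auto intro!: continuous_intros)
qed

lemma Dv_mult: "smooth_fn \<phi> \<Longrightarrow> smooth_fn \<psi> \<Longrightarrow> Dv (\<lambda>p. \<phi> p * \<psi> p) p = \<psi> p *\<^sub>R Dv \<phi> p + \<phi> p *\<^sub>R Dv \<psi> p"
  by (simp add: Dv_def vec_eq_iff pd_mult mult.commute)

lemma Dx_mult: "smooth_fn \<phi> \<Longrightarrow> smooth_fn \<psi> \<Longrightarrow> Dx (\<lambda>p. \<phi> p * \<psi> p) p = \<psi> p *\<^sub>R Dx \<phi> p + \<phi> p *\<^sub>R Dx \<psi> p"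
  by (simp add: Dx_def vec_eq_iff pd_mult mult.commute)

lemma Dt_mult: "smooth_fn \<phi> \<Longrightarrow> smooth_fn \<psi> \<Longrightarrow> Dt (\<lambda>p. \<phi> p * \<psi> p) p = \<psi> p * Dt \<phi> p + \<phi> p * Dt \<psi> p"
  by (simp add: Dt_def pd_mult mult.commute)

lemma Y_mult: "smooth_fn \<phi> \<Longrightarrow> smooth_fn \<psi> \<Longrightarrow> Y \<alpha> (\<lambda>p. \<phi> p * \<psi> p) p = \<psi> p * Y \<alpha> \<phi> p + \<phi> p * Y \<alpha> \<psi> p"
  by (simp add: Dt_mult Dx_mult inner_add_right algebra_simps)

text \<open>The Borel version is cut off by the ball, because a version agrees only almost
  everywhere, while the whole-space identity asks for vanishing at every point outside.\<close>

lemma ex_borel_sqi: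
  fixes f :: "'a::euclidean_space \<Rightarrow> 'b::euclidean_space"
  assumes G: "G \<in> sets lebesgue" and f: "sqi (lebesgue_on G) f" and R: "\<And>p. p \<in> G \<Longrightarrow> norm p > R \<Longrightarrow> f p = 0"
  shows "\<exists>h. sqi lborel h \<and> (\<forall>p. norm p > R \<longrightarrow> h p = 0) \<and> (AE p in lebesgue. h p = (if p \<in> G then f p else 0))"
proof -
  let ?f = "\<lambda>p. if p \<in> G then f p else 0"
  have f0: "sqi lebesgue ?f" using sqi_extend_zero[OF G _ f, of UNIV] by (simp add: lebesgue_on_UNIV_eq)
  obtain h where h [measurable]: "h \<in> borel_measurable borel" and AE: "AE x in lborel. ?f x = h x"
    using ex_borel_representative[of ?f] f0 by (auto simp: sqi_def)
  define h' where "h' p = indicat_real (cball 0 R) p *\<^sub>R h p" for p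
  have h'm [measurable]: "h' \<in> borel_measurable borel"
    unfolding h'_def by (intro borel_measurable_scaleR borel_measurable_indicator h) simp
  have AE': "AE x in lborel. h' x = ?f x"
    using AE
  proof eventually_elim
    case (elim x)
    then show ?case using R[of x] by (cases "norm x \<le> R") (auto simp: h'_def split: if_splits)
  qed
  then have AE'': "AE x in lebesgue. h' x = ?f x" by (rule AE_completion)
  have "integrable lebesgue (\<lambda>x. (norm (h' x))\<^sup>2)"
  proof (rule integrable_cong_AE_imp)
    show "integrable lebesgue (\<lambda>x. (norm (?f x))\<^sup>2)" using f0 by (simp add: sqi_def)
    show "(\<lambda>x. (norm (h' x))\<^sup>2) \<in> borel_measurable lebesgue" by (intro measurable_completion) measurable
    show "AE x in lebesgue. (norm (?f x))\<^sup>2 = (norm (h' x))\<^sup>2" using AE'' by eventually_elim simp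
  qed
  then have "integrable lborel (\<lambda>x. (norm (h' x))\<^sup>2)" by (simp add: integrable_completion)
  then have "sqi lborel h'" by (simp add: sqi_def)
  then show ?thesis using AE'' by (intro exI[of _ h']) (auto simp: h'_def)
qed

lemma integral_borel_representative:
  fixes h h' :: "'a::euclidean_space \<Rightarrow> real"
  assumes "G \<in> sets lebesgue" "h' \<in> borel_measurable borel" "h \<in> borel_measurable (lebesgue_on G)"
    and AE: "AE p in lebesgue. h' p = (if p \<in> G then h p else 0)"
  shows "(\<integral>p. h' p \<partial>lborel) = (\<integral>p. h p \<partial>lebesgue_on G)"
proof -
  have "(\<integral>p. h' p \<partial>lborel) = (\<integral>p. h' p \<partial>lebesgue)" using assms(2) by (simp add: integral_completion)
  also have "\<dots> = (\<integral>p. (if p \<in> G then h p else 0) \<partial>lebesgue)"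
  proof (rule integral_cong_AE[OF _ _ AE])
    show "h' \<in> borel_measurable lebesgue" by (intro measurable_completion) (use assms(2) in simp)
    show "(\<lambda>p. if p \<in> G then h p else 0) \<in> borel_measurable lebesgue"
      by (rule borel_measurable_if_I[OF assms(3,1)])
  qed
  also have "\<dots> = (\<integral>p. h p \<partial>lebesgue_on G)" by (rule Lebesgue_Measure.integral_restrict_UNIV[OF assms(1)])
  finally show ?thesis .
qed

text \<open>Since \<zeta> \<phi> is a test function on G for every smooth \<phi>, the product
  \<zeta> u solves an equation on the whole space: the product rule moves F \<bullet> D_v \<zeta>
  and u Y \<zeta> into the source and u D_v \<zeta> into the gradient.\<close>

lemma local_energy:
  fixes u g \<zeta> :: "('d::finite, 'd1::finite) pt \<Rightarrow> real" and F w :: "('d, 'd1) pt \<Rightarrow> real ^ 'd1"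
    and \<alpha> :: "real ^ 'd1 \<Rightarrow> real ^ 'd"
  assumes G: "G \<in> sets lebesgue" and cont: "continuous_on UNIV \<alpha>"
    and hol: "\<And>v v'. norm (\<alpha> v - \<alpha> v') \<le> K * norm (v - v') powr \<theta>" and \<theta>: "\<theta> > 0" and K: "K \<ge> 0"
    and sqi: "sqi (lebesgue_on G) u" "sqi (lebesgue_on G) g" "sqi (lebesgue_on G) F" "sqi (lebesgue_on G) w"
    and weak: "weak_Dv G u w"
    and eq: "\<And>\<phi>. test_fn G \<phi> \<Longrightarrow> transport_pair G \<alpha> u \<phi> = Hm1_pair G F g \<phi>"
    and \<zeta>: "test_fn G \<zeta>"
  shows "(\<integral>p. (\<zeta> p *\<^sub>R F p) \<bullet> (\<zeta> p *\<^sub>R w p + u p *\<^sub>R Dv \<zeta> p) \<partial>lebesgue_on G)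
    = (\<integral>p. (\<zeta> p * g p - F p \<bullet> Dv \<zeta> p + u p * Y \<alpha> \<zeta> p) * (\<zeta> p * u p) \<partial>lebesgue_on G)"
proof -
  let ?M = "lebesgue_on G"
  note c = cc_test_fn[OF \<zeta>] cc_Dv[OF \<zeta>] cc_Y[OF \<zeta> cont]
  have \<zeta>s: "smooth_fn \<zeta>" by (rule test_fn_smooth[OF \<zeta>])
  obtain C where "smooth_fn \<zeta>" and C: "compact C" "C \<subseteq> G" "\<And>p. p \<notin> C \<Longrightarrow> \<zeta> p = 0"
    using test_fnE[OF \<zeta>] by blast
  \<comment> \<open>Regarding \<zeta> as a test function on its own compact set C shows that its
    derivatives vanish off C as well.\<close>
  have C': "test_fn C \<zeta>" by (rule test_fnI[OF \<zeta>s C(1) subset_refl C(3)])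
  obtain R where R: "\<And>p. p \<in> C \<Longrightarrow> norm p \<le> R" using compact_imp_bounded[OF C(1)] by (auto simp: bounded_iff)
  have pd0: "pd \<zeta> h p = 0" if "norm p > R" for h p
  proof -
    have "p \<notin> C" using R[of p] that by auto
    then show ?thesis by (rule test_fn_outside[OF test_fn_pd[OF C']])
  qed
  have z: "\<zeta> p = 0" "Dv \<zeta> p = 0" "Y \<alpha> \<zeta> p = 0" if "norm p > R" for p
    using C(3)[of p] R[of p] that pd0[OF that] by (auto simp: Dv_def Dt_def Dx_def vec_eq_iff inner_vec_sum not_le)
  define U0 where "U0 p = \<zeta> p * u p" for p
  define F0 where "F0 p = \<zeta> p *\<^sub>R F p" for p
  define W0 where "W0 p = \<zeta> p *\<^sub>R w p + u p *\<^sub>R Dv \<zeta> p" for p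
  define g0 where "g0 p = \<zeta> p * g p - F p \<bullet> Dv \<zeta> p + u p * Y \<alpha> \<zeta> p" for p
  have U0: "sqi ?M U0" unfolding U0_def by (rule cc_sqi_mult[OF c(1) G sqi(1)])
  have F0: "sqi ?M F0" unfolding F0_def by (rule cc_sqi_scaleR[OF c(1) G sqi(3)])
  have W0: "sqi ?M W0" unfolding W0_def
    by (intro sqi_add cc_sqi_scaleR[OF c(1) G sqi(4)] cc_sqi_scaleR'[OF c(2) G sqi(1)])
  have g0: "sqi ?M g0" unfolding g0_def
    using cc_sqi_mult[OF c(3) G sqi(1)]
    by (intro sqi_add sqi_diff cc_sqi_mult[OF c(1) G sqi(2)] cc_sqi_inner[OF c(2) G sqi(3)]) (simp add: mult.commute)
  obtain U where U: "sqi lborel U" "\<And>p. norm p > R \<Longrightarrow> U p = 0" "AE p in lebesgue. U p = (if p \<in> G then U0 p else 0)"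
    using ex_borel_sqi[OF G U0, of R] z by (auto simp: U0_def)
  obtain F1 where F1: "sqi lborel F1" "\<And>p. norm p > R \<Longrightarrow> F1 p = 0" "AE p in lebesgue. F1 p = (if p \<in> G then F0 p else 0)"
    using ex_borel_sqi[OF G F0, of R] z by (auto simp: F0_def)
  obtain W where W: "sqi lborel W" "\<And>p. norm p > R \<Longrightarrow> W p = 0" "AE p in lebesgue. W p = (if p \<in> G then W0 p else 0)"
    using ex_borel_sqi[OF G W0, of R] z by (auto simp: W0_def)
  obtain g1 where g1: "sqi lborel g1" "\<And>p. norm p > R \<Longrightarrow> g1 p = 0" "AE p in lebesgue. g1 p = (if p \<in> G then g0 p else 0)"
    using ex_borel_sqi[OF G g0, of R] z by (auto simp: g0_def)
  have m: "U \<in> borel_measurable borel" "F1 \<in> borel_measurable borel" "W \<in> borel_measurable borel" "g1 \<in> borel_measurable borel"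
    using U F1 W g1 by (auto simp: sqi_def)
  have trm: "(\<integral>p. h p * \<psi> p \<partial>lborel) = (\<integral>p. h0 p * \<psi> p \<partial>?M)"
    if "sqi lborel h" "sqi ?M h0" "AE p in lebesgue. h p = (if p \<in> G then h0 p else 0)" "cc \<psi>" for h h0 \<psi> :: "('d, 'd1) pt \<Rightarrow> real"
  proof (rule integral_borel_representative[OF G])
    show "(\<lambda>p. h p * \<psi> p) \<in> borel_measurable borel" using that(1) cc_measurable[OF that(4)] by (auto simp: sqi_def)
    show "(\<lambda>p. h0 p * \<psi> p) \<in> borel_measurable ?M" using cc_integrable_mult[OF that(4) G that(2)] by auto
    show "AE p in lebesgue. h p * \<psi> p = (if p \<in> G then h0 p * \<psi> p else 0)"
      using that(3) by eventually_elim auto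
  qed
  have tri: "(\<integral>p. h p \<bullet> \<psi> p \<partial>lborel) = (\<integral>p. h0 p \<bullet> \<psi> p \<partial>?M)"
    if "sqi lborel h" "sqi ?M h0" "AE p in lebesgue. h p = (if p \<in> G then h0 p else 0)" "cc \<psi>" for h h0 \<psi> :: "('d, 'd1) pt \<Rightarrow> real ^ 'd1"
  proof (rule integral_borel_representative[OF G])
    show "(\<lambda>p. h p \<bullet> \<psi> p) \<in> borel_measurable borel" using that(1) cc_measurable[OF that(4)] by (auto simp: sqi_def)
    show "(\<lambda>p. h0 p \<bullet> \<psi> p) \<in> borel_measurable ?M" using cc_integrable_inner[OF that(4) G that(2)] by auto
    show "AE p in lebesgue. h p \<bullet> \<psi> p = (if p \<in> G then h0 p \<bullet> \<psi> p else 0)"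
      using that(3) by eventually_elim auto
  qed
  have "(\<integral>p. F1 p \<bullet> W p \<partial>lborel) = (\<integral>p. g1 p * U p \<partial>lborel)"
  proof (rule global_energy[OF cont hol \<theta> K U(1) g1(1) F1(1) W(1) U(2) g1(2) F1(2) W(2)])
    fix \<phi> :: "('d, 'd1) pt \<Rightarrow> real" and i assume \<phi>: "test_fn UNIV \<phi>"
    have \<phi>s: "smooth_fn \<phi>" by (rule test_fn_smooth[OF \<phi>])
    have t: "test_fn G (\<lambda>p. \<zeta> p * \<phi> p)" by (rule test_fn_mult(1)[OF \<zeta> \<phi>s])
    let ?e = "(0, 0, axis i 1) :: ('d, 'd1) pt"
    have i1: "integrable ?M (\<lambda>p. U0 p * pd \<phi> ?e p)" by (rule cc_integrable_mult[OF cc_pd[OF \<phi>] G U0])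
    have i2: "integrable ?M (\<lambda>p. (u p * pd \<zeta> ?e p) * \<phi> p)"
      using cc_integrable_mult[OF cc_test_fn[OF \<phi>] G cc_sqi_mult[OF cc_pd[OF \<zeta>] G sqi(1)]] by (simp add: mult_ac)
    have i3: "integrable ?M (\<lambda>p. (\<zeta> p * w p $ i) * \<phi> p)"
      by (rule cc_integrable_mult[OF cc_test_fn[OF \<phi>] G cc_sqi_mult[OF c(1) G sqi_nth[OF sqi(4)]]])
    have "(\<integral>p. u p * pd (\<lambda>p. \<zeta> p * \<phi> p) ?e p \<partial>?M) = - (\<integral>p. (w p $ i) * (\<zeta> p * \<phi> p) \<partial>?M)"
      using weak t unfolding weak_Dv_def by blast
    moreover have "(\<integral>p. u p * pd (\<lambda>p. \<zeta> p * \<phi> p) ?e p \<partial>?M)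
       = (\<integral>p. U0 p * pd \<phi> ?e p \<partial>?M) + (\<integral>p. (u p * pd \<zeta> ?e p) * \<phi> p \<partial>?M)"
      unfolding Bochner_Integration.integral_add[OF i1 i2, symmetric] pd_mult[OF \<zeta>s \<phi>s]
      by (intro Bochner_Integration.integral_cong refl) (simp add: U0_def algebra_simps)
    moreover have "(\<integral>p. W0 p $ i * \<phi> p \<partial>?M) = (\<integral>p. (\<zeta> p * w p $ i) * \<phi> p \<partial>?M) + (\<integral>p. (u p * pd \<zeta> ?e p) * \<phi> p \<partial>?M)"
      unfolding Bochner_Integration.integral_add[OF i3 i2, symmetric]
      by (intro Bochner_Integration.integral_cong refl) (simp add: W0_def Dv_def algebra_simps)
    moreover have "(\<integral>p. (w p $ i) * (\<zeta> p * \<phi> p) \<partial>?M) = (\<integral>p. (\<zeta> p * w p $ i) * \<phi> p \<partial>?M)"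
      by (simp add: mult_ac)
    moreover have "(\<integral>p. U p * pd \<phi> ?e p \<partial>lborel) = (\<integral>p. U0 p * pd \<phi> ?e p \<partial>?M)"
      by (rule trm[OF U(1) U0 U(3) cc_pd[OF \<phi>]])
    moreover have "(\<integral>p. W p $ i * \<phi> p \<partial>lborel) = (\<integral>p. W0 p $ i * \<phi> p \<partial>?M)"
      by (rule trm[OF sqi_nth[OF W(1)] sqi_nth[OF W0] _ cc_test_fn[OF \<phi>]]) (use W(3) in eventually_elim, auto)
    ultimately show "(\<integral>p. U p * pd \<phi> ?e p \<partial>lborel) = - (\<integral>p. W p $ i * \<phi> p \<partial>lborel)" by simp
  next
    fix \<phi> :: "('d, 'd1) pt \<Rightarrow> real" assume \<phi>: "test_fn UNIV \<phi>"
    have \<phi>s: "smooth_fn \<phi>" by (rule test_fn_smooth[OF \<phi>])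
    have t: "test_fn G (\<lambda>p. \<zeta> p * \<phi> p)" by (rule test_fn_mult(1)[OF \<zeta> \<phi>s])
    note cp = cc_test_fn[OF \<phi>] cc_Dv[OF \<phi>] cc_Y[OF \<phi> cont]
    have i1: "integrable ?M (\<lambda>p. U0 p * Y \<alpha> \<phi> p)" by (rule cc_integrable_mult[OF cp(3) G U0])
    have i2: "integrable ?M (\<lambda>p. (Y \<alpha> \<zeta> p * u p) * \<phi> p)"
      by (rule cc_integrable_mult[OF cp(1) G cc_sqi_mult[OF c(3) G sqi(1)]])
    have i3: "integrable ?M (\<lambda>p. F0 p \<bullet> Dv \<phi> p)" by (rule cc_integrable_inner[OF cp(2) G F0])
    have i4: "integrable ?M (\<lambda>p. (F p \<bullet> Dv \<zeta> p) * \<phi> p)"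
      by (rule cc_integrable_mult[OF cp(1) G cc_sqi_inner[OF c(2) G sqi(3)]])
    have i5: "integrable ?M (\<lambda>p. (\<zeta> p * g p) * \<phi> p)"
      by (rule cc_integrable_mult[OF cp(1) G cc_sqi_mult[OF c(1) G sqi(2)]])
    have "transport_pair G \<alpha> u (\<lambda>p. \<zeta> p * \<phi> p) = - ((\<integral>p. U0 p * Y \<alpha> \<phi> p \<partial>?M) + (\<integral>p. (Y \<alpha> \<zeta> p * u p) * \<phi> p \<partial>?M))"
      unfolding Bochner_Integration.integral_add[OF i1 i2, symmetric] transport_pair_def Y_mult[OF \<zeta>s \<phi>s]
      by (intro arg_cong[where f = uminus] Bochner_Integration.integral_cong refl) (simp add: U0_def algebra_simps)
    moreover have "Hm1_pair G F g (\<lambda>p. \<zeta> p * \<phi> p) = - ((\<integral>p. F0 p \<bullet> Dv \<phi> p \<partial>?M) + (\<integral>p. (F p \<bullet> Dv \<zeta> p) * \<phi> p \<partial>?M))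
       + (\<integral>p. (\<zeta> p * g p) * \<phi> p \<partial>?M)"
      unfolding Bochner_Integration.integral_add[OF i3 i4, symmetric] Hm1_pair_def Dv_mult[OF \<zeta>s \<phi>s]
      by (intro arg_cong2[where f = plus] arg_cong[where f = uminus] Bochner_Integration.integral_cong refl)
         (simp_all add: F0_def inner_add_right algebra_simps)
    moreover have "(\<integral>p. g0 p * \<phi> p \<partial>?M) = (\<integral>p. (\<zeta> p * g p) * \<phi> p \<partial>?M) - (\<integral>p. (F p \<bullet> Dv \<zeta> p) * \<phi> p \<partial>?M) + (\<integral>p. (Y \<alpha> \<zeta> p * u p) * \<phi> p \<partial>?M)"
      unfolding Bochner_Integration.integral_diff[OF i5 i4, symmetric]
        Bochner_Integration.integral_add[OF Bochner_Integration.integrable_diff[OF i5 i4] i2, symmetric]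
      by (intro Bochner_Integration.integral_cong refl) (simp add: g0_def algebra_simps)
    moreover note eq[OF t]
    moreover have "(\<integral>p. U p * Y \<alpha> \<phi> p \<partial>lborel) = (\<integral>p. U0 p * Y \<alpha> \<phi> p \<partial>?M)"
      by (rule trm[OF U(1) U0 U(3) cp(3)])
    moreover have "(\<integral>p. F1 p \<bullet> Dv \<phi> p \<partial>lborel) = (\<integral>p. F0 p \<bullet> Dv \<phi> p \<partial>?M)"
      by (rule tri[OF F1(1) F0 F1(3) cp(2)])
    moreover have "(\<integral>p. g1 p * \<phi> p \<partial>lborel) = (\<integral>p. g0 p * \<phi> p \<partial>?M)"
      by (rule trm[OF g1(1) g0 g1(3) cp(1)])
    ultimately show "(\<integral>p. U p * Y \<alpha> \<phi> p \<partial>lborel) = (\<integral>p. F1 p \<bullet> Dv \<phi> p \<partial>lborel) - (\<integral>p. g1 p * \<phi> p \<partial>lborel)"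
      by linarith
  qed
  moreover have "(\<integral>p. F1 p \<bullet> W p \<partial>lborel) = (\<integral>p. F0 p \<bullet> W0 p \<partial>?M)"
  proof (rule integral_borel_representative[OF G])
    show "(\<lambda>p. F1 p \<bullet> W p) \<in> borel_measurable borel" using m by measurable
    show "(\<lambda>p. F0 p \<bullet> W0 p) \<in> borel_measurable ?M" using sqi_inner_integrable[OF F0 W0] by auto
    show "AE p in lebesgue. F1 p \<bullet> W p = (if p \<in> G then F0 p \<bullet> W0 p else 0)"
      using F1(3) W(3) by eventually_elim auto
  qed
  moreover have "(\<integral>p. g1 p * U p \<partial>lborel) = (\<integral>p. g0 p * U0 p \<partial>?M)"
  proof (rule integral_borel_representative[OF G])
    show "(\<lambda>p. g1 p * U p) \<in> borel_measurable borel" using m by measurable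
    show "(\<lambda>p. g0 p * U0 p) \<in> borel_measurable ?M" using sqi_mult_integrable[OF g0 U0] by auto
    show "AE p in lebesgue. g1 p * U p = (if p \<in> G then g0 p * U0 p else 0)"
      using g1(3) U(3) by eventually_elim auto
  qed
  ultimately show ?thesis unfolding F0_def W0_def g0_def U0_def by simp
qed

subsection \<open>The energy inequality on half spaces\<close>

text \<open>In the local identity the cut-off enters as \<zeta>^2 E plus terms with D_v \<zeta> and
  with \<zeta> Y \<zeta>. The first are small in absolute value; for the second an upper bound is
  enough, because it multiplies u^2 and only an inequality is claimed.\<close>

lemma energy_limit:
  fixes u g :: "('d::finite, 'd1::finite) pt \<Rightarrow> real" and F w :: "('d, 'd1) pt \<Rightarrow> real ^ 'd1"
    and \<alpha> :: "real ^ 'd1 \<Rightarrow> real ^ 'd" and \<zeta> :: "nat \<Rightarrow> ('d, 'd1) pt \<Rightarrow> real"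
  assumes G: "G \<in> sets lebesgue" and cont: "continuous_on UNIV \<alpha>"
    and hol: "\<And>v v'. norm (\<alpha> v - \<alpha> v') \<le> K * norm (v - v') powr \<theta>" and \<theta>: "\<theta> > 0" and K: "K \<ge> 0"
    and sqi: "sqi (lebesgue_on G) u" "sqi (lebesgue_on G) g" "sqi (lebesgue_on G) F" "sqi (lebesgue_on G) w"
    and weak: "weak_Dv G u w"
    and eq: "\<And>\<phi>. test_fn G \<phi> \<Longrightarrow> transport_pair G \<alpha> u \<phi> = Hm1_pair G F g \<phi>"
    and \<zeta>: "\<And>n. test_fn G (\<zeta> n)" "\<And>n p. 0 \<le> \<zeta> n p" "\<And>n p. \<zeta> n p \<le> 1"
    and lim: "\<And>p. p \<in> G \<Longrightarrow> (\<lambda>n. \<zeta> n p) \<longlonglongrightarrow> 1"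
    and Dv: "\<And>n p. norm (Dv (\<zeta> n) p) \<le> \<kappa> n" and Y: "\<And>n p. \<zeta> n p * Y \<alpha> (\<zeta> n) p \<le> \<kappa> n"
    and \<kappa>: "\<kappa> \<longlonglongrightarrow> 0"
  shows "(\<integral>p. F p \<bullet> w p - g p * u p \<partial>lebesgue_on G) \<le> 0"
proof -
  let ?M = "lebesgue_on G"
  define E where "E p = F p \<bullet> w p - g p * u p" for p
  have E: "integrable ?M E" unfolding E_def
    by (intro Bochner_Integration.integrable_diff sqi_inner_integrable sqi_mult_integrable sqi)
  have bound: "(\<integral>p. (\<zeta> n p)\<^sup>2 * E p \<partial>?M) \<le> \<kappa> n * (2 * sq ?M u + sq ?M F)" for n
  proof -
    note c = cc_test_fn[OF \<zeta>(1)[of n]] cc_Dv[OF \<zeta>(1)[of n]] cc_Y[OF \<zeta>(1)[of n] cont]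
    have u0: "sqi ?M (\<lambda>p. \<zeta> n p * u p)" by (rule cc_sqi_mult[OF c(1) G sqi(1)])
    define P where "P p = (\<zeta> n p *\<^sub>R F p) \<bullet> (\<zeta> n p *\<^sub>R w p + u p *\<^sub>R Dv (\<zeta> n) p)" for p
    define Q where "Q p = (\<zeta> n p * g p - F p \<bullet> Dv (\<zeta> n) p + u p * Y \<alpha> (\<zeta> n) p) * (\<zeta> n p * u p)" for p
    have P: "integrable ?M P" unfolding P_def
      by (intro sqi_inner_integrable sqi_add cc_sqi_scaleR[OF c(1) G] cc_sqi_scaleR'[OF c(2) G] sqi)
    have Q: "integrable ?M Q" unfolding Q_def
      using cc_sqi_mult[OF c(3) G sqi(1)]
      by (intro sqi_mult_integrable u0 sqi_add sqi_diff cc_sqi_mult[OF c(1) G sqi(2)] cc_sqi_inner[OF c(2) G sqi(3)])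
         (simp add: mult.commute)
    have id: "(\<integral>p. P p - Q p \<partial>?M) = 0"
      using local_energy[OF G cont hol \<theta> K sqi weak eq \<zeta>(1)[of n]] Bochner_Integration.integral_diff[OF P Q]
      unfolding P_def Q_def by simp
    define Z where "Z p = \<kappa> n * (2 * (norm (u p))\<^sup>2 + (norm (F p))\<^sup>2)" for p
    have Z: "integrable ?M Z" unfolding Z_def using sqi(1,3) by (auto simp: sqi_def)
    have le: "(\<zeta> n p)\<^sup>2 * E p \<le> P p - Q p + Z p" for p
    proof -
      have \<kappa>0: "0 \<le> \<kappa> n" using order_trans[OF norm_ge_zero Dv] .
      let ?X = "\<zeta> n p * u p * (F p \<bullet> Dv (\<zeta> n) p)"
      have "P p - Q p = (\<zeta> n p)\<^sup>2 * E p + 2 * ?X - \<zeta> n p * Y \<alpha> (\<zeta> n) p * (u p)\<^sup>2"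
        by (simp add: P_def Q_def E_def inner_add_right power2_eq_square algebra_simps)
      moreover have "\<zeta> n p * Y \<alpha> (\<zeta> n) p * (u p)\<^sup>2 \<le> \<kappa> n * (u p)\<^sup>2" by (intro mult_right_mono Y) simp
      moreover have "- ?X * 2 \<le> \<kappa> n * ((u p)\<^sup>2 + (norm (F p))\<^sup>2)"
      proof -
        have "\<bar>?X\<bar> = \<bar>\<zeta> n p\<bar> * (\<bar>u p\<bar> * \<bar>F p \<bullet> Dv (\<zeta> n) p\<bar>)" by (simp add: abs_mult)
        also have "\<dots> \<le> 1 * (\<bar>u p\<bar> * (norm (F p) * \<kappa> n))"
        proof (intro mult_mono mult_nonneg_nonneg)
          have "\<bar>F p \<bullet> Dv (\<zeta> n) p\<bar> \<le> norm (F p) * norm (Dv (\<zeta> n) p)" by (rule Cauchy_Schwarz_ineq2)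
          also have "\<dots> \<le> norm (F p) * \<kappa> n" by (intro mult_left_mono Dv) simp
          finally show "\<bar>F p \<bullet> Dv (\<zeta> n) p\<bar> \<le> norm (F p) * \<kappa> n" .
        qed (use \<zeta>(2,3)[of n p] \<kappa>0 in auto)
        finally have "2 * \<bar>?X\<bar> \<le> \<kappa> n * (2 * \<bar>u p\<bar> * norm (F p))" by (simp add: mult_ac)
        also have "\<dots> \<le> \<kappa> n * (\<bar>u p\<bar>\<^sup>2 + (norm (F p))\<^sup>2)"
          by (intro mult_left_mono sum_squares_bound \<kappa>0)
        finally have "2 * \<bar>?X\<bar> \<le> \<kappa> n * ((u p)\<^sup>2 + (norm (F p))\<^sup>2)" by simp
        moreover have "- ?X * 2 \<le> 2 * \<bar>?X\<bar>" by linarith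
        ultimately show ?thesis by linarith
      qed
      moreover have "Z p = \<kappa> n * (u p)\<^sup>2 + \<kappa> n * ((u p)\<^sup>2 + (norm (F p))\<^sup>2)"
        by (simp add: Z_def algebra_simps)
      ultimately show ?thesis by linarith
    qed
    have "(\<integral>p. (\<zeta> n p)\<^sup>2 * E p \<partial>?M) \<le> (\<integral>p. P p - Q p + Z p \<partial>?M)"
    proof (rule integral_mono)
      show "integrable ?M (\<lambda>p. (\<zeta> n p)\<^sup>2 * E p)"
      proof (rule Bochner_Integration.integrable_bound[OF E])
        show "(\<lambda>p. (\<zeta> n p)\<^sup>2 * E p) \<in> borel_measurable ?M"
          using sqi_measurable[OF cc_sqi[OF c(1) G]] E by (intro borel_measurable_times borel_measurable_power) auto
        show "AE p in ?M. norm ((\<zeta> n p)\<^sup>2 * E p) \<le> norm (E p)"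
          using \<zeta>(2,3)[of n] by (intro AE_I2) (auto simp: abs_mult power_le_one intro!: mult_left_le_one_le)
      qed
      show "integrable ?M (\<lambda>p. P p - Q p + Z p)" using P Q Z by auto
    qed (rule le)
    also have "\<dots> = (\<integral>p. P p - Q p \<partial>?M) + (\<integral>p. Z p \<partial>?M)"
      by (rule Bochner_Integration.integral_add[OF Bochner_Integration.integrable_diff[OF P Q] Z])
    also have "(\<integral>p. Z p \<partial>?M) = \<kappa> n * (2 * sq ?M u + sq ?M F)"
      unfolding Z_def sq_def using sqi(1,3) by (simp add: sqi_def)
    finally show ?thesis using id by simp
  qed
  have "(\<lambda>n. \<integral>p. (\<zeta> n p)\<^sup>2 * E p \<partial>?M) \<longlonglongrightarrow> (\<integral>p. E p \<partial>?M)"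
  proof (rule integral_dominated_convergence[where w = "\<lambda>p. \<bar>E p\<bar>"])
    show "(\<lambda>p. (\<zeta> n p)\<^sup>2 * E p) \<in> borel_measurable ?M" for n
      using sqi_measurable[OF cc_sqi[OF cc_test_fn[OF \<zeta>(1)] G]] E
      by (intro borel_measurable_times borel_measurable_power) auto
    show "AE p in ?M. (\<lambda>n. (\<zeta> n p)\<^sup>2 * E p) \<longlonglongrightarrow> E p"
    proof (rule AE_I2)
      fix p assume "p \<in> space ?M"
      then have "p \<in> G" by simp
      then have "(\<lambda>n. (\<zeta> n p)\<^sup>2 * E p) \<longlonglongrightarrow> 1\<^sup>2 * E p" by (intro tendsto_intros lim)
      then show "(\<lambda>n. (\<zeta> n p)\<^sup>2 * E p) \<longlonglongrightarrow> E p" by simp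
    qed
    show "AE p in ?M. norm ((\<zeta> n p)\<^sup>2 * E p) \<le> \<bar>E p\<bar>" for n
      using \<zeta>(2,3)[of n] by (intro AE_I2) (auto simp: abs_mult power_le_one intro!: mult_left_le_one_le)
  qed (use E in auto)
  moreover have "(\<lambda>n. \<kappa> n * (2 * sq ?M u + sq ?M F)) \<longlonglongrightarrow> 0 * (2 * sq ?M u + sq ?M F)"
    by (intro tendsto_intros \<kappa>)
  ultimately have "(\<integral>p. E p \<partial>?M) \<le> 0 * (2 * sq ?M u + sq ?M F)"
    by (rule LIMSEQ_le) (use bound in auto)
  then show ?thesis by (simp add: E_def)
qed

text \<open>Spatial cut-offs live on the scale \<open>m\<^sup>2\<close>, velocity and time cut-offs on the scale \<open>m\<close>, because
  \<open>\<alpha>\<close> grows at most linearly.\<close>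

definition rc :: "real \<Rightarrow> ('d::finite, 'd1::finite) pt \<Rightarrow> real" where
  "rc m e = (if fst (snd e) \<noteq> 0 then m\<^sup>2 else m)"

lemma rc_simps [simp]: "rc m (1, 0, 0) = m" "rc m (0, axis k 1, 0) = m\<^sup>2" "rc m (0, 0, axis i 1) = m"
  by (auto simp: rc_def axis_eq_0_iff)

text \<open>Since \<theta> \<le> 1, the Holder bound from the origin is at most linear; this
  controls \<alpha> on the growing velocity support of the cut-offs.\<close>

lemma holder_linear_growth:
  fixes \<alpha> :: "'a::real_normed_vector \<Rightarrow> 'b::real_normed_vector"
  assumes hol: "\<And>v v'. norm (\<alpha> v - \<alpha> v') \<le> K * norm (v - v') powr \<theta>" and \<theta>: "0 < \<theta>" "\<theta> \<le> 1" and K: "K \<ge> 0"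
  shows "norm (\<alpha> v) \<le> norm (\<alpha> 0) + K * (1 + norm v)"
proof -
  have "norm v powr \<theta> \<le> (1 + norm v) powr 1"
  proof -
    have "norm v powr \<theta> \<le> (1 + norm v) powr \<theta>" using \<theta> by (intro powr_mono2) auto
    also have "\<dots> \<le> (1 + norm v) powr 1" using \<theta> by (intro powr_mono) auto
    finally show ?thesis .
  qed
  then have "norm v powr \<theta> \<le> 1 + norm v" by simp
  then have "norm (\<alpha> v - \<alpha> 0) \<le> K * (1 + norm v)"
    using order_trans[OF hol[of v 0] mult_left_mono[OF _ K]] by simp
  then show ?thesis using norm_triangle_sub[of "\<alpha> v" "\<alpha> 0"] by linarith
qed

text \<open>The constant is replaced by its absolute value, because \<open>holder_alpha\<close> does
  not fix its sign; the case v = v' is trivial.\<close>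

lemma holder_alphaE:
  fixes \<alpha> :: "real ^ 'b \<Rightarrow> real ^ 'c"
  assumes "holder_alpha \<alpha>"
  obtains \<theta> K where "0 < \<theta>" "\<theta> \<le> 1" "K \<ge> 0" "\<And>v v'. norm (\<alpha> v - \<alpha> v') \<le> K * norm (v - v') powr \<theta>"
    "continuous_on UNIV \<alpha>"
proof -
  obtain \<theta> K where \<theta>: "0 < \<theta>" "\<theta> \<le> 1" and K: "\<And>v v'. v \<noteq> v' \<Longrightarrow> norm (\<alpha> v - \<alpha> v') \<le> K * norm (v - v') powr \<theta>"
    using assms unfolding holder_alpha_def by blast
  have hol: "norm (\<alpha> v - \<alpha> v') \<le> \<bar>K\<bar> * norm (v - v') powr \<theta>" for v v'
  proof (cases "v = v'")
    case False
    have "K * norm (v - v') powr \<theta> \<le> \<bar>K\<bar> * norm (v - v') powr \<theta>" by (intro mult_right_mono) auto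
    then show ?thesis using K[OF False] by linarith
  qed simp
  have "continuous_on UNIV \<alpha>"
    unfolding continuous_on_def
  proof
    fix v :: "real ^ 'b"
    have "((\<lambda>x. norm (x - v)) \<longlongrightarrow> norm (v - v)) (at v)" by (intro tendsto_intros)
    then have "((\<lambda>x. norm (x - v)) \<longlongrightarrow> 0) (at v)" by simp
    from tendsto_zero_powrI[OF this tendsto_const _ \<theta>(1)]
    have "((\<lambda>x. norm (x - v) powr \<theta>) \<longlongrightarrow> 0) (at v)" by simp
    then have "((\<lambda>x. \<bar>K\<bar> * norm (x - v) powr \<theta>) \<longlongrightarrow> \<bar>K\<bar> * 0) (at v)" by (intro tendsto_intros)
    then have "((\<lambda>x. \<bar>K\<bar> * norm (x - v) powr \<theta>) \<longlongrightarrow> 0) (at v)" by simp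
    then have "((\<lambda>x. \<alpha> x - \<alpha> v) \<longlongrightarrow> 0) (at v)"
      by (intro Lim_null_comparison[of "\<lambda>x. \<alpha> x - \<alpha> v" "\<lambda>x. \<bar>K\<bar> * norm (x - v) powr \<theta>"] always_eventually allI hol)
    then show "(\<alpha> \<longlongrightarrow> \<alpha> v) (at v within UNIV)" by (simp add: LIM_zero_iff)
  qed
  with \<theta> hol that[of \<theta> "\<bar>K\<bar>"] show ?thesis by simp
qed

text \<open>The time factor falls from 1 to 0 just before the level \<open>Tn n\<close>; its
  derivative is of order m but nonpositive, which is why only an upper bound for \<zeta> Y \<zeta>
  is claimed. In the remaining part \<alpha> is of order m on the box and D_x of order m^(-2), so
  every term is of order 1/m.\<close>

lemma cutoffs_HT:
  fixes \<alpha> :: "real ^ 'd1::finite \<Rightarrow> real ^ 'd::finite"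
  assumes cont: "continuous_on UNIV \<alpha>"
    and hol: "\<And>v v'. norm (\<alpha> v - \<alpha> v') \<le> K * norm (v - v') powr \<theta>" and \<theta>: "0 < \<theta>" "\<theta> \<le> 1" and K: "K \<ge> 0"
    and Tn: "\<And>n. ereal (Tn n) < T" "\<And>t. ereal t < T \<Longrightarrow> \<forall>\<^sub>F n in sequentially. 1 \<le> (Tn n - t) * real (Suc n)"
  shows "\<exists>\<zeta> \<kappa>. (\<forall>n. test_fn (HT T :: ('d, 'd1) pt set) (\<zeta> n)) \<and> (\<forall>n p. 0 \<le> \<zeta> n p) \<and> (\<forall>n p. \<zeta> n p \<le> 1)
    \<and> (\<forall>p\<in>HT T. (\<lambda>n. \<zeta> n p) \<longlonglongrightarrow> 1) \<and> (\<forall>n p. norm (Dv (\<zeta> n) p) \<le> \<kappa> n)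
    \<and> (\<forall>n p. \<zeta> n p * Y \<alpha> (\<zeta> n) p \<le> \<kappa> n) \<and> \<kappa> \<longlonglongrightarrow> 0"
proof -
  define m where "m n = real (Suc n)" for n
  have m: "m n \<ge> 1" for n by (simp add: m_def)
  define r :: "nat \<Rightarrow> ('d, 'd1) pt \<Rightarrow> real" where "r n = rc (m n)" for n
  have r: "\<And>e. e \<in> Basis \<Longrightarrow> r n e > 0" for n using m[of n] by (auto simp: r_def rc_def)
  define b where "b n = boxbump (r n)" for n
  \<comment> \<open>That is, \<open>step\<close> at m (Tn n - t): it is 0 from the level
    \<open>Tn n\<close> on, and 1 as long as m (Tn n - t) \<ge> 1.\<close>
  define q where "q n p = step (- (m n * fst p) + m n * Tn n)" for n and p :: "('d, 'd1) pt"
  define \<zeta> where "\<zeta> n p = b n p * q n p" for n p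
  have bl: "bounded_linear (\<lambda>p::('d, 'd1) pt. - (m n * fst p))" for n
    by (intro bounded_linear_minus bounded_linear_const_mult bounded_linear_fst)
  have qs: "smooth_fn (q n)" for n
    unfolding q_def[abs_def] by (rule smooth_fn_affine(1)[OF smooth_fn_step bl])
  have qpd: "pd (q n) h p = - (m n * fst h) * deriv step (- (m n * fst p) + m n * Tn n)" for n h p
    unfolding q_def[abs_def] smooth_fn_affine(2)[OF smooth_fn_step bl] step_pd by simp
  have q01: "0 \<le> q n p" "q n p \<le> 1" for n p by (simp_all add: q_def step_nonneg step_le_1)
  have bs: "smooth_fn (b n)" for n unfolding b_def by (rule smooth_fn_boxbump[where r = "r n", OF r])
  have b01: "0 \<le> b n p" "b n p \<le> 1" for n p
    unfolding b_def using boxbump_nonneg[where r = "r n", OF r] boxbump_le_1[where r = "r n", OF r] by auto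
  have bpd: "\<bar>pd (b n) e p\<bar> \<le> bmpC / r n e" if "e \<in> Basis" for n e p
    unfolding b_def by (rule pd_boxbump[where r = "r n", OF r that])
  have q0: "Dx (q n) p = 0" "Dv (q n) p = 0" "Dt (q n) p \<le> 0" for n p
    using step_deriv_nonneg m[of n] by (auto simp: Dx_def Dv_def Dt_def qpd vec_eq_iff)
  define A0 where "A0 = norm (\<alpha> 0) + K"
  have A0: "A0 \<ge> 0" using K by (simp add: A0_def)
  \<comment> \<open>The three summands bound the time derivative, the drift (linear growth of
    \<alpha> on a box of velocity size 2 m) and the v gradient.\<close>
  define C1 where "C1 = bmpC * (1 + real CARD('d) * (A0 + 2 * K * CARD('d1)) + real CARD('d1))"
  define \<kappa> where "\<kappa> n = C1 / m n" for n
  have s1: "Dv (\<zeta> n) p = q n p *\<^sub>R Dv (b n) p" for n p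
    unfolding \<zeta>_def[abs_def] Dv_mult[OF bs qs] q0 by simp
  have s2: "Y \<alpha> (\<zeta> n) p = q n p * Y \<alpha> (b n) p + b n p * Dt (q n) p" for n p
    unfolding \<zeta>_def[abs_def] Y_mult[OF bs qs] q0 by simp
  have DvB: "norm (Dv (b n) p) \<le> CARD('d1) * (bmpC / m n)" for n p
  proof -
    have "norm (Dv (b n) p) \<le> (\<Sum>i\<in>UNIV. \<bar>Dv (b n) p $ i\<bar>)" by (rule norm_le_l1_cart)
    also have "\<dots> \<le> (\<Sum>i\<in>(UNIV::'d1 set). bmpC / m n)"
      using bpd[OF Basis_pt(3)] by (intro sum_mono) (simp add: Dv_def r_def)
    finally show ?thesis by simp
  qed
  have DxB: "norm (Dx (b n) p) \<le> CARD('d) * (bmpC / (m n)\<^sup>2)" for n p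
  proof -
    have "norm (Dx (b n) p) \<le> (\<Sum>i\<in>UNIV. \<bar>Dx (b n) p $ i\<bar>)" by (rule norm_le_l1_cart)
    also have "\<dots> \<le> (\<Sum>i\<in>(UNIV::'d set). bmpC / (m n)\<^sup>2)"
      using bpd[OF Basis_pt(2)] by (intro sum_mono) (simp add: Dx_def r_def)
    finally show ?thesis by simp
  qed
  have YB: "\<bar>Y \<alpha> (b n) p\<bar> \<le> \<kappa> n" for n p
  proof (cases "p \<in> box_of (\<lambda>e. 2 * r n e)")
    case False
    then have "pd (b n) h p = 0" for h unfolding b_def using pd_boxbump_0[where r = "r n", OF r] by blast
    then show ?thesis using m[of n] A0 K bmpC
      by (simp add: Dt_def Dx_def inner_vec_sum \<kappa>_def C1_def)
  next
    case True
    have "\<bar>snd (snd p) $ i\<bar> \<le> 2 * m n" for i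
      using True[unfolded mem_box_of, rule_format, OF Basis_pt(3)[of i]]
      by (cases p) (simp add: inner_axis r_def)
    then have "(\<Sum>i\<in>UNIV. \<bar>snd (snd p) $ i\<bar>) \<le> (\<Sum>i\<in>(UNIV::'d1 set). 2 * m n)" by (intro sum_mono)
    then have v: "norm (snd (snd p)) \<le> 2 * m n * CARD('d1)"
      using norm_le_l1_cart[of "snd (snd p)"] by (simp add: mult.commute)
    have "norm (\<alpha> (snd (snd p))) \<le> norm (\<alpha> 0) + K * (1 + norm (snd (snd p)))"
      by (rule holder_linear_growth[OF hol \<theta> K])
    also have "\<dots> \<le> norm (\<alpha> 0) + K * (1 + 2 * m n * CARD('d1))"
      using v K by (intro add_left_mono mult_left_mono) auto
    also have "\<dots> = A0 * 1 + (2 * K * CARD('d1)) * m n" by (simp add: A0_def algebra_simps)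
    also have "\<dots> \<le> A0 * m n + (2 * K * CARD('d1)) * m n"
      using A0 m[of n] by (intro add_right_mono mult_left_mono)
    finally have al: "norm (\<alpha> (snd (snd p))) \<le> (A0 + 2 * K * CARD('d1)) * m n" by (simp add: algebra_simps)
    have "\<bar>\<alpha> (snd (snd p)) \<bullet> Dx (b n) p\<bar> \<le> norm (\<alpha> (snd (snd p))) * norm (Dx (b n) p)"
      by (rule Cauchy_Schwarz_ineq2)
    also have "\<dots> \<le> ((A0 + 2 * K * CARD('d1)) * m n) * (CARD('d) * (bmpC / (m n)\<^sup>2))"
      by (intro mult_mono al DxB) (use A0 K m[of n] in auto)
    also have "\<dots> = bmpC * (real CARD('d) * (A0 + 2 * K * CARD('d1))) / m n"
      using m[of n] by (simp add: power2_eq_square)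
    finally have x: "\<bar>\<alpha> (snd (snd p)) \<bullet> Dx (b n) p\<bar> \<le> bmpC * (real CARD('d) * (A0 + 2 * K * CARD('d1))) / m n" .
    have t: "\<bar>Dt (b n) p\<bar> \<le> bmpC * 1 / m n"
      using bpd[OF Basis_pt(1), of n p] by (simp add: Dt_def r_def)
    have "\<bar>Y \<alpha> (b n) p\<bar> \<le> bmpC * 1 / m n + bmpC * (real CARD('d) * (A0 + 2 * K * CARD('d1))) / m n"
      using x t by linarith
    also have "\<dots> = bmpC * (1 + real CARD('d) * (A0 + 2 * K * CARD('d1))) / m n"
      by (simp add: add_divide_distrib distrib_left)
    also have "\<dots> \<le> \<kappa> n"
      unfolding \<kappa>_def C1_def using m[of n] bmpC by (intro divide_right_mono mult_left_mono) auto
    finally show ?thesis .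
  qed
  have "test_fn (HT T) (\<zeta> n)" for n
  proof (rule test_fnI)
    show "smooth_fn (\<zeta> n)" unfolding \<zeta>_def[abs_def] by (intro smooth_fn_mult bs qs)
    show "compact (box_of (\<lambda>e. 2 * r n e) \<inter> {p. fst p \<le> Tn n})"
      by (intro compact_Int_closed compact_box_of closed_Collect_le continuous_intros)
    show "box_of (\<lambda>e. 2 * r n e) \<inter> {p. fst p \<le> Tn n} \<subseteq> HT T"
      using Tn(1)[of n] by (auto simp: HT_def simp flip: ereal_less_eq(3) intro: le_less_trans)
    fix p assume p: "p \<notin> box_of (\<lambda>e. 2 * r n e) \<inter> {p. fst p \<le> Tn n}"
    show "\<zeta> n p = 0"
    proof (cases "p \<in> box_of (\<lambda>e. 2 * r n e)")
      case False
      then have "b n p = 0" unfolding b_def using boxbump_0[where r = "r n", OF r] by blast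
      then show ?thesis by (simp add: \<zeta>_def)
    next
      case True
      then have "m n * Tn n \<le> m n * fst p" using p m[of n] by (intro mult_left_mono) auto
      then have "q n p = 0" unfolding q_def by (intro step_0) simp
      then show ?thesis by (simp add: \<zeta>_def)
    qed
  qed
  moreover have "0 \<le> \<zeta> n p" "\<zeta> n p \<le> 1" for n p
    unfolding \<zeta>_def using b01[of n p] q01[of n p] mult_mono[of "b n p" 1 "q n p" 1] by auto
  moreover have "(\<lambda>n. \<zeta> n p) \<longlonglongrightarrow> 1" if p: "p \<in> HT T" for p
  proof (rule tendsto_eventually)
    have "\<forall>\<^sub>F n in sequentially. norm p \<le> m n"
      using eventually_ge_at_top[of "nat \<lceil>norm p\<rceil>"]
    proof eventually_elim
      case (elim n)
      then show ?case unfolding m_def by linarith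
    qed
    moreover have "\<forall>\<^sub>F n in sequentially. 1 \<le> (Tn n - fst p) * real (Suc n)"
      using p by (intro Tn(2)) (simp add: HT_def)
    ultimately show "\<forall>\<^sub>F n in sequentially. \<zeta> n p = 1"
    proof eventually_elim
      case (elim n)
      have "\<bar>p \<bullet> e\<bar> \<le> r n e" if "e \<in> Basis" for e
      proof -
        have "\<bar>p \<bullet> e\<bar> \<le> m n" using Basis_le_norm[OF that, of p] elim(1) by linarith
        moreover have "m n \<le> (m n)\<^sup>2" using m[of n] by (simp add: power2_eq_square)
        ultimately show ?thesis by (auto simp: r_def rc_def)
      qed
      then have "b n p = 1" unfolding b_def by (intro boxbump_1[where r = "r n", OF r]) (auto simp: mem_box_of)
      moreover have "q n p = 1" unfolding q_def
        by (rule step_1) (use elim(2) in \<open>simp only: m_def[symmetric], simp add: algebra_simps\<close>)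
      ultimately show ?case by (simp add: \<zeta>_def)
    qed
  qed
  moreover have "norm (Dv (\<zeta> n) p) \<le> \<kappa> n" for n p
  proof -
    have "norm (Dv (\<zeta> n) p) = q n p * norm (Dv (b n) p)" using q01[of n p] by (simp add: s1)
    also have "\<dots> \<le> 1 * (CARD('d1) * (bmpC / m n))" by (intro mult_mono DvB q01) auto
    also have "\<dots> = bmpC * real CARD('d1) / m n" by simp
    also have "\<dots> \<le> \<kappa> n" unfolding \<kappa>_def C1_def
      using m[of n] bmpC A0 K by (intro divide_right_mono mult_left_mono) auto
    finally show ?thesis .
  qed
  moreover have "\<zeta> n p * Y \<alpha> (\<zeta> n) p \<le> \<kappa> n" for n p
  proof -
    have "\<zeta> n p * Y \<alpha> (\<zeta> n) p = (\<zeta> n p * q n p) * Y \<alpha> (b n) p + (\<zeta> n p * b n p) * Dt (q n) p"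
      unfolding s2 by (simp add: algebra_simps)
    also have "(\<zeta> n p * b n p) * Dt (q n) p \<le> 0"
      using b01[of n p] q01[of n p] q0(3)[of n p] by (auto simp: \<zeta>_def mult_nonneg_nonpos)
    also have "(\<zeta> n p * q n p) * Y \<alpha> (b n) p \<le> (\<zeta> n p * q n p) * \<bar>Y \<alpha> (b n) p\<bar>"
      using b01[of n p] q01[of n p] by (intro mult_left_mono) (auto simp: \<zeta>_def)
    also have "\<dots> \<le> 1 * \<bar>Y \<alpha> (b n) p\<bar>"
      using b01[of n p] q01[of n p] by (intro mult_right_mono) (auto simp: \<zeta>_def intro!: mult_le_one)
    finally show ?thesis using YB[of n p] by simp
  qed
  moreover have "\<kappa> \<longlonglongrightarrow> 0"
  proof -
    have "(\<lambda>n. C1 * inverse (real (Suc n))) \<longlonglongrightarrow> C1 * 0" by (intro tendsto_intros LIMSEQ_inverse_real_of_nat)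
    then show ?thesis by (simp add: \<kappa>_def[abs_def] m_def divide_inverse)
  qed
  ultimately show ?thesis by (intro exI[of _ \<zeta>] exI[of _ \<kappa>]) blast
qed

text \<open>For finite T the level T - 1/(n+1) gives (Tn n - t)(n+1) = (T - t)(n+1) - 1, which grows
  without bound; for T = \<infinity> the levels n do the same.\<close>

lemma ex_time_levels:
  assumes "T \<noteq> -\<infinity>"
  shows "\<exists>Tn. (\<forall>n. ereal (Tn n) < T) \<and> (\<forall>t. ereal t < T \<longrightarrow> (\<forall>\<^sub>F n in sequentially. 1 \<le> (Tn n - t) * real (Suc n)))"
proof (cases T)
  case (real \<tau>)
  show ?thesis
  proof (intro exI[of _ "\<lambda>n. \<tau> - 1 / real (Suc n)"] conjI allI impI)
    fix t assume "ereal t < T"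
    then have t: "\<tau> - t > 0" by (simp add: real)
    obtain N where N: "2 / (\<tau> - t) < real N" using reals_Archimedean2 by blast
    show "\<forall>\<^sub>F n in sequentially. 1 \<le> (\<tau> - 1 / real (Suc n) - t) * real (Suc n)"
      using eventually_ge_at_top[of N]
    proof eventually_elim
      case (elim n)
      then have "2 / (\<tau> - t) < real (Suc n)" using N by simp
      then have "2 < (\<tau> - t) * real (Suc n)" using t by (simp add: field_simps)
      moreover have "(\<tau> - 1 / real (Suc n) - t) * real (Suc n) = (\<tau> - t) * real (Suc n) - 1"
        by (simp add: field_simps)
      ultimately show ?case by linarith
    qed
  qed (simp add: real)
next
  case PInf
  show ?thesis
  proof (intro exI[of _ "\<lambda>n. real n"] conjI allI impI)
    fix t
    obtain N where N: "t + 1 < real N" using reals_Archimedean2 by blast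
    show "\<forall>\<^sub>F n in sequentially. 1 \<le> (real n - t) * real (Suc n)"
      using eventually_ge_at_top[of N]
    proof eventually_elim
      case (elim n)
      then have "1 * 1 \<le> (real n - t) * real (Suc n)" using N by (intro mult_mono) auto
      then show ?case by simp
    qed
  qed (simp add: PInf)
qed (use assms in simp)

lemma HT_lebesgue [simp]: "HT T \<in> sets lebesgue"
proof -
  have "{p :: ('a, 'b) pt. ereal (fst p) < T} \<in> sets borel"
  proof (cases T)
    case (real \<tau>)
    then show ?thesis by (auto intro!: borel_open open_Collect_less continuous_intros)
  qed auto
  then show ?thesis by (simp add: HT_def)
qed

lemma energy_HT:
  fixes u g :: "('d::finite, 'd1::finite) pt \<Rightarrow> real" and F w :: "('d, 'd1) pt \<Rightarrow> real ^ 'd1"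
    and \<alpha> :: "real ^ 'd1 \<Rightarrow> real ^ 'd"
  assumes hol: "holder_alpha \<alpha>"
    and sqi: "sqi (lebesgue_on (HT T)) u" "sqi (lebesgue_on (HT T)) g" "sqi (lebesgue_on (HT T)) F" "sqi (lebesgue_on (HT T)) w"
    and weak: "weak_Dv (HT T) u w"
    and eq: "\<And>\<phi>. test_fn (HT T) \<phi> \<Longrightarrow> transport_pair (HT T) \<alpha> u \<phi> = Hm1_pair (HT T) F g \<phi>"
  shows "(\<integral>p. F p \<bullet> w p - g p * u p \<partial>lebesgue_on (HT T)) \<le> 0"
proof (cases "T = -\<infinity>")
  \<comment> \<open>No time level lies below -\<infinity>, but the half space is empty then.\<close>
  case True
  have "HT T = ({} :: ('d, 'd1) pt set)" by (simp add: True HT_def)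
  then show ?thesis by simp
next
  case False
  obtain \<theta> K where h: "0 < \<theta>" "\<theta> \<le> 1" "K \<ge> 0" "\<And>v v'. norm (\<alpha> v - \<alpha> v') \<le> K * norm (v - v') powr \<theta>"
    "continuous_on UNIV \<alpha>"
    by (rule holder_alphaE[OF hol]) (rule that)
  obtain Tn where Tn: "\<And>n. ereal (Tn n) < T" "\<And>t. ereal t < T \<Longrightarrow> \<forall>\<^sub>F n in sequentially. 1 \<le> (Tn n - t) * real (Suc n)"
    using ex_time_levels[OF False] by blast
  obtain \<zeta> \<kappa> where c: "\<And>n. test_fn (HT T :: ('d, 'd1) pt set) (\<zeta> n)" "\<And>n p. 0 \<le> \<zeta> n p" "\<And>n p. \<zeta> n p \<le> 1"
    "\<And>p. p \<in> HT T \<Longrightarrow> (\<lambda>n. \<zeta> n p) \<longlonglongrightarrow> 1" "\<And>n p. norm (Dv (\<zeta> n) p) \<le> \<kappa> n"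
    "\<And>n p. \<zeta> n p * Y \<alpha> (\<zeta> n) p \<le> \<kappa> n" "\<kappa> \<longlonglongrightarrow> 0"
    using cutoffs_HT[OF h(5,4,1,2,3) Tn] by blast
  show ?thesis
    by (rule energy_limit[OF HT_lebesgue h(5,4,1,3) sqi weak eq c])
qed

subsection \<open>Integration by parts for test functions\<close>

text \<open>Translation along h preserves both \<open>lborel\<close> and m, so the weighted
  difference quotients of \<psi> integrate to 0, and dominated convergence passes to the derivative.
  The weight is never differentiated, so the components of \<alpha> qualify.\<close>

lemma integral_weight_pd:
  fixes \<psi> m :: "'a::euclidean_space \<Rightarrow> real"
  assumes m: "continuous_on UNIV m" "\<And>p s. m (p + s *\<^sub>R h) = m p" and \<psi>: "test_fn UNIV \<psi>"
  shows "(\<integral>p. m p * pd \<psi> h p \<partial>lborel) = 0"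
proof -
  have \<psi>s: "smooth_fn \<psi>" by (rule test_fn_smooth[OF \<psi>])
  obtain Kc where "smooth_fn \<psi>" and Kc: "compact Kc" "Kc \<subseteq> UNIV" "\<And>p. p \<notin> Kc \<Longrightarrow> \<psi> p = 0"
    using test_fnE[OF \<psi>] by blast
  obtain R where R: "\<And>p. p \<in> Kc \<Longrightarrow> norm p \<le> R" using compact_imp_bounded[OF Kc(1)] by (auto simp: bounded_iff)
  obtain C where C: "C \<ge> 0" "\<And>p. \<bar>pd \<psi> h p\<bar> \<le> C" using test_fn_bounded[OF test_fn_pd[OF \<psi>]] by blast
  have "bounded (m ` cball 0 (R + norm h))"
    by (intro compact_imp_bounded compact_continuous_image continuous_on_subset[OF m(1)]) auto
  then obtain B where B: "\<forall>p\<in>cball 0 (R + norm h). \<bar>m p\<bar> \<le> B" by (auto simp: bounded_iff)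
  define s where "s n = inverse (real (Suc n))" for n
  have s: "0 < s n" "s n \<le> 1" for n by (auto simp: s_def inverse_le_1_iff)
  have s0: "s \<longlonglongrightarrow> 0" unfolding s_def by (rule LIMSEQ_inverse_real_of_nat)
  define q where "q n p = m p * ((\<psi> (p + s n *\<^sub>R h) - \<psi> p) / s n)" for n p
  have cmp: "cc (\<lambda>p. m p * \<psi> p)" by (rule cc_mult(1)[OF cc_test_fn[OF \<psi>] m(1)])
  have [measurable]: "m \<in> borel_measurable borel" "\<psi> \<in> borel_measurable borel" "pd \<psi> h \<in> borel_measurable borel"
    using borel_measurable_continuous_onI[OF m(1)] cc_measurable[OF cc_test_fn[OF \<psi>]]
      cc_measurable[OF cc_pd[OF \<psi>]] by auto
  have t: "smooth_fn (\<lambda>p. \<psi> (p + s n *\<^sub>R h))" for n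
    using smooth_fn_shift(1)[OF \<psi>s, of "- s n *\<^sub>R h"] by simp
  have qi: "(\<integral>p. q n p \<partial>lborel) = 0" for n
  proof -
    have e: "m p * \<psi> (p + s n *\<^sub>R h) = (\<lambda>p. m p * \<psi> p) (p + s n *\<^sub>R h)" for p using m(2) by simp
    have i1: "integrable lborel (\<lambda>p. m p * \<psi> p)" by (rule cc_integrable_lborel[OF cmp])
    have i2: "integrable lborel (\<lambda>p. m p * \<psi> (p + s n *\<^sub>R h))"
    proof -
      have "integrable lborel (\<lambda>p. (\<lambda>x. m (- x) * \<psi> (- x)) ((- s n *\<^sub>R h) - p))"
        by (subst lborel_integrable_reflect)
           (use i1 lborel_integrable_reflect[of "\<lambda>p. m p * \<psi> p" 0] in auto)
      then show ?thesis unfolding e by simp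
    qed
    have "(\<integral>p. q n p \<partial>lborel) = (\<integral>p. (m p * \<psi> (p + s n *\<^sub>R h) - m p * \<psi> p) / s n \<partial>lborel)"
      by (intro Bochner_Integration.integral_cong refl) (simp add: q_def right_diff_distrib)
    also have "\<dots> = ((\<integral>p. m p * \<psi> (p + s n *\<^sub>R h) \<partial>lborel) - (\<integral>p. m p * \<psi> p \<partial>lborel)) / s n"
      using i1 i2 by simp
    also have "(\<integral>p. m p * \<psi> (p + s n *\<^sub>R h) \<partial>lborel) = (\<integral>p. m p * \<psi> p \<partial>lborel)"
      unfolding e by (rule lborel_integral_shift) measurable
    finally show ?thesis by simp
  qed
  have "(\<lambda>n. \<integral>p. q n p \<partial>lborel) \<longlonglongrightarrow> (\<integral>p. m p * pd \<psi> h p \<partial>lborel)"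
  proof (rule integral_dominated_convergence[where w = "\<lambda>p. (B * C) * indicator (cball 0 (R + norm h)) p"])
    show "integrable lborel (\<lambda>p. (B * C) * indicat_real (cball 0 (R + norm h)) (p::'a))"
      by (intro integrable_mult_right integrable_real_indicator[OF _ emeasure_compact_finite]) auto
    show "AE p in lborel. (\<lambda>n. q n p) \<longlonglongrightarrow> m p * pd \<psi> h p"
    proof (rule AE_I2)
      fix p
      have "((\<lambda>s. (\<psi> (p + s *\<^sub>R h) - \<psi> p) / s) \<longlongrightarrow> pd \<psi> h p) (at 0)"
        using pd_line[OF \<psi>s, of p h 0] by (simp add: DERIV_def)
      moreover have "filterlim s (at 0) sequentially"
        unfolding filterlim_at using s0 s(1) by (auto intro!: always_eventually simp: less_imp_neq[symmetric])
      ultimately have "(\<lambda>n. (\<psi> (p + s n *\<^sub>R h) - \<psi> p) / s n) \<longlonglongrightarrow> pd \<psi> h p"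
        by (rule filterlim_compose)
      then show "(\<lambda>n. q n p) \<longlonglongrightarrow> m p * pd \<psi> h p" unfolding q_def by (intro tendsto_intros)
    qed
    show "AE p in lborel. norm (q n p) \<le> (B * C) * indicat_real (cball 0 (R + norm h)) p" for n
    proof (rule AE_I2)
      fix p
      show "norm (q n p) \<le> (B * C) * indicat_real (cball 0 (R + norm h)) p"
      proof (cases "norm p \<le> R + norm h")
        case True
        then have mB: "\<bar>m p\<bar> \<le> B" using B by auto
        \<comment> \<open>The mean value theorem bounds the quotient by the supremum of the
          derivative, uniformly in n.\<close>
        obtain z where "\<psi> (p + s n *\<^sub>R h) - \<psi> (p + 0 *\<^sub>R h) = (s n - 0) * pd \<psi> h (p + z *\<^sub>R h)"
          using MVT2[OF s(1)[of n], of "\<lambda>s. \<psi> (p + s *\<^sub>R h)" "\<lambda>z. pd \<psi> h (p + z *\<^sub>R h)"] pd_line[OF \<psi>s] by blast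
        then have "(\<psi> (p + s n *\<^sub>R h) - \<psi> p) / s n = pd \<psi> h (p + z *\<^sub>R h)" using s(1)[of n] by simp
        then have "norm (q n p) = \<bar>m p\<bar> * \<bar>pd \<psi> h (p + z *\<^sub>R h)\<bar>" by (simp add: q_def abs_mult)
        also have "\<dots> \<le> B * C" by (intro mult_mono mB C) (use mB in auto)
        finally show ?thesis using True by simp
      next
        case False
        then have 1: "p \<notin> Kc" using R[of p] norm_ge_zero[of h] by auto
        have "s n * norm h \<le> norm h" using s[of n] by (intro mult_left_le_one_le) auto
        then have "norm (p + s n *\<^sub>R h) > R"
          using False norm_triangle_ineq4[of "p + s n *\<^sub>R h" "s n *\<^sub>R h"] s[of n] by simp
        then have "p + s n *\<^sub>R h \<notin> Kc" using R[of "p + s n *\<^sub>R h"] by auto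
        then show ?thesis using 1 Kc(3) False by (simp add: q_def)
      qed
    qed
  qed (auto simp: q_def)
  then have "(\<lambda>n::nat. 0) \<longlonglongrightarrow> (\<integral>p. m p * pd \<psi> h p \<partial>lborel)" by (simp add: qi)
  then show ?thesis using LIMSEQ_unique[OF _ tendsto_const] by fastforce
qed

lemma integral_weight_pd_on:
  fixes \<psi> m :: "'a::euclidean_space \<Rightarrow> real"
  assumes m: "continuous_on UNIV m" "\<And>p s. m (p + s *\<^sub>R h) = m p" and \<psi>: "test_fn G \<psi>" and G: "G \<in> sets lebesgue"
  shows "(\<integral>p. m p * pd \<psi> h p \<partial>lebesgue_on G) = 0"
proof -
  have U: "test_fn UNIV \<psi>" by (rule test_fn_mono[OF \<psi>]) simp
  have b: "(\<lambda>p. m p * pd \<psi> h p) \<in> borel_measurable borel"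
    using cc_measurable[OF cc_mult(1)[OF cc_pd[OF U] m(1)]] .
  have "(\<integral>p. m p * pd \<psi> h p \<partial>lborel) = (\<integral>p. m p * pd \<psi> h p \<partial>lebesgue_on G)"
  proof (rule integral_borel_representative[OF G b])
    show "(\<lambda>p. m p * pd \<psi> h p) \<in> borel_measurable (lebesgue_on G)"
      using cc_sqi[OF cc_mult(1)[OF cc_pd[OF U] m(1)] G] by (rule sqi_measurable)
    show "AE p in lebesgue. m p * pd \<psi> h p = (if p \<in> G then m p * pd \<psi> h p else 0)"
      using test_fn_outside[OF test_fn_pd[OF \<psi>]] by (intro AE_I2) auto
  qed
  then show ?thesis using integral_weight_pd[OF m U] by simp
qed

text \<open>\<phi> Y \<phi> is half of Y (\<phi>^2), and each coefficient of the field is constant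
  along its own direction.\<close>

lemma integral_Y_test:
  fixes \<phi> :: "('d::finite, 'd1::finite) pt \<Rightarrow> real"
  assumes \<phi>: "test_fn G \<phi>" and G: "G \<in> sets lebesgue" and cont: "continuous_on UNIV \<alpha>"
  shows "(\<integral>p. \<phi> p * Y \<alpha> \<phi> p \<partial>lebesgue_on G) = 0"
proof -
  have \<phi>s: "smooth_fn \<phi>" by (rule test_fn_smooth[OF \<phi>])
  define \<psi> where "\<psi> p = \<phi> p * \<phi> p" for p
  have \<psi>: "test_fn G \<psi>" unfolding \<psi>_def[abs_def] by (rule test_fn_mult(1)[OF \<phi> \<phi>s])
  let ?al = "\<lambda>k (p::('d, 'd1) pt). \<alpha> (snd (snd p)) $ k"
  have alc: "continuous_on UNIV (?al k)" for k
    by (intro continuous_intros continuous_on_compose2[OF cont]) auto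
  have 0: "(\<integral>p. 1 * pd \<psi> (1, 0, 0) p \<partial>lebesgue_on G) = 0"
    by (rule integral_weight_pd_on[OF _ _ \<psi> G]) auto
  have k: "(\<integral>p. ?al k p * pd \<psi> (0, axis k 1, 0) p \<partial>lebesgue_on G) = 0" for k
    by (rule integral_weight_pd_on[OF alc _ \<psi> G]) auto
  have i0: "integrable (lebesgue_on G) (\<lambda>p. 1 * pd \<psi> (1, 0, 0) p)"
    and ik: "integrable (lebesgue_on G) (\<lambda>p. ?al k p * pd \<psi> (0, axis k 1, 0) p)" for k
  proof -
    have I: "integrable (lebesgue_on G) (\<lambda>p. m p * pd \<psi> h p)" if "continuous_on UNIV m" for m h
    proof -
      have "cc (\<lambda>p. m p * pd \<psi> h p)" by (rule cc_mult(1)[OF cc_pd[OF \<psi>] that])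
      then have "integrable lebesgue (\<lambda>p. m p * pd \<psi> h p)"
        using cc_integrable_lborel[of "\<lambda>p. m p * pd \<psi> h p"] cc_measurable[of "\<lambda>p. m p * pd \<psi> h p"]
        by (simp add: integrable_completion)
      then show ?thesis
        using integrable_lebesgue_on_subset[of G UNIV] G by (simp add: lebesgue_on_UNIV_eq)
    qed
    show "integrable (lebesgue_on G) (\<lambda>p. 1 * pd \<psi> (1, 0, 0) p)"
      "integrable (lebesgue_on G) (\<lambda>p. ?al k p * pd \<psi> (0, axis k 1, 0) p)"
      by (rule I, simp) (rule I[OF alc])
  qed
  have "(\<integral>p. 2 * (\<phi> p * Y \<alpha> \<phi> p) \<partial>lebesgue_on G)
     = (\<integral>p. 1 * pd \<psi> (1, 0, 0) p + (\<Sum>k\<in>UNIV. ?al k p * pd \<psi> (0, axis k 1, 0) p) \<partial>lebesgue_on G)"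
    by (intro Bochner_Integration.integral_cong refl)
       (simp add: \<psi>_def[abs_def] pd_mult[OF \<phi>s \<phi>s] Dt_def Dx_def inner_vec_sum algebra_simps sum_distrib_left sum.distrib[symmetric])
  also have "\<dots> = 0"
    by (subst Bochner_Integration.integral_add[OF i0 Bochner_Integration.integrable_sum[OF ik]])
       (simp only: 0 k Bochner_Integration.integral_sum[OF ik], simp)
  finally show ?thesis by simp
qed

subsection \<open>The equation as a transport identity\<close>

lemma vec_measurable:
  fixes f :: "'a \<Rightarrow> real ^ 'n"
  assumes "\<And>i. (\<lambda>x. f x $ i) \<in> borel_measurable M"
  shows "f \<in> borel_measurable M"
proof -
  have "f = (\<lambda>x. \<Sum>i\<in>UNIV. (f x $ i) *\<^sub>R axis i 1)"
    by (simp add: fun_eq_iff vec_eq_iff axis_def if_distrib cong: if_cong)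
  moreover have "(\<lambda>x. \<Sum>i\<in>UNIV. (f x $ i) *\<^sub>R (axis i 1 :: real ^ 'n)) \<in> borel_measurable M"
    using assms by measurable
  ultimately show ?thesis by simp
qed

context
  fixes \<delta> L :: real and a :: "('d::finite, 'd1::finite) pt \<Rightarrow> real ^ 'd1 ^ 'd1" and b bb c
  assumes \<delta>: "0 < \<delta>" and co: "coeff_hyp \<delta> L a b bb c"
begin

lemma coeff_bounds:
  shows ell: "\<delta> * (norm \<xi>)\<^sup>2 \<le> \<xi> \<bullet> (a p *v \<xi>)" and abd: "\<bar>a p $ i $ j\<bar> \<le> 1 / \<delta>"
    and bbd: "norm (b p) \<le> L" "norm (bb p) \<le> L" "\<bar>c p\<bar> \<le> L" "norm (b p - bb p) \<le> L" and L0: "L \<ge> 0"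
proof -
  have s: "norm (b p) + norm (bb p) + \<bar>c p\<bar> \<le> L" for p using co unfolding coeff_hyp_def by blast
  show "norm (b p) \<le> L" "norm (bb p) \<le> L" "\<bar>c p\<bar> \<le> L" "L \<ge> 0"
    using s[of p] norm_ge_zero[of "b p"] norm_ge_zero[of "bb p"] by linarith+
  show "norm (b p - bb p) \<le> L" using s[of p] norm_triangle_ineq4[of "b p" "bb p"] by linarith
qed (use co in \<open>unfold coeff_hyp_def, blast+\<close>)

lemma coeff_measurable:
  shows "(\<lambda>p. a p $ i $ j) \<in> borel_measurable (lebesgue_on G)" "b \<in> borel_measurable (lebesgue_on G)"
    "bb \<in> borel_measurable (lebesgue_on G)" "c \<in> borel_measurable (lebesgue_on G)"
proof -
  have "(\<lambda>p. a p $ i) \<in> borel_measurable lebesgue"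
    by (rule borel_measurable_continuous_on[where f = "\<lambda>v. v $ i"]) (use co in \<open>auto simp: coeff_hyp_def intro!: continuous_intros\<close>)
  then have "(\<lambda>p. a p $ i $ j) \<in> borel_measurable lebesgue" by (rule borel_measurable_vec_nth)
  then show "(\<lambda>p. a p $ i $ j) \<in> borel_measurable (lebesgue_on G)" by (rule measurable_restrict_space1)
qed (use co in \<open>auto simp: coeff_hyp_def intro: measurable_restrict_space1\<close>)

text \<open>A crude constant from bounding every entry of the matrix by 1/\<delta>; it only secures
  integrability and never reaches the estimates of the theorem.\<close>

lemma matvec_bound:
  assumes "\<And>i. \<bar>x $ i\<bar> \<le> (\<Sum>j\<in>UNIV. \<bar>y $ j\<bar> / \<delta>)"
  shows "norm (x :: real ^ 'd1) \<le> (CARD('d1) * CARD('d1) / \<delta>) * norm (y :: real ^ 'd1)"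
proof -
  have "\<bar>x $ i\<bar> \<le> CARD('d1) / \<delta> * norm y" for i
  proof -
    have "(\<Sum>j\<in>UNIV. \<bar>y $ j\<bar> / \<delta>) \<le> (\<Sum>j\<in>(UNIV::'d1 set). norm y / \<delta>)"
      using \<delta> by (intro sum_mono divide_right_mono component_le_norm_cart) auto
    then show ?thesis using assms[of i] by simp
  qed
  then have "(\<Sum>i\<in>UNIV. \<bar>x $ i\<bar>) \<le> (\<Sum>i\<in>(UNIV::'d1 set). CARD('d1) / \<delta> * norm y)" by (intro sum_mono)
  then show ?thesis using norm_le_l1_cart[of x] by simp
qed

lemma sqi_matvec:
  assumes w: "sqi (lebesgue_on G) w"
  shows "sqi (lebesgue_on G) (\<lambda>p. a p *v w p)" "sqi (lebesgue_on G) (\<lambda>p. w p v* a p)"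
proof -
  have m: "(\<lambda>x. w x $ i) \<in> borel_measurable (lebesgue_on G)" for i
    by (rule borel_measurable_vec_nth[OF sqi_measurable[OF w]])
  have t: "\<bar>\<Sum>j\<in>UNIV. A j * y $ j\<bar> \<le> (\<Sum>j\<in>UNIV. \<bar>y $ j\<bar> / \<delta>)" if "\<And>j. \<bar>A j\<bar> \<le> 1 / \<delta>" for A and y :: "real ^ 'd1"
  proof -
    have "\<bar>\<Sum>j\<in>UNIV. A j * y $ j\<bar> \<le> (\<Sum>j\<in>UNIV. \<bar>A j\<bar> * \<bar>y $ j\<bar>)"
      unfolding abs_mult[symmetric] by (rule sum_abs)
    also have "\<dots> \<le> (\<Sum>j\<in>UNIV. 1 / \<delta> * \<bar>y $ j\<bar>)" by (intro sum_mono mult_right_mono that) auto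
    finally show ?thesis by simp
  qed
  have t': "\<bar>\<Sum>j\<in>UNIV. y $ j * A j\<bar> \<le> (\<Sum>j\<in>UNIV. \<bar>y $ j\<bar> / \<delta>)" if "\<And>j. \<bar>A j\<bar> \<le> 1 / \<delta>" for A and y :: "real ^ 'd1"
    using t[of A y, OF that] by (simp only: mult.commute)
  show "sqi (lebesgue_on G) (\<lambda>p. a p *v w p)"
  proof (rule sqi_dominated[OF w, where C = "CARD('d1) * CARD('d1) / \<delta>"])
    show "(\<lambda>p. a p *v w p) \<in> borel_measurable (lebesgue_on G)"
      by (intro vec_measurable) (simp add: matrix_vector_mult_def, intro borel_measurable_sum borel_measurable_times coeff_measurable m)
    show "norm (a p *v w p) \<le> CARD('d1) * CARD('d1) / \<delta> * norm (w p)" for p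
      by (intro matvec_bound) (simp add: matrix_vector_mult_def t abd)
  qed
  show "sqi (lebesgue_on G) (\<lambda>p. w p v* a p)"
  proof (rule sqi_dominated[OF w, where C = "CARD('d1) * CARD('d1) / \<delta>"])
    show "(\<lambda>p. w p v* a p) \<in> borel_measurable (lebesgue_on G)"
      by (intro vec_measurable) (simp add: vector_matrix_mult_def, intro borel_measurable_sum borel_measurable_times coeff_measurable m)
    show "norm (w p v* a p) \<le> CARD('d1) * CARD('d1) / \<delta> * norm (w p)" for p
      by (intro matvec_bound) (simp add: vector_matrix_mult_def t' abd)
  qed
qed

lemma sqi_lower_order:
  assumes u: "sqi (lebesgue_on G) u" and w: "sqi (lebesgue_on G) w"
  shows "sqi (lebesgue_on G) (\<lambda>p. u p *\<^sub>R bb p)" "sqi (lebesgue_on G) (\<lambda>p. u p *\<^sub>R b p)"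
    "sqi (lebesgue_on G) (\<lambda>p. b p \<bullet> w p)" "sqi (lebesgue_on G) (\<lambda>p. bb p \<bullet> w p)"
    "sqi (lebesgue_on G) (\<lambda>p. (c p + lam) * u p)"
proof -
  note m = sqi_measurable[OF u] sqi_measurable[OF w] coeff_measurable(2-4)
  show "sqi (lebesgue_on G) (\<lambda>p. u p *\<^sub>R bb p)" "sqi (lebesgue_on G) (\<lambda>p. u p *\<^sub>R b p)"
    by (rule sqi_dominated[OF u, where C = L], use m in simp,
        use bbd in \<open>simp add: mult.commute[of L] mult_left_mono\<close>)+
  have i: "\<bar>v \<bullet> x\<bar> \<le> L * norm x" if "norm v \<le> L" for v x :: "real ^ 'd1"
    using Cauchy_Schwarz_ineq2[of v x] mult_right_mono[OF that norm_ge_zero[of x]] by linarith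
  show "sqi (lebesgue_on G) (\<lambda>p. b p \<bullet> w p)" "sqi (lebesgue_on G) (\<lambda>p. bb p \<bullet> w p)"
    by (rule sqi_dominated[OF w, where C = L], use m in simp, use i bbd in simp)+
  show "sqi (lebesgue_on G) (\<lambda>p. (c p + lam) * u p)"
  proof (rule sqi_dominated[OF u, where C = "L + \<bar>lam\<bar>"])
    show "(\<lambda>p. (c p + lam) * u p) \<in> borel_measurable (lebesgue_on G)" using m by simp
    have "\<bar>c p + lam\<bar> \<le> L + \<bar>lam\<bar>" for p using bbd(3)[of p] by linarith
    then show "norm ((c p + lam) * u p) \<le> (L + \<bar>lam\<bar>) * norm (u p)" for p
      unfolding real_norm_def abs_mult by (intro mult_right_mono) auto
  qed
qed

text \<open>With every term but the transport moved to the right, the equation says that the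
  transport of u is div_v of \<open>flux\<close> plus \<open>source\<close>, the form to which the
  energy inequality applies.\<close>

abbreviation "flux f u w p \<equiv> a p *v w p - u p *\<^sub>R bb p + f p"
abbreviation "source lam g u w p \<equiv> g p - b p \<bullet> w p - (c p + lam) * u p"

lemma sqi_flux_source:
  assumes "sqi (lebesgue_on G) u" "sqi (lebesgue_on G) w" "sqi (lebesgue_on G) f" "sqi (lebesgue_on G) g"
  shows "sqi (lebesgue_on G) (flux f u w)" "sqi (lebesgue_on G) (source lam g u w)"
  by (intro sqi_add sqi_diff sqi_matvec sqi_lower_order[OF assms(1,2)] assms)+

lemma eq_holds_iff:
  assumes G: "G \<in> sets lebesgue" and u: "sqi (lebesgue_on G) u" and w: "sqi (lebesgue_on G) w"
    and f: "sqi (lebesgue_on G) f" and g: "sqi (lebesgue_on G) g"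
  shows "eq_holds G \<alpha> a b bb c lam f g u w
    \<longleftrightarrow> (\<forall>\<phi>. test_fn G \<phi> \<longrightarrow> transport_pair G \<alpha> u \<phi> = Hm1_pair G (flux f u w) (source lam g u w) \<phi>)"
proof -
  have *: "Hm1_pair G (flux f u w) (source lam g u w) \<phi> = Hm1_pair G f g \<phi>
      - (\<integral>p. (a p *v w p) \<bullet> Dv \<phi> p \<partial>(lebesgue_on G))
      + (\<integral>p. u p * (bb p \<bullet> Dv \<phi> p) \<partial>(lebesgue_on G))
      - (\<integral>p. ((b p \<bullet> w p) + (c p + lam) * u p) * \<phi> p \<partial>(lebesgue_on G))" if \<phi>: "test_fn G \<phi>" for \<phi>
  proof -
    let ?M = "lebesgue_on G"
    note cp = cc_test_fn[OF \<phi>] cc_Dv[OF \<phi>]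
    have i1: "integrable ?M (\<lambda>p. (a p *v w p) \<bullet> Dv \<phi> p)" by (rule cc_integrable_inner[OF cp(2) G sqi_matvec(1)[OF w]])
    have i2: "integrable ?M (\<lambda>p. (u p *\<^sub>R bb p) \<bullet> Dv \<phi> p)"
      by (rule cc_integrable_inner[OF cp(2) G sqi_lower_order(1)[OF u w]])
    have i3: "integrable ?M (\<lambda>p. f p \<bullet> Dv \<phi> p)" by (rule cc_integrable_inner[OF cp(2) G f])
    have i4: "integrable ?M (\<lambda>p. g p * \<phi> p)" by (rule cc_integrable_mult[OF cp(1) G g])
    have i5: "integrable ?M (\<lambda>p. ((b p \<bullet> w p) + (c p + lam) * u p) * \<phi> p)"
      by (rule cc_integrable_mult[OF cp(1) G sqi_add[OF sqi_lower_order(3,5)[OF u w]]])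
    have "(\<integral>p. flux f u w p \<bullet> Dv \<phi> p \<partial>?M) = (\<integral>p. (a p *v w p) \<bullet> Dv \<phi> p \<partial>?M) - (\<integral>p. (u p *\<^sub>R bb p) \<bullet> Dv \<phi> p \<partial>?M) + (\<integral>p. f p \<bullet> Dv \<phi> p \<partial>?M)"
      unfolding Bochner_Integration.integral_diff[OF i1 i2, symmetric]
        Bochner_Integration.integral_add[OF Bochner_Integration.integrable_diff[OF i1 i2] i3, symmetric]
      by (intro Bochner_Integration.integral_cong refl) (simp add: inner_add_left inner_diff_left)
    moreover have "(\<integral>p. source lam g u w p * \<phi> p \<partial>?M) = (\<integral>p. g p * \<phi> p \<partial>?M) - (\<integral>p. ((b p \<bullet> w p) + (c p + lam) * u p) * \<phi> p \<partial>?M)"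
      unfolding Bochner_Integration.integral_diff[OF i4 i5, symmetric]
      by (intro Bochner_Integration.integral_cong refl) (simp add: algebra_simps)
    ultimately show ?thesis by (simp add: Hm1_pair_def)
  qed
  have arith: "(t + x - y + z = h) \<longleftrightarrow> t = h - x + y - z" for t x y z h :: real by linarith
  show ?thesis unfolding eq_holds_def arith by (auto simp only: *)
qed

end

subsection \<open>Linearity\<close>

lemma pd_lin: "smooth_fn \<phi> \<Longrightarrow> smooth_fn \<psi> \<Longrightarrow> pd (\<lambda>p. \<phi> p + s * \<psi> p) h p = pd \<phi> h p + s * pd \<psi> h p"
  by (subst pd_add) (auto intro: smooth_fn_cmult simp: pd_cmult)

lemma Dv_lin: "smooth_fn \<phi> \<Longrightarrow> smooth_fn \<psi> \<Longrightarrow> Dv (\<lambda>p. \<phi> p + s * \<psi> p) p = Dv \<phi> p + s *\<^sub>R Dv \<psi> p"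
  by (simp add: Dv_def vec_eq_iff pd_lin)

lemma Y_lin: "smooth_fn \<phi> \<Longrightarrow> smooth_fn \<psi> \<Longrightarrow> Y \<alpha> (\<lambda>p. \<phi> p + s * \<psi> p) p = Y \<alpha> \<phi> p + s * Y \<alpha> \<psi> p"
proof -
  assume a: "smooth_fn \<phi>" "smooth_fn \<psi>"
  have "Dx (\<lambda>p. \<phi> p + s * \<psi> p) p = Dx \<phi> p + s *\<^sub>R Dx \<psi> p"
    using a by (simp add: Dx_def vec_eq_iff pd_lin)
  moreover have "Dt (\<lambda>p. \<phi> p + s * \<psi> p) p = Dt \<phi> p + s * Dt \<psi> p" using a by (simp add: Dt_def pd_lin)
  ultimately show ?thesis by (simp add: inner_add_right algebra_simps)
qed

lemma test_fn_lin: "test_fn G \<phi> \<Longrightarrow> test_fn G \<psi> \<Longrightarrow> test_fn G (\<lambda>p. \<phi> p + s * \<psi> p)"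
  by (intro test_fn_add test_fn_mult(2) smooth_fn_const)

lemma Hm1_pair_lin:
  assumes "G \<in> sets lebesgue" "sqi (lebesgue_on G) F" "sqi (lebesgue_on G) g" "test_fn G \<phi>" "test_fn G \<psi>"
  shows "Hm1_pair G F g (\<lambda>p. \<phi> p + s * \<psi> p) = Hm1_pair G F g \<phi> + s * Hm1_pair G F g \<psi>"
proof -
  have s: "smooth_fn \<phi>" "smooth_fn \<psi>" using assms test_fn_smooth by blast+
  have i: "integrable (lebesgue_on G) (\<lambda>p. F p \<bullet> Dv \<phi> p)" "integrable (lebesgue_on G) (\<lambda>p. g p * \<phi> p)"
    if "test_fn G \<phi>" for \<phi>
    using cc_integrable_inner[OF cc_Dv[OF that] assms(1,2)] cc_integrable_mult[OF cc_test_fn[OF that] assms(1,3)] by auto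
  show ?thesis
    unfolding Hm1_pair_def Dv_lin[OF s]
    using i[OF assms(4)] i[OF assms(5)] by (simp add: inner_add_right distrib_left mult.left_commute algebra_simps)
qed

lemma Hm1_pair_diff:
  assumes "G \<in> sets lebesgue" "sqi (lebesgue_on G) F" "sqi (lebesgue_on G) g"
    "sqi (lebesgue_on G) F'" "sqi (lebesgue_on G) g'" "test_fn G \<phi>"
  shows "Hm1_pair G (\<lambda>p. F p - F' p) (\<lambda>p. g p - g' p) \<phi> = Hm1_pair G F g \<phi> - Hm1_pair G F' g' \<phi>"
proof -
  note i = cc_integrable_inner[OF cc_Dv[OF assms(6)] assms(1)] cc_integrable_mult[OF cc_test_fn[OF assms(6)] assms(1)]
  show ?thesis
    unfolding Hm1_pair_def inner_diff_left left_diff_distrib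
    using i(1)[OF assms(2)] i(1)[OF assms(4)] i(2)[OF assms(3)] i(2)[OF assms(5)] by simp
qed

lemma transport_pair_diff:
  assumes "G \<in> sets lebesgue" "continuous_on UNIV \<alpha>" "sqi (lebesgue_on G) u" "sqi (lebesgue_on G) u'" "test_fn G \<phi>"
  shows "transport_pair G \<alpha> (\<lambda>p. u p - u' p) \<phi> = transport_pair G \<alpha> u \<phi> - transport_pair G \<alpha> u' \<phi>"
  using Bochner_Integration.integral_diff[OF cc_integrable_mult[OF cc_Y[OF assms(5,2)] assms(1,3)]
      cc_integrable_mult[OF cc_Y[OF assms(5,2)] assms(1,4)]]
  unfolding transport_pair_def left_diff_distrib by simp

lemma weak_Dv_diff:
  assumes "G \<in> sets lebesgue" "sqi (lebesgue_on G) u" "sqi (lebesgue_on G) w" "sqi (lebesgue_on G) u'"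
    "sqi (lebesgue_on G) w'" "weak_Dv G u w" "weak_Dv G u' w'"
  shows "weak_Dv G (\<lambda>p. u p - u' p) (\<lambda>p. w p - w' p)"
  unfolding weak_Dv_def
proof (intro allI impI)
  fix \<phi> i assume \<phi>: "test_fn G \<phi>"
  note 1 = cc_integrable_mult[OF cc_pd[OF \<phi>] assms(1)] and 2 = cc_integrable_mult[OF cc_test_fn[OF \<phi>] assms(1)]
  show "(\<integral>p. (u p - u' p) * pd \<phi> (0, 0, axis i 1) p \<partial>lebesgue_on G) = - (\<integral>p. (w p - w' p) $ i * \<phi> p \<partial>lebesgue_on G)"
    unfolding left_diff_distrib vector_minus_component
    using 1[OF assms(2)] 1[OF assms(4)] 2[OF sqi_nth[OF assms(3)]] 2[OF sqi_nth[OF assms(5)]]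
      assms(6,7) \<phi> unfolding weak_Dv_def by simp
qed

text \<open>Completing the square. The factor \<delta> / 4 allows two such terms to be absorbed
  while half of the ellipticity remains.\<close>

lemma young:
  fixes x y L \<delta> :: real
  assumes "\<delta> > 0"
  shows "L * x * y \<le> L\<^sup>2 / \<delta> * x\<^sup>2 + \<delta> / 4 * y\<^sup>2"
proof -
  have "0 \<le> (2 * L * x - \<delta> * y)\<^sup>2 / (4 * \<delta>)" using assms by simp
  also have "\<dots> = L\<^sup>2 / \<delta> * x\<^sup>2 + \<delta> / 4 * y\<^sup>2 - L * x * y"
    using assms by (simp add: power2_eq_square field_simps)
  finally show ?thesis by simp
qed

subsection \<open>The whole half space\<close>

context
  fixes \<delta> L :: real and a :: "('d::finite, 'd1::finite) pt \<Rightarrow> real ^ 'd1 ^ 'd1" and b bb c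
  assumes \<delta>: "0 < \<delta>" and co: "coeff_hyp \<delta> L a b bb c"
begin

lemmas coeffs = coeff_bounds[OF \<delta> co]

text \<open>The second claim absorbs the lower order terms into a quarter of \<open>lam\<close>; the
  third makes the zeroth order part of the adjoint form positive in the existence proof.\<close>

lemma lam_props:
  assumes "lam \<ge> 4 * (L\<^sup>2 / \<delta> + L) + 1"
  shows "0 < lam" "L\<^sup>2 / \<delta> + L \<le> lam / 4" "0 < lam - L - L\<^sup>2 / \<delta>"
proof -
  define q where "q = L\<^sup>2 / \<delta>"
  have "0 \<le> q" using \<delta> by (simp add: q_def)
  moreover have "4 * q + 4 * L + 1 \<le> lam" using assms by (simp add: q_def distrib_left)
  ultimately show "0 < lam" "L\<^sup>2 / \<delta> + L \<le> lam / 4" "0 < lam - L - L\<^sup>2 / \<delta>"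
    unfolding q_def[symmetric] using coeffs(7) by simp_all
qed

lemma eq_holds_diff:
  assumes G: "G \<in> sets lebesgue" and cont: "continuous_on UNIV \<alpha>"
    and s: "sqi (lebesgue_on G) u" "sqi (lebesgue_on G) w" "sqi (lebesgue_on G) f" "sqi (lebesgue_on G) g"
    and s': "sqi (lebesgue_on G) u'" "sqi (lebesgue_on G) w'" "sqi (lebesgue_on G) f'" "sqi (lebesgue_on G) g'"
    and e: "eq_holds G \<alpha> a b bb c lam f g u w" "eq_holds G \<alpha> a b bb c lam f' g' u' w'"
  shows "eq_holds G \<alpha> a b bb c lam (\<lambda>p. f p - f' p) (\<lambda>p. g p - g' p) (\<lambda>p. u p - u' p) (\<lambda>p. w p - w' p)"
proof -
  note iff = eq_holds_iff[OF \<delta> co G]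
  note fs = sqi_flux_source[OF \<delta> co s(1,2,3,4)] and fs' = sqi_flux_source[OF \<delta> co s'(1,2,3,4)]
  have F: "a p *v (w p - w' p) - (u p - u' p) *\<^sub>R bb p + (f p - f' p)
     = (a p *v w p - u p *\<^sub>R bb p + f p) - (a p *v w' p - u' p *\<^sub>R bb p + f' p)" for p
    by (simp add: matrix_vector_mult_diff_distrib scaleR_diff_left)
  have S: "g p - g' p - b p \<bullet> (w p - w' p) - (c p + lam) * (u p - u' p)
     = (g p - b p \<bullet> w p - (c p + lam) * u p) - (g' p - b p \<bullet> w' p - (c p + lam) * u' p)" for p
    by (simp add: inner_diff_right algebra_simps)
  show ?thesis
    unfolding iff[OF sqi_diff[OF s(1) s'(1)] sqi_diff[OF s(2) s'(2)] sqi_diff[OF s(3) s'(3)] sqi_diff[OF s(4) s'(4)]] F S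
    using e[unfolded iff[OF s] iff[OF s']]
    by (auto simp only: transport_pair_diff[OF G cont s(1) s'(1)] Hm1_pair_diff[OF G fs fs'])
qed

text \<open>The pointwise inequality \<open>D p \<le> E p\<close> is integrated and combined with
  the energy inequality. The drift and f use \<delta> / 4 each of the ellipticity; g uses lam / 4,
  and L^2 / \<delta> + L, which collects the rest of the drift and c, uses another lam / 4. Half of
  each remains.\<close>

lemma energy_estimate:
  assumes hol: "holder_alpha \<alpha>" and lam: "lam \<ge> 4 * (L\<^sup>2 / \<delta> + L) + 1"
    and u: "sqi (lebesgue_on (HT T)) u" and w: "sqi (lebesgue_on (HT T)) w"
    and f: "sqi (lebesgue_on (HT T)) f" and g: "sqi (lebesgue_on (HT T)) g"
    and weak: "weak_Dv (HT T) u w" and eq: "eq_holds (HT T) \<alpha> a b bb c lam f g u w"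
  shows "\<delta> / 2 * sq (lebesgue_on (HT T)) w + lam / 2 * sq (lebesgue_on (HT T)) u
     \<le> sq (lebesgue_on (HT T)) f / \<delta> + sq (lebesgue_on (HT T)) g / lam"
proof -
  let ?M = "lebesgue_on (HT T) :: ('d, 'd1) pt measure"
  note lam0 = lam_props(1,2)[OF lam]
  have le: "(\<integral>p. (a p *v w p - u p *\<^sub>R bb p + f p) \<bullet> w p - (g p - b p \<bullet> w p - (c p + lam) * u p) * u p \<partial>?M) \<le> 0"
    using eq unfolding eq_holds_iff[OF \<delta> co HT_lebesgue u w f g]
    by (intro energy_HT[OF hol u _ _ w weak] sqi_flux_source[OF \<delta> co u w f g]) auto
  define E where "E p = (a p *v w p - u p *\<^sub>R bb p + f p) \<bullet> w p - (g p - b p \<bullet> w p - (c p + lam) * u p) * u p" for p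
  have E: "integrable ?M E" unfolding E_def
    by (intro Bochner_Integration.integrable_diff sqi_inner_integrable sqi_mult_integrable sqi_flux_source[OF \<delta> co u w f g] u w)
  define D where "D p = \<delta> / 2 * (norm (w p))\<^sup>2 + lam / 2 * (norm (u p))\<^sup>2 - (norm (f p))\<^sup>2 / \<delta> - (norm (g p))\<^sup>2 / lam" for p
  have D: "integrable ?M D" unfolding D_def using u w f g by (auto simp: sqi_def)
  have "D p \<le> E p" for p
  proof -
    let ?u = "\<bar>u p\<bar>" and ?w = "norm (w p)"
    \<comment> \<open>The two drift terms meet only in the difference b - bb: one enters through the
      source, the other through the flux.\<close>
    have "E p = w p \<bullet> (a p *v w p) + u p * ((b p - bb p) \<bullet> w p) + f p \<bullet> w p - g p * u p + c p * (u p)\<^sup>2 + lam * (u p)\<^sup>2"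
      by (simp add: E_def inner_add_left inner_diff_left inner_commute power2_eq_square algebra_simps)
    moreover have "\<delta> * ?w\<^sup>2 \<le> w p \<bullet> (a p *v w p)" by (rule coeffs(1))
    moreover have "- (L\<^sup>2 / \<delta> * ?u\<^sup>2 + \<delta> / 4 * ?w\<^sup>2) \<le> u p * ((b p - bb p) \<bullet> w p)"
    proof -
      have "\<bar>u p * ((b p - bb p) \<bullet> w p)\<bar> \<le> ?u * (L * ?w)"
        unfolding abs_mult
        by (intro mult_left_mono order_trans[OF Cauchy_Schwarz_ineq2] mult_right_mono coeffs) auto
      then show ?thesis using young[OF \<delta>, of L ?u ?w] by (simp add: mult_ac)
    qed
    moreover have "- ((norm (f p))\<^sup>2 / \<delta> + \<delta> / 4 * ?w\<^sup>2) \<le> f p \<bullet> w p"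
      using young[OF \<delta>, of 1 "norm (f p)" ?w] Cauchy_Schwarz_ineq2[of "f p" "w p"] by simp
    moreover have "- ((norm (g p))\<^sup>2 / lam + lam / 4 * ?u\<^sup>2) \<le> - (g p * u p)"
      using young[OF lam0(1), of 1 "\<bar>g p\<bar>" ?u] abs_ge_self[of "g p * u p"] by (simp add: abs_mult)
    moreover have "- (L * ?u\<^sup>2) \<le> c p * (u p)\<^sup>2"
    proof -
      have "\<bar>c p * (u p)\<^sup>2\<bar> \<le> L * ?u\<^sup>2" unfolding abs_mult using coeffs(5) by (intro mult_mono) (auto simp: coeffs)
      then show ?thesis by linarith
    qed
    moreover have "(L\<^sup>2 / \<delta> + L) * ?u\<^sup>2 \<le> lam / 4 * ?u\<^sup>2" using lam0 by (intro mult_right_mono) auto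
    ultimately show ?thesis unfolding D_def by (simp add: distrib_right)
  qed
  then have "(\<integral>p. D p \<partial>?M) \<le> (\<integral>p. E p \<partial>?M)" by (intro integral_mono D E)
  moreover have "(\<integral>p. D p \<partial>?M) = \<delta> / 2 * sq ?M w + lam / 2 * sq ?M u - sq ?M f / \<delta> - sq ?M g / lam"
    unfolding D_def sq_def using u w f g by (simp add: sqi_def)
  ultimately show ?thesis using le unfolding E_def by simp
qed

text \<open>With x the norm of f and y the norm of g divided by sqrt lam, both sqrt lam times the
  norm of u and the norm of w are at most 2 / \<delta> (x + y), and their sum gives 4 / \<delta>.
  The condition \<delta> < 1 allows y^2 to be divided by \<delta>, so that both data carry the same
  factor.\<close>

lemma norm_estimate:
  assumes hol: "holder_alpha \<alpha>" and \<delta>1: "\<delta> < 1" and lam: "lam \<ge> 4 * (L\<^sup>2 / \<delta> + L) + 1"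
    and u: "sqi (lebesgue_on (HT T)) u" and w: "sqi (lebesgue_on (HT T)) w"
    and f: "sqi (lebesgue_on (HT T)) f" and g: "sqi (lebesgue_on (HT T)) g"
    and weak: "weak_Dv (HT T) u w" and eq: "eq_holds (HT T) \<alpha> a b bb c lam f g u w"
  shows "sqrt lam * nrm (HT T) u + nrmv (HT T) w \<le> 4 / \<delta> * nrmv (HT T) f + 4 / \<delta> / sqrt lam * nrm (HT T) g"
proof -
  let ?M = "lebesgue_on (HT T) :: ('d, 'd1) pt measure"
  note lam0 = lam_props(1)[OF lam]
  define x where "x = sqrt (sq ?M f)"
  define y where "y = sqrt (sq ?M g) / sqrt lam"
  have xy: "x \<ge> 0" "y \<ge> 0" using lam0 by (auto simp: x_def y_def)
  have x2: "sq ?M f = x\<^sup>2" and y2: "sq ?M g / lam = y\<^sup>2"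
    using lam0 by (auto simp: x_def y_def power_divide)
  have "x\<^sup>2 / \<delta> + y\<^sup>2 \<le> x\<^sup>2 / \<delta> + y\<^sup>2 / \<delta>"
    using \<delta> \<delta>1 mult_right_mono[of \<delta> 1 "y\<^sup>2"] by (simp add: field_simps)
  also have "\<dots> \<le> (x + y)\<^sup>2 / \<delta>"
    unfolding add_divide_distrib[symmetric] using xy \<delta> by (intro divide_right_mono) (auto simp: power2_sum)
  finally have S: "\<delta> / 2 * sq ?M w + lam / 2 * sq ?M u \<le> (x + y)\<^sup>2 / \<delta>"
    using energy_estimate[OF hol lam u w f g weak eq] unfolding x2 y2 by linarith
  have sq4: "4 * ((x + y) / \<delta>)\<^sup>2 = (2 / \<delta> * (x + y))\<^sup>2"
  proof -
    have "2 / \<delta> * (x + y) = 2 * ((x + y) / \<delta>)" by simp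
    then show ?thesis by (simp only: power_mult_distrib) simp
  qed
  have W: "sq ?M w \<le> (2 / \<delta> * (x + y))\<^sup>2"
  proof -
    have "0 \<le> lam / 2 * sq ?M u" using lam0 by (intro mult_nonneg_nonneg) auto
    then have "\<delta> / 2 * sq ?M w \<le> (x + y)\<^sup>2 / \<delta>" using S by linarith
    then have "sq ?M w \<le> 2 / \<delta> * ((x + y)\<^sup>2 / \<delta>)" using \<delta> by (simp add: field_simps)
    also have "\<dots> = 2 * ((x + y) / \<delta>)\<^sup>2" using \<delta> by (simp add: power2_eq_square)
    also have "\<dots> \<le> 4 * ((x + y) / \<delta>)\<^sup>2" by (intro mult_right_mono) auto
    also have "\<dots> = (2 / \<delta> * (x + y))\<^sup>2" by (rule sq4)
    finally show ?thesis .
  qed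
  have U: "lam * sq ?M u \<le> (2 / \<delta> * (x + y))\<^sup>2"
  proof -
    have "0 \<le> \<delta> / 2 * sq ?M w" using \<delta> by (intro mult_nonneg_nonneg) auto
    then have "lam * sq ?M u \<le> 2 * ((x + y)\<^sup>2 / \<delta>)" using S by linarith
    also have "\<dots> \<le> 4 / \<delta> * ((x + y)\<^sup>2 / \<delta>)"
      using \<delta> \<delta>1 by (intro mult_right_mono) (auto simp: field_simps)
    also have "\<dots> = 4 * ((x + y) / \<delta>)\<^sup>2" by (simp add: power_divide power2_eq_square[of \<delta>])
    also have "\<dots> = (2 / \<delta> * (x + y))\<^sup>2" by (rule sq4)
    finally show ?thesis .
  qed
  have n: "0 \<le> 2 / \<delta> * (x + y)" using \<delta> xy by simp
  have "sqrt (sq ?M w) \<le> 2 / \<delta> * (x + y)" by (rule real_le_lsqrt[OF n W])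
  moreover have "sqrt lam * sqrt (sq ?M u) \<le> 2 / \<delta> * (x + y)"
    unfolding real_sqrt_mult[symmetric] by (rule real_le_lsqrt[OF n U])
  ultimately show ?thesis
    unfolding nrm_sq nrmv_sq using \<delta> lam0 by (simp add: x_def y_def field_simps)
qed

text \<open>The difference of two solutions solves the equation with zero data, and the energy
  estimate annihilates it.\<close>

lemma solution_unique:
  assumes hol: "holder_alpha \<alpha>" and \<delta>1: "\<delta> < 1" and lam: "lam \<ge> 4 * (L\<^sup>2 / \<delta> + L) + 1"
    and s: "sqi (lebesgue_on (HT T)) u" "sqi (lebesgue_on (HT T)) w" "sqi (lebesgue_on (HT T)) f" "sqi (lebesgue_on (HT T)) g"
    and s': "sqi (lebesgue_on (HT T)) u'" "sqi (lebesgue_on (HT T)) w'"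
    and weak: "weak_Dv (HT T) u w" "weak_Dv (HT T) u' w'"
    and e: "eq_holds (HT T) \<alpha> a b bb c lam f g u w" "eq_holds (HT T) \<alpha> a b bb c lam f g u' w'"
  shows "AE p in lebesgue_on (HT T). u' p = u p"
proof -
  obtain \<theta> K where "0 < \<theta>" "\<theta> \<le> 1" "K \<ge> 0" "\<And>v v'. norm (\<alpha> v - \<alpha> v') \<le> K * norm (v - v') powr \<theta>"
    and cont: "continuous_on UNIV \<alpha>"
    by (rule holder_alphaE[OF hol]) (rule that)
  have d: "sqi (lebesgue_on (HT T)) (\<lambda>p. u' p - u p)" by (rule sqi_diff[OF s'(1) s(1)])
  have "eq_holds (HT T) \<alpha> a b bb c lam (\<lambda>p. f p - f p) (\<lambda>p. g p - g p) (\<lambda>p. u' p - u p) (\<lambda>p. w' p - w p)"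
    by (rule eq_holds_diff[OF HT_lebesgue cont s' s(3,4) s e(2,1)])
  then have "eq_holds (HT T) \<alpha> a b bb c lam (\<lambda>p. 0) (\<lambda>p. 0) (\<lambda>p. u' p - u p) (\<lambda>p. w' p - w p)" by simp
  from energy_estimate[OF hol lam d sqi_diff[OF s'(2) s(2)] sqi_zero sqi_zero
      weak_Dv_diff[OF HT_lebesgue s' s(1,2) weak(2,1)] this]
  have "\<delta> / 2 * sq (lebesgue_on (HT T)) (\<lambda>p. w' p - w p) + lam / 2 * sq (lebesgue_on (HT T)) (\<lambda>p. u' p - u p) \<le> 0"
    by (simp add: sq_def)
  moreover have "0 \<le> \<delta> / 2 * sq (lebesgue_on (HT T)) (\<lambda>p. w' p - w p)" using \<delta> by (intro mult_nonneg_nonneg) auto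
  moreover note lam_props(1)[OF lam]
  ultimately have "lam / 2 * sq (lebesgue_on (HT T)) (\<lambda>p. u' p - u p) \<le> 0" "lam / 2 > 0" by auto
  then have "sq (lebesgue_on (HT T)) (\<lambda>p. u' p - u p) \<le> 0" by (simp add: mult_le_0_iff)
  then have "sq (lebesgue_on (HT T)) (\<lambda>p. u' p - u p) = 0"
    using sq_nonneg[of "lebesgue_on (HT T)" "\<lambda>p. u' p - u p"] by linarith
  from sq_AE_zero[OF d this] show ?thesis by eventually_elim simp
qed

lemma S2_of_solution:
  assumes G: "G \<in> sets lebesgue" and s: "sqi (lebesgue_on G) u" "sqi (lebesgue_on G) w" "sqi (lebesgue_on G) f" "sqi (lebesgue_on G) g"
    and weak: "weak_Dv G u w" and e: "eq_holds G \<alpha> a b bb c lam f g u w"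
  shows "S2 G \<alpha> u w"
  using s(1,2) weak e[unfolded eq_holds_iff[OF \<delta> co G s]] sqi_flux_source[OF \<delta> co s]
  unfolding S2_def L2_sqi L2v_sqi by blast

text \<open>Testing the image \<open>k\<close> of \<open>(\<phi>, \<psi>)\<close> against \<open>(\<phi>, D\<^sub>v \<phi>)\<close> removes \<open>\<psi>\<close>, whose only role is to
  force the second component of the representing pair to be the weak gradient of the first.\<close>

lemma solution_exists:
  assumes G: "G \<in> sets lebesgue" and cont: "continuous_on UNIV \<alpha>"
    and lam: "lam \<ge> 4 * (L\<^sup>2 / \<delta> + L) + 1"
    and f: "sqi (lebesgue_on G) f" and g: "sqi (lebesgue_on G) g"
  shows "\<exists>u w. sqi (lebesgue_on G) u \<and> sqi (lebesgue_on G) w \<and> weak_Dv G u w \<and> eq_holds G \<alpha> a b bb c lam f g u w"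
proof -
  let ?M = "lebesgue_on G"
  note lam0 = lam_props(3)[OF lam]
  define ev :: "'d1 \<Rightarrow> ('d, 'd1) pt" where "ev i = (0, 0, axis i 1)" for i
  \<comment> \<open>\<open>k1\<close> and \<open>k2\<close> are the factors of u and w when the weak
    equation tested with \<phi> is added to the gradient relation tested with \<psi>: a formal
    adjoint acting on (\<phi>, \<psi>), with one test function \<psi> i per velocity
    direction.\<close>
  define k1 where "k1 \<phi> \<psi> p = - Y \<alpha> \<phi> p - bb p \<bullet> Dv \<phi> p + (c p + lam) * \<phi> p + (\<Sum>i\<in>UNIV. pd (\<psi> i) (ev i) p)"
    for \<phi> :: "('d, 'd1) pt \<Rightarrow> real" and \<psi> :: "'d1 \<Rightarrow> ('d, 'd1) pt \<Rightarrow> real" and p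
  define k2 where "k2 \<phi> \<psi> p = Dv \<phi> p v* a p + \<phi> p *\<^sub>R b p + (\<chi> i. \<psi> i p)"
    for \<phi> :: "('d, 'd1) pt \<Rightarrow> real" and \<psi> :: "'d1 \<Rightarrow> ('d, 'd1) pt \<Rightarrow> real" and p
  define X where "X = {(\<lambda>p. (k1 \<phi> \<psi> p, k2 \<phi> \<psi> p), Hm1_pair G f g \<phi>) | \<phi> \<psi>. test_fn G \<phi> \<and> (\<forall>i. test_fn G (\<psi> i))}"
  have ks: "sqi ?M (k1 \<phi> \<psi>)" "sqi ?M (k2 \<phi> \<psi>)" if t: "test_fn G \<phi>" "\<And>i. test_fn G (\<psi> i)" for \<phi> \<psi>
  proof -
    have p: "sqi ?M \<phi>" by (rule cc_sqi[OF cc_test_fn[OF t(1)] G])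
    have d: "sqi ?M (Dv \<phi>)" by (rule cc_sqi[OF cc_Dv[OF t(1)] G])
    have y: "sqi ?M (Y \<alpha> \<phi>)" by (rule cc_sqi[OF cc_Y[OF t(1) cont] G])
    show "sqi ?M (k1 \<phi> \<psi>)" unfolding k1_def
      by (intro sqi_add sqi_diff sqi_minus sqi_sum y sqi_lower_order[OF \<delta> co p d] cc_sqi[OF cc_pd[OF t(2)] G])
    have "cc (\<lambda>p. \<chi> i. \<psi> i p)" by (rule cc_vec) (simp add: cc_test_fn[OF t(2)])
    then show "sqi ?M (k2 \<phi> \<psi>)" unfolding k2_def
      by (intro sqi_add sqi_matvec[OF \<delta> co d] sqi_lower_order[OF \<delta> co p d] cc_sqi G)
  qed
  \<comment> \<open>Coercivity constant: Young's inequality for the drift leaves 3/4 of \<delta> on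
    the gradient and lam - L - L^2 / \<delta> on the function.\<close>
  define \<mu> where "\<mu> = min (3 / 4 * \<delta>) (lam - L - L\<^sup>2 / \<delta>)"
  have \<mu>: "\<mu> > 0" using \<delta> lam0 by (simp add: \<mu>_def)
  have bound: "\<bar>Hm1_pair G f g \<phi>\<bar> \<le> ((sqrt (sq ?M f) + sqrt (sq ?M g)) / \<mu>) * sqrt (sq ?M (\<lambda>p. (k1 \<phi> \<psi> p, k2 \<phi> \<psi> p)))"
    if t: "test_fn G \<phi>" "\<And>i. test_fn G (\<psi> i)" for \<phi> \<psi>
  proof -
    define e where "e p = (\<phi> p, Dv \<phi> p)" for p
    have \<phi>s: "smooth_fn \<phi>" and \<psi>s: "smooth_fn (\<psi> i)" for i using t test_fn_smooth by blast+
    have p: "sqi ?M \<phi>" by (rule cc_sqi[OF cc_test_fn[OF t(1)] G])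
    have d: "sqi ?M (Dv \<phi>)" by (rule cc_sqi[OF cc_Dv[OF t(1)] G])
    have e: "sqi ?M e" unfolding e_def by (rule sqi_Pair[OF p d])
    have k: "sqi ?M (\<lambda>p. (k1 \<phi> \<psi> p, k2 \<phi> \<psi> p))" by (rule sqi_Pair[OF ks[OF t]])
    define B where "B p = \<phi> p * ((b p - bb p) \<bullet> Dv \<phi> p) + (c p + lam) * (\<phi> p)\<^sup>2 + Dv \<phi> p \<bullet> (a p *v Dv \<phi> p)" for p
    have e2: "(norm (e p))\<^sup>2 = (\<phi> p)\<^sup>2 + (norm (Dv \<phi> p))\<^sup>2" for p by (simp add: e_def norm_Pair)
    have Bge: "\<mu> * (norm (e p))\<^sup>2 \<le> B p" for p
    proof -
      let ?u = "\<bar>\<phi> p\<bar>" and ?w = "norm (Dv \<phi> p)"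
      have "- (L\<^sup>2 / \<delta> * ?u\<^sup>2 + \<delta> / 4 * ?w\<^sup>2) \<le> \<phi> p * ((b p - bb p) \<bullet> Dv \<phi> p)"
      proof -
        have "\<bar>\<phi> p * ((b p - bb p) \<bullet> Dv \<phi> p)\<bar> \<le> ?u * (L * ?w)"
          unfolding abs_mult
          by (intro mult_left_mono order_trans[OF Cauchy_Schwarz_ineq2] mult_right_mono coeffs) auto
        then show ?thesis using young[OF \<delta>, of L ?u ?w] by (simp add: mult_ac)
      qed
      moreover have "(lam - L) * (\<phi> p)\<^sup>2 \<le> (c p + lam) * (\<phi> p)\<^sup>2"
        using coeffs(5)[of p] by (intro mult_right_mono) auto
      moreover have "\<delta> * ?w\<^sup>2 \<le> Dv \<phi> p \<bullet> (a p *v Dv \<phi> p)" by (rule coeffs(1))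
      moreover have "\<mu> * (\<phi> p)\<^sup>2 \<le> (lam - L - L\<^sup>2 / \<delta>) * (\<phi> p)\<^sup>2" "\<mu> * ?w\<^sup>2 \<le> 3 / 4 * \<delta> * ?w\<^sup>2"
        unfolding \<mu>_def by (intro mult_right_mono min.cobounded1 min.cobounded2; simp)+
      ultimately show ?thesis unfolding B_def e2 by (simp add: algebra_simps)
    qed
    have iY: "integrable ?M (\<lambda>p. \<phi> p * Y \<alpha> \<phi> p)" by (rule cc_integrable_mult[OF cc_Y[OF t(1) cont] G p])
    have ps: "test_fn G (\<lambda>p. \<phi> p * \<psi> i p)" for i by (rule test_fn_mult(1)[OF t(1) \<psi>s])
    have ipd: "integrable ?M (\<lambda>p. 1 * pd (\<lambda>p. \<phi> p * \<psi> i p) (ev i) p)" for i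
    proof -
      have "pd (\<lambda>p. \<phi> p * \<psi> i p) (ev i) p = \<phi> p * pd (\<psi> i) (ev i) p + \<psi> i p * pd \<phi> (ev i) p" for p
        by (simp add: pd_mult[OF \<phi>s \<psi>s])
      then show ?thesis
        using cc_integrable_mult[OF cc_pd[OF t(2)] G p] cc_integrable_mult[OF cc_pd[OF t(1)] G cc_sqi[OF cc_test_fn[OF t(2)] G]]
        by simp
    qed
    have pd0: "(\<integral>p. 1 * pd (\<lambda>p. \<phi> p * \<psi> i p) (ev i) p \<partial>?M) = 0" for i
      by (rule integral_weight_pd_on[OF _ _ ps G]) auto
    have iB: "integrable ?M B"
    proof -
      have "integrable ?M (\<lambda>p. (\<phi> p *\<^sub>R b p) \<bullet> Dv \<phi> p - (\<phi> p *\<^sub>R bb p) \<bullet> Dv \<phi> p + ((c p + lam) * \<phi> p) * \<phi> p + Dv \<phi> p \<bullet> (a p *v Dv \<phi> p))"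
        by (intro Bochner_Integration.integrable_add Bochner_Integration.integrable_diff sqi_inner_integrable sqi_mult_integrable
            sqi_lower_order[OF \<delta> co p d] sqi_matvec[OF \<delta> co d] p d)
      then show ?thesis unfolding B_def by (simp add: inner_diff_left algebra_simps power2_eq_square)
    qed
    \<comment> \<open>Against (\<phi>, D_v \<phi>) the \<psi> terms combine to the sum of the i-th
      derivatives of \<phi> \<psi> i, whose integral vanishes, as does that of \<phi> Y \<phi>; only
      the coercive form B survives.\<close>
    have dec: "(k1 \<phi> \<psi> p, k2 \<phi> \<psi> p) \<bullet> e p = B p - \<phi> p * Y \<alpha> \<phi> p + (\<Sum>i\<in>UNIV. 1 * pd (\<lambda>p. \<phi> p * \<psi> i p) (ev i) p)" for p
    proof -
      have "(\<Sum>i\<in>UNIV. 1 * pd (\<lambda>p. \<phi> p * \<psi> i p) (ev i) p)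
        = \<phi> p * (\<Sum>i\<in>UNIV. pd (\<psi> i) (ev i) p) + (\<chi> i. \<psi> i p) \<bullet> Dv \<phi> p"
        by (simp add: pd_mult[OF \<phi>s \<psi>s] sum.distrib sum_distrib_left inner_vec_sum Dv_def ev_def algebra_simps)
      then show ?thesis
        by (simp add: k1_def k2_def e_def B_def inner_add_left dot_lmul_matrix inner_diff_left power2_eq_square algebra_simps)
    qed
    have iS: "integrable ?M (\<lambda>p. \<Sum>i\<in>UNIV. 1 * pd (\<lambda>p. \<phi> p * \<psi> i p) (ev i) p)"
      by (rule Bochner_Integration.integrable_sum[OF ipd])
    have "(\<integral>p. (k1 \<phi> \<psi> p, k2 \<phi> \<psi> p) \<bullet> e p \<partial>?M) = (\<integral>p. B p \<partial>?M)"
      unfolding dec Bochner_Integration.integral_add[OF Bochner_Integration.integrable_diff[OF iB iY] iS]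
        Bochner_Integration.integral_diff[OF iB iY] Bochner_Integration.integral_sum[OF ipd] pd0
        integral_Y_test[OF t(1) G cont] by simp
    moreover have "\<mu> * sq ?M e \<le> (\<integral>p. B p \<partial>?M)"
    proof -
      have "\<mu> * sq ?M e = (\<integral>p. \<mu> * (norm (e p))\<^sup>2 \<partial>?M)" by (simp add: sq_def)
      also have "\<dots> \<le> (\<integral>p. B p \<partial>?M)" using e iB Bge by (intro integral_mono) (auto simp: sqi_def)
      finally show ?thesis .
    qed
    moreover note sqi_Cauchy_Schwarz[OF k e]
    ultimately have "\<mu> * sq ?M e \<le> sqrt (sq ?M (\<lambda>p. (k1 \<phi> \<psi> p, k2 \<phi> \<psi> p))) * sqrt (sq ?M e)" by linarith
    then have *: "(\<mu> * sqrt (sq ?M e)) * sqrt (sq ?M e) \<le> sqrt (sq ?M (\<lambda>p. (k1 \<phi> \<psi> p, k2 \<phi> \<psi> p))) * sqrt (sq ?M e)"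
      by (simp add: mult.assoc)
    \<comment> \<open>Coercivity and Cauchy-Schwarz bound the norm of \<open>e\<close> by that of
      the image pair; the functional is in turn bounded by the norm of \<open>e\<close>.\<close>
    have A: "\<mu> * sqrt (sq ?M e) \<le> sqrt (sq ?M (\<lambda>p. (k1 \<phi> \<psi> p, k2 \<phi> \<psi> p)))"
    proof (cases "sq ?M e = 0")
      case False
      then have "0 < sq ?M e" using sq_nonneg[of ?M e] by linarith
      then have "0 < sqrt (sq ?M e)" by simp
      with * show ?thesis by (rule mult_right_le_imp_le)
    qed simp
    have se: "sq ?M e = sq ?M \<phi> + sq ?M (Dv \<phi>)"
      unfolding sq_def e2 using p d by (simp add: sqi_def)
    have "\<bar>Hm1_pair G f g \<phi>\<bar> \<le> \<bar>\<integral>p. f p \<bullet> Dv \<phi> p \<partial>?M\<bar> + \<bar>\<integral>p. g p * \<phi> p \<partial>?M\<bar>"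
      unfolding Hm1_pair_def by linarith
    also have "\<dots> \<le> sqrt (sq ?M f) * sqrt (sq ?M (Dv \<phi>)) + sqrt (sq ?M g) * sqrt (sq ?M \<phi>)"
      using sqi_Cauchy_Schwarz[OF f d] sqi_Cauchy_Schwarz[OF g p] by (simp add: inner_real_def)
    also have "\<dots> \<le> sqrt (sq ?M f) * sqrt (sq ?M e) + sqrt (sq ?M g) * sqrt (sq ?M e)"
      by (intro add_mono mult_left_mono) (auto simp: se)
    also have "\<dots> = (sqrt (sq ?M f) + sqrt (sq ?M g)) / \<mu> * (\<mu> * sqrt (sq ?M e))" using \<mu> by (simp add: field_simps)
    also have "\<dots> \<le> (sqrt (sq ?M f) + sqrt (sq ?M g)) / \<mu> * sqrt (sq ?M (\<lambda>p. (k1 \<phi> \<psi> p, k2 \<phi> \<psi> p)))"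
      using \<mu> by (intro mult_left_mono A divide_nonneg_pos add_nonneg_nonneg) auto
    finally show ?thesis .
  qed
  have lin: "(\<lambda>x. k x + s *\<^sub>R k' x, l + s * l') \<in> X" if "(k, l) \<in> X" "(k', l') \<in> X" for k l k' l' s
  proof -
    obtain \<phi> \<psi> where 1: "k = (\<lambda>p. (k1 \<phi> \<psi> p, k2 \<phi> \<psi> p))" "l = Hm1_pair G f g \<phi>" "test_fn G \<phi>" "\<And>i. test_fn G (\<psi> i)"
      using \<open>(k, l) \<in> X\<close> unfolding X_def by blast
    obtain \<phi>' \<psi>' where 2: "k' = (\<lambda>p. (k1 \<phi>' \<psi>' p, k2 \<phi>' \<psi>' p))" "l' = Hm1_pair G f g \<phi>'" "test_fn G \<phi>'" "\<And>i. test_fn G (\<psi>' i)"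
      using \<open>(k', l') \<in> X\<close> unfolding X_def by blast
    have s: "smooth_fn \<phi>" "smooth_fn \<phi>'" "\<And>i. smooth_fn (\<psi> i)" "\<And>i. smooth_fn (\<psi>' i)"
      using 1 2 test_fn_smooth by blast+
    have a1: "k1 (\<lambda>p. \<phi> p + s * \<phi>' p) (\<lambda>i p. \<psi> i p + s * \<psi>' i p) p = k1 \<phi> \<psi> p + s * k1 \<phi>' \<psi>' p" for p
      unfolding k1_def Y_lin[OF s(1,2)] Dv_lin[OF s(1,2)] pd_lin[OF s(3,4)]
      by (simp add: inner_add_right sum.distrib sum_distrib_left algebra_simps)
    have a2: "k2 (\<lambda>p. \<phi> p + s * \<phi>' p) (\<lambda>i p. \<psi> i p + s * \<psi>' i p) p = k2 \<phi> \<psi> p + s *\<^sub>R k2 \<phi>' \<psi>' p" for p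
      unfolding k2_def Dv_lin[OF s(1,2)]
      by (simp add: vec_eq_iff vector_matrix_mult_def sum.distrib sum_distrib_left algebra_simps)
    have "(\<lambda>x. k x + s *\<^sub>R k' x) = (\<lambda>p. (k1 (\<lambda>p. \<phi> p + s * \<phi>' p) (\<lambda>i p. \<psi> i p + s * \<psi>' i p) p,
        k2 (\<lambda>p. \<phi> p + s * \<phi>' p) (\<lambda>i p. \<psi> i p + s * \<psi>' i p) p))"
      unfolding a1 a2 1 2 by (simp add: fun_eq_iff)
    moreover have "l + s * l' = Hm1_pair G f g (\<lambda>p. \<phi> p + s * \<phi>' p)"
      unfolding Hm1_pair_lin[OF G f g 1(3) 2(3)] 1 2 by (rule refl)
    ultimately show ?thesis unfolding X_def using test_fn_lin[OF 1(3) 2(3)] test_fn_lin[OF 1(4) 2(4)] by blast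
  qed
  have mem: "(\<lambda>p. (k1 \<phi> \<psi> p, k2 \<phi> \<psi> p), Hm1_pair G f g \<phi>) \<in> X" if "test_fn G \<phi>" "\<And>i. test_fn G (\<psi> i)" for \<phi> \<psi>
    unfolding X_def using that by blast
  have "\<exists>h. sqi ?M h \<and> (\<forall>(k, l)\<in>X. (\<integral>x. h x \<bullet> k x \<partial>?M) = l)"
  proof (rule lions_representation[OF _ _ lin])
    show "sqi ?M k" if "(k, l) \<in> X" for k l
      using that sqi_Pair[OF ks] unfolding X_def by blast
    show "X \<noteq> {}" using mem[OF test_fn_zero test_fn_zero] by blast
    show "\<bar>l\<bar> \<le> ((sqrt (sq ?M f) + sqrt (sq ?M g)) / \<mu>) * sqrt (sq ?M k)" if "(k, l) \<in> X" for k l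
      using that bound unfolding X_def by blast
  qed
  then obtain h where hs: "sqi ?M h" and hX: "\<forall>(k, l)\<in>X. (\<integral>x. h x \<bullet> k x \<partial>?M) = l" by blast
  have h: "sqi ?M h" "(k, l) \<in> X \<Longrightarrow> (\<integral>x. h x \<bullet> k x \<partial>?M) = l" for k l
    using hs bspec[OF hX, of "(k, l)"] by auto
  define u where "u p = fst (h p)" for p
  define w where "w p = snd (h p)" for p
  have u: "sqi ?M u" and w: "sqi ?M w" unfolding u_def w_def using sqi_fst[OF h(1)] sqi_snd[OF h(1)] by auto
  have hk: "(\<integral>p. u p * k1 \<phi> \<psi> p + w p \<bullet> k2 \<phi> \<psi> p \<partial>?M) = Hm1_pair G f g \<phi>"
    if "test_fn G \<phi>" "\<And>i. test_fn G (\<psi> i)" for \<phi> \<psi>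
    using h(2)[OF mem[OF that]] by (simp add: u_def w_def inner_prod_def)
  have z: "Y \<alpha> (\<lambda>p. 0) p = 0" "Dv (\<lambda>p. 0) p = 0" for p :: "('d, 'd1) pt"
    by (simp_all add: Dt_def Dx_def Dv_def vec_eq_iff inner_vec_sum)
  have "weak_Dv G u w"
    unfolding weak_Dv_def
  proof (intro allI impI)
    fix \<phi> :: "('d, 'd1) pt \<Rightarrow> real" and j :: 'd1 assume \<phi>: "test_fn G \<phi>"
    \<comment> \<open>The first test function is 0 and only slot j of the second is filled, so the
      representation reads off the weak derivative in direction j.\<close>
    define \<psi> where "\<psi> i = (if i = j then \<phi> else (\<lambda>p. 0))" for i
    have t: "test_fn G (\<psi> i)" for i by (simp add: \<psi>_def \<phi> test_fn_zero)
    have "pd (\<psi> i) (ev i) p = (if i = j then pd \<phi> (ev j) p else 0)" for i p by (simp add: \<psi>_def)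
    then have e1: "k1 (\<lambda>p. 0) \<psi> p = pd \<phi> (ev j) p" for p by (simp add: k1_def z)
    have k2i: "k2 (\<lambda>p. 0) \<psi> p $ i = (if i = j then \<phi> p else 0)" for i p
      by (simp add: k2_def z vector_matrix_mult_def \<psi>_def)
    have e2: "w p \<bullet> k2 (\<lambda>p. 0) \<psi> p = w p $ j * \<phi> p" for p
      unfolding inner_vec_sum k2i by (simp add: if_distrib[of "(*) _"] cong: if_cong)
    have i1: "integrable ?M (\<lambda>p. u p * pd \<phi> (ev j) p)" by (rule cc_integrable_mult[OF cc_pd[OF \<phi>] G u])
    have i2: "integrable ?M (\<lambda>p. w p $ j * \<phi> p)" by (rule cc_integrable_mult[OF cc_test_fn[OF \<phi>] G sqi_nth[OF w]])
    have "Hm1_pair G f g (\<lambda>p. 0) = 0" by (simp add: Hm1_pair_def z)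
    then have "(\<integral>p. u p * pd \<phi> (ev j) p \<partial>?M) + (\<integral>p. w p $ j * \<phi> p \<partial>?M) = 0"
      using hk[of "\<lambda>p. 0" \<psi>, OF test_fn_zero t] unfolding e1 e2 Bochner_Integration.integral_add[OF i1 i2] by simp
    then show "(\<integral>p. u p * pd \<phi> (0, 0, axis j 1) p \<partial>?M) = - (\<integral>p. (w p $ j) * \<phi> p \<partial>?M)"
      unfolding ev_def by simp
  qed
  moreover have "eq_holds G \<alpha> a b bb c lam f g u w"
    unfolding eq_holds_def
  proof (intro allI impI)
    fix \<phi> :: "('d, 'd1) pt \<Rightarrow> real" assume \<phi>: "test_fn G \<phi>"
    note cp = cc_test_fn[OF \<phi>] cc_Dv[OF \<phi>]
    have z0: "(\<chi> i. 0) = (0 :: real ^ 'd1)" by (simp add: vec_eq_iff)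
    \<comment> \<open>Conversely, \<psi> = 0 leaves exactly the weak equation.\<close>
    have e: "u p * k1 \<phi> (\<lambda>i p. 0) p + w p \<bullet> k2 \<phi> (\<lambda>i p. 0) p
       = (a p *v w p) \<bullet> Dv \<phi> p - (u p *\<^sub>R bb p) \<bullet> Dv \<phi> p + ((b p \<bullet> w p) + (c p + lam) * u p) * \<phi> p - u p * Y \<alpha> \<phi> p" for p
    proof -
      have "w p \<bullet> (Dv \<phi> p v* a p) = (a p *v w p) \<bullet> Dv \<phi> p"
        by (simp add: inner_commute[of "w p"] dot_lmul_matrix inner_commute[of "a p *v w p"])
      then show ?thesis by (simp add: k1_def k2_def z0 inner_add_right inner_commute[of "w p" "b p"] algebra_simps)
    qed
    have i1: "integrable ?M (\<lambda>p. (a p *v w p) \<bullet> Dv \<phi> p)" by (rule cc_integrable_inner[OF cp(2) G sqi_matvec(1)[OF \<delta> co w]])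
    have i2: "integrable ?M (\<lambda>p. (u p *\<^sub>R bb p) \<bullet> Dv \<phi> p)"
      by (rule cc_integrable_inner[OF cp(2) G sqi_lower_order(1)[OF \<delta> co u w]])
    have i3: "integrable ?M (\<lambda>p. ((b p \<bullet> w p) + (c p + lam) * u p) * \<phi> p)"
      by (rule cc_integrable_mult[OF cp(1) G sqi_add[OF sqi_lower_order(3,5)[OF \<delta> co u w]]])
    have i4: "integrable ?M (\<lambda>p. u p * Y \<alpha> \<phi> p)" by (rule cc_integrable_mult[OF cc_Y[OF \<phi> cont] G u])
    show "transport_pair G \<alpha> u \<phi> + (\<integral>p. (a p *v w p) \<bullet> Dv \<phi> p \<partial>?M) - (\<integral>p. u p * (bb p \<bullet> Dv \<phi> p) \<partial>?M)
      + (\<integral>p. ((b p \<bullet> w p) + (c p + lam) * u p) * \<phi> p \<partial>?M) = Hm1_pair G f g \<phi>"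
      using hk[of \<phi> "\<lambda>i p. 0", OF \<phi> test_fn_zero]
      unfolding e Bochner_Integration.integral_diff[OF Bochner_Integration.integrable_add[OF Bochner_Integration.integrable_diff[OF i1 i2] i3] i4]
        Bochner_Integration.integral_add[OF Bochner_Integration.integrable_diff[OF i1 i2] i3]
        Bochner_Integration.integral_diff[OF i1 i2] transport_pair_def by simp
  qed
  ultimately show ?thesis using u w by blast
qed

end

subsection \<open>Restriction and modification on null sets\<close>

lemma Y_outside:
  assumes "test_fn A \<phi>" "p \<notin> A"
  shows "Y \<alpha> \<phi> p = 0" "Dv \<phi> p = 0" "\<phi> p = 0"
  using test_fn_outside[OF test_fn_pd[OF assms(1)] assms(2)] test_fn_outside[OF assms]
  by (auto simp: Dt_def Dx_def Dv_def vec_eq_iff inner_vec_sum)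

lemma transport_pair_restrict:
  assumes "A \<subseteq> B" "A \<in> sets lebesgue" "B \<in> sets lebesgue" "test_fn A \<phi>"
  shows "transport_pair B \<alpha> u \<phi> = transport_pair A \<alpha> u \<phi>"
  unfolding transport_pair_def
  by (subst integral_lebesgue_on_mono_support[OF assms(1-3)]) (auto simp: Y_outside(1)[OF assms(4)])

lemma Hm1_pair_restrict:
  assumes "A \<subseteq> B" "A \<in> sets lebesgue" "B \<in> sets lebesgue" "test_fn A \<phi>"
  shows "Hm1_pair B F g \<phi> = Hm1_pair A F g \<phi>"
  unfolding Hm1_pair_def
  by (subst (1 2) integral_lebesgue_on_mono_support[OF assms(1-3)]) (auto simp: Y_outside(2,3)[OF assms(4)])

lemma weak_Dv_restrict:
  assumes "A \<subseteq> B" "A \<in> sets lebesgue" "B \<in> sets lebesgue" "weak_Dv B u w"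
  shows "weak_Dv A u w"
  unfolding weak_Dv_def
proof (intro allI impI)
  fix \<phi> i assume \<phi>: "test_fn A \<phi>"
  have "(\<integral>p. u p * pd \<phi> (0, 0, axis i 1) p \<partial>lebesgue_on B) = - (\<integral>p. w p $ i * \<phi> p \<partial>lebesgue_on B)"
    using assms(4) test_fn_mono[OF \<phi> assms(1)] unfolding weak_Dv_def by blast
  moreover have "(\<integral>p. u p * pd \<phi> (0, 0, axis i 1) p \<partial>lebesgue_on B) = (\<integral>p. u p * pd \<phi> (0, 0, axis i 1) p \<partial>lebesgue_on A)"
    by (rule integral_lebesgue_on_mono_support[OF assms(1-3)]) (simp add: test_fn_outside[OF test_fn_pd[OF \<phi>]])
  moreover have "(\<integral>p. w p $ i * \<phi> p \<partial>lebesgue_on B) = (\<integral>p. w p $ i * \<phi> p \<partial>lebesgue_on A)"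
    by (rule integral_lebesgue_on_mono_support[OF assms(1-3)]) (simp add: test_fn_outside[OF \<phi>])
  ultimately show "(\<integral>p. u p * pd \<phi> (0, 0, axis i 1) p \<partial>lebesgue_on A) = - (\<integral>p. w p $ i * \<phi> p \<partial>lebesgue_on A)"
    by simp
qed

lemma integral_mult_cong_AE:
  fixes u u' :: "'a::euclidean_space \<Rightarrow> real"
  assumes "G \<in> sets lebesgue" "sqi (lebesgue_on G) u" "sqi (lebesgue_on G) u'" "AE p in lebesgue_on G. u p = u' p" "cc \<psi>"
  shows "(\<integral>p. u p * \<psi> p \<partial>lebesgue_on G) = (\<integral>p. u' p * \<psi> p \<partial>lebesgue_on G)"
  by (rule integral_cong_AE)
     (use cc_integrable_mult[OF assms(5,1,2)] cc_integrable_mult[OF assms(5,1,3)] assms(4) in auto)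

lemma integral_inner_cong_AE:
  fixes u u' :: "'a::euclidean_space \<Rightarrow> 'b::euclidean_space"
  assumes "G \<in> sets lebesgue" "sqi (lebesgue_on G) u" "sqi (lebesgue_on G) u'" "AE p in lebesgue_on G. u p = u' p" "cc \<psi>"
  shows "(\<integral>p. u p \<bullet> \<psi> p \<partial>lebesgue_on G) = (\<integral>p. u' p \<bullet> \<psi> p \<partial>lebesgue_on G)"
  by (rule integral_cong_AE)
     (use cc_integrable_inner[OF assms(5,1,2)] cc_integrable_inner[OF assms(5,1,3)] assms(4) in auto)

lemma weak_Dv_cong_AE:
  assumes G: "G \<in> sets lebesgue" and s: "sqi (lebesgue_on G) u" "sqi (lebesgue_on G) w" "sqi (lebesgue_on G) u'" "sqi (lebesgue_on G) w'"
    and AE: "AE p in lebesgue_on G. u p = u' p" "AE p in lebesgue_on G. w p = w' p" and weak: "weak_Dv G u w"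
  shows "weak_Dv G u' w'"
  unfolding weak_Dv_def
proof (intro allI impI)
  fix \<phi> i assume \<phi>: "test_fn G \<phi>"
  have AE': "AE p in lebesgue_on G. w p $ i = w' p $ i" using AE(2) by eventually_elim simp
  show "(\<integral>p. u' p * pd \<phi> (0, 0, axis i 1) p \<partial>lebesgue_on G) = - (\<integral>p. w' p $ i * \<phi> p \<partial>lebesgue_on G)"
    unfolding integral_mult_cong_AE[OF G s(1,3) AE(1) cc_pd[OF \<phi>], symmetric]
      integral_mult_cong_AE[OF G sqi_nth[OF s(2)] sqi_nth[OF s(4)] AE' cc_test_fn[OF \<phi>], symmetric]
    using weak \<phi> unfolding weak_Dv_def by blast
qed

lemma transport_pair_cong_AE:
  assumes "G \<in> sets lebesgue" "continuous_on UNIV \<alpha>" "sqi (lebesgue_on G) u" "sqi (lebesgue_on G) u'"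
    "AE p in lebesgue_on G. u p = u' p" "test_fn G \<phi>"
  shows "transport_pair G \<alpha> u \<phi> = transport_pair G \<alpha> u' \<phi>"
  unfolding transport_pair_def integral_mult_cong_AE[OF assms(1,3,4,5) cc_Y[OF assms(6,2)]] by (rule refl)

lemma Hm1_pair_cong_AE:
  assumes "G \<in> sets lebesgue" "sqi (lebesgue_on G) F" "sqi (lebesgue_on G) g" "sqi (lebesgue_on G) F'" "sqi (lebesgue_on G) g'"
    "AE p in lebesgue_on G. F p = F' p" "AE p in lebesgue_on G. g p = g' p" "test_fn G \<phi>"
  shows "Hm1_pair G F g \<phi> = Hm1_pair G F' g' \<phi>"
  unfolding Hm1_pair_def integral_mult_cong_AE[OF assms(1,3,5,7) cc_test_fn[OF assms(8)]]
    integral_inner_cong_AE[OF assms(1,2,4,6) cc_Dv[OF assms(8)]] by (rule refl)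

subsection \<open>Functions of time\<close>

lemma time_fn:
  fixes s :: "real \<Rightarrow> real"
  assumes "smooth_fn s"
  shows "smooth_fn (\<lambda>p::('d::finite, 'd1::finite) pt. s (fst p + r))"
    and "Dv (\<lambda>p::('d, 'd1) pt. s (fst p + r)) p = 0" and "Dx (\<lambda>p::('d, 'd1) pt. s (fst p + r)) p = 0"
    and "Dt (\<lambda>p::('d, 'd1) pt. s (fst p + r)) p = pd s 1 (fst p + r)"
proof -
  have pd: "pd (\<lambda>p::('d, 'd1) pt. s (fst p + r)) h p = pd s (fst h) (fst p + r)" for h
    by (rule smooth_fn_affine(2)[OF assms bounded_linear_fst])
  have 0: "pd s 0 x = 0" for x using pd_scale[OF assms, of 0 0] by simp
  show "smooth_fn (\<lambda>p::('d, 'd1) pt. s (fst p + r))" by (rule smooth_fn_affine(1)[OF assms bounded_linear_fst])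
  show "Dv (\<lambda>p::('d, 'd1) pt. s (fst p + r)) p = 0" "Dx (\<lambda>p::('d, 'd1) pt. s (fst p + r)) p = 0"
    "Dt (\<lambda>p::('d, 'd1) pt. s (fst p + r)) p = pd s 1 (fst p + r)"
    by (simp_all add: Dv_def Dx_def Dt_def pd 0 vec_eq_iff)
qed

lemma Dv_time_mult:
  assumes "smooth_fn \<phi>" "smooth_fn \<kappa>" "\<And>p. Dv \<kappa> p = 0"
  shows "Dv (\<lambda>p. \<phi> p * \<kappa> p) p = \<kappa> p *\<^sub>R Dv \<phi> p" "pd (\<lambda>p. \<phi> p * \<kappa> p) (0, 0, axis i 1) p = \<kappa> p * pd \<phi> (0, 0, axis i 1) p"
proof -
  show "Dv (\<lambda>p. \<phi> p * \<kappa> p) p = \<kappa> p *\<^sub>R Dv \<phi> p" by (simp add: Dv_mult[OF assms(1,2)] assms(3))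
  then have "Dv (\<lambda>p. \<phi> p * \<kappa> p) p $ i = (\<kappa> p *\<^sub>R Dv \<phi> p) $ i" by simp
  then show "pd (\<lambda>p. \<phi> p * \<kappa> p) (0, 0, axis i 1) p = \<kappa> p * pd \<phi> (0, 0, axis i 1) p" by (simp add: Dv_def)
qed

lemma smooth_measurable_on: "smooth_fn \<kappa> \<Longrightarrow> G \<in> sets lebesgue \<Longrightarrow> \<kappa> \<in> borel_measurable (lebesgue_on G)"
  for \<kappa> :: "'a::euclidean_space \<Rightarrow> real"
  by (intro continuous_imp_measurable_on_sets_lebesgue smooth_fn_continuous_on)

lemma integral_cutoff_tendsto:
  fixes h :: "'a::euclidean_space \<Rightarrow> real"
  assumes G: "G \<in> sets lebesgue" and h: "integrable (lebesgue_on G) h"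
    and \<kappa>: "\<And>n. smooth_fn (\<kappa> n)" "\<And>n p. 0 \<le> \<kappa> n p" "\<And>n p. \<kappa> n p \<le> 1"
    and lim: "AE p in lebesgue_on G. (\<lambda>n. \<kappa> n p) \<longlonglongrightarrow> 1"
  shows "(\<lambda>n. \<integral>p. \<kappa> n p * h p \<partial>lebesgue_on G) \<longlonglongrightarrow> (\<integral>p. h p \<partial>lebesgue_on G)"
proof (rule integral_dominated_convergence[where w = "\<lambda>p. \<bar>h p\<bar>"])
  show "(\<lambda>p. \<kappa> n p * h p) \<in> borel_measurable (lebesgue_on G)" for n
    using h smooth_measurable_on[OF \<kappa>(1) G] by (intro borel_measurable_times) auto
  show "AE p in lebesgue_on G. (\<lambda>n. \<kappa> n p * h p) \<longlonglongrightarrow> h p"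
    using lim
  proof eventually_elim
    case (elim p)
    then have "(\<lambda>n. \<kappa> n p * h p) \<longlonglongrightarrow> 1 * h p" by (intro tendsto_intros)
    then show ?case by simp
  qed
  show "AE p in lebesgue_on G. norm (\<kappa> n p * h p) \<le> \<bar>h p\<bar>" for n
    using \<kappa>(2,3)[of n] by (intro AE_I2) (auto simp: abs_mult intro!: mult_left_le_one_le)
qed (use h in auto)

text \<open>The cut-offs are constant in v, so D_v (\<phi> \<kappa>) = \<kappa> D_v \<phi>, and no
  derivative of \<kappa>, which would blow up as the cut-off sharpens, enters the pairing.\<close>

lemma Hm1_pair_cutoff_tendsto:
  assumes G: "G \<in> sets lebesgue" and F: "sqi (lebesgue_on G) F" and g: "sqi (lebesgue_on G) g"
    and \<kappa>: "\<And>n. smooth_fn (\<kappa> n)" "\<And>n p. 0 \<le> \<kappa> n p" "\<And>n p. \<kappa> n p \<le> 1" "\<And>n p. Dv (\<kappa> n) p = 0"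
    and lim: "AE p in lebesgue_on G. (\<lambda>n. \<kappa> n p) \<longlonglongrightarrow> 1"
    and i: "integrable (lebesgue_on G) (\<lambda>p. F p \<bullet> Dv \<phi> p)" "integrable (lebesgue_on G) (\<lambda>p. g p * \<phi> p)"
    and \<phi>: "smooth_fn \<phi>"
  shows "(\<lambda>n. Hm1_pair G F g (\<lambda>p. \<phi> p * \<kappa> n p)) \<longlonglongrightarrow> Hm1_pair G F g \<phi>"
proof -
  have "Hm1_pair G F g (\<lambda>p. \<phi> p * \<kappa> n p)
    = - (\<integral>p. \<kappa> n p * (F p \<bullet> Dv \<phi> p) \<partial>lebesgue_on G) + (\<integral>p. \<kappa> n p * (g p * \<phi> p) \<partial>lebesgue_on G)" for n
    unfolding Hm1_pair_def Dv_time_mult(1)[OF \<phi> \<kappa>(1) \<kappa>(4)] by (simp add: mult_ac)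
  then show ?thesis unfolding Hm1_pair_def[of G F g \<phi>]
    by (simp only:) (intro tendsto_intros integral_cutoff_tendsto[OF G] i \<kappa> lim)
qed

definition kup :: "real \<Rightarrow> nat \<Rightarrow> ('d::finite, 'd1::finite) pt \<Rightarrow> real" where
  "kup S n p = step (real (Suc n) * (fst p + (- S)) + (-1))"

definition kdn :: "real \<Rightarrow> nat \<Rightarrow> ('d::finite, 'd1::finite) pt \<Rightarrow> real" where
  "kdn S n p = step ((- real (Suc n)) * (fst p + (- S)) + (-1))"

lemma time_cutoff:
  fixes p :: "('d::finite, 'd1::finite) pt"
  defines "k \<equiv> \<lambda>c S (p::('d, 'd1) pt). step (c * (fst p + (- S)) + (-1))"
  shows "smooth_fn (k c S)" "Dv (k c S) p = 0" "0 \<le> k c S p" "k c S p \<le> 1"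
proof -
  have s: "smooth_fn (\<lambda>x. step (c * x + (-1)))"
    by (rule smooth_fn_affine(1)[OF smooth_fn_step bounded_linear_mult_right])
  show "smooth_fn (k c S)" unfolding k_def by (rule time_fn(1)[OF s])
  show "Dv (k c S) p = 0" unfolding k_def by (rule time_fn(2)[OF s])
  show "0 \<le> k c S p" "k c S p \<le> 1" by (auto simp: k_def step_nonneg step_le_1)
qed

lemma kup_props:
  shows "smooth_fn (kup S n)" "Dv (kup S n) p = 0" "0 \<le> kup S n p" "kup S n p \<le> 1"
    and "smooth_fn (kdn S n)" "Dv (kdn S n) p = 0" "0 \<le> kdn S n p" "kdn S n p \<le> 1"
  unfolding kup_def[abs_def] kdn_def[abs_def] by (rule time_cutoff)+

text \<open>The shift by -1 inside \<open>step\<close> keeps the cut-off zero up to distance 1/(n+1)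
  from the time S, so that multiplication by it leaves a compact support strictly on one side of
  S.\<close>

lemma kup_0: "fst p < S + 1 / real (Suc n) \<Longrightarrow> kup S n p = 0"
  and kdn_0: "fst p > S - 1 / real (Suc n) \<Longrightarrow> kdn S n p = 0"
  unfolding kup_def kdn_def by (rule step_0, simp add: field_simps)+

lemma kup_lim: "S < fst p \<Longrightarrow> (\<lambda>n. kup S n p) \<longlonglongrightarrow> 1"
  and kdn_lim: "fst p < S \<Longrightarrow> (\<lambda>n. kdn S n p) \<longlonglongrightarrow> 1"
proof -
  have ev: "\<forall>\<^sub>F n in sequentially. 2 \<le> real (Suc n) * x" if "x > 0" for x :: real
  proof -
    obtain N where "2 / x < real N" using reals_Archimedean2 by blast
    then have "2 < real N * x" using that by (simp add: field_simps)
    then have "2 \<le> real (Suc n) * x" if "n \<ge> N" for n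
      using mult_right_mono[of "real N" "real (Suc n)" x] that \<open>x > 0\<close> by linarith
    then show ?thesis unfolding eventually_sequentially by blast
  qed
  show "(\<lambda>n. kup S n p) \<longlonglongrightarrow> 1" if "S < fst p"
  proof (rule tendsto_eventually)
    have "0 < fst p - S" using that by simp
    from ev[OF this] show "\<forall>\<^sub>F n in sequentially. kup S n p = 1"
      by eventually_elim (unfold kup_def, rule step_1, simp)
  qed
  show "(\<lambda>n. kdn S n p) \<longlonglongrightarrow> 1" if "fst p < S"
  proof (rule tendsto_eventually)
    have "0 < S - fst p" using that by simp
    from ev[OF this] show "\<forall>\<^sub>F n in sequentially. kdn S n p = 1"
      by eventually_elim (unfold kdn_def, rule step_1, simp add: algebra_simps)
  qed
qed

lemma Strip_lebesgue [simp]: "Strip S T \<in> sets lebesgue"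
proof -
  have "{p :: ('a, 'b) pt. S < fst p \<and> fst p < T} \<in> sets borel"
    by (intro borel_open open_Collect_conj open_Collect_less continuous_intros)
  then show ?thesis by (simp add: Strip_def)
qed

lemma Strip_subset: "Strip S T \<subseteq> HT (ereal T)" and HT_subset: "S < T \<Longrightarrow> HT (ereal S) \<subseteq> HT (ereal T)"
  by (auto simp: Strip_def HT_def)

lemma test_fn_kup:
  assumes "test_fn (HT (ereal T)) \<phi>"
  shows "test_fn (Strip S T) (\<lambda>p. \<phi> p * kup S n p)"
proof -
  obtain C where "smooth_fn \<phi>" and C: "compact C" "C \<subseteq> HT (ereal T)" "\<And>p. p \<notin> C \<Longrightarrow> \<phi> p = 0"
    using test_fnE[OF assms] by blast
  show ?thesis
  proof (rule test_fnI)
    show "smooth_fn (\<lambda>p. \<phi> p * kup S n p)" by (intro smooth_fn_mult \<open>smooth_fn \<phi>\<close> kup_props)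
    show "compact (C \<inter> {p. S + 1 / real (Suc n) \<le> fst p})"
      by (intro compact_Int_closed C closed_Collect_le continuous_intros)
    show "C \<inter> {p. S + 1 / real (Suc n) \<le> fst p} \<subseteq> Strip S T"
    proof
      fix p assume p: "p \<in> C \<inter> {p. S + 1 / real (Suc n) \<le> fst p}"
      have "S < S + 1 / real (Suc n)" by simp
      also have "\<dots> \<le> fst p" using p by simp
      finally show "p \<in> Strip S T" using p C(2) by (auto simp: Strip_def HT_def)
    qed
    show "\<phi> p * kup S n p = 0" if "p \<notin> C \<inter> {p. S + 1 / real (Suc n) \<le> fst p}" for p
      using that C(3)[of p] kup_0[of p S n] by auto
  qed
qed

lemma test_fn_kdn:
  assumes "test_fn G \<phi>"
  shows "test_fn (HT (ereal S)) (\<lambda>p. \<phi> p * kdn S n p)"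
proof -
  obtain C where "smooth_fn \<phi>" and C: "compact C" "C \<subseteq> G" "\<And>p. p \<notin> C \<Longrightarrow> \<phi> p = 0"
    using test_fnE[OF assms] by blast
  show ?thesis
  proof (rule test_fnI)
    show "smooth_fn (\<lambda>p. \<phi> p * kdn S n p)" by (intro smooth_fn_mult \<open>smooth_fn \<phi>\<close> kup_props)
    show "compact (C \<inter> {p. fst p \<le> S - 1 / real (Suc n)})"
      by (intro compact_Int_closed C closed_Collect_le continuous_intros)
    show "C \<inter> {p. fst p \<le> S - 1 / real (Suc n)} \<subseteq> HT (ereal S)"
    proof
      fix p assume "p \<in> C \<inter> {p. fst p \<le> S - 1 / real (Suc n)}"
      then have "fst p \<le> S - 1 / real (Suc n)" by simp
      also have "\<dots> < S" by simp
      finally show "p \<in> HT (ereal S)" by (simp add: HT_def)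
    qed
    show "\<phi> p * kdn S n p = 0" if "p \<notin> C \<inter> {p. fst p \<le> S - 1 / real (Suc n)}" for p
      using that C(3)[of p] kdn_0[of S n p] by auto
  qed
qed

lemma AE_time_ne: "AE p in lebesgue_on G. fst p \<noteq> S" if "G \<in> sets lebesgue" for G :: "('d::finite, 'd1::finite) pt set"
proof -
  have "negligible {p :: ('d, 'd1) pt. (1, 0, 0) \<bullet> p = S}" by (rule negligible_hyperplane) (simp add: zero_prod_def)
  moreover have "{p :: ('d, 'd1) pt. (1, 0, 0) \<bullet> p = S} = {p. fst p = S}" by (auto simp: inner_prod_def)
  ultimately have "{p :: ('d, 'd1) pt. fst p = S} \<in> null_sets lebesgue" by (simp add: negligible_iff_null_sets)
  then have "AE p in lebesgue. p \<notin> {p :: ('d, 'd1) pt. fst p = S}" by (rule AE_not_in)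
  then show ?thesis using that by (simp add: AE_restrict_space_iff) (auto elim: eventually_mono)
qed

abbreviation (input) ext where "ext S T h \<equiv> (\<lambda>p. if p \<in> Strip S T then h p else 0)"

lemma sqi_ext: "sqi (lebesgue_on (Strip S T)) h \<Longrightarrow> G \<in> sets lebesgue \<Longrightarrow> sqi (lebesgue_on G) (ext S T h)"
  by (rule sqi_extend_zero) auto

lemma integral_ext:
  fixes h :: "('d::finite, 'd1::finite) pt \<Rightarrow> real"
  assumes "\<And>p. p \<in> HT (ereal T) \<Longrightarrow> p \<notin> Strip S T \<Longrightarrow> h p = 0" "\<And>p. p \<in> Strip S T \<Longrightarrow> h p = h' p"
  shows "(\<integral>p. h p \<partial>lebesgue_on (HT (ereal T))) = (\<integral>p. h' p \<partial>lebesgue_on (Strip S T))"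
proof -
  have "(\<integral>p. h p \<partial>lebesgue_on (HT (ereal T))) = (\<integral>p. h p \<partial>lebesgue_on (Strip S T))"
    by (rule integral_lebesgue_on_mono_support[OF Strip_subset]) (use assms in auto)
  also have "\<dots> = (\<integral>p. h' p \<partial>lebesgue_on (Strip S T))"
    by (rule Bochner_Integration.integral_cong) (use assms in auto)
  finally show ?thesis .
qed

context
  fixes \<delta> L :: real and a :: "('d::finite, 'd1::finite) pt \<Rightarrow> real ^ 'd1 ^ 'd1" and b bb c
  assumes \<delta>: "0 < \<delta>" and co: "coeff_hyp \<delta> L a b bb c"
begin

lemma eq_holds_restrict:
  assumes AB: "A \<subseteq> B" "A \<in> sets lebesgue" "B \<in> sets lebesgue"
    and s: "sqi (lebesgue_on B) u" "sqi (lebesgue_on B) w" "sqi (lebesgue_on B) f" "sqi (lebesgue_on B) g"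
    and e: "eq_holds B \<alpha> a b bb c lam f g u w"
  shows "eq_holds A \<alpha> a b bb c lam f g u w"
  unfolding eq_holds_iff[OF \<delta> co AB(2) s[THEN sqi_lebesgue_on_subset[OF AB]]]
proof (intro allI impI)
  fix \<phi> assume \<phi>: "test_fn A \<phi>"
  then show "transport_pair A \<alpha> u \<phi> = Hm1_pair A (\<lambda>p. a p *v w p - u p *\<^sub>R bb p + f p) (\<lambda>p. g p - b p \<bullet> w p - (c p + lam) * u p) \<phi>"
    using e[unfolded eq_holds_iff[OF \<delta> co AB(3) s]] test_fn_mono[OF \<phi> AB(1)]
    unfolding transport_pair_restrict[OF AB \<phi>, symmetric] Hm1_pair_restrict[OF AB \<phi>, symmetric] by blast
qed

lemma eq_holds_cong_AE:
  assumes G: "G \<in> sets lebesgue" and cont: "continuous_on UNIV \<alpha>"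
    and s: "sqi (lebesgue_on G) u" "sqi (lebesgue_on G) w" "sqi (lebesgue_on G) f" "sqi (lebesgue_on G) g"
    and s': "sqi (lebesgue_on G) u'" "sqi (lebesgue_on G) w'" "sqi (lebesgue_on G) f'" "sqi (lebesgue_on G) g'"
    and AE: "AE p in lebesgue_on G. u p = u' p" "AE p in lebesgue_on G. w p = w' p"
      "AE p in lebesgue_on G. f p = f' p" "AE p in lebesgue_on G. g p = g' p"
    and e: "eq_holds G \<alpha> a b bb c lam f g u w"
  shows "eq_holds G \<alpha> a b bb c lam f' g' u' w'"
  unfolding eq_holds_iff[OF \<delta> co G s']
proof (intro allI impI)
  fix \<phi> assume \<phi>: "test_fn G \<phi>"
  have "transport_pair G \<alpha> u' \<phi> = transport_pair G \<alpha> u \<phi>"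
    by (rule transport_pair_cong_AE[OF G cont s(1) s'(1) AE(1) \<phi>, symmetric])
  also have "\<dots> = Hm1_pair G (\<lambda>p. a p *v w p - u p *\<^sub>R bb p + f p) (\<lambda>p. g p - b p \<bullet> w p - (c p + lam) * u p) \<phi>"
    using e[unfolded eq_holds_iff[OF \<delta> co G s]] \<phi> by blast
  also have "\<dots> = Hm1_pair G (\<lambda>p. a p *v w' p - u' p *\<^sub>R bb p + f' p) (\<lambda>p. g' p - b p \<bullet> w' p - (c p + lam) * u' p) \<phi>"
  proof (rule Hm1_pair_cong_AE[OF G sqi_flux_source[OF \<delta> co s] sqi_flux_source[OF \<delta> co s'] _ _ \<phi>])
    show "AE p in lebesgue_on G. a p *v w p - u p *\<^sub>R bb p + f p = a p *v w' p - u' p *\<^sub>R bb p + f' p"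
      using AE(1,2,3) by eventually_elim simp
    show "AE p in lebesgue_on G. g p - b p \<bullet> w p - (c p + lam) * u p = g' p - b p \<bullet> w' p - (c p + lam) * u' p"
      using AE(1,2,4) by eventually_elim simp
  qed
  finally show "transport_pair G \<alpha> u' \<phi> = Hm1_pair G (\<lambda>p. a p *v w' p - u' p *\<^sub>R bb p + f' p) (\<lambda>p. g' p - b p \<bullet> w' p - (c p + lam) * u' p) \<phi>" .
qed

text \<open>Testing with \<phi> \<omega>, where Y (\<phi> \<omega>) = \<omega> Y \<phi> + \<mu>
  \<phi> \<omega>, shifts the zeroth order coefficient by \<mu> and nothing else, as \<omega>
  depends on time alone. Square integrability of the weighted functions is assumed because \<omega>
  may be unbounded on G.\<close>

lemma eq_holds_exp_weight:
  fixes \<mu> r :: real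
  defines "\<omega> \<equiv> \<lambda>p::('d, 'd1) pt. exp (\<mu> * (fst p + r))"
  assumes G: "G \<in> sets lebesgue" and cont: "continuous_on UNIV \<alpha>"
    and s: "sqi (lebesgue_on G) u" "sqi (lebesgue_on G) w" "sqi (lebesgue_on G) f" "sqi (lebesgue_on G) g"
    and s': "sqi (lebesgue_on G) (\<lambda>p. \<omega> p * u p)" "sqi (lebesgue_on G) (\<lambda>p. \<omega> p *\<^sub>R w p)"
      "sqi (lebesgue_on G) (\<lambda>p. \<omega> p *\<^sub>R f p)" "sqi (lebesgue_on G) (\<lambda>p. \<omega> p * g p)"
    and weak: "weak_Dv G u w" and e: "eq_holds G \<alpha> a b bb c lam f g u w"
  shows "weak_Dv G (\<lambda>p. \<omega> p * u p) (\<lambda>p. \<omega> p *\<^sub>R w p)"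
    and "eq_holds G \<alpha> a b bb c (lam - \<mu>) (\<lambda>p. \<omega> p *\<^sub>R f p) (\<lambda>p. \<omega> p * g p) (\<lambda>p. \<omega> p * u p) (\<lambda>p. \<omega> p *\<^sub>R w p)"
proof -
  let ?M = "lebesgue_on G"
  have es: "smooth_fn (\<lambda>x::real. exp (\<mu> * x))" by (rule smooth_fn_exp)
  have \<omega>s: "smooth_fn \<omega>" and \<omega>v: "Dv \<omega> p = 0" and \<omega>x: "Dx \<omega> p = 0" for p
    unfolding \<omega>_def by (rule time_fn[OF es])+
  have \<omega>t: "Dt \<omega> p = \<mu> * \<omega> p" for p
  proof -
    have "pd (\<lambda>x. exp (\<mu> * x)) 1 x = \<mu> * exp (\<mu> * x)" for x
      by (rule pd_eqI[where f' = "\<lambda>h. \<mu> * exp (\<mu> * x) * h", THEN trans]) (auto intro!: derivative_eq_intros)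
    then show ?thesis unfolding \<omega>_def time_fn(4)[OF es] by simp
  qed
  show "weak_Dv G (\<lambda>p. \<omega> p * u p) (\<lambda>p. \<omega> p *\<^sub>R w p)"
    unfolding weak_Dv_def
  proof (intro allI impI)
    fix \<phi> i assume \<phi>: "test_fn G \<phi>"
    have t: "test_fn G (\<lambda>p. \<phi> p * \<omega> p)" by (rule test_fn_mult(1)[OF \<phi> \<omega>s])
    have "(\<integral>p. u p * pd (\<lambda>p. \<phi> p * \<omega> p) (0, 0, axis i 1) p \<partial>?M) = - (\<integral>p. w p $ i * (\<phi> p * \<omega> p) \<partial>?M)"
      using weak t unfolding weak_Dv_def by blast
    then show "(\<integral>p. \<omega> p * u p * pd \<phi> (0, 0, axis i 1) p \<partial>?M) = - (\<integral>p. (\<omega> p *\<^sub>R w p) $ i * \<phi> p \<partial>?M)"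
      unfolding Dv_time_mult(2)[OF test_fn_smooth[OF \<phi>] \<omega>s \<omega>v] by (simp add: mult_ac)
  qed
  show "eq_holds G \<alpha> a b bb c (lam - \<mu>) (\<lambda>p. \<omega> p *\<^sub>R f p) (\<lambda>p. \<omega> p * g p) (\<lambda>p. \<omega> p * u p) (\<lambda>p. \<omega> p *\<^sub>R w p)"
    unfolding eq_holds_iff[OF \<delta> co G s']
  proof (intro allI impI)
    fix \<phi> assume \<phi>: "test_fn G \<phi>"
    have \<phi>s: "smooth_fn \<phi>" by (rule test_fn_smooth[OF \<phi>])
    have t: "test_fn G (\<lambda>p. \<phi> p * \<omega> p)" by (rule test_fn_mult(1)[OF \<phi> \<omega>s])
    note fs = sqi_flux_source(2)[OF \<delta> co s, where lam = lam]
    have i1: "integrable ?M (\<lambda>p. \<omega> p * u p * Y \<alpha> \<phi> p)" by (rule cc_integrable_mult[OF cc_Y[OF \<phi> cont] G s'(1)])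
    have i2: "integrable ?M (\<lambda>p. \<mu> * (\<omega> p * u p * \<phi> p))"
      by (intro integrable_mult_right cc_integrable_mult[OF cc_test_fn[OF \<phi>] G s'(1)])
    have i3: "integrable ?M (\<lambda>p. (g p - b p \<bullet> w p - (c p + lam) * u p) * (\<phi> p * \<omega> p))"
      by (rule cc_integrable_mult[OF cc_test_fn[OF t] G fs])
    have Yw: "Y \<alpha> (\<lambda>p. \<phi> p * \<omega> p) p = \<omega> p * Y \<alpha> \<phi> p + \<phi> p * (\<mu> * \<omega> p)" for p
      unfolding Y_mult[OF \<phi>s \<omega>s] \<omega>t \<omega>x by simp
    have 1: "transport_pair G \<alpha> u (\<lambda>p. \<phi> p * \<omega> p) = - ((\<integral>p. \<omega> p * u p * Y \<alpha> \<phi> p \<partial>?M) + (\<integral>p. \<mu> * (\<omega> p * u p * \<phi> p) \<partial>?M))"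
      unfolding transport_pair_def Yw Bochner_Integration.integral_add[OF i1 i2, symmetric]
      by (intro arg_cong[where f = uminus] Bochner_Integration.integral_cong refl) (simp add: algebra_simps)
    have 2: "transport_pair G \<alpha> u (\<lambda>p. \<phi> p * \<omega> p)
      = Hm1_pair G (\<lambda>p. a p *v w p - u p *\<^sub>R bb p + f p) (\<lambda>p. g p - b p \<bullet> w p - (c p + lam) * u p) (\<lambda>p. \<phi> p * \<omega> p)"
      using e[unfolded eq_holds_iff[OF \<delta> co G s]] t by blast
    have 3: "(a p *v (\<omega> p *\<^sub>R w p) - (\<omega> p * u p) *\<^sub>R bb p + \<omega> p *\<^sub>R f p) \<bullet> Dv \<phi> p
      = (a p *v w p - u p *\<^sub>R bb p + f p) \<bullet> Dv (\<lambda>p. \<phi> p * \<omega> p) p" for p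
      unfolding Dv_time_mult(1)[OF \<phi>s \<omega>s \<omega>v]
      by (simp add: matrix_vector_mult_scaleR inner_add_left inner_diff_left algebra_simps)
    have 4: "(\<integral>p. (\<omega> p * g p - b p \<bullet> (\<omega> p *\<^sub>R w p) - (c p + (lam - \<mu>)) * (\<omega> p * u p)) * \<phi> p \<partial>?M)
      = (\<integral>p. (g p - b p \<bullet> w p - (c p + lam) * u p) * (\<phi> p * \<omega> p) \<partial>?M) + (\<integral>p. \<mu> * (\<omega> p * u p * \<phi> p) \<partial>?M)"
      unfolding Bochner_Integration.integral_add[OF i3 i2, symmetric]
      by (intro Bochner_Integration.integral_cong refl) (simp add: algebra_simps)
    show "transport_pair G \<alpha> (\<lambda>p. \<omega> p * u p) \<phi> = Hm1_pair G (\<lambda>p. a p *v (\<omega> p *\<^sub>R w p) - (\<omega> p * u p) *\<^sub>R bb p + \<omega> p *\<^sub>R f p)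
        (\<lambda>p. \<omega> p * g p - b p \<bullet> (\<omega> p *\<^sub>R w p) - (c p + (lam - \<mu>)) * (\<omega> p * u p)) \<phi>"
      using 1 2 4 unfolding transport_pair_def[of G \<alpha> "\<lambda>p. \<omega> p * u p"] Hm1_pair_def 3 by simp
  qed
qed

text \<open>Cut-offs in time do not interact with \<open>D\<^sub>v\<close>, so the two representations of the transport term,
  for \<open>t < S\<close> and for \<open>t > S\<close>, may be glued along \<open>t = S\<close>.\<close>

lemma cauchy_sol_extend:
  assumes hol: "holder_alpha \<alpha>" and ST: "S < T"
    and f: "sqi (lebesgue_on (Strip S T)) f" and g: "sqi (lebesgue_on (Strip S T)) g"
    and sol: "cauchy_sol S T \<alpha> a b bb c f g u w"
  shows "weak_Dv (HT (ereal T)) (ext S T u) (ext S T w)"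
    and "eq_holds (HT (ereal T)) \<alpha> a b bb c 0 (ext S T f) (ext S T g) (ext S T u) (ext S T w)"
    and "sqi (lebesgue_on (Strip S T)) u" "sqi (lebesgue_on (Strip S T)) w"
proof -
  let ?H = "HT (ereal T) :: ('d, 'd1) pt set" and ?S = "Strip S T :: ('d, 'd1) pt set"
  obtain \<theta> K where "0 < \<theta>" "\<theta> \<le> 1" "K \<ge> 0" "\<And>v v'. norm (\<alpha> v - \<alpha> v') \<le> K * norm (v - v') powr \<theta>"
    and cont: "continuous_on UNIV \<alpha>"
    by (rule holder_alphaE[OF hol]) (rule that)
  obtain ut wt where S2s: "S2 ?S \<alpha> u w" and es: "eq_holds ?S \<alpha> a b bb c 0 f g u w"
    and S2t: "S2 ?H \<alpha> ut wt" and utu: "\<And>p. p \<in> ?S \<Longrightarrow> ut p = u p" and ut0: "\<And>p. fst p < S \<Longrightarrow> ut p = 0"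
    using sol unfolding cauchy_sol_def by blast
  show u: "sqi (lebesgue_on ?S) u" and w: "sqi (lebesgue_on ?S) w"
    using S2s by (auto simp: S2_def L2_sqi L2v_sqi)
  have weak: "weak_Dv ?S u w" using S2s by (simp add: S2_def)
  have kup_AE: "AE p in lebesgue_on ?S. (\<lambda>n. kup S n p) \<longlonglongrightarrow> 1"
    by (rule AE_I2) (auto simp: Strip_def intro: kup_lim)
  show "weak_Dv ?H (ext S T u) (ext S T w)"
    unfolding weak_Dv_def
  proof (intro allI impI)
    fix \<phi> :: "('d, 'd1) pt \<Rightarrow> real" and i assume \<phi>: "test_fn ?H \<phi>"
    have \<phi>s: "smooth_fn \<phi>" by (rule test_fn_smooth[OF \<phi>])
    let ?e = "(0, 0, axis i 1) :: ('d, 'd1) pt"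
    have i1: "integrable (lebesgue_on ?S) (\<lambda>p. u p * pd \<phi> ?e p)" by (rule cc_integrable_mult[OF cc_pd[OF \<phi>] Strip_lebesgue u])
    have i2: "integrable (lebesgue_on ?S) (\<lambda>p. w p $ i * \<phi> p)"
      by (rule cc_integrable_mult[OF cc_test_fn[OF \<phi>] Strip_lebesgue sqi_nth[OF w]])
    have e: "(\<integral>p. kup S n p * (u p * pd \<phi> ?e p) \<partial>lebesgue_on ?S) = - (\<integral>p. kup S n p * (w p $ i * \<phi> p) \<partial>lebesgue_on ?S)" for n
    proof -
      have "(\<integral>p. u p * pd (\<lambda>p. \<phi> p * kup S n p) ?e p \<partial>lebesgue_on ?S) = - (\<integral>p. w p $ i * (\<phi> p * kup S n p) \<partial>lebesgue_on ?S)"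
        using weak test_fn_kup[OF \<phi>] unfolding weak_Dv_def by blast
      then show ?thesis unfolding Dv_time_mult(2)[OF \<phi>s kup_props(1,2)] by (simp add: mult_ac)
    qed
    have "(\<lambda>n. \<integral>p. kup S n p * (u p * pd \<phi> ?e p) \<partial>lebesgue_on ?S) \<longlonglongrightarrow> (\<integral>p. u p * pd \<phi> ?e p \<partial>lebesgue_on ?S)"
      by (intro integral_cutoff_tendsto[OF Strip_lebesgue i1] kup_props kup_AE)
    moreover have "(\<lambda>n. - (\<integral>p. kup S n p * (w p $ i * \<phi> p) \<partial>lebesgue_on ?S)) \<longlonglongrightarrow> - (\<integral>p. w p $ i * \<phi> p \<partial>lebesgue_on ?S)"
      by (intro tendsto_minus integral_cutoff_tendsto[OF Strip_lebesgue i2] kup_props kup_AE)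
    ultimately have "(\<integral>p. u p * pd \<phi> ?e p \<partial>lebesgue_on ?S) = - (\<integral>p. w p $ i * \<phi> p \<partial>lebesgue_on ?S)"
      unfolding e using LIMSEQ_unique by blast
    moreover have "(\<integral>p. ext S T u p * pd \<phi> ?e p \<partial>lebesgue_on ?H) = (\<integral>p. u p * pd \<phi> ?e p \<partial>lebesgue_on ?S)"
      by (rule integral_ext) auto
    moreover have "(\<integral>p. ext S T w p $ i * \<phi> p \<partial>lebesgue_on ?H) = (\<integral>p. w p $ i * \<phi> p \<partial>lebesgue_on ?S)"
      by (rule integral_ext) auto
    ultimately show "(\<integral>p. ext S T u p * pd \<phi> ?e p \<partial>lebesgue_on ?H) = - (\<integral>p. ext S T w p $ i * \<phi> p \<partial>lebesgue_on ?H)"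
      by simp
  qed
  have ut: "sqi (lebesgue_on ?H) ut" using S2t by (auto simp: S2_def L2_sqi)
  \<comment> \<open>This representation on t < T comes only from membership in the solution class;
    it is a priori unrelated to the flux and the source of the equation on the strip.\<close>
  obtain F1 g1 where F1: "sqi (lebesgue_on ?H) F1" and g1: "sqi (lebesgue_on ?H) g1"
    and eqt: "\<And>\<phi>. test_fn ?H \<phi> \<Longrightarrow> transport_pair ?H \<alpha> ut \<phi> = Hm1_pair ?H F1 g1 \<phi>"
    using S2t unfolding S2_def L2_sqi L2v_sqi by blast
  define F where "F p = a p *v w p - u p *\<^sub>R bb p + f p" for p
  define G where "G p = g p - b p \<bullet> w p - (c p + 0) * u p" for p
  have F: "sqi (lebesgue_on ?S) F" and G: "sqi (lebesgue_on ?S) G"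
    unfolding F_def G_def by (rule sqi_flux_source[OF \<delta> co u w f g])+
  have eqs: "transport_pair ?S \<alpha> u \<phi> = Hm1_pair ?S F G \<phi>" if "test_fn ?S \<phi>" for \<phi>
    using es[unfolded eq_holds_iff[OF \<delta> co Strip_lebesgue u w f g]] that unfolding F_def G_def by blast
  have key: "Hm1_pair ?H F1 g1 \<phi> = Hm1_pair ?S F G \<phi>" if \<phi>: "test_fn ?H \<phi>" for \<phi>
  proof -
    have \<phi>s: "smooth_fn \<phi>" by (rule test_fn_smooth[OF \<phi>])
    \<comment> \<open>The sum of the two one-sided cut-offs tends to 1 off the null set t = S. At
      every point at most one of them is nonzero, which keeps the sum below 1.\<close>
    define \<kappa> where "\<kappa> n p = kup S n p + kdn S n p" for n and p :: "('d, 'd1) pt"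
    have one: "kup S n p = 0 \<or> kdn S n p = 0" for n and p :: "('d, 'd1) pt"
    proof -
      have "S - 1 / real (Suc n) < S + 1 / real (Suc n)" by simp
      then show ?thesis using kup_0[of p S n] kdn_0[of S n p] by linarith
    qed
    have \<kappa>: "smooth_fn (\<kappa> n)" "0 \<le> \<kappa> n p" "\<kappa> n p \<le> 1" "Dv (\<kappa> n) p = 0" for n p
    proof -
      show "smooth_fn (\<kappa> n)" unfolding \<kappa>_def[abs_def] by (intro smooth_fn_add kup_props)
      show "0 \<le> \<kappa> n p" "\<kappa> n p \<le> 1" using one[of n p] kup_props(3,4,7,8)[of S n p] by (auto simp: \<kappa>_def)
      show "Dv (\<kappa> n) p = 0"
        using Dv_lin[OF kup_props(1,5), of S n 1 S n p] kup_props(2,6)[of S n p] by (simp add: \<kappa>_def[abs_def])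
    qed
    have lim: "AE p in lebesgue_on ?H. (\<lambda>n. \<kappa> n p) \<longlonglongrightarrow> 1"
      using AE_time_ne[OF HT_lebesgue, of S]
    proof eventually_elim
      case (elim p)
      have k0: "kdn S n p = 0" if "S < fst p" for n
        by (rule kdn_0) (use that in \<open>auto intro: less_trans[rotated]\<close>)
      have k1: "kup S n p = 0" if "fst p < S" for n
        by (rule kup_0) (use that in \<open>auto intro: less_trans\<close>)
      show ?case
      proof (cases "S < fst p")
        case True
        then show ?thesis using kup_lim[of S p] by (simp add: \<kappa>_def k0)
      next
        case False
        then have "fst p < S" using elim by simp
        then show ?thesis using kdn_lim[of p S] by (simp add: \<kappa>_def k1)
      qed
    qed
    have l1: "(\<lambda>n. Hm1_pair ?H F1 g1 (\<lambda>p. \<phi> p * \<kappa> n p)) \<longlonglongrightarrow> Hm1_pair ?H F1 g1 \<phi>"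
      by (rule Hm1_pair_cutoff_tendsto[OF HT_lebesgue F1 g1 \<kappa> lim
            cc_integrable_inner[OF cc_Dv[OF \<phi>] HT_lebesgue F1] cc_integrable_mult[OF cc_test_fn[OF \<phi>] HT_lebesgue g1] \<phi>s])
    have l2: "(\<lambda>n. Hm1_pair ?S F G (\<lambda>p. \<phi> p * kup S n p)) \<longlonglongrightarrow> Hm1_pair ?S F G \<phi>"
      by (rule Hm1_pair_cutoff_tendsto[OF Strip_lebesgue F G kup_props(1,3,4,2) kup_AE
            cc_integrable_inner[OF cc_Dv[OF \<phi>] Strip_lebesgue F] cc_integrable_mult[OF cc_test_fn[OF \<phi>] Strip_lebesgue G] \<phi>s])
    \<comment> \<open>Below S the extension is 0, hence so is the pairing; above S the extension is
      u, and the equation on the strip takes over.\<close>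
    have l3: "Hm1_pair ?H F1 g1 (\<lambda>p. \<phi> p * \<kappa> n p) = Hm1_pair ?S F G (\<lambda>p. \<phi> p * kup S n p)" for n
    proof -
      have up: "test_fn ?S (\<lambda>p. \<phi> p * kup S n p)" by (rule test_fn_kup[OF \<phi>])
      have up': "test_fn ?H (\<lambda>p. \<phi> p * kup S n p)" by (rule test_fn_mono[OF up Strip_subset])
      have dn: "test_fn (HT (ereal S)) (\<lambda>p. \<phi> p * kdn S n p)" by (rule test_fn_kdn[OF \<phi>])
      have dn': "test_fn ?H (\<lambda>p. \<phi> p * kdn S n p)" by (rule test_fn_mono[OF dn HT_subset[OF ST]])
      have "Hm1_pair ?H F1 g1 (\<lambda>p. \<phi> p * \<kappa> n p) = Hm1_pair ?H F1 g1 (\<lambda>p. \<phi> p * kup S n p + 1 * (\<phi> p * kdn S n p))"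
        by (simp add: \<kappa>_def distrib_left)
      also have "\<dots> = Hm1_pair ?H F1 g1 (\<lambda>p. \<phi> p * kup S n p) + Hm1_pair ?H F1 g1 (\<lambda>p. \<phi> p * kdn S n p)"
        unfolding Hm1_pair_lin[OF HT_lebesgue F1 g1 up' dn'] by simp
      also have "Hm1_pair ?H F1 g1 (\<lambda>p. \<phi> p * kdn S n p) = transport_pair (HT (ereal S)) \<alpha> ut (\<lambda>p. \<phi> p * kdn S n p)"
        unfolding eqt[OF dn', symmetric] by (rule transport_pair_restrict[OF HT_subset[OF ST] HT_lebesgue HT_lebesgue dn])
      also have "\<dots> = transport_pair (HT (ereal S)) \<alpha> (\<lambda>p. 0) (\<lambda>p. \<phi> p * kdn S n p)"
        unfolding transport_pair_def
        by (intro arg_cong[where f = uminus] Bochner_Integration.integral_cong refl) (simp add: ut0 HT_def)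
      also have "\<dots> = 0" by (simp add: transport_pair_def)
      also have "Hm1_pair ?H F1 g1 (\<lambda>p. \<phi> p * kup S n p) = transport_pair ?S \<alpha> ut (\<lambda>p. \<phi> p * kup S n p)"
        unfolding eqt[OF up', symmetric] by (rule transport_pair_restrict[OF Strip_subset Strip_lebesgue HT_lebesgue up])
      also have "\<dots> = transport_pair ?S \<alpha> u (\<lambda>p. \<phi> p * kup S n p)"
        unfolding transport_pair_def
        by (intro arg_cong[where f = uminus] Bochner_Integration.integral_cong refl) (simp add: utu)
      also have "\<dots> = Hm1_pair ?S F G (\<lambda>p. \<phi> p * kup S n p)" by (rule eqs[OF up])
      finally show ?thesis by simp
    qed
    show ?thesis by (rule LIMSEQ_unique[OF l1[unfolded l3] l2])
  qed
  show "eq_holds ?H \<alpha> a b bb c 0 (ext S T f) (ext S T g) (ext S T u) (ext S T w)"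
    unfolding eq_holds_iff[OF \<delta> co HT_lebesgue sqi_ext[OF u HT_lebesgue] sqi_ext[OF w HT_lebesgue]
      sqi_ext[OF f HT_lebesgue] sqi_ext[OF g HT_lebesgue]]
  proof (intro allI impI)
    fix \<phi> assume \<phi>: "test_fn ?H \<phi>"
    have AEu: "AE p in lebesgue_on ?H. ext S T u p = ut p"
    proof -
      have "AE p in lebesgue_on ?H. p \<in> ?H" by (rule AE_I2) simp
      with AE_time_ne[OF HT_lebesgue, of S] show ?thesis
      proof eventually_elim
        case (elim p)
        show ?case
        proof (cases "p \<in> ?S")
          case False
          then have "fst p < S" using elim by (auto simp: Strip_def HT_def)
          then show ?thesis using False ut0 by simp
        qed (simp add: utu)
      qed
    qed
    have "transport_pair ?H \<alpha> (ext S T u) \<phi> = transport_pair ?H \<alpha> ut \<phi>"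
      by (rule transport_pair_cong_AE[OF HT_lebesgue cont sqi_ext[OF u HT_lebesgue] ut AEu \<phi>])
    also have "\<dots> = Hm1_pair ?S F G \<phi>" unfolding eqt[OF \<phi>] by (rule key[OF \<phi>])
    also have "\<dots> = Hm1_pair ?H (\<lambda>p. a p *v ext S T w p - ext S T u p *\<^sub>R bb p + ext S T f p)
       (\<lambda>p. ext S T g p - b p \<bullet> ext S T w p - (c p + 0) * ext S T u p) \<phi>"
      unfolding Hm1_pair_def
      by (intro arg_cong2[where f = plus] arg_cong[where f = uminus] integral_ext[symmetric])
         (auto simp: F_def G_def)
    finally show "transport_pair ?H \<alpha> (ext S T u) \<phi> = Hm1_pair ?H (\<lambda>p. a p *v ext S T w p - ext S T u p *\<^sub>R bb p + ext S T f p)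
       (\<lambda>p. ext S T g p - b p \<bullet> ext S T w p - (c p + 0) * ext S T u p) \<phi>" .
  qed
qed

end

subsection \<open>The Cauchy problem\<close>

lemma sqrt_sq_le:
  assumes "sqi M f" "g \<in> borel_measurable M" "\<And>x. x \<in> space M \<Longrightarrow> norm (g x) \<le> C * norm (f x)" "C \<ge> 0"
  shows "sqrt (sq M g) \<le> C * sqrt (sq M f)"
proof -
  have g: "sqi M g" by (rule sqi_dominated[OF assms(1-3)])
  have "sq M g \<le> (\<integral>x. C\<^sup>2 * (norm (f x))\<^sup>2 \<partial>M)"
    unfolding sq_def
  proof (rule integral_mono)
    show "(norm (g x))\<^sup>2 \<le> C\<^sup>2 * (norm (f x))\<^sup>2" if "x \<in> space M" for x
      using power_mono[OF assms(3)[OF that] norm_ge_zero, of 2] by (simp add: power_mult_distrib)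
  qed (use g assms(1) in \<open>auto simp: sqi_def\<close>)
  also have "\<dots> = C\<^sup>2 * sq M f" by (simp add: sq_def)
  finally have "sqrt (sq M g) \<le> sqrt (C\<^sup>2 * sq M f)" by (rule real_sqrt_le_mono)
  then show ?thesis using assms(4) by (simp add: real_sqrt_mult)
qed

lemma sq_ext: "sq (lebesgue_on (HT (ereal T))) (ext S T h) = sq (lebesgue_on (Strip S T)) h"
  unfolding sq_def by (rule integral_ext) auto

text \<open>On the strip 0 < t - S < T - S, so the exponent is bounded by 0 for \<nu> \<le> 0 and by
  \<nu> (T - S) otherwise. One bound thus serves for applying and for removing the weight.\<close>

lemma exp_weight_strip:
  fixes h :: "('d::finite, 'd1::finite) pt \<Rightarrow> 'b::euclidean_space"
  assumes h: "sqi (lebesgue_on (Strip S T)) h"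
  shows "sqi (lebesgue_on (Strip S T)) (\<lambda>p. exp (\<nu> * (fst p + - S)) *\<^sub>R h p)"
    and "sqrt (sq (lebesgue_on (Strip S T)) (\<lambda>p. exp (\<nu> * (fst p + - S)) *\<^sub>R h p))
       \<le> exp (max 0 (\<nu> * (T - S))) * sqrt (sq (lebesgue_on (Strip S T)) h)"
proof -
  let ?M = "lebesgue_on (Strip S T) :: ('d, 'd1) pt measure"
  have m: "(\<lambda>p. exp (\<nu> * (fst p + - S)) *\<^sub>R h p) \<in> borel_measurable ?M"
    by (intro borel_measurable_scaleR sqi_measurable[OF h] smooth_measurable_on Strip_lebesgue time_fn(1) smooth_fn_exp)
  have le: "norm (exp (\<nu> * (fst p + - S)) *\<^sub>R h p) \<le> exp (max 0 (\<nu> * (T - S))) * norm (h p)" if "p \<in> space ?M" for p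
  proof -
    have p: "0 \<le> fst p - S" "fst p - S \<le> T - S" using that by (auto simp: Strip_def)
    have "\<nu> * (fst p - S) \<le> max 0 (\<nu> * (T - S))"
    proof (cases "\<nu> \<ge> 0")
      case True
      then show ?thesis using mult_left_mono[OF p(2) True] by simp
    next
      case False
      then show ?thesis using p(1) by (simp add: mult_nonpos_nonneg le_max_iff_disj)
    qed
    then show ?thesis by (simp add: mult_right_mono)
  qed
  show "sqi ?M (\<lambda>p. exp (\<nu> * (fst p + - S)) *\<^sub>R h p)" by (rule sqi_dominated[OF h m le])
  show "sqrt (sq ?M (\<lambda>p. exp (\<nu> * (fst p + - S)) *\<^sub>R h p)) \<le> exp (max 0 (\<nu> * (T - S))) * sqrt (sq ?M h)"
    by (rule sqrt_sq_le[OF h m le]) auto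
qed

lemma exp_weight_ext:
  fixes h :: "('d::finite, 'd1::finite) pt \<Rightarrow> 'b::euclidean_space"
  assumes h: "sqi (lebesgue_on (Strip S T)) h" and G: "G \<in> sets lebesgue"
  shows "sqi (lebesgue_on G) (\<lambda>p. exp (\<nu> * (fst p + - S)) *\<^sub>R ext S T h p)"
  by (rule sqi_cong[OF _ sqi_ext[OF exp_weight_strip(1)[OF h] G]]) auto

context
  fixes \<delta> L :: real and a :: "('d::finite, 'd1::finite) pt \<Rightarrow> real ^ 'd1 ^ 'd1" and b bb c
  assumes \<delta>: "0 < \<delta>" and co: "coeff_hyp \<delta> L a b bb c"
begin

text \<open>The data, extended by 0 and damped by exp (-\<mu> (t - S)), are solved for on t < T with
  \<mu> added to the zeroth order coefficient, and the solution is multiplied back. Damping costs a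
  factor 1 on the strip and undamping exp (\<mu> (T - S)), the only source of dependence on T -
  S.\<close>

lemma cauchy_problem:
  fixes \<mu> :: real
  defines "\<mu> \<equiv> 4 * (L\<^sup>2 / \<delta> + L) + 1"
  assumes hol: "holder_alpha \<alpha>" and \<delta>1: "\<delta> < 1" and ST: "S < T"
    and f: "sqi (lebesgue_on (Strip S T)) f" and g: "sqi (lebesgue_on (Strip S T)) g"
  shows "\<exists>u w. cauchy_sol S T \<alpha> a b bb c f g u w
    \<and> (\<forall>u' w'. cauchy_sol S T \<alpha> a b bb c f g u' w' \<longrightarrow> (AE p in lebesgue_on (Strip S T). u' p = u p))
    \<and> nrm (Strip S T) u + nrmv (Strip S T) w
        \<le> (exp (\<mu> * (T - S)) * (4 / \<delta>)) * nrmv (Strip S T) f + (exp (\<mu> * (T - S)) * (4 / \<delta>)) * nrm (Strip S T) g"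
proof -
  let ?H = "HT (ereal T) :: ('d, 'd1) pt set" and ?S = "Strip S T :: ('d, 'd1) pt set"
    and ?P = "HT (ereal S) :: ('d, 'd1) pt set"
  obtain \<theta> K where "0 < \<theta>" "\<theta> \<le> 1" "K \<ge> 0" "\<And>v v'. norm (\<alpha> v - \<alpha> v') \<le> K * norm (v - v') powr \<theta>"
    and cont: "continuous_on UNIV \<alpha>"
    by (rule holder_alphaE[OF hol]) (rule that)
  have lam: "\<mu> \<ge> 4 * (L\<^sup>2 / \<delta> + L) + 1" by (simp add: \<mu>_def)
  note lam0 = lam_props[OF \<delta> co lam]
  have \<mu>1: "\<mu> \<ge> 1"
  proof -
    have "0 \<le> L\<^sup>2 / \<delta>" using \<delta> by simp
    then show ?thesis unfolding \<mu>_def using coeff_bounds(7)[OF \<delta> co] by simp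
  qed
  have PH: "?P \<subseteq> ?H" by (rule HT_subset[OF ST])
  define f1 where "f1 p = exp (- \<mu> * (fst p + - S)) *\<^sub>R ext S T f p" for p
  define g1 where "g1 p = exp (- \<mu> * (fst p + - S)) *\<^sub>R ext S T g p" for p
  have f1: "sqi (lebesgue_on ?H) f1" and g1: "sqi (lebesgue_on ?H) g1"
    unfolding f1_def g1_def by (rule exp_weight_ext[OF f HT_lebesgue], rule exp_weight_ext[OF g HT_lebesgue])
  obtain u0 w0 where u0: "sqi (lebesgue_on ?H) u0" and w0: "sqi (lebesgue_on ?H) w0" and wk0: "weak_Dv ?H u0 w0"
    and e0: "eq_holds ?H \<alpha> a b bb c \<mu> f1 g1 u0 w0"
    using solution_exists[OF \<delta> co HT_lebesgue cont lam f1 g1] by blast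
  note sub = sqi_lebesgue_on_subset[OF PH HT_lebesgue HT_lebesgue]
  \<comment> \<open>Causality: on t < S the data vanish, and the estimate on this smaller half space
    forces the solution to be 0 there.\<close>
  have "\<delta> / 2 * sq (lebesgue_on ?P) w0 + \<mu> / 2 * sq (lebesgue_on ?P) u0
     \<le> sq (lebesgue_on ?P) f1 / \<delta> + sq (lebesgue_on ?P) g1 / \<mu>"
    by (rule energy_estimate[OF \<delta> co hol lam sub[OF u0] sub[OF w0] sub[OF f1] sub[OF g1]
          weak_Dv_restrict[OF PH HT_lebesgue HT_lebesgue wk0]
          eq_holds_restrict[OF \<delta> co PH HT_lebesgue HT_lebesgue u0 w0 f1 g1 e0]])
  moreover have "sq (lebesgue_on ?P) f1 = 0"
  proof -
    have "sq (lebesgue_on ?P) f1 = (\<integral>p. 0 \<partial>lebesgue_on ?P)"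
      unfolding sq_def by (intro Bochner_Integration.integral_cong refl) (auto simp: f1_def Strip_def HT_def)
    then show ?thesis by simp
  qed
  moreover have "sq (lebesgue_on ?P) g1 = 0"
  proof -
    have "sq (lebesgue_on ?P) g1 = (\<integral>p. 0 \<partial>lebesgue_on ?P)"
      unfolding sq_def by (intro Bochner_Integration.integral_cong refl) (auto simp: g1_def Strip_def HT_def)
    then show ?thesis by simp
  qed
  ultimately have "\<delta> / 2 * sq (lebesgue_on ?P) w0 + \<mu> / 2 * sq (lebesgue_on ?P) u0 \<le> 0" by simp
  moreover have "0 \<le> \<delta> / 2 * sq (lebesgue_on ?P) w0" "0 \<le> \<mu> / 2 * sq (lebesgue_on ?P) u0"
    using \<delta> lam0 by (auto intro!: mult_nonneg_nonneg)
  ultimately have "\<delta> / 2 * sq (lebesgue_on ?P) w0 = 0" "\<mu> / 2 * sq (lebesgue_on ?P) u0 = 0" by linarith+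
  then have "sq (lebesgue_on ?P) w0 = 0" "sq (lebesgue_on ?P) u0 = 0" using \<delta> lam0 by auto
  then have z: "AE p in lebesgue_on ?P. w0 p = 0" "AE p in lebesgue_on ?P. u0 p = 0"
    using sq_AE_zero[OF sub[OF w0]] sq_AE_zero[OF sub[OF u0]] by auto
  \<comment> \<open>The solution is 0 before S only almost everywhere; cutting it off outside the
    strip makes it 0 at every such point, as \<open>cauchy_sol\<close> requires.\<close>
  define u1 where "u1 = ext S T u0"
  define w1 where "w1 = ext S T w0"
  have u0S: "sqi (lebesgue_on ?S) u0" and w0S: "sqi (lebesgue_on ?S) w0"
    using sqi_lebesgue_on_subset[OF Strip_subset Strip_lebesgue HT_lebesgue] u0 w0 by auto
  have u1: "sqi (lebesgue_on ?H) u1" and w1: "sqi (lebesgue_on ?H) w1"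
    unfolding u1_def w1_def by (rule sqi_ext[OF u0S HT_lebesgue], rule sqi_ext[OF w0S HT_lebesgue])
  have AE: "AE p in lebesgue_on ?H. h p = ext S T h p" if "AE p in lebesgue_on ?P. h p = 0"
    for h :: "('d, 'd1) pt \<Rightarrow> 'b::real_vector"
  proof -
    have 1: "AE p in lebesgue. p \<in> ?P \<longrightarrow> h p = 0" using that by (simp add: AE_restrict_space_iff)
    have 2: "AE p in lebesgue. p \<in> ?H \<longrightarrow> fst p \<noteq> S" using AE_time_ne[OF HT_lebesgue[of "ereal T"], of S]
      by (simp add: AE_restrict_space_iff)
    have "AE p in lebesgue. p \<in> ?H \<longrightarrow> h p = ext S T h p"
      using 1 2 by eventually_elim (auto simp: HT_def Strip_def)
    then show ?thesis by (simp add: AE_restrict_space_iff)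
  qed
  have AEu: "AE p in lebesgue_on ?H. u0 p = u1 p" and AEw: "AE p in lebesgue_on ?H. w0 p = w1 p"
    unfolding u1_def w1_def by (rule AE[OF z(2)], rule AE[OF z(1)])
  have wk1: "weak_Dv ?H u1 w1" by (rule weak_Dv_cong_AE[OF HT_lebesgue u0 w0 u1 w1 AEu AEw wk0])
  have e1: "eq_holds ?H \<alpha> a b bb c \<mu> f1 g1 u1 w1"
    by (rule eq_holds_cong_AE[OF \<delta> co HT_lebesgue cont u0 w0 f1 g1 u1 w1 f1 g1 AEu AEw _ _ e0]) auto
  define U where "U p = exp (\<mu> * (fst p + - S)) * u1 p" for p
  define W where "W p = exp (\<mu> * (fst p + - S)) *\<^sub>R w1 p" for p
  have U: "sqi (lebesgue_on ?H) U" and W: "sqi (lebesgue_on ?H) W"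
    unfolding U_def W_def u1_def w1_def
    using exp_weight_ext[OF u0S HT_lebesgue, of T \<mu>] exp_weight_ext[OF w0S HT_lebesgue, of T \<mu>] by simp_all
  have fe: "(\<lambda>p. exp (\<mu> * (fst p + - S)) *\<^sub>R f1 p) = ext S T f"
    and ge: "(\<lambda>p. exp (\<mu> * (fst p + - S)) * g1 p) = ext S T g"
  proof -
    have "exp (\<mu> * (fst p + - S)) * exp (- \<mu> * (fst p + - S)) = 1" for p :: "('d, 'd1) pt"
      unfolding exp_add[symmetric] by simp
    then show "(\<lambda>p. exp (\<mu> * (fst p + - S)) *\<^sub>R f1 p) = ext S T f" "(\<lambda>p. exp (\<mu> * (fst p + - S)) * g1 p) = ext S T g"
      unfolding f1_def g1_def by (auto simp: fun_eq_iff simp flip: mult.assoc)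
  qed
  have fx: "sqi (lebesgue_on ?H) (ext S T f)" and gx: "sqi (lebesgue_on ?H) (ext S T g)"
    by (rule sqi_ext[OF f HT_lebesgue], rule sqi_ext[OF g HT_lebesgue])
  have wkU: "weak_Dv ?H U W" and eU: "eq_holds ?H \<alpha> a b bb c 0 (ext S T f) (ext S T g) U W"
  proof -
    note wt = eq_holds_exp_weight[OF \<delta> co HT_lebesgue cont u1 w1 f1 g1, of \<mu> "- S", folded U_def W_def,
        unfolded fe ge, OF U W fx gx wk1 e1]
    show "weak_Dv ?H U W" "eq_holds ?H \<alpha> a b bb c 0 (ext S T f) (ext S T g) U W" using wt by simp_all
  qed
  note subS = sqi_lebesgue_on_subset[OF Strip_subset Strip_lebesgue HT_lebesgue]
  have eS: "eq_holds ?S \<alpha> a b bb c 0 f g U W"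
    by (rule eq_holds_cong_AE[OF \<delta> co Strip_lebesgue cont subS[OF U] subS[OF W] subS[OF fx] subS[OF gx]
          subS[OF U] subS[OF W] f g _ _ _ _ eq_holds_restrict[OF \<delta> co Strip_subset Strip_lebesgue HT_lebesgue U W fx gx eU]])
       (auto intro!: AE_I2)
  have "cauchy_sol S T \<alpha> a b bb c f g U W"
    unfolding cauchy_sol_def
  proof (intro conjI exI ballI allI impI)
    show "S2 ?S \<alpha> U W"
      by (rule S2_of_solution[OF \<delta> co Strip_lebesgue subS[OF U] subS[OF W] f g
            weak_Dv_restrict[OF Strip_subset Strip_lebesgue HT_lebesgue wkU] eS])
    show "S2 ?H \<alpha> U W" by (rule S2_of_solution[OF \<delta> co HT_lebesgue U W fx gx wkU eU])
    show "U p = 0" if "fst p < S" for p using that by (simp add: U_def u1_def Strip_def)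
  qed (rule eS, rule refl)
  moreover have "AE p in lebesgue_on ?S. u' p = U p" if sol: "cauchy_sol S T \<alpha> a b bb c f g u' w'" for u' w'
  proof -
    \<comment> \<open>A competitor is extended by 0 and damped; both solutions are then subject to
      uniqueness on t < T with coefficient \<mu>.\<close>
    note cs = cauchy_sol_extend[OF \<delta> co hol ST f g sol]
    define \<omega> where "\<omega> p = exp (- \<mu> * (fst p + - S))" for p :: "('d, 'd1) pt"
    have eu: "sqi (lebesgue_on ?H) (ext S T u')" and ew: "sqi (lebesgue_on ?H) (ext S T w')"
      by (rule sqi_ext[OF cs(3) HT_lebesgue], rule sqi_ext[OF cs(4) HT_lebesgue])
    have s': "sqi (lebesgue_on ?H) (\<lambda>p. \<omega> p * ext S T u' p)" "sqi (lebesgue_on ?H) (\<lambda>p. \<omega> p *\<^sub>R ext S T w' p)"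
      "sqi (lebesgue_on ?H) (\<lambda>p. \<omega> p *\<^sub>R ext S T f p)" "sqi (lebesgue_on ?H) (\<lambda>p. \<omega> p * ext S T g p)"
      using exp_weight_ext[OF cs(3) HT_lebesgue, of T "- \<mu>"] exp_weight_ext[OF cs(4) HT_lebesgue, of T "- \<mu>"]
        exp_weight_ext[OF f HT_lebesgue, of T "- \<mu>"] exp_weight_ext[OF g HT_lebesgue, of T "- \<mu>"]
      unfolding \<omega>_def by simp_all
    have oU: "(\<lambda>p. \<omega> p * U p) = u1" and oW: "(\<lambda>p. \<omega> p *\<^sub>R W p) = w1"
    proof -
      have "exp (- \<mu> * (fst p + - S)) * exp (\<mu> * (fst p + - S)) = 1" for p :: "('d, 'd1) pt"
        unfolding exp_add[symmetric] by simp
      then show "(\<lambda>p. \<omega> p * U p) = u1" "(\<lambda>p. \<omega> p *\<^sub>R W p) = w1"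
        unfolding \<omega>_def U_def W_def by (auto simp: fun_eq_iff simp flip: mult.assoc)
    qed
    note w' = eq_holds_exp_weight[OF \<delta> co HT_lebesgue cont eu ew fx gx, of "- \<mu>" "- S", folded \<omega>_def, OF s' cs(1,2)]
    note wU = eq_holds_exp_weight[OF \<delta> co HT_lebesgue cont U W fx gx, of "- \<mu>" "- S", folded \<omega>_def, unfolded oU oW,
        OF u1 w1 s'(3,4) wkU eU]
    have "AE p in lebesgue_on ?H. \<omega> p * ext S T u' p = u1 p"
      by (rule solution_unique[OF \<delta> co hol \<delta>1 lam u1 w1 s'(3,4) s'(1,2) wU(1) w'(1)])
         (use wU(2) w'(2) in simp_all)
    then have "AE p in lebesgue. p \<in> ?H \<longrightarrow> \<omega> p * ext S T u' p = \<omega> p * U p"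
      unfolding oU[symmetric] by (simp add: AE_restrict_space_iff)
    then have "AE p in lebesgue. p \<in> ?S \<longrightarrow> u' p = U p"
    proof eventually_elim
      case (elim p)
      then show ?case using Strip_subset[of S T] by (auto simp: \<omega>_def)
    qed
    then show ?thesis by (simp add: AE_restrict_space_iff)
  qed
  moreover have "nrm ?S U + nrmv ?S W
      \<le> (exp (\<mu> * (T - S)) * (4 / \<delta>)) * nrmv ?S f + (exp (\<mu> * (T - S)) * (4 / \<delta>)) * nrm ?S g"
  proof -
    define E where "E = exp (\<mu> * (T - S))"
    have E0: "E > 0" by (simp add: E_def)
    have Emax: "exp (max 0 (\<mu> * (T - S))) = E" "exp (max 0 (- \<mu> * (T - S))) = 1"
      using lam0(1) ST by (auto simp: E_def max_def mult_less_0_iff not_le mult_le_0_iff)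
    have nm: "sqrt (sq (lebesgue_on ?S) h) \<le> sqrt (sq (lebesgue_on ?H) h)" if "sqi (lebesgue_on ?H) h"
      for h :: "('d, 'd1) pt \<Rightarrow> 'b::euclidean_space"
    proof -
      have "sqrt (sq (lebesgue_on ?H) (ext S T h)) \<le> 1 * sqrt (sq (lebesgue_on ?H) h)"
        by (rule sqrt_sq_le[OF that sqi_measurable[OF sqi_ext[OF subS[OF that] HT_lebesgue]]]) auto
      then show ?thesis by (simp only: sq_ext mult_1)
    qed
    have "nrm ?S U \<le> E * nrm ?H u0"
    proof -
      have "sq (lebesgue_on ?S) U = sq (lebesgue_on ?S) (\<lambda>p. exp (\<mu> * (fst p + - S)) *\<^sub>R u0 p)"
        unfolding sq_def by (intro Bochner_Integration.integral_cong refl) (simp add: U_def u1_def)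
      then have "nrm ?S U \<le> E * sqrt (sq (lebesgue_on ?S) u0)"
        unfolding nrm_sq using exp_weight_strip(2)[OF u0S, of \<mu>] by (simp add: Emax)
      also have "\<dots> \<le> E * nrm ?H u0" unfolding nrm_sq using E0 nm[OF u0] by (intro mult_left_mono) auto
      finally show ?thesis .
    qed
    moreover have "nrmv ?S W \<le> E * nrmv ?H w0"
    proof -
      have "sq (lebesgue_on ?S) W = sq (lebesgue_on ?S) (\<lambda>p. exp (\<mu> * (fst p + - S)) *\<^sub>R w0 p)"
        unfolding sq_def by (intro Bochner_Integration.integral_cong refl) (simp add: W_def w1_def)
      then have "nrmv ?S W \<le> E * sqrt (sq (lebesgue_on ?S) w0)"
        unfolding nrmv_sq using exp_weight_strip(2)[OF w0S, of \<mu>] by (simp add: Emax)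
      also have "\<dots> \<le> E * nrmv ?H w0" unfolding nrmv_sq using E0 nm[OF w0] by (intro mult_left_mono) auto
      finally show ?thesis .
    qed
    moreover have uw: "nrm ?H u0 + nrmv ?H w0 \<le> 4 / \<delta> * nrmv ?S f + 4 / \<delta> * nrm ?S g"
    proof -
      have n0: "0 \<le> nrm G h" for G and h :: "('d, 'd1) pt \<Rightarrow> real" by (simp add: nrm_sq)
      have "sq (lebesgue_on ?H) f1 = sq (lebesgue_on ?H) (ext S T (\<lambda>p. exp (- \<mu> * (fst p + - S)) *\<^sub>R f p))"
        by (rule arg_cong[where f = "sq (lebesgue_on ?H)"]) (auto simp: f1_def)
      then have fl: "nrmv ?H f1 \<le> nrmv ?S f"
        unfolding nrmv_sq sq_ext using exp_weight_strip(2)[OF f, of "- \<mu>"] by (simp only: Emax sq_ext mult_1)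
      have "sq (lebesgue_on ?H) g1 = sq (lebesgue_on ?H) (ext S T (\<lambda>p. exp (- \<mu> * (fst p + - S)) *\<^sub>R g p))"
        by (rule arg_cong[where f = "sq (lebesgue_on ?H)"]) (auto simp: g1_def)
      then have gl: "nrm ?H g1 \<le> nrm ?S g"
        unfolding nrm_sq sq_ext using exp_weight_strip(2)[OF g, of "- \<mu>"] by (simp only: Emax sq_ext mult_1)
      \<comment> \<open>Because \<mu> \<ge> 1, the factor sqrt \<mu> may be dropped in front of u
        and 1 / sqrt \<mu> in front of g.\<close>
      have s1: "1 \<le> sqrt \<mu>" using \<mu>1 by simp
      have "nrm ?H u0 + nrmv ?H w0 \<le> sqrt \<mu> * nrm ?H u0 + nrmv ?H w0"
        using mult_right_mono[OF s1 n0[of ?H u0]] by simp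
      also have "\<dots> \<le> 4 / \<delta> * nrmv ?H f1 + 4 / \<delta> / sqrt \<mu> * nrm ?H g1"
        by (rule norm_estimate[OF \<delta> co hol \<delta>1 lam u0 w0 f1 g1 wk0 e0])
      also have "\<dots> \<le> 4 / \<delta> * nrmv ?S f + 4 / \<delta> * nrm ?S g"
      proof (intro add_mono mult_mono fl gl)
        show "4 / \<delta> / sqrt \<mu> \<le> 4 / \<delta>" using s1 \<delta> by (simp add: divide_le_eq)
      qed (use \<delta> n0 in \<open>auto simp: nrmv_sq\<close>)
      finally show ?thesis .
    qed
    ultimately have "nrm ?S U + nrmv ?S W \<le> E * (4 / \<delta> * nrmv ?S f + 4 / \<delta> * nrm ?S g)"
      using mult_left_mono[OF uw less_imp_le[OF E0]] by (simp add: distrib_left)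
    then show ?thesis unfolding E_def[symmetric] by (simp add: distrib_left mult.assoc)
  qed
  ultimately show ?thesis by blast
qed

end

theorem theorem1p10:
  fixes \<delta> :: real
  assumes "0 < \<delta>" and "\<delta> < 1"
  shows
  "(\<exists>N>0. \<forall>L\<ge>0. \<exists>lam0>0. \<forall>(T::ereal)
       (a :: ('d::finite, 'd1::finite) pt \<Rightarrow> real ^ 'd1 ^ 'd1) b bb c (\<alpha> :: real ^ 'd1 \<Rightarrow> real ^ 'd).
      coeff_hyp \<delta> L a b bb c \<and> holder_alpha \<alpha> \<longrightarrow>
      (\<forall>lam\<ge>lam0. \<forall>u w f g.
          L2v (HT T) f \<and> L2 (HT T) g \<and> S2 (HT T) \<alpha> u w \<and>
          eq_holds (HT T) \<alpha> a b bb c lam f g u w \<longrightarrow>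
          sqrt lam * nrm (HT T) u + nrmv (HT T) w
            \<le> N * nrmv (HT T) f + N / sqrt lam * nrm (HT T) g) \<and>
      (\<forall>lam\<ge>lam0. \<forall>f g. L2v (HT T) f \<and> L2 (HT T) g \<longrightarrow>
          (\<exists>u w. S2 (HT T) \<alpha> u w \<and> eq_holds (HT T) \<alpha> a b bb c lam f g u w \<and>
             (\<forall>u' w'. S2 (HT T) \<alpha> u' w' \<and> eq_holds (HT T) \<alpha> a b bb c lam f g u' w' \<longrightarrow>
                (AE p in lebesgue_on (HT T). u' p = u p)))))
   \<and>
   (\<forall>L\<ge>0. \<forall>\<tau>>0. \<exists>N>0. \<forall>(S::real) (T::real)
       (a :: ('d::finite, 'd1::finite) pt \<Rightarrow> real ^ 'd1 ^ 'd1) b bb c (\<alpha> :: real ^ 'd1 \<Rightarrow> real ^ 'd) f g.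
      T - S = \<tau> \<and> coeff_hyp \<delta> L a b bb c \<and> holder_alpha \<alpha> \<and>
      L2v (Strip S T) f \<and> L2 (Strip S T) g \<longrightarrow>
      (\<exists>u w. cauchy_sol S T \<alpha> a b bb c f g u w \<and>
         (\<forall>u' w'. cauchy_sol S T \<alpha> a b bb c f g u' w' \<longrightarrow>
            (AE p in lebesgue_on (Strip S T). u' p = u p)) \<and>
         nrm (Strip S T) u + nrmv (Strip S T) w
           \<le> N * nrmv (Strip S T) f + N * nrm (Strip S T) g))"
proof (rule conjI, goal_cases)
  case 1
  \<comment> \<open>This constant is fixed before L is chosen and depends on \<delta> alone; the
    threshold for \<open>lam\<close> depends on \<delta> and L.\<close>
  have N: "0 < 4 / \<delta>" using assms(1) by simp
  show ?case
  proof (rule exI[of _ "4 / \<delta>"], rule conjI[OF N], intro allI impI, goal_cases)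
    case (1 L)
    then have lam0: "0 < 4 * (L\<^sup>2 / \<delta> + L) + 1"
      using assms(1) by (intro add_nonneg_pos mult_nonneg_nonneg add_nonneg_nonneg) auto
    show ?case
    proof (rule exI[of _ "4 * (L\<^sup>2 / \<delta> + L) + 1"], rule conjI[OF lam0], intro allI impI conjI; elim conjE)
      fix T and a :: "('d, 'd1) pt \<Rightarrow> real ^ 'd1 ^ 'd1" and b bb c and \<alpha> :: "real ^ 'd1 \<Rightarrow> real ^ 'd" and lam u w f g
      assume "coeff_hyp \<delta> L a b bb c" "holder_alpha \<alpha>" "4 * (L\<^sup>2 / \<delta> + L) + 1 \<le> lam"
        "L2v (HT T) f" "L2 (HT T) g" "S2 (HT T) \<alpha> u w" "eq_holds (HT T) \<alpha> a b bb c lam f g u w"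
      then show "sqrt lam * nrm (HT T) u + nrmv (HT T) w \<le> 4 / \<delta> * nrmv (HT T) f + 4 / \<delta> / sqrt lam * nrm (HT T) g"
        by (intro norm_estimate[OF assms(1) _ _ assms(2)]) (auto simp: S2_def L2_sqi L2v_sqi)
    next
      fix T and a :: "('d, 'd1) pt \<Rightarrow> real ^ 'd1 ^ 'd1" and b bb c and \<alpha> :: "real ^ 'd1 \<Rightarrow> real ^ 'd" and lam
        and f :: "('d, 'd1) pt \<Rightarrow> real ^ 'd1" and g :: "('d, 'd1) pt \<Rightarrow> real"
      assume co: "coeff_hyp \<delta> L a b bb c" and hol: "holder_alpha \<alpha>" and lam: "4 * (L\<^sup>2 / \<delta> + L) + 1 \<le> lam"
        and "L2v (HT T) f" "L2 (HT T) g"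
      then have f: "sqi (lebesgue_on (HT T)) f" and g: "sqi (lebesgue_on (HT T)) g" by (auto simp: L2_sqi L2v_sqi)
      obtain \<theta> K where "0 < \<theta>" "\<theta> \<le> 1" "K \<ge> 0" "\<And>v v'. norm (\<alpha> v - \<alpha> v') \<le> K * norm (v - v') powr \<theta>"
        and cont: "continuous_on UNIV \<alpha>"
        by (rule holder_alphaE[OF hol]) (rule that)
      obtain u w where u: "sqi (lebesgue_on (HT T)) u" and w: "sqi (lebesgue_on (HT T)) w"
        and wk: "weak_Dv (HT T) u w" and e: "eq_holds (HT T) \<alpha> a b bb c lam f g u w"
        using solution_exists[OF assms(1) co HT_lebesgue cont lam f g] by blast
      have "S2 (HT T) \<alpha> u w" by (rule S2_of_solution[OF assms(1) co HT_lebesgue u w f g wk e])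
      moreover have "AE p in lebesgue_on (HT T). u' p = u p"
        if "S2 (HT T) \<alpha> u' w'" "eq_holds (HT T) \<alpha> a b bb c lam f g u' w'" for u' w'
        using that by (intro solution_unique[OF assms(1) co hol assms(2) lam u w f g _ _ wk _ e])
          (auto simp: S2_def L2_sqi L2v_sqi)
      ultimately show "\<exists>u w. S2 (HT T) \<alpha> u w \<and> eq_holds (HT T) \<alpha> a b bb c lam f g u w \<and>
             (\<forall>u' w'. S2 (HT T) \<alpha> u' w' \<and> eq_holds (HT T) \<alpha> a b bb c lam f g u' w' \<longrightarrow>
                (AE p in lebesgue_on (HT T). u' p = u p))"
        using e by blast
    qed
  qed
next
  case 2
  show ?case
  proof (intro allI impI, goal_cases)
    case (1 L \<tau>)
    \<comment> \<open>The times S and T enter only through their difference \<tau>, so the constant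
      can be named before them.\<close>
    let ?N = "exp ((4 * (L\<^sup>2 / \<delta> + L) + 1) * \<tau>) * (4 / \<delta>)"
    have N: "0 < ?N" using assms(1) by simp
    show ?case
    proof (rule exI[of _ ?N], rule conjI[OF N], intro allI impI, elim conjE)
      fix S T and a :: "('d, 'd1) pt \<Rightarrow> real ^ 'd1 ^ 'd1" and b bb c and \<alpha> :: "real ^ 'd1 \<Rightarrow> real ^ 'd"
        and f :: "('d, 'd1) pt \<Rightarrow> real ^ 'd1" and g :: "('d, 'd1) pt \<Rightarrow> real"
      assume T: "T - S = \<tau>" and co: "coeff_hyp \<delta> L a b bb c" and hol: "holder_alpha \<alpha>"
        and "L2v (Strip S T) f" "L2 (Strip S T) g"
      then have f: "sqi (lebesgue_on (Strip S T)) f" and g: "sqi (lebesgue_on (Strip S T)) g"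
        by (auto simp: L2_sqi L2v_sqi)
      have "S < T" using T 1(2) by simp
      from cauchy_problem[OF assms(1) co hol assms(2) this f g, unfolded T]
      show "\<exists>u w. cauchy_sol S T \<alpha> a b bb c f g u w \<and>
         (\<forall>u' w'. cauchy_sol S T \<alpha> a b bb c f g u' w' \<longrightarrow>
            (AE p in lebesgue_on (Strip S T). u' p = u p)) \<and>
         nrm (Strip S T) u + nrmv (Strip S T) w
           \<le> ?N * nrmv (Strip S T) f + ?N * nrm (Strip S T) g" .
    qed
  qed
qed

end
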